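(* Suppose $X_1, X_2, \ldots$ are i.i.d. draws from a distribution $\mu$ that satisfies Assumption A (see context) with $-0.095 < \alpha < 0$ and associated radial density $f_R(r)$, and denote the largest-in-magnitude critical point of $p_n(z) := \prod_{j=1}^n (z - X_j)$ by $W^{\downarrow}_{(1)}$ and the largest-in-magnitude root by $X^{\downarrow}_{(1)}$. Then, provided $\lim_{r \to 1^-} \frac{f_R(r)}{(1-r)^\alpha}$ exists, we have $$\frac{n^{\frac{3+2\alpha}{2+\alpha}}}{e^{\sqrt{-1}\arg(X^{\downarrow}_{(1)})}} \left( W^{\downarrow}_{(1)} - X^{\downarrow}_{(1)}(1 - n^{-1}) \right) \longrightarrow \mathcal{H}_{2+\alpha}$$ in distribution as $n \to \infty$, where $\mathcal{H}_{2+\alpha}$ is a complex-valued random variable which, by identifying $\mathbb{C}$ with $\mathbb{R}^2$, is a multivariate $(2+\alpha)$-stable random vector whose spectral measure on $\mathbb{S}^1 = \{z\in\mathbb{C}: |z|=1\}$ is, up to a positive multiplicative constant, the probability measure $$D \mapsto \frac{\int_{\arg(D) \cap (-\pi/2, \pi/2)} (\cos\theta)^\alpha\, d\theta}{\int_{-\pi/2}^{\pi/2} (\cos\theta)^\alpha\, d\theta}, \qquad D \subset \mathbb{S}^1 \text{ Borel}.$$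
   Context: Assumption A (with parameter $\alpha > -1$): $\mu$ is a radially symmetric (rotation-invariant about $0$) probability measure supported on the unit disk centered at the origin in $\mathbb{C}$ such that (a) there is $\varepsilon \in (0,1]$ so that in the annulus $\{z : 1 - \varepsilon \le |z| \le 1\}$, $\mu$ has a density $f_\mu(z)$ with respect to Lebesgue measure on $\mathbb{C}$; (b) there are constants $c_\mu, C_\mu > 0$ so that the radial density $f_R(r) := 2\pi r f_\mu(r e^{\sqrt{-1}\theta})$ (which does not depend on $\theta$) satisfies $c_\mu \le \frac{f_R(r)}{(1-r)^\alpha} \le C_\mu$ for $1-\varepsilon \le r < 1$. Critical points of a polynomial are the roots of its derivative. $\arg$ is the principal argument with values in $(-\pi,\pi]$, and $\arg(D)=\{\arg z: z\in D\}$. Points are ordered by modulus, ties broken by argument. For $p \in (1,2)$, a random vector $Z$ in $\mathbb{R}^2$ is $p$-stable with spectral measure $\Gamma$ (a finite measure on the unit circle) if, for some $b\in\mathbb{R}^2$, its characteristic function is $\exp\left(-\int |\langle t,s\rangle|^p (1 - \sqrt{-1}\,\mathrm{sgn}(\langle t,s\rangle)\tan(\pi p/2))\,\Gamma(ds) + \sqrt{-1}\langle t,b\rangle\right)$. *)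

theory Defs
  imports "HOL-Probability.Probability" "HOL-Computational_Algebra.Polynomial"
begin

definition radial_density :: "(complex \<Rightarrow> real) \<Rightarrow> real \<Rightarrow> real" where
  "radial_density f r = 2 * pi * r * f (complex_of_real r)"

text \<open>
  A density is only determined almost everywhere, so the predicate carries the version \<open>f\<close> of the
  density on the annulus, for which rotation invariance and the two-sided bound hold pointwise.
  Values of \<open>f\<close> off the annulus are irrelevant, and so are its values on the unit circle,
  which is a Lebesgue null set.
\<close>

definition assumption_A :: "real \<Rightarrow> complex measure \<Rightarrow> (complex \<Rightarrow> real) \<Rightarrow> bool" where
  "assumption_A \<alpha> \<mu> f \<longleftrightarrow>
     - 1 < \<alpha> \<and>
     prob_space \<mu> \<and> sets \<mu> = sets borel \<and>
     (\<forall>\<theta>::real. distr \<mu> borel (\<lambda>z. cis \<theta> * z) = \<mu>) \<and>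
     emeasure \<mu> (- cball 0 1) = 0 \<and>
     (\<exists>\<epsilon>. 0 < \<epsilon> \<and> \<epsilon> \<le> 1 \<and>
        (let ann = {z. 1 - \<epsilon> \<le> norm z \<and> norm z \<le> 1} in
           f \<in> borel_measurable (restrict_space borel ann) \<and>
           (\<forall>z\<in>ann. 0 \<le> f z) \<and>
           restrict_space \<mu> ann = density (restrict_space lborel ann) (\<lambda>z. ennreal (f z))) \<and>
        (\<forall>r \<theta>. 1 - \<epsilon> \<le> r \<and> r < 1 \<longrightarrow>
           f (complex_of_real r * cis \<theta>) = f (complex_of_real r)) \<and>
        (\<exists>c C. 0 < c \<and> 0 < C \<and>
           (\<forall>r. 1 - \<epsilon> \<le> r \<and> r < 1 \<longrightarrow>
              c \<le> radial_density f r / (1 - r) powr \<alpha> \<and>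
              radial_density f r / (1 - r) powr \<alpha> \<le> C)))"

definition mod_arg_le :: "complex \<Rightarrow> complex \<Rightarrow> bool" where
  "mod_arg_le w z \<longleftrightarrow> norm w < norm z \<or> (norm w = norm z \<and> Arg w \<le> Arg z)"

text \<open>
  For a nonempty finite set this is the maximum for the linear order \<open>mod_arg_le\<close>;
  for the empty set it is an unspecified constant.
\<close>

definition largest_pt :: "complex set \<Rightarrow> complex" where
  "largest_pt S = (THE z. z \<in> S \<and> (\<forall>w\<in>S. mod_arg_le w z))"

definition roots :: "complex poly \<Rightarrow> complex set" where
  "roots p = {z. poly p z = 0}"

definition critical_points :: "complex poly \<Rightarrow> complex set" where
  "critical_points p = roots (pderiv p)"

definition random_poly :: "(nat \<Rightarrow> 'a \<Rightarrow> complex) \<Rightarrow> nat \<Rightarrow> 'a \<Rightarrow> complex poly" where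
  "random_poly X n \<omega> = (\<Prod>j=1..n. [:- X j \<omega>, 1:])"

definition iid_draws :: "'a measure \<Rightarrow> (nat \<Rightarrow> 'a \<Rightarrow> complex) \<Rightarrow> complex measure \<Rightarrow> bool" where
  "iid_draws M X \<mu> \<longleftrightarrow> prob_space M \<and>
     prob_space.indep_vars M (\<lambda>_. borel) X {1..} \<and> (\<forall>j\<ge>1. distr M borel (X j) = \<mu>)"

text \<open>
  The library's \<open>weak_conv_m\<close> and \<open>char\<close> are restricted to measures on the real line.
\<close>

definition converges_in_distr ::
    "'a measure \<Rightarrow> (nat \<Rightarrow> 'a \<Rightarrow> 'b::topological_space) \<Rightarrow> 'b measure \<Rightarrow> bool" where
  "converges_in_distr M Y H \<longleftrightarrow>
     prob_space M \<and> prob_space H \<and> sets H = sets borel \<and>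
     (\<forall>n. Y n \<in> borel_measurable M) \<and>
     (\<forall>g :: 'b \<Rightarrow> real. continuous_on UNIV g \<and> bounded (range g) \<longrightarrow>
        (\<lambda>n. \<integral>\<omega>. g (Y n \<omega>) \<partial>M) \<longlonglongrightarrow> (\<integral>x. g x \<partial>H))"

definition char_vec :: "'b::euclidean_space measure \<Rightarrow> 'b \<Rightarrow> complex" where
  "char_vec H t = (CLINT x|H. iexp (t \<bullet> x))"

text \<open>
  On \<open>complex\<close> the inner product \<open>\<bullet>\<close> is that of the plane, so no explicit identification
  is needed.
\<close>

definition stable_law :: "real \<Rightarrow> complex measure \<Rightarrow> complex measure \<Rightarrow> bool" where
  "stable_law p \<Gamma> H \<longleftrightarrow>
     1 < p \<and> p < 2 \<and>
     finite_measure \<Gamma> \<and> sets \<Gamma> = sets (restrict_space borel (sphere 0 1)) \<and>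
     prob_space H \<and> sets H = sets borel \<and>
     (\<exists>b. \<forall>t. char_vec H t =
        exp (- (CLINT s|\<Gamma>. complex_of_real (\<bar>t \<bullet> s\<bar> powr p) *
                   (1 - \<i> * complex_of_real (sgn (t \<bullet> s) * tan (pi * p / 2))))
             + \<i> * complex_of_real (t \<bullet> b)))"

definition cos_arg_prob :: "real \<Rightarrow> complex set \<Rightarrow> real" where
  "cos_arg_prob \<alpha> D =
     (LINT \<theta>:(Arg ` D \<inter> {- pi / 2<..<pi / 2})|lborel. cos \<theta> powr \<alpha>) /
     (LINT \<theta>:{- pi / 2..pi / 2}|lborel. cos \<theta> powr \<alpha>)"

end

theory Submission
  imports Defs "HOL-Real_Asymp.Real_Asymp" "HOL-Computational_Algebra.Fundamental_Theorem_Algebra"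
begin

text \<open>
  Let \<open>X\<^sub>J\<close> be the largest root. A critical point \<open>z\<close> near it solves
  \<open>1 / (z - X\<^sub>J) = - (\<Sum>j \<noteq> J. 1 / (z - X\<^sub>j))\<close>, and with high probability the right hand side may be evaluated at
  the point \<open>u\<close> of the unit circle closest to \<open>X\<^sub>J\<close>. It is then \<open>- n / u\<close> up to fluctuations, whence
  \<open>z \<approx> X\<^sub>J (1 - 1 / n) + u n\<^bsup>-2\<^esup> ((\<Sum>j \<noteq> J. 1 / (1 - X\<^sub>j / u)) - n)\<close>. The other critical points have smaller modulus,
  because on an outer annulus every critical point is paired with a nearby root.

  The index \<open>J\<close> is a function of the moduli, so by rotation invariance replacing \<open>X\<^sub>j / u\<close> by \<open>X\<^sub>j\<close> does not
  change the law of the sum. What remains is a centred sum of independent copies of \<open>1 / (1 - X)\<close>,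
  which has mean 1 (mean value property) and a tail of index \<open>2 + \<alpha>\<close> coming from the points near 1. Its
  characteristic function is computed in the coordinates \<open>X = (1 - \<delta> s) exp (\<i> \<delta> s tan v)\<close>,
  \<open>\<delta> = n\<^bsup>-1/(2+\<alpha>)\<^esup>\<close>, in which the limiting intensity is a product and the spectral density
  \<open>(cos v)\<^bsup>\<alpha>\<^esup>\<close> appears.
\<close>

text \<open>The summands 1 / (1 - X) have tail index 2 + \<alpha> < 2, so fluctuations are not
  controlled by a variance: the estimates use the moment of order 1.8 and a truncation at distance
  \<eta> from 1. Moreover the fluctuations must be controlled around every root of an outer layer at
  once, not only around the largest one, because a priori any of these roots may be the partner of
  the largest critical point. The union bound over them is affordable since a layer of width
  n^(-0.97) contains on average at most a constant times n^0.123 roots.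

  Two demands compete. The gap between the two largest moduli must exceed twice the error 4 w / n^2
  in the position of a critical point, while w must be large enough for the fluctuation bound to
  hold around all roots of the layer. The lower bound on \<alpha> enters these estimates in the form
  1 + \<alpha> > 0.905.

  The limit law is built from its characteristic function, whose modulus is at most exp (- k |t|^(2
  + \<alpha>)) for some k > 0. It is therefore integrable, and Fourier inversion yields a density
  without any compactness argument.\<close>

section \<open>Continuity theorem for characteristic functions in the plane\<close>

lemma norm_integral_le:
  fixes f :: "'a \<Rightarrow> 'b::{banach, second_countable_topology}"
  assumes "integrable M g" "f \<in> borel_measurable M" "\<And>x. x \<in> space M \<Longrightarrow> norm (f x) \<le> g x"
  shows "norm (integral\<^sup>L M f) \<le> integral\<^sup>L M g"
proof -
  have i: "integrable M f"
    by (rule Bochner_Integration.integrable_bound[OF assms(1,2)])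
      (auto intro!: AE_I2 order_trans[OF assms(3)])
  have "norm (integral\<^sup>L M f) \<le> (LINT x|M. norm (f x))" by simp
  also have "\<dots> \<le> integral\<^sup>L M g" using assms i by (intro integral_mono) auto
  finally show ?thesis .
qed

text \<open>Reduces planar integrals to iterated real ones, so that Gaussian and exponential
  integrals factor.\<close>

lemma lborel_complex:
  "(lborel :: complex measure) = distr (lborel \<Otimes>\<^sub>M lborel) borel (\<lambda>(x, y). Complex x y)"
proof (rule lborel_eqI)
  have [measurable]: "(\<lambda>(x, y). Complex x y) \<in> borel_measurable (lborel \<Otimes>\<^sub>M lborel)"
    unfolding Complex_eq by measurable
  fix l u :: complex
  assume lu: "\<And>b. b \<in> Basis \<Longrightarrow> l \<bullet> b \<le> u \<bullet> b"
  have 1: "Re l \<le> Re u" "Im l \<le> Im u" using lu[of 1] lu[of \<i>] by (auto simp: Basis_complex_def)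
  have "(\<lambda>(x, y). Complex x y) -` box l u \<inter> space (lborel \<Otimes>\<^sub>M lborel) = {Re l<..<Re u} \<times> {Im l<..<Im u}"
    by (auto simp: box_def Basis_complex_def space_pair_measure)
  then show "emeasure (distr (lborel \<Otimes>\<^sub>M lborel) borel (\<lambda>(x, y). Complex x y)) (box l u) =
      ennreal (\<Prod>b\<in>Basis. (u - l) \<bullet> b)"
    using 1 by (subst emeasure_distr) (auto simp: lborel.emeasure_pair_measure_Times Basis_complex_def ennreal_mult)
qed simp

lemma integral_lborel_complex:
  fixes f :: "complex \<Rightarrow> 'b::{banach, second_countable_topology}"
  assumes [measurable]: "f \<in> borel_measurable borel"
  shows "integrable lborel f \<longleftrightarrow> integrable (lborel \<Otimes>\<^sub>M lborel) (\<lambda>(x, y). f (Complex x y))"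
    and "integral\<^sup>L lborel f = (LINT z|(lborel \<Otimes>\<^sub>M lborel). f (Complex (fst z) (snd z)))"
proof -
  have [measurable]: "(\<lambda>(x, y). Complex x y) \<in> borel_measurable (lborel \<Otimes>\<^sub>M lborel)"
    unfolding Complex_eq by measurable
  show "integrable lborel f \<longleftrightarrow> integrable (lborel \<Otimes>\<^sub>M lborel) (\<lambda>(x, y). f (Complex x y))"
    by (subst lborel_complex, subst integrable_distr_eq) (auto simp: case_prod_unfold)
  show "integral\<^sup>L lborel f = (LINT z|(lborel \<Otimes>\<^sub>M lborel). f (Complex (fst z) (snd z)))"
    by (subst lborel_complex, subst integral_distr) (auto simp: case_prod_unfold)
qed

lemma (in pair_sigma_finite) product_integral:
  fixes f :: "'a \<Rightarrow> 'c::{real_normed_field, banach, second_countable_topology}"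
  assumes [measurable]: "integrable M1 f" "integrable M2 g"
  shows "integrable (M1 \<Otimes>\<^sub>M M2) (\<lambda>z. f (fst z) * g (snd z))"
    and "(LINT z|(M1 \<Otimes>\<^sub>M M2). f (fst z) * g (snd z)) = integral\<^sup>L M1 f * integral\<^sup>L M2 g"
proof -
  show *: "integrable (M1 \<Otimes>\<^sub>M M2) (\<lambda>z. f (fst z) * g (snd z))"
    by (rule Fubini_integrable) (auto simp: norm_mult assms)
  show "(LINT z|(M1 \<Otimes>\<^sub>M M2). f (fst z) * g (snd z)) = integral\<^sup>L M1 f * integral\<^sup>L M2 g"
    using integral_fst[of "\<lambda>x y. f x * g y"] * by (simp add: case_prod_unfold)
qed

section \<open>Planar Gaussians and Gaussian smoothing of a law\<close>

definition gauss :: "complex \<Rightarrow> real" where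
  "gauss z = exp (- (norm z)\<^sup>2 / 2)"

lemma gauss_measurable [measurable]: "gauss \<in> borel_measurable borel"
  unfolding gauss_def by measurable

lemma gauss_bounds: "0 < gauss z" "gauss z \<le> 1"
  by (auto simp: gauss_def)

text \<open>The characteristic function of the standard normal law at \<open>t / \<sigma>\<close>,
  after the substitution of \<open>\<sigma> * x\<close> for the variable.\<close>

lemma gauss_FT_real:
  fixes \<sigma> t :: real
  assumes "0 < \<sigma>"
  shows "integrable lborel (\<lambda>x. iexp (t * x) * complex_of_real (exp (- (\<sigma> * x)\<^sup>2 / 2)))"
    and "(CLINT x|lborel. iexp (t * x) * complex_of_real (exp (- (\<sigma> * x)\<^sup>2 / 2))) =
      complex_of_real (sqrt (2 * pi) / \<sigma> * exp (- (t / \<sigma>)\<^sup>2 / 2))"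
proof -
  interpret real_distribution std_normal_distribution by (rule real_dist_normal_dist)
  have "(CLINT x|std_normal_distribution. iexp (t / \<sigma> * x)) = complex_of_real (exp (- (t / \<sigma>)\<^sup>2 / 2))"
    using fun_cong[OF char_std_normal_distribution, of "t / \<sigma>"] by (simp add: char_def)
  moreover have "integrable std_normal_distribution (\<lambda>x. iexp (t / \<sigma> * x))"
    by (rule integrable_iexp) auto
  ultimately have
    i: "integrable lborel (\<lambda>x. std_normal_density x *\<^sub>R iexp (t / \<sigma> * x))" and
    e: "(CLINT x|lborel. std_normal_density x *\<^sub>R iexp (t / \<sigma> * x)) = complex_of_real (exp (- (t / \<sigma>)\<^sup>2 / 2))"
    by (auto simp: integral_density integrable_density)
  have i2: "integrable lborel (\<lambda>x. std_normal_density (\<sigma> * x) *\<^sub>R iexp (t * x))"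
    using lborel_integrable_real_affine[OF i, of \<sigma> 0] assms by (simp add: field_simps)
  have e2: "(CLINT x|lborel. std_normal_density (\<sigma> * x) *\<^sub>R iexp (t * x)) = complex_of_real (exp (- (t / \<sigma>)\<^sup>2 / 2) / \<sigma>)"
    using lborel_integral_real_affine[of \<sigma> "\<lambda>x. std_normal_density x *\<^sub>R iexp (t / \<sigma> * x)" 0] assms e
    by (simp add: field_simps scaleR_conv_of_real)
  have eq: "(\<lambda>x. iexp (t * x) * complex_of_real (exp (- (\<sigma> * x)\<^sup>2 / 2))) =
     (\<lambda>x. complex_of_real (sqrt (2 * pi)) * (std_normal_density (\<sigma> * x) *\<^sub>R iexp (t * x)))"
    by (auto simp: normal_density_def scaleR_conv_of_real fun_eq_iff mult_ac)
  show "integrable lborel (\<lambda>x. iexp (t * x) * complex_of_real (exp (- (\<sigma> * x)\<^sup>2 / 2)))"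
    unfolding eq using i2 by (rule integrable_mult_right)
  show "(CLINT x|lborel. iexp (t * x) * complex_of_real (exp (- (\<sigma> * x)\<^sup>2 / 2))) =
      complex_of_real (sqrt (2 * pi) / \<sigma> * exp (- (t / \<sigma>)\<^sup>2 / 2))"
    unfolding eq by (subst integral_mult_right_zero, subst e2) simp
qed

lemma gauss_FT:
  fixes \<sigma> :: real and t :: complex
  assumes "0 < \<sigma>"
  shows "integrable lborel (\<lambda>s. iexp (t \<bullet> s) * complex_of_real (gauss (complex_of_real \<sigma> * s)))"
    and "(CLINT s|lborel. iexp (t \<bullet> s) * complex_of_real (gauss (complex_of_real \<sigma> * s))) =
      complex_of_real (2 * pi / \<sigma>\<^sup>2 * gauss (t / complex_of_real \<sigma>))"
proof -
  let ?f = "\<lambda>t x. iexp (t * x) * complex_of_real (exp (- (\<sigma> * x)\<^sup>2 / 2))"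
  have eq: "iexp (t \<bullet> Complex x y) * complex_of_real (gauss (complex_of_real \<sigma> * Complex x y)) = ?f (Re t) x * ?f (Im t) y" for x y
  proof -
    have 1: "gauss (complex_of_real \<sigma> * Complex x y) = exp (- (\<sigma> * x)\<^sup>2 / 2) * exp (- (\<sigma> * y)\<^sup>2 / 2)"
      by (simp add: gauss_def cmod_power2 exp_add[symmetric] field_simps)
    have 2: "iexp (t \<bullet> Complex x y) = iexp (Re t * x) * iexp (Im t * y)"
      by (simp add: exp_add[symmetric] inner_complex_def algebra_simps)
    show ?thesis unfolding 1 2 by simp
  qed
  note P = lborel_pair.product_integral[OF gauss_FT_real(1)[OF assms, of "Re t"] gauss_FT_real(1)[OF assms, of "Im t"]]
  show "integrable lborel (\<lambda>s. iexp (t \<bullet> s) * complex_of_real (gauss (complex_of_real \<sigma> * s)))"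
    using P(1) by (subst integral_lborel_complex) (auto simp: eq case_prod_unfold)
  have "(CLINT s|lborel. iexp (t \<bullet> s) * complex_of_real (gauss (complex_of_real \<sigma> * s))) =
    complex_of_real (sqrt (2 * pi) / \<sigma> * exp (- (Re t / \<sigma>)\<^sup>2 / 2)) * complex_of_real (sqrt (2 * pi) / \<sigma> * exp (- (Im t / \<sigma>)\<^sup>2 / 2))"
    using P(2) gauss_FT_real(2)[OF assms] by (subst integral_lborel_complex) (auto simp: eq)
  also have "\<dots> = complex_of_real (2 * pi / \<sigma>\<^sup>2 * (exp (- (Re t / \<sigma>)\<^sup>2 / 2) * exp (- (Im t / \<sigma>)\<^sup>2 / 2)))"
    unfolding of_real_mult[symmetric] by (intro arg_cong[of _ _ complex_of_real]) (simp add: power2_eq_square field_simps)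
  also have "exp (- (Re t / \<sigma>)\<^sup>2 / 2) * exp (- (Im t / \<sigma>)\<^sup>2 / 2) = gauss (t / complex_of_real \<sigma>)"
    by (simp add: gauss_def cmod_power2 exp_add[symmetric] field_simps)
  finally show "(CLINT s|lborel. iexp (t \<bullet> s) * complex_of_real (gauss (complex_of_real \<sigma> * s))) =
      complex_of_real (2 * pi / \<sigma>\<^sup>2 * gauss (t / complex_of_real \<sigma>))" .
qed

lemma gauss_integrable:
  assumes "0 < \<sigma>"
  shows "integrable lborel (\<lambda>s. gauss (complex_of_real \<sigma> * s))"
    and "(LINT s|lborel. gauss (complex_of_real \<sigma> * s)) = 2 * pi / \<sigma>\<^sup>2"
proof -
  have 1: "integrable lborel (\<lambda>s. complex_of_real (gauss (complex_of_real \<sigma> * s)))"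
    using gauss_FT(1)[OF assms, of 0] by simp
  then show "integrable lborel (\<lambda>s. gauss (complex_of_real \<sigma> * s))"
    by (simp add: complex_of_real_integrable_eq)
  have "complex_of_real (LINT s|lborel. gauss (complex_of_real \<sigma> * s)) = complex_of_real (2 * pi / \<sigma>\<^sup>2)"
    using gauss_FT(2)[OF assms, of 0] by (simp add: gauss_def)
  then show "(LINT s|lborel. gauss (complex_of_real \<sigma> * s)) = 2 * pi / \<sigma>\<^sup>2"
    using of_real_eq_iff by blast
qed

text \<open>Fourier inversion with Gaussian damping. If \<open>\<psi>\<close> is the characteristic
  function of Y, this is the density of Y plus \<open>\<sigma>\<close> times an independent standard
  Gaussian. With \<open>\<sigma>\<close> = 0 it is the plain inversion formula for an integrable
  \<open>\<psi>\<close>. The constant is the square of 2 pi.\<close>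

definition smoothed_density :: "real \<Rightarrow> (complex \<Rightarrow> complex) \<Rightarrow> complex \<Rightarrow> real" where
  "smoothed_density \<sigma> \<psi> x =
     Re (CLINT s|lborel. iexp (- (x \<bullet> s)) * \<psi> s * complex_of_real (gauss (complex_of_real \<sigma> * s))) / (4 * pi\<^sup>2)"

lemma smoothed_density_measurable [measurable]:
  assumes [measurable]: "\<psi> \<in> borel_measurable borel"
  shows "smoothed_density \<sigma> \<psi> \<in> borel_measurable borel"
  unfolding smoothed_density_def by measurable

lemma smoothed_density_bound:
  assumes [measurable]: "\<psi> \<in> borel_measurable borel"
  assumes "integrable lborel \<phi>" "\<And>s. norm (\<psi> s * complex_of_real (gauss (complex_of_real \<sigma> * s))) \<le> \<phi> s"
  shows "\<bar>smoothed_density \<sigma> \<psi> x\<bar> \<le> integral\<^sup>L lborel \<phi> / (4 * pi\<^sup>2)"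
proof -
  let ?f = "\<lambda>s. iexp (- (x \<bullet> s)) * \<psi> s * complex_of_real (gauss (complex_of_real \<sigma> * s))"
  have b: "norm (?f s) \<le> \<phi> s" for s
    using assms(3)[of s] by (simp add: norm_mult)
  have "norm (integral\<^sup>L lborel ?f) \<le> integral\<^sup>L lborel \<phi>"
    by (rule norm_integral_le) (use b assms(2) in auto)
  then show ?thesis
    unfolding smoothed_density_def using abs_Re_le_cmod[of "integral\<^sup>L lborel ?f"]
    by (simp add: divide_right_mono)
qed

text \<open>Both \<open>\<psi>\<close> and \<open>\<sigma>\<close> may vary because two different
  limits are taken later: n to infinity at fixed damping, dominated by the Gaussian, and removal of
  the damping, dominated by the limit function itself.\<close>

lemma smoothed_density_tendsto:
  assumes [measurable]: "\<And>n. \<psi> n \<in> borel_measurable borel" "\<psi>' \<in> borel_measurable borel"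
  assumes "integrable lborel \<phi>" "\<And>n s. norm (\<psi> n s * complex_of_real (gauss (complex_of_real (\<sigma> n) * s))) \<le> \<phi> s"
    and lim: "\<And>s. (\<lambda>n. \<psi> n s) \<longlonglongrightarrow> \<psi>' s" "\<sigma> \<longlonglongrightarrow> \<sigma>'"
  shows "(\<lambda>n. smoothed_density (\<sigma> n) (\<psi> n) x) \<longlonglongrightarrow> smoothed_density \<sigma>' \<psi>' x"
  unfolding smoothed_density_def
proof (intro tendsto_intros integral_dominated_convergence[where w=\<phi>])
  show "AE s in lborel. norm (iexp (- (x \<bullet> s)) * \<psi> n s * complex_of_real (gauss (complex_of_real (\<sigma> n) * s))) \<le> \<phi> s" for n
    using assms(4) by (auto simp: norm_mult)
  show "AE s in lborel. (\<lambda>n. iexp (- (x \<bullet> s)) * \<psi> n s * complex_of_real (gauss (complex_of_real (\<sigma> n) * s)))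
     \<longlonglongrightarrow> iexp (- (x \<bullet> s)) * \<psi>' s * complex_of_real (gauss (complex_of_real \<sigma>' * s))"
    unfolding gauss_def by (intro AE_I2 tendsto_intros lim) auto
qed (use assms in auto)

lemma (in prob_space) integrable_iexp_inner:
  fixes Y :: "'a \<Rightarrow> complex"
  assumes [measurable]: "Y \<in> borel_measurable M"
  shows "integrable M (\<lambda>\<omega>. iexp (t \<bullet> Y \<omega>))"
  by (rule integrable_const_bound[of _ 1]) auto

text \<open>A Gaussian is the Fourier transform of a Gaussian; insert this for the kernel and
  exchange the integrals. The left side makes the smoothed density visibly nonnegative.\<close>

lemma (in prob_space) smoothed_density_char:
  fixes Y :: "'a \<Rightarrow> complex"
  assumes [measurable]: "Y \<in> borel_measurable M" and \<sigma>: "0 < \<sigma>"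
  shows "expectation (\<lambda>\<omega>. gauss ((x - Y \<omega>) / \<sigma>) / (2 * pi * \<sigma>\<^sup>2)) =
    smoothed_density \<sigma> (\<lambda>s. CLINT \<omega>|M. iexp (s \<bullet> Y \<omega>)) x"
proof -
  interpret P: pair_sigma_finite lborel M ..
  let ?g = "\<lambda>s. complex_of_real (gauss (complex_of_real \<sigma> * s))"
  have gi: "integrable lborel ?g"
    using gauss_integrable(1)[OF \<sigma>] by (simp add: complex_of_real_integrable_eq)
  have i: "integrable (lborel \<Otimes>\<^sub>M M) (\<lambda>(s, \<omega>). iexp ((Y \<omega> - x) \<bullet> s) * ?g s)"
  proof (rule P.Fubini_integrable)
    have "(\<lambda>s. LINT \<omega>|M. norm (case (s, \<omega>) of (s, \<omega>) \<Rightarrow> iexp ((Y \<omega> - x) \<bullet> s) * ?g s)) = (\<lambda>s. norm (?g s))"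
      by (auto simp: norm_mult prob_space)
    then show "integrable lborel (\<lambda>s. LINT \<omega>|M. norm (case (s, \<omega>) of (s, \<omega>) \<Rightarrow> iexp ((Y \<omega> - x) \<bullet> s) * ?g s))"
      using integrable_norm[OF gi] by simp
    show "AE s in lborel. integrable M (\<lambda>\<omega>. case (s, \<omega>) of (s, \<omega>) \<Rightarrow> iexp ((Y \<omega> - x) \<bullet> s) * ?g s)"
      by (auto intro!: AE_I2 integrable_const_bound[of _ "norm (?g _)"] simp: norm_mult)
  qed measurable
  have "complex_of_real (gauss ((x - y) / \<sigma>) / (2 * pi * \<sigma>\<^sup>2)) = (CLINT s|lborel. iexp ((y - x) \<bullet> s) * ?g s) / (4 * pi\<^sup>2)" for y
    using gauss_FT(2)[OF \<sigma>, of "y - x"] \<sigma>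
    by (simp add: field_simps power2_eq_square gauss_def norm_divide norm_minus_commute)
  then have "complex_of_real (expectation (\<lambda>\<omega>. gauss ((x - Y \<omega>) / \<sigma>) / (2 * pi * \<sigma>\<^sup>2))) =
     (CLINT \<omega>|M. (CLINT s|lborel. iexp ((Y \<omega> - x) \<bullet> s) * ?g s)) / (4 * pi\<^sup>2)"
    by (simp only: integral_complex_of_real[symmetric]) simp
  also have "(CLINT \<omega>|M. (CLINT s|lborel. iexp ((Y \<omega> - x) \<bullet> s) * ?g s)) = (CLINT s|lborel. (CLINT \<omega>|M. iexp ((Y \<omega> - x) \<bullet> s) * ?g s))"
    by (rule P.Fubini_integral[OF i])
  also have "(\<lambda>s. CLINT \<omega>|M. iexp ((Y \<omega> - x) \<bullet> s) * ?g s) = (\<lambda>s. iexp (- (x \<bullet> s)) * (CLINT \<omega>|M. iexp (s \<bullet> Y \<omega>)) * ?g s)"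
  proof
    fix s
    have "(\<lambda>\<omega>. iexp ((Y \<omega> - x) \<bullet> s) * ?g s) = (\<lambda>\<omega>. (iexp (- (x \<bullet> s)) * ?g s) * iexp (s \<bullet> Y \<omega>))"
      by (auto simp: inner_diff_left inner_commute algebra_simps exp_add[symmetric] exp_diff exp_minus field_simps)
    then show "(CLINT \<omega>|M. iexp ((Y \<omega> - x) \<bullet> s) * ?g s) = iexp (- (x \<bullet> s)) * (CLINT \<omega>|M. iexp (s \<bullet> Y \<omega>)) * ?g s"
      by simp
  qed
  finally have "complex_of_real (expectation (\<lambda>\<omega>. gauss ((x - Y \<omega>) / \<sigma>) / (2 * pi * \<sigma>\<^sup>2))) = 
     (CLINT s|lborel. iexp (- (x \<bullet> s)) * (CLINT \<omega>|M. iexp (s \<bullet> Y \<omega>)) * ?g s) / (4 * pi\<^sup>2)" .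
  from arg_cong[OF this, of Re] show ?thesis
    unfolding smoothed_density_def by (simp add: Re_divide_of_real[of _ "4 * pi\<^sup>2", simplified])
qed

text \<open>The same exchange at the origin. It expresses a Gaussian expectation as an average of
  the characteristic function over arguments of size \<open>\<sigma>\<close>, which is what
  tightness is read off from.\<close>

lemma (in prob_space) gauss_char:
  fixes Y :: "'a \<Rightarrow> complex"
  assumes [measurable]: "Y \<in> borel_measurable M"
  shows "complex_of_real (expectation (\<lambda>\<omega>. gauss (of_real \<sigma> * Y \<omega>))) =
    (CLINT s|lborel. (CLINT \<omega>|M. iexp ((of_real \<sigma> * s) \<bullet> Y \<omega>)) * complex_of_real (gauss s)) / (2 * pi)"
proof -
  interpret P: pair_sigma_finite lborel M ..
  let ?g = "\<lambda>s. complex_of_real (gauss s)"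
  have gi: "integrable lborel ?g"
    using gauss_integrable(1)[of 1] by (simp add: complex_of_real_integrable_eq)
  have i: "integrable (lborel \<Otimes>\<^sub>M M) (\<lambda>(s, \<omega>). iexp ((of_real \<sigma> * s) \<bullet> Y \<omega>) * ?g s)"
  proof (rule P.Fubini_integrable)
    have "(\<lambda>s. LINT \<omega>|M. norm (case (s, \<omega>) of (s, \<omega>) \<Rightarrow> iexp ((of_real \<sigma> * s) \<bullet> Y \<omega>) * ?g s)) = (\<lambda>s. norm (?g s))"
      by (auto simp: norm_mult prob_space)
    then show "integrable lborel (\<lambda>s. LINT \<omega>|M. norm (case (s, \<omega>) of (s, \<omega>) \<Rightarrow> iexp ((of_real \<sigma> * s) \<bullet> Y \<omega>) * ?g s))"
      using integrable_norm[OF gi] by simp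
    show "AE s in lborel. integrable M (\<lambda>\<omega>. case (s, \<omega>) of (s, \<omega>) \<Rightarrow> iexp ((of_real \<sigma> * s) \<bullet> Y \<omega>) * ?g s)"
      by (auto intro!: AE_I2 integrable_const_bound[of _ "norm (?g _)"] simp: norm_mult)
  qed measurable
  have "complex_of_real (gauss (of_real \<sigma> * y)) = (CLINT s|lborel. iexp ((of_real \<sigma> * s) \<bullet> y) * ?g s) / (2 * pi)" for y
  proof -
    have "(of_real \<sigma> * s) \<bullet> y = (of_real \<sigma> * y) \<bullet> s" for s
      by (simp add: inner_complex_def algebra_simps)
    then show ?thesis
      using gauss_FT(2)[of 1 "of_real \<sigma> * y"] by simp
  qed
  then have "complex_of_real (expectation (\<lambda>\<omega>. gauss (of_real \<sigma> * Y \<omega>))) =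
     (CLINT \<omega>|M. (CLINT s|lborel. iexp ((of_real \<sigma> * s) \<bullet> Y \<omega>) * ?g s)) / (2 * pi)"
    by (simp add: integral_complex_of_real[symmetric] del: integral_complex_of_real)
  also have "(CLINT \<omega>|M. (CLINT s|lborel. iexp ((of_real \<sigma> * s) \<bullet> Y \<omega>) * ?g s)) = (CLINT s|lborel. (CLINT \<omega>|M. iexp ((of_real \<sigma> * s) \<bullet> Y \<omega>) * ?g s))"
    by (rule P.Fubini_integral[OF i])
  finally show ?thesis by simp
qed

lemma gauss_integrable_div:
  assumes "0 < \<sigma>"
  shows "integrable lborel (\<lambda>s. gauss (s / complex_of_real \<sigma>))"
    and "(LINT s|lborel. gauss (s / complex_of_real \<sigma>)) = 2 * pi * \<sigma>\<^sup>2"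
  using gauss_integrable[of "1 / \<sigma>"] assms by (auto simp: field_simps)

text \<open>Half of the exponent absorbs the factor of order |z|^2, by r / 4 \<le> exp (r / 4). The
  remaining half is a wider Gaussian whose integral is already known.\<close>

lemma gauss_second_moment:
  assumes "0 < \<sigma>"
  shows "(norm z)\<^sup>2 * gauss (z / complex_of_real \<sigma>) \<le> 4 * \<sigma>\<^sup>2 * gauss (z / complex_of_real (sqrt 2 * \<sigma>))"
proof -
  let ?r = "(norm z / \<sigma>)\<^sup>2"
  have 1: "gauss (z / complex_of_real \<sigma>) = exp (- ?r / 4) * exp (- ?r / 4)"
    using assms by (simp add: gauss_def norm_divide exp_add[symmetric])
  have 2: "gauss (z / complex_of_real (sqrt 2 * \<sigma>)) = exp (- ?r / 4)"
    using assms by (simp add: gauss_def norm_divide norm_mult power_divide power_mult_distrib)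
  have "?r / 4 \<le> exp (?r / 4)" using exp_ge_add_one_self[of "?r/4"] by linarith
  then have "?r / 4 * exp (- ?r / 4) \<le> exp (?r / 4) * exp (- ?r / 4)" by (intro mult_right_mono) auto
  also have "\<dots> = 1" by (simp add: exp_add[symmetric])
  finally have "?r / 4 * exp (- ?r / 4) \<le> 1" .
  then have "4 * \<sigma>\<^sup>2 * exp (- ?r / 4) * (?r / 4 * exp (- ?r / 4)) \<le> 4 * \<sigma>\<^sup>2 * exp (- ?r / 4) * 1"
    by (intro mult_left_mono) auto
  then show ?thesis unfolding 1 2 using assms by (simp add: field_simps power2_eq_square)
qed

lemma lborel_shift:
  fixes f :: "complex \<Rightarrow> real" and y :: complex
  assumes "integrable lborel f"
  shows "integrable lborel (\<lambda>x. f (x - y))" "(LINT x|lborel. f (x - y)) = integral\<^sup>L lborel f"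
proof -
  have [measurable]: "f \<in> borel_measurable borel" using assms by auto
  have d: "distr lborel borel ((+) (- y)) = (lborel :: complex measure)" by (rule lborel_distr_plus)
  have "integrable (distr lborel borel ((+) (- y))) f" using d assms by simp
  then show "integrable lborel (\<lambda>x. f (x - y))" by (simp add: integrable_distr_eq)
  have "integral\<^sup>L (distr lborel borel ((+) (- y))) f = integral\<^sup>L lborel f" using d by simp
  then show "(LINT x|lborel. f (x - y)) = integral\<^sup>L lborel f" by (simp add: integral_distr)
qed

text \<open>Convolution with a Gaussian of width \<open>\<sigma>\<close> moves g by at most e at
  displacements below d. At larger displacements the oscillation is at most 2 B, hence at most 2 B
  |x - y|^2 / d^2, and the second moment is bounded by 8 \<open>\<sigma>\<close>^2.\<close>

lemma (in prob_space) smoothing_error: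
  fixes Y :: "'a \<Rightarrow> complex" and g :: "complex \<Rightarrow> real"
  assumes [measurable]: "Y \<in> borel_measurable M" and \<sigma>: "0 < \<sigma>" and "0 < d" and "0 \<le> e"
    and gi: "integrable lborel g" and B: "\<And>x. \<bar>g x\<bar> \<le> B"
    and uc: "\<And>x y. norm (x - y) < d \<Longrightarrow> \<bar>g x - g y\<bar> \<le> e"
  shows "\<bar>expectation (\<lambda>\<omega>. g (Y \<omega>)) - (LINT x|lborel. g x * smoothed_density \<sigma> (\<lambda>s. CLINT \<omega>|M. iexp (s \<bullet> Y \<omega>)) x)\<bar>
     \<le> e + 16 * B * \<sigma>\<^sup>2 / d\<^sup>2"
proof -
  interpret P: pair_sigma_finite lborel M ..
  have [measurable]: "g \<in> borel_measurable borel" using gi by auto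
  have B0: "0 \<le> B" using B[of 0] by linarith
  define G where "G z = gauss (z / complex_of_real \<sigma>) / (2 * pi * \<sigma>\<^sup>2)" for z
  have [measurable]: "G \<in> borel_measurable borel" unfolding G_def by measurable
  have Gpos: "0 \<le> G z" "G z \<le> 1 / (2 * pi * \<sigma>\<^sup>2)" for z
    using gauss_bounds[of "z / complex_of_real \<sigma>"] \<sigma> by (auto simp: G_def field_simps)
  have Gint: "integrable lborel G" "integral\<^sup>L lborel G = 1"
    unfolding G_def using gauss_integrable_div[OF \<sigma>] \<sigma> by auto
  define G2 where "G2 z = (4 * \<sigma>\<^sup>2) / (2 * pi * \<sigma>\<^sup>2) * gauss (z / complex_of_real (sqrt 2 * \<sigma>))" for z
  have G2: "integrable lborel G2" "integral\<^sup>L lborel G2 = 8 * \<sigma>\<^sup>2"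
    unfolding G2_def using gauss_integrable_div[of "sqrt 2 * \<sigma>"] \<sigma> by (auto simp: power_mult_distrib field_simps)
  have G2b: "(norm z)\<^sup>2 * G z \<le> G2 z" for z
    using gauss_second_moment[OF \<sigma>, of z] \<sigma> by (simp add: G_def G2_def field_simps)
  have gb: "\<bar>g y - g x\<bar> \<le> e + 2 * B / d\<^sup>2 * (norm (x - y))\<^sup>2" for x y
  proof (cases "norm (x - y) < d")
    case True
    then show ?thesis using uc[OF True] B0 by (simp add: abs_minus_commute add_increasing2)
  next
    case False
    then have "1 \<le> (norm (x - y))\<^sup>2 / d\<^sup>2" using \<open>0 < d\<close> by (simp add: power_mono)
    then have "2 * B * 1 \<le> 2 * B * ((norm (x - y))\<^sup>2 / d\<^sup>2)" using B0 by (intro mult_left_mono) auto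
    moreover have "\<bar>g y - g x\<bar> \<le> 2 * B" using B[of x] B[of y] by linarith
    ultimately show ?thesis using \<open>0 \<le> e\<close> by simp
  qed
  have igG: "integrable lborel (\<lambda>x. g x * G (x - y))" for y
    by (rule Bochner_Integration.integrable_bound[OF integrable_mult_right[OF lborel_shift(1)[OF Gint(1)], of B y]])
      (use B Gpos B0 in \<open>auto simp: abs_mult intro!: mult_mono\<close>)
  have err: "\<bar>g y - (LINT x|lborel. g x * G (x - y))\<bar> \<le> e + 16 * B * \<sigma>\<^sup>2 / d\<^sup>2" for y
  proof -
    have "g y = (LINT x|lborel. g y * G (x - y))"
      using lborel_shift(2)[OF Gint(1), of y] Gint by simp
    then have "g y - (LINT x|lborel. g x * G (x - y)) = (LINT x|lborel. g y * G (x - y) - g x * G (x - y))"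
      using igG lborel_shift(1)[OF Gint(1), of y] by simp
    also have "norm \<dots> \<le> (LINT x|lborel. e * G (x - y) + 2 * B / d\<^sup>2 * G2 (x - y))"
    proof (rule norm_integral_le)
      fix x
      have "norm (g y * G (x - y) - g x * G (x - y)) = \<bar>g y - g x\<bar> * G (x - y)"
        using Gpos by (simp add: left_diff_distrib[symmetric] abs_mult)
      also have "\<dots> \<le> (e + 2 * B / d\<^sup>2 * (norm (x - y))\<^sup>2) * G (x - y)"
        using gb Gpos by (intro mult_right_mono) auto
      also have "\<dots> = e * G (x - y) + 2 * B / d\<^sup>2 * ((norm (x - y))\<^sup>2 * G (x - y))"
        by (simp add: algebra_simps)
      also have "\<dots> \<le> e * G (x - y) + 2 * B / d\<^sup>2 * G2 (x - y)"
        using G2b B0 by (intro add_left_mono mult_left_mono) auto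
      finally show "norm (g y * G (x - y) - g x * G (x - y)) \<le> e * G (x - y) + 2 * B / d\<^sup>2 * G2 (x - y)" .
    qed (use igG lborel_shift(1)[OF Gint(1)] lborel_shift(1)[OF G2(1)] in auto)
    also have "\<dots> = e + 2 * B / d\<^sup>2 * (8 * \<sigma>\<^sup>2)"
      using lborel_shift[OF Gint(1), of y] lborel_shift[OF G2(1), of y] Gint(2) G2(2) by simp
    finally show ?thesis by (simp add: mult_ac)
  qed
  have i: "integrable (lborel \<Otimes>\<^sub>M M) (\<lambda>(x, \<omega>). g x * G (x - Y \<omega>))"
  proof (rule Bochner_Integration.integrable_bound)
    show "integrable (lborel \<Otimes>\<^sub>M M) (\<lambda>z. (g (fst z) / (2 * pi * \<sigma>\<^sup>2)) * (\<lambda>_. 1) (snd z))"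
      by (rule P.product_integral) (use gi in auto)
    show "AE z in lborel \<Otimes>\<^sub>M M. norm (case z of (x, \<omega>) \<Rightarrow> g x * G (x - Y \<omega>)) \<le> norm (g (fst z) / (2 * pi * \<sigma>\<^sup>2) * 1)"
    proof (rule AE_I2, clarify)
      fix a b
      have "\<bar>g a\<bar> * G (a - Y b) \<le> \<bar>g a\<bar> * (1 / (2 * pi * \<sigma>\<^sup>2))" using Gpos by (intro mult_left_mono) auto
      then show "norm (g a * G (a - Y b)) \<le> norm (g (fst (a,b)) / (2 * pi * \<sigma>\<^sup>2) * 1)"
        using Gpos[of "a - Y b"] by (simp add: abs_mult)
    qed
  qed measurable
  have "(LINT \<omega>|M. (LINT x|lborel. g x * G (x - Y \<omega>))) = (LINT x|lborel. (LINT \<omega>|M. g x * G (x - Y \<omega>)))"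
    by (rule P.Fubini_integral[OF i])
  also have "\<dots> = (LINT x|lborel. g x * smoothed_density \<sigma> (\<lambda>s. CLINT \<omega>|M. iexp (s \<bullet> Y \<omega>)) x)"
    by (subst smoothed_density_char[symmetric, OF _ \<sigma>]) (auto simp: G_def)
  finally have "expectation (\<lambda>\<omega>. g (Y \<omega>)) - (LINT x|lborel. g x * smoothed_density \<sigma> (\<lambda>s. CLINT \<omega>|M. iexp (s \<bullet> Y \<omega>)) x)
     = expectation (\<lambda>\<omega>. g (Y \<omega>)) - (LINT \<omega>|M. (LINT x|lborel. g x * G (x - Y \<omega>)))" by simp
  also have "\<dots> = (LINT \<omega>|M. g (Y \<omega>) - (LINT x|lborel. g x * G (x - Y \<omega>)))"
    using P.integrable_snd[OF i] B by (subst Bochner_Integration.integral_diff) (auto intro!: integrable_const_bound[of _ B])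
  also have "norm \<dots> \<le> (LINT \<omega>|M. e + 16 * B * \<sigma>\<^sup>2 / d\<^sup>2)"
    using P.integrable_snd[OF i] B err
    by (intro norm_integral_le) (auto intro!: integrable_const_bound[of _ B] Bochner_Integration.integrable_diff)
  finally show ?thesis by (simp add: prob_space)
qed

lemma uniform_continuity_of_compact_support:
  fixes g :: "complex \<Rightarrow> real"
  assumes "continuous_on UNIV g" and supp: "\<And>x. K \<le> norm x \<Longrightarrow> g x = 0" and "0 < e"
  shows "\<exists>d>0. \<forall>x y. norm (x - y) < d \<longrightarrow> \<bar>g x - g y\<bar> \<le> e"
proof -
  have "uniformly_continuous_on (cball 0 (K + 1)) g"
    by (rule compact_uniformly_continuous) (use assms(1) in \<open>auto intro: continuous_on_subset\<close>)
  then obtain d where d: "d > 0" "\<And>x y. norm x \<le> K + 1 \<Longrightarrow> norm y \<le> K + 1 \<Longrightarrow> norm (x - y) < d \<Longrightarrow> \<bar>g x - g y\<bar> < e"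
    using \<open>0 < e\<close> unfolding uniformly_continuous_on_def dist_norm by (auto simp: norm_minus_commute dist_norm)
  show ?thesis
  \<comment> \<open>At distance below 1, a pair that is not contained in the ball of radius K + 1
    lies entirely outside the ball of radius K, where g vanishes.\<close>
  proof (intro exI[of _ "min d 1"] conjI allI impI)
    fix x y :: complex assume xy: "norm (x - y) < min d 1"
    show "\<bar>g x - g y\<bar> \<le> e"
    proof (cases "norm x \<le> K + 1 \<and> norm y \<le> K + 1")
      case True
      then show ?thesis using d(2)[of x y] xy by (simp add: less_imp_le)
    next
      case False
      have "norm x \<le> norm y + norm (x - y)" "norm y \<le> norm x + norm (x - y)"
        using norm_triangle_ineq[of y "x - y"] norm_triangle_ineq[of x "y - x"] by (auto simp: norm_minus_commute)
      then have "K \<le> norm x" "K \<le> norm y" using False xy by auto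
      then show ?thesis using supp \<open>0 < e\<close> by simp
    qed
  qed (use d in auto)
qed

lemma integrable_compact_support:
  fixes g :: "complex \<Rightarrow> real"
  assumes [measurable]: "g \<in> borel_measurable borel" and "\<And>x. \<bar>g x\<bar> \<le> B" and "\<And>x. K < norm x \<Longrightarrow> g x = 0"
  shows "integrable lborel g"
proof (rule Bochner_Integration.integrable_bound)
  show "integrable lborel (\<lambda>x::complex. B * indicator (cball 0 K) x)"
    by (intro integrable_mult_right integrable_real_indicator) (use emeasure_bounded_finite[OF bounded_cball, of "0::complex" K] in auto)
  show "AE x in lborel. norm (g x) \<le> norm (B * indicator (cball 0 K) x)"
    using assms(2,3) by (auto simp: indicator_def intro!: AE_I2 order_trans[OF assms(2)])
qed simp

text \<open>Integrability of the limit \<open>\<psi>\<close> makes the candidate law explicit: its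
  density is the inverse Fourier transform q. Smoothing gives convergence against compactly
  supported test functions, and continuity of \<open>\<psi>\<close> at 0 prevents loss of mass,
  which extends the convergence to bounded continuous ones.\<close>

theorem levy_continuity_plane:
  fixes Y :: "nat \<Rightarrow> 'a \<Rightarrow> complex" and \<psi> :: "complex \<Rightarrow> complex"
  assumes "prob_space M" and Y [measurable]: "\<And>n. Y n \<in> borel_measurable M"
    and lim: "\<And>t. (\<lambda>n. CLINT \<omega>|M. iexp (t \<bullet> Y n \<omega>)) \<longlonglongrightarrow> \<psi> t"
    and \<psi>i: "integrable lborel \<psi>" and \<psi>c: "isCont \<psi> 0" and \<psi>0: "\<psi> 0 = 1"
  shows "\<exists>H. prob_space H \<and> sets H = sets borel \<and> converges_in_distr M Y H \<and> (\<forall>t. char_vec H t = \<psi> t)"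
proof -
  interpret prob_space M by fact
  define C where "C n s = (CLINT \<omega>|M. iexp (s \<bullet> Y n \<omega>))" for n s
  have [measurable]: "C n \<in> borel_measurable borel" for n
    unfolding C_def by measurable
  have [measurable]: "\<psi> \<in> borel_measurable borel" using \<psi>i by auto
  have C1: "norm (C n s) \<le> 1" for n s
    unfolding C_def using norm_integral_le[of M "\<lambda>_. 1" "\<lambda>\<omega>. iexp (s \<bullet> Y n \<omega>)"] by (simp add: prob_space)
  have Clim: "(\<lambda>n. C n s) \<longlonglongrightarrow> \<psi> s" for s using lim[of s] by (simp add: C_def)
  have \<psi>1: "norm (\<psi> s) \<le> 1" for s
    by (rule tendsto_upperbound[OF tendsto_norm[OF Clim[of s]]]) (auto simp: C1)
  define q where "q = smoothed_density 0 \<psi>"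
  have [measurable]: "q \<in> borel_measurable borel" unfolding q_def by measurable
  define \<sigma> where "\<sigma> m = 1 / real (Suc m)" for m
  have \<sigma>0: "\<sigma> m > 0" for m by (simp add: \<sigma>_def)
  have \<sigma>lim: "\<sigma> \<longlonglongrightarrow> 0" unfolding \<sigma>_def by (rule LIMSEQ_inverse_real_of_nat[unfolded inverse_eq_divide])
  have gi: "integrable lborel (\<lambda>s. gauss (complex_of_real (\<sigma> m) * s))" for m by (rule gauss_integrable(1)[OF \<sigma>0])
  have g1: "norm (complex_of_real (gauss z)) \<le> 1" "0 \<le> gauss z" for z using gauss_bounds[of z] by auto
  have bC: "norm (C n s * complex_of_real (gauss (complex_of_real (\<sigma> m) * s))) \<le> gauss (complex_of_real (\<sigma> m) * s)" for n m s
    using mult_right_mono[OF C1[of n s], of "gauss (complex_of_real (\<sigma> m) * s)"] g1(2) by (simp add: norm_mult)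
  have b\<psi>: "norm (\<psi> s * complex_of_real (gauss (complex_of_real a * s))) \<le> norm (\<psi> s)" for a s
    using mult_left_mono[OF g1(1), of "norm (\<psi> s)"] by (simp add: norm_mult)
  \<comment> \<open>The order of the limits matters: the \<open>C n\<close> are only bounded, so the
    damping is kept while n grows and is removed afterwards. Positivity passes through both limits
    to q.\<close>
  have L1: "(\<lambda>n. smoothed_density (\<sigma> m) (C n) x) \<longlonglongrightarrow> smoothed_density (\<sigma> m) \<psi> x" for m x
    by (rule smoothed_density_tendsto[OF _ _ gi[of m] bC]) (auto simp: Clim)
  have L2: "(\<lambda>m. smoothed_density (\<sigma> m) \<psi> x) \<longlonglongrightarrow> q x" for x
    unfolding q_def by (rule smoothed_density_tendsto[OF _ _ integrable_norm[OF \<psi>i] b\<psi>]) (auto simp: \<sigma>lim)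
  have pos1: "0 \<le> smoothed_density (\<sigma> m) (C n) x" for m n x
    unfolding C_def by (subst smoothed_density_char[symmetric, OF Y \<sigma>0]) (auto intro!: integral_nonneg simp: g1)
  have pos2: "0 \<le> smoothed_density (\<sigma> m) \<psi> x" for m x
    by (rule LIMSEQ_le_const[OF L1]) (auto simp: pos1)
  have qpos: "0 \<le> q x" for x by (rule LIMSEQ_le_const[OF L2]) (auto simp: pos2)
  define Bm where "Bm m = (LINT s|lborel. gauss (complex_of_real (\<sigma> m) * s)) / (4 * pi\<^sup>2)" for m
  define B\<psi> where "B\<psi> = (LINT s|lborel. norm (\<psi> s)) / (4 * pi\<^sup>2)"
  have bd1: "\<bar>smoothed_density (\<sigma> m) (C n) x\<bar> \<le> Bm m" for m n x
    unfolding Bm_def by (rule smoothed_density_bound[OF _ gi bC]) auto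
  have bd2: "\<bar>smoothed_density a \<psi> x\<bar> \<le> B\<psi>" for a x
    unfolding B\<psi>_def by (rule smoothed_density_bound[OF _ integrable_norm[OF \<psi>i] b\<psi>]) auto
  have bdq: "\<bar>q x\<bar> \<le> B\<psi>" for x unfolding q_def by (rule bd2)
  have compact_conv: "(\<lambda>n. expectation (\<lambda>\<omega>. g (Y n \<omega>))) \<longlonglongrightarrow> (LINT x|lborel. g x * q x)"
    if gc: "continuous_on UNIV g" and gB: "\<And>x. \<bar>g x\<bar> \<le> B" and supp: "\<And>x. K \<le> norm x \<Longrightarrow> g x = 0" for g :: "complex \<Rightarrow> real" and B K
  proof (rule LIMSEQ_I)
    fix r :: real assume "0 < r"
    have [measurable]: "g \<in> borel_measurable borel" using gc by (rule borel_measurable_continuous_onI)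
    have gint: "integrable lborel g" by (rule integrable_compact_support[OF _ gB, where K=K]) (auto simp: supp)
    obtain d where d: "d > 0" "\<And>x y. norm (x - y) < d \<Longrightarrow> \<bar>g x - g y\<bar> \<le> r / 4"
      using uniform_continuity_of_compact_support[OF gc supp, where e="r/4" and K=K] \<open>0 < r\<close> by auto
    have "(\<lambda>m. 16 * B * (\<sigma> m)\<^sup>2 / d\<^sup>2) \<longlonglongrightarrow> 16 * B * 0\<^sup>2 / d\<^sup>2"
      using d(1) by (intro tendsto_intros \<sigma>lim) auto
    then have e1: "\<forall>\<^sub>F m in sequentially. 16 * B * (\<sigma> m)\<^sup>2 / d\<^sup>2 < r / 4"
      using \<open>0 < r\<close> by (intro order_tendstoD(2)) auto
    have "(\<lambda>m. LINT x|lborel. g x * smoothed_density (\<sigma> m) \<psi> x) \<longlonglongrightarrow> (LINT x|lborel. g x * q x)"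
    proof (rule integral_dominated_convergence[where w="\<lambda>x. \<bar>g x\<bar> * B\<psi>"])
      show "integrable lborel (\<lambda>x. \<bar>g x\<bar> * B\<psi>)" using gint by auto
      show "AE x in lborel. norm (g x * smoothed_density (\<sigma> m) \<psi> x) \<le> \<bar>g x\<bar> * B\<psi>" for m
        using bd2 by (auto simp: abs_mult intro!: mult_left_mono)
    qed (auto intro!: tendsto_intros L2)
    then have e2: "\<forall>\<^sub>F m in sequentially. \<bar>(LINT x|lborel. g x * smoothed_density (\<sigma> m) \<psi> x) - (LINT x|lborel. g x * q x)\<bar> < r / 4"
      using \<open>0 < r\<close> unfolding tendsto_iff dist_real_def by (elim allE[of _ "r / 4"]) simp
    \<comment> \<open>The damping index m is fixed before n. The total error r is made of four
      quarters: modulus of continuity, smoothing tail, passage from \<open>C n\<close> to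
      \<open>\<psi>\<close>, and passage from damped to undamped density.\<close>
    from eventually_happens'[OF _ eventually_conj[OF e1 e2]] obtain m where
      m: "16 * B * (\<sigma> m)\<^sup>2 / d\<^sup>2 < r / 4"
        "\<bar>(LINT x|lborel. g x * smoothed_density (\<sigma> m) \<psi> x) - (LINT x|lborel. g x * q x)\<bar> < r / 4" by auto
    have "(\<lambda>n. LINT x|lborel. g x * smoothed_density (\<sigma> m) (C n) x) \<longlonglongrightarrow> (LINT x|lborel. g x * smoothed_density (\<sigma> m) \<psi> x)"
    proof (rule integral_dominated_convergence[where w="\<lambda>x. \<bar>g x\<bar> * Bm m"])
      show "integrable lborel (\<lambda>x. \<bar>g x\<bar> * Bm m)" using gint by auto
      show "AE x in lborel. norm (g x * smoothed_density (\<sigma> m) (C n) x) \<le> \<bar>g x\<bar> * Bm m" for n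
        using bd1 by (auto simp: abs_mult intro!: mult_left_mono)
    qed (auto intro!: tendsto_intros L1)
    then have "\<forall>\<^sub>F n in sequentially. \<bar>(LINT x|lborel. g x * smoothed_density (\<sigma> m) (C n) x) - (LINT x|lborel. g x * smoothed_density (\<sigma> m) \<psi> x)\<bar> < r / 4"
      using \<open>0 < r\<close> unfolding tendsto_iff dist_real_def by (elim allE[of _ "r / 4"]) simp
    then obtain N where N: "\<And>n. n \<ge> N \<Longrightarrow> \<bar>(LINT x|lborel. g x * smoothed_density (\<sigma> m) (C n) x) - (LINT x|lborel. g x * smoothed_density (\<sigma> m) \<psi> x)\<bar> < r / 4"
      by (auto simp: eventually_sequentially)
    have S: "\<bar>expectation (\<lambda>\<omega>. g (Y n \<omega>)) - (LINT x|lborel. g x * smoothed_density (\<sigma> m) (C n) x)\<bar> \<le> r / 4 + 16 * B * (\<sigma> m)\<^sup>2 / d\<^sup>2" for n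
      unfolding C_def by (rule smoothing_error[OF Y \<sigma>0 d(1) _ gint gB d(2)]) (use \<open>0 < r\<close> in auto)
    show "\<exists>no. \<forall>n\<ge>no. norm (expectation (\<lambda>\<omega>. g (Y n \<omega>)) - (LINT x|lborel. g x * q x)) < r"
    proof (intro exI[of _ N] allI impI)
      fix n assume "N \<le> n"
      from N[OF this] S[of n] m show "norm (expectation (\<lambda>\<omega>. g (Y n \<omega>)) - (LINT x|lborel. g x * q x)) < r"
        unfolding real_norm_def by linarith
    qed
  qed
  define cut where "cut m x = max 0 (min 1 (2 + real m - norm x))" for m and x :: complex
  have cut_c: "continuous_on UNIV (cut m)" for m unfolding cut_def by (intro continuous_intros)
  have [measurable]: "cut m \<in> borel_measurable borel" for m using cut_c by (rule borel_measurable_continuous_onI)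
  have cut_b: "0 \<le> cut m x" "cut m x \<le> 1" "\<bar>cut m x\<bar> \<le> 1" for m x by (auto simp: cut_def)
  have cut_s: "cut m x = 0" if "real m + 2 \<le> norm x" for m x using that by (auto simp: cut_def)
  have cut_1: "cut m x = 1" if "norm x \<le> real m + 1" for m x using that by (auto simp: cut_def)
  \<comment> \<open>Where the cutoff is below 1, the point has norm above m + 1, so the Gaussian of
    scale \<open>\<sigma> m0\<close> is at most exp (-1/2) there. Hence the escaping mass is at most
    (1 - E gauss) / c, and E gauss is close to 1 because it averages \<open>C n\<close> over small
    arguments, where the limit \<open>\<psi>\<close> is close to 1.\<close>
  have tight: "\<exists>m0. \<forall>m\<ge>m0. \<forall>\<^sub>F n in sequentially. expectation (\<lambda>\<omega>. 1 - cut m (Y n \<omega>)) \<le> r" if "0 < r" for r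
  proof -
    define c where "c = 1 - exp (- (1/2 :: real))"
    have c: "c > 0" by (simp add: c_def)
    have lim1: "(\<lambda>m. (CLINT s|lborel. \<psi> (of_real (\<sigma> m) * s) * complex_of_real (gauss s)) / (2 * pi)) \<longlonglongrightarrow>
       (CLINT s|lborel. 1 * complex_of_real (gauss s)) / (2 * pi)"
    proof (intro tendsto_intros integral_dominated_convergence[where w=gauss])
      show "AE s in lborel. (\<lambda>m. \<psi> (of_real (\<sigma> m) * s) * complex_of_real (gauss s)) \<longlonglongrightarrow> 1 * complex_of_real (gauss s)"
      proof (intro AE_I2 tendsto_intros)
        fix s :: complex
        have "(\<lambda>m. of_real (\<sigma> m) * s) \<longlonglongrightarrow> of_real 0 * s" by (intro tendsto_intros \<sigma>lim)
        from isCont_tendsto_compose[OF _ this, of \<psi>] \<psi>c \<psi>0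
        show "(\<lambda>m. \<psi> (of_real (\<sigma> m) * s)) \<longlonglongrightarrow> 1" by simp
      qed
      show "AE s in lborel. norm (\<psi> (of_real (\<sigma> m) * s) * complex_of_real (gauss s)) \<le> gauss s" for m
        using \<psi>1 g1(2) by (auto simp: norm_mult intro!: mult_left_le_one_le)
    qed (use gauss_integrable(1)[of 1] in auto)
    have "(CLINT s|lborel. 1 * complex_of_real (gauss s)) / (2 * pi) = 1"
      using gauss_FT(2)[of 1 0] by (simp add: gauss_def)
    then have "(\<lambda>m. Re ((CLINT s|lborel. \<psi> (of_real (\<sigma> m) * s) * complex_of_real (gauss s)) / (2 * pi))) \<longlonglongrightarrow> 1"
      using tendsto_Re[OF lim1] by simp
    then have "\<forall>\<^sub>F m in sequentially. Re ((CLINT s|lborel. \<psi> (of_real (\<sigma> m) * s) * complex_of_real (gauss s)) / (2 * pi)) > 1 - r * c"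
      using \<open>0 < r\<close> c by (intro order_tendstoD) auto
    then obtain m0 where m0: "Re ((CLINT s|lborel. \<psi> (of_real (\<sigma> m0) * s) * complex_of_real (gauss s)) / (2 * pi)) > 1 - r * c"
      by (auto simp: eventually_sequentially)
    have "(\<lambda>n. (CLINT s|lborel. C n (of_real (\<sigma> m0) * s) * complex_of_real (gauss s)) / (2 * pi)) \<longlonglongrightarrow>
       (CLINT s|lborel. \<psi> (of_real (\<sigma> m0) * s) * complex_of_real (gauss s)) / (2 * pi)"
    proof (intro tendsto_intros integral_dominated_convergence[where w=gauss])
      show "AE s in lborel. norm (C n (of_real (\<sigma> m0) * s) * complex_of_real (gauss s)) \<le> gauss s" for n
        using C1 g1(2) by (auto simp: norm_mult intro!: mult_left_le_one_le)
    qed (use gauss_integrable(1)[of 1] in \<open>auto intro!: tendsto_intros Clim\<close>)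
    from tendsto_Re[OF this] have "(\<lambda>n. expectation (\<lambda>\<omega>. gauss (of_real (\<sigma> m0) * Y n \<omega>))) \<longlonglongrightarrow>
       Re ((CLINT s|lborel. \<psi> (of_real (\<sigma> m0) * s) * complex_of_real (gauss s)) / (2 * pi))"
      unfolding C_def gauss_char[OF Y, symmetric] by simp
    then have ev: "\<forall>\<^sub>F n in sequentially. expectation (\<lambda>\<omega>. gauss (of_real (\<sigma> m0) * Y n \<omega>)) > 1 - r * c"
      using m0 by (rule order_tendstoD)
    show ?thesis
    proof (intro exI[of _ m0] allI impI)
      fix m assume "m0 \<le> m"
      show "\<forall>\<^sub>F n in sequentially. expectation (\<lambda>\<omega>. 1 - cut m (Y n \<omega>)) \<le> r"
        using ev
      proof eventually_elim
        case (elim n)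
        have int: "integrable M (\<lambda>\<omega>. gauss (of_real (\<sigma> m0) * Y n \<omega>))"
          using gauss_bounds by (intro integrable_const_bound[of _ 1]) (auto simp: less_imp_le intro!: AE_I2)
        have "c * (1 - cut m y) \<le> 1 - gauss (of_real (\<sigma> m0) * y)" for y
        proof (cases "norm y \<le> real m + 1")
          case True
          then show ?thesis using cut_1 gauss_bounds by simp
        next
          case False
          then have "1 \<le> \<sigma> m0 * norm y" using \<open>m0 \<le> m\<close> by (simp add: \<sigma>_def field_simps)
          then have "1 \<le> (\<sigma> m0 * norm y)\<^sup>2" by simp
          then have "gauss (of_real (\<sigma> m0) * y) \<le> exp (- (1/2))"
            using \<sigma>0[of m0] by (simp add: gauss_def norm_mult)
          moreover have "c * (1 - cut m y) \<le> c * 1" using c cut_b by (intro mult_left_mono) auto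
          ultimately show ?thesis unfolding c_def mult_1_right by linarith
        qed
        then have "expectation (\<lambda>\<omega>. c * (1 - cut m (Y n \<omega>))) \<le> expectation (\<lambda>\<omega>. 1 - gauss (of_real (\<sigma> m0) * Y n \<omega>))"
          using int cut_b by (intro integral_mono) (auto intro!: integrable_const_bound[of _ "1::real"] Bochner_Integration.integrable_diff)
        also have "\<dots> < r * c" using elim int by (simp add: prob_space)
        finally have "c * expectation (\<lambda>\<omega>. 1 - cut m (Y n \<omega>)) < c * r" by (simp add: mult.commute)
        then show ?case using c by simp
      qed
    qed
  qed
  have cutY: "integrable M (\<lambda>\<omega>. cut m (Y n \<omega>))" for m n
    using cut_b by (intro integrable_const_bound[of _ 1]) auto
  have cutq_i: "integrable lborel (\<lambda>x. cut m x * q x)" for m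
  proof (rule integrable_compact_support[where B=B\<psi> and K="real m + 2"])
    have "0 \<le> B\<psi>" using bdq[of 0] by linarith
    then show "\<bar>cut m x * q x\<bar> \<le> B\<psi>" for x
      using mult_mono[OF cut_b(3)[of m x] bdq[of x]] by (simp add: abs_mult)
  qed (auto simp: cut_s)
  have cutq_lim: "(\<lambda>n. expectation (\<lambda>\<omega>. cut m (Y n \<omega>))) \<longlonglongrightarrow> (LINT x|lborel. cut m x * q x)" for m
    by (rule compact_conv[OF cut_c cut_b(3) cut_s]) (auto simp: add_ac)
  have mass_le: "(LINT x|lborel. cut m x * q x) \<le> 1" for m
  proof (rule LIMSEQ_le_const2[OF cutq_lim])
    show "\<exists>N. \<forall>n\<ge>N. expectation (\<lambda>\<omega>. cut m (Y n \<omega>)) \<le> 1"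
      using cut_b by (auto intro!: integral_le_const cutY)
  qed
  \<comment> \<open>By tightness no mass escapes to infinity; with monotone convergence along the
    cutoffs this makes q a probability density.\<close>
  have mass_lim: "(\<lambda>m. LINT x|lborel. cut m x * q x) \<longlonglongrightarrow> 1"
  proof (rule LIMSEQ_I)
    fix r :: real assume "0 < r"
    then obtain m0 where m0: "\<And>m. m \<ge> m0 \<Longrightarrow> \<forall>\<^sub>F n in sequentially. expectation (\<lambda>\<omega>. 1 - cut m (Y n \<omega>)) \<le> r / 2"
      using tight[of "r/2"] by auto
    have "\<bar>(LINT x|lborel. cut m x * q x) - 1\<bar> < r" if "m \<ge> m0" for m
    proof -
      have "1 - r / 2 \<le> (LINT x|lborel. cut m x * q x)"
      proof (rule tendsto_lowerbound[OF cutq_lim])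
        show "\<forall>\<^sub>F n in sequentially. 1 - r / 2 \<le> expectation (\<lambda>\<omega>. cut m (Y n \<omega>))"
          using m0[OF that] by eventually_elim (use cutY in \<open>simp add: prob_space\<close>)
      qed simp
      then show ?thesis using mass_le[of m] \<open>0 < r\<close> by linarith
    qed
    then show "\<exists>no. \<forall>m\<ge>no. norm ((LINT x|lborel. cut m x * q x) - 1) < r" by auto
  qed
  have cut_mono: "cut m x \<le> cut n x" if "m \<le> n" for m n x using that by (auto simp: cut_def)
  have cut_lim: "(\<lambda>m. cut m x) \<longlonglongrightarrow> 1" for x
  proof (rule tendsto_eventually)
    obtain m0 where "norm x \<le> real m0" using real_arch_simple by blast
    then show "\<forall>\<^sub>F m in sequentially. cut m x = 1"
      unfolding eventually_sequentially by (intro exI[of _ m0]) (auto intro!: cut_1)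
  qed
  have qlim: "(\<lambda>m. cut m x * q x) \<longlonglongrightarrow> q x" for x
    using tendsto_mult[OF cut_lim[of x] tendsto_const[of "q x"]] by simp
  have mono: "AE x in lborel. mono (\<lambda>n. cut n x * q x)"
    by (auto intro!: AE_I2 monoI mult_right_mono cut_mono qpos)
  have qlim': "AE x in lborel. (\<lambda>m. cut m x * q x) \<longlonglongrightarrow> q x"
    by (rule AE_I2) (rule qlim)
  have qi: "integrable lborel q"
    by (rule integrable_monotone_convergence[OF cutq_i mono qlim' mass_lim]) simp
  have q1: "integral\<^sup>L lborel q = 1"
    by (rule integral_monotone_convergence[OF cutq_i mono qlim' mass_lim]) simp
  define H where "H = density lborel (\<lambda>x. ennreal (q x))"
  have sH: "sets H = sets borel" by (simp add: H_def)
  have pH: "prob_space H"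
  proof
    show "emeasure H (space H) = 1"
      unfolding H_def using qi qpos q1 by (simp add: emeasure_density nn_integral_eq_integral)
  qed
  have H_int: "(LINT x|H. g x) = (LINT x|lborel. q x * g x)" if "g \<in> borel_measurable borel" for g :: "complex \<Rightarrow> real"
    unfolding H_def using that qpos by (subst integral_density) auto
  have conv: "(\<lambda>n. expectation (\<lambda>\<omega>. g (Y n \<omega>))) \<longlonglongrightarrow> (LINT x|H. g x)"
    if gc: "continuous_on UNIV g" and "bounded (range g)" for g :: "complex \<Rightarrow> real"
  proof (rule LIMSEQ_I)
    fix r :: real assume "0 < r"
    have [measurable]: "g \<in> borel_measurable borel" using gc by (rule borel_measurable_continuous_onI)
    obtain B where gB: "\<And>x. \<bar>g x\<bar> \<le> B" and "0 < B"
      using \<open>bounded (range g)\<close> by (auto simp: bounded_pos)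
    have gY: "integrable M (\<lambda>\<omega>. g (Y n \<omega>))" for n using gB by (intro integrable_const_bound[of _ B]) auto
    have gcY: "integrable M (\<lambda>\<omega>. g (Y n \<omega>) * cut m (Y n \<omega>))" for n m
      using mult_mono[OF gB cut_b(3)] \<open>0 < B\<close> by (intro integrable_const_bound[of _ B]) (auto simp: abs_mult)
    have gq: "integrable lborel (\<lambda>x. q x * g x)"
    proof (rule Bochner_Integration.integrable_bound[OF integrable_mult_right[OF qi, of B]])
      show "AE x in lborel. norm (q x * g x) \<le> norm (B * q x)"
      proof (rule AE_I2)
        fix x
        have "q x * \<bar>g x\<bar> \<le> q x * B" using gB qpos by (intro mult_left_mono)
        then show "norm (q x * g x) \<le> norm (B * q x)"
          using qpos[of x] \<open>0 < B\<close> by (simp add: abs_mult mult.commute)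
      qed
    qed simp
    have gcut: "integrable lborel (\<lambda>x. g x * cut m x * q x)" for m
    proof (rule Bochner_Integration.integrable_bound[OF gq])
      show "AE x in lborel. norm (g x * cut m x * q x) \<le> norm (q x * g x)"
      proof (rule AE_I2)
        fix x
        have "\<bar>q x * g x\<bar> * \<bar>cut m x\<bar> \<le> \<bar>q x * g x\<bar> * 1" using cut_b by (intro mult_left_mono) auto
        then show "norm (g x * cut m x * q x) \<le> norm (q x * g x)"
          by (simp add: abs_mult mult_ac)
      qed
    qed simp
    obtain m0 where m0: "\<And>m. m \<ge> m0 \<Longrightarrow> \<forall>\<^sub>F n in sequentially. expectation (\<lambda>\<omega>. 1 - cut m (Y n \<omega>)) \<le> r / (4 * B)"
      using tight[of "r/(4*B)"] \<open>0 < r\<close> \<open>0 < B\<close> by auto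
    have "\<forall>\<^sub>F m in sequentially. 1 - r / (4 * B) < (LINT x|lborel. cut m x * q x)"
      using mass_lim \<open>0 < r\<close> \<open>0 < B\<close> by (intro order_tendstoD) auto
    then obtain m1 where "\<And>m. m \<ge> m1 \<Longrightarrow> 1 - r / (4 * B) < (LINT x|lborel. cut m x * q x)"
      unfolding eventually_sequentially by auto
    then obtain m where m: "m \<ge> m0" "1 - r / (4 * B) < (LINT x|lborel. cut m x * q x)"
      using max.cobounded1 max.cobounded2 by blast
    have c: "(\<lambda>n. expectation (\<lambda>\<omega>. g (Y n \<omega>) * cut m (Y n \<omega>))) \<longlonglongrightarrow> (LINT x|lborel. g x * cut m x * q x)"
    proof (rule compact_conv[of "\<lambda>x. g x * cut m x" B "real m + 2"])
      show "\<bar>g x * cut m x\<bar> \<le> B" for x using mult_mono[OF gB[of x] cut_b(3)[of m x]] \<open>0 < B\<close> by (simp add: abs_mult)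
    qed (auto intro!: continuous_intros gc cut_c cut_s)
    then have "\<forall>\<^sub>F n in sequentially. \<bar>expectation (\<lambda>\<omega>. g (Y n \<omega>) * cut m (Y n \<omega>)) - (LINT x|lborel. g x * cut m x * q x)\<bar> < r / 4"
      using \<open>0 < r\<close> unfolding tendsto_iff dist_real_def by (elim allE[of _ "r / 4"]) simp
    with m0[OF m(1)] have "\<forall>\<^sub>F n in sequentially. \<bar>expectation (\<lambda>\<omega>. g (Y n \<omega>)) - (LINT x|H. g x)\<bar> < r"
    proof eventually_elim
      case (elim n)
      have "expectation (\<lambda>\<omega>. g (Y n \<omega>)) - expectation (\<lambda>\<omega>. g (Y n \<omega>) * cut m (Y n \<omega>)) =
        expectation (\<lambda>\<omega>. g (Y n \<omega>) - g (Y n \<omega>) * cut m (Y n \<omega>))" using gY gcY by simp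
      also have "norm \<dots> \<le> expectation (\<lambda>\<omega>. B * (1 - cut m (Y n \<omega>)))"
      proof (rule norm_integral_le)
        fix \<omega>
        have "norm (g (Y n \<omega>) - g (Y n \<omega>) * cut m (Y n \<omega>)) = \<bar>g (Y n \<omega>)\<bar> * (1 - cut m (Y n \<omega>))"
        proof -
          have "g (Y n \<omega>) - g (Y n \<omega>) * cut m (Y n \<omega>) = g (Y n \<omega>) * (1 - cut m (Y n \<omega>))"
            by (simp add: right_diff_distrib)
          then show ?thesis using cut_b(2)[of m "Y n \<omega>"] by (simp add: abs_mult)
        qed
        also have "\<dots> \<le> B * (1 - cut m (Y n \<omega>))" using gB cut_b by (intro mult_right_mono) auto
        finally show "norm (g (Y n \<omega>) - g (Y n \<omega>) * cut m (Y n \<omega>)) \<le> B * (1 - cut m (Y n \<omega>))" .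
      qed (use cutY in auto)
      also have "\<dots> = B * expectation (\<lambda>\<omega>. 1 - cut m (Y n \<omega>))" by simp
      also have "\<dots> \<le> r / 4" using mult_left_mono[OF elim(1), of B] \<open>0 < B\<close> by simp
      finally have 1: "\<bar>expectation (\<lambda>\<omega>. g (Y n \<omega>)) - expectation (\<lambda>\<omega>. g (Y n \<omega>) * cut m (Y n \<omega>))\<bar> \<le> r / 4" by simp
      have "(LINT x|H. g x) - (LINT x|lborel. g x * cut m x * q x) = (LINT x|lborel. q x * g x - g x * cut m x * q x)"
        using gq gcut by (simp add: H_int)
      also have "norm \<dots> \<le> (LINT x|lborel. B * (q x - cut m x * q x))"
      proof (rule norm_integral_le)
        fix x
        have "q x * g x - g x * cut m x * q x = g x * (q x - cut m x * q x)" by (simp add: algebra_simps)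
        moreover have "0 \<le> q x - cut m x * q x" using cut_b[of m x] qpos[of x] by (simp add: mult_left_le_one_le)
        ultimately show "norm (q x * g x - g x * cut m x * q x) \<le> B * (q x - cut m x * q x)"
          using gB[of x] by (simp add: abs_mult mult_right_mono)
      qed (use qi cutq_i in auto)
      also have "\<dots> = B * (1 - (LINT x|lborel. cut m x * q x))" using qi cutq_i q1 by simp
      also have "\<dots> \<le> B * (r / (4 * B))" using m(2) \<open>0 < B\<close> by (intro mult_left_mono) auto
      also have "\<dots> = r / 4" using \<open>0 < B\<close> by simp
      finally show ?case using 1 elim(2) \<open>0 < r\<close> unfolding real_norm_def by linarith
    qed
    then show "\<exists>no. \<forall>n\<ge>no. norm (expectation (\<lambda>\<omega>. g (Y n \<omega>)) - (LINT x|H. g x)) < r"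
      by (auto simp: eventually_sequentially)
  qed
  have "converges_in_distr M Y H"
    unfolding converges_in_distr_def using pH sH conv Y \<open>prob_space M\<close> by auto
  \<comment> \<open>The convergence just shown is for real test functions, so it is applied to
    cosine and sine separately.\<close>
  moreover have "char_vec H t = \<psi> t" for t
  proof -
    interpret H: prob_space H by fact
    have [measurable_cong]: "sets H = sets borel" by (rule sH)
    have iH: "integrable H (\<lambda>x. iexp (t \<bullet> x))" by (rule H.integrable_const_bound[of _ 1]) auto
    have iM: "integrable M (\<lambda>\<omega>. iexp (t \<bullet> Y n \<omega>))" for n by (rule integrable_iexp_inner) auto
    have re: "Re (C n t) = expectation (\<lambda>\<omega>. cos (t \<bullet> Y n \<omega>))" "Im (C n t) = expectation (\<lambda>\<omega>. sin (t \<bullet> Y n \<omega>))" for n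
      unfolding C_def using integral_Re[OF iM] integral_Im[OF iM] by (simp_all add: Re_exp Im_exp)
    have reH: "Re (char_vec H t) = (LINT x|H. cos (t \<bullet> x))" "Im (char_vec H t) = (LINT x|H. sin (t \<bullet> x))"
      unfolding char_vec_def using integral_Re[OF iH] integral_Im[OF iH] by (simp_all add: Re_exp Im_exp)
    have "(\<lambda>n. Re (C n t)) \<longlonglongrightarrow> Re (char_vec H t)" unfolding re reH
      by (rule conv[of "\<lambda>x. cos (t \<bullet> x)"]) (auto intro!: continuous_intros boundedI[of _ 1])
    moreover have "(\<lambda>n. Im (C n t)) \<longlonglongrightarrow> Im (char_vec H t)" unfolding re reH
      by (rule conv[of "\<lambda>x. sin (t \<bullet> x)"]) (auto intro!: continuous_intros boundedI[of _ 1])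
    ultimately show ?thesis
      using LIMSEQ_unique[OF _ tendsto_Re[OF Clim[of t]]] LIMSEQ_unique[OF _ tendsto_Im[OF Clim[of t]]]
      by (intro complex_eqI) auto
  qed
  ultimately show ?thesis using pH sH by blast
qed

section \<open>Measurability of the largest root and critical point\<close>

lemma Arg_measurable [measurable]: "Arg \<in> borel_measurable borel"
proof -
  have c: "continuous_on (- \<real>\<^sub>\<le>\<^sub>0) Arg"
    by (rule continuous_on_Arg)
  have "(\<lambda>z. if z = 0 then 0 else if z \<in> - \<real>\<^sub>\<le>\<^sub>0 then Arg z else pi) \<in> borel_measurable borel"
    by (intro measurable_If borel_measurable_continuous_on_if c) auto
  also have "(\<lambda>z. if z = 0 then 0 else if z \<in> - \<real>\<^sub>\<le>\<^sub>0 then Arg z else pi) = Arg"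
    by (auto simp: fun_eq_iff Arg_zero nonpos_Reals_def Arg_eq_pi complex_nonpos_Reals_iff)
  finally show ?thesis .
qed

lemma cis_measurable [measurable]: "cis \<in> borel_measurable borel"
  by (intro borel_measurable_continuous_onI continuous_intros)

lemma norm_cis_Arg: "complex_of_real (norm z) * cis (Arg z) = z"
  by (metis cis_conv_exp Arg_eq mult_zero_left norm_zero of_real_0)

lemma mod_arg_le_largest_pt:
  assumes "finite S" "S \<noteq> {}"
  shows "largest_pt S \<in> S" "\<And>w. w \<in> S \<Longrightarrow> mod_arg_le w (largest_pt S)"
    and "\<And>z. z \<in> S \<Longrightarrow> (\<And>w. w \<in> S \<Longrightarrow> mod_arg_le w z) \<Longrightarrow> largest_pt S = z"
proof -
  have "\<exists>z\<in>S. \<forall>w\<in>S. mod_arg_le w z"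
    using assms
  proof (induction rule: finite_ne_induct)
    case (singleton x)
    then show ?case by (auto simp: mod_arg_le_def)
  next
    case (insert x F)
    then obtain z where z: "z \<in> F" "\<And>w. w \<in> F \<Longrightarrow> mod_arg_le w z" by auto
    show ?case
    proof (cases "mod_arg_le x z")
      case True
      then show ?thesis using z by auto
    next
      case False
      then have "mod_arg_le z x" by (auto simp: mod_arg_le_def)
      then have "mod_arg_le w x" if "w \<in> F" for w
        using z(2)[OF that] by (auto simp: mod_arg_le_def)
      then show ?thesis by (auto simp: mod_arg_le_def)
    qed
  qed
  then obtain z where z: "z \<in> S" "\<And>w. w \<in> S \<Longrightarrow> mod_arg_le w z" by auto
  have anti: "x = y" if "mod_arg_le x y" "mod_arg_le y x" for x y
  proof -
    have "norm x = norm y" "Arg x = Arg y" using that by (auto simp: mod_arg_le_def)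
    then show ?thesis by (metis norm_cis_Arg)
  qed
  have uniq: "largest_pt S = y" if "y \<in> S" "\<And>w. w \<in> S \<Longrightarrow> mod_arg_le w y" for y
    unfolding largest_pt_def by (rule the_equality) (use that anti in auto)
  have "largest_pt S = z" by (rule uniq) (use z in auto)
  then show "largest_pt S \<in> S" "\<And>w. w \<in> S \<Longrightarrow> mod_arg_le w (largest_pt S)"
    using z by auto
  show "\<And>z. z \<in> S \<Longrightarrow> (\<And>w. w \<in> S \<Longrightarrow> mod_arg_le w z) \<Longrightarrow> largest_pt S = z"
    by (rule uniq)
qed

text \<open>The modulus attains its minimum on the compact set and takes values arbitrarily close to
  it on a countable dense subset, so the existence of a zero is a countable condition.\<close>

lemma sets_exists_zero_in_compact:
  fixes F :: "'a \<Rightarrow> 'b::euclidean_space \<Rightarrow> complex"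
  assumes K: "compact K"
    and cont: "\<And>\<omega>. \<omega> \<in> space M \<Longrightarrow> continuous_on K (F \<omega>)"
    and meas [measurable]: "\<And>z. z \<in> K \<Longrightarrow> (\<lambda>\<omega>. F \<omega> z) \<in> borel_measurable M"
  shows "{\<omega> \<in> space M. \<exists>z\<in>K. F \<omega> z = 0} \<in> sets M"
proof -
  obtain D where D: "countable D" "D \<subseteq> K" "K \<subseteq> closure D"
    using separable by blast
  have "{\<omega> \<in> space M. \<exists>z\<in>K. F \<omega> z = 0} = (\<Inter>k::nat. \<Union>z\<in>D. {\<omega> \<in> space M. norm (F \<omega> z) < 1 / real (Suc k)})"
    (is "?A = ?B")
  proof (intro set_eqI iffI)
    fix \<omega> assume "\<omega> \<in> ?A"
    then obtain z where z: "\<omega> \<in> space M" "z \<in> K" "F \<omega> z = 0" by auto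
    have "\<exists>y\<in>D. norm (F \<omega> y) < 1 / real (Suc k)" for k
    proof -
      obtain d where d: "d > 0" "\<And>y. y \<in> K \<Longrightarrow> dist y z < d \<Longrightarrow> dist (F \<omega> y) (F \<omega> z) < 1 / real (Suc k)"
        using cont[OF z(1)] z(2) unfolding continuous_on_iff by (metis of_nat_0_less_iff zero_less_Suc zero_less_divide_1_iff)
      obtain y where "y \<in> D" "dist y z < d"
        using z(2) D(3) d(1) closure_approachable by blast
      then show ?thesis using d(2)[of y] D(2) z(3) by (auto simp: dist_norm)
    qed
    then show "\<omega> \<in> ?B" using z(1) by auto
  next
    fix \<omega> assume B: "\<omega> \<in> ?B"
    then have sp: "\<omega> \<in> space M" and ex: "\<And>k. \<exists>z\<in>D. norm (F \<omega> z) < 1 / real (Suc k)" by auto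
    have "K \<noteq> {}" using ex D by blast
    then obtain z where z: "z \<in> K" "\<And>y. y \<in> K \<Longrightarrow> norm (F \<omega> z) \<le> norm (F \<omega> y)"
      using continuous_attains_inf[OF K, of "\<lambda>z. norm (F \<omega> z)"] cont[OF sp] continuous_on_norm by blast
    have "F \<omega> z = 0"
    proof (rule ccontr)
      assume "F \<omega> z \<noteq> 0"
      then obtain k where k: "inverse (real (Suc k)) < norm (F \<omega> z)"
        using reals_Archimedean by (meson zero_less_norm_iff)
      obtain y where "y \<in> D" "norm (F \<omega> y) < 1 / real (Suc k)" using ex by blast
      then show False using z(2)[of y] D(2) k by (auto simp: inverse_eq_divide)
    qed
    then show "\<omega> \<in> ?A" using z sp by auto
  qed
  also have "?B \<in> sets M"
  proof (intro sets.countable_INT' sets.countable_UN' D(1))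
    show "(\<lambda>k. \<Union>z\<in>D. {\<omega> \<in> space M. norm (F \<omega> z) < 1 / real (Suc k)}) ` UNIV \<subseteq> sets M"
    proof (clarify, intro sets.countable_UN' D(1))
      fix k :: nat
      show "(\<lambda>z. {\<omega> \<in> space M. norm (F \<omega> z) < 1 / real (Suc k)}) ` D \<subseteq> sets M"
      proof clarify
        fix z assume "z \<in> D"
        then have [measurable]: "(\<lambda>\<omega>. F \<omega> z) \<in> borel_measurable M" using D(2) meas by auto
        show "{\<omega> \<in> space M. norm (F \<omega> z) < 1 / real (Suc k)} \<in> sets M" by measurable
      qed
    qed
  qed auto
  finally show ?thesis .
qed

lemma poly_measurable:
  fixes P :: "'a \<Rightarrow> complex poly"
  assumes [measurable]: "\<And>i. (\<lambda>\<omega>. coeff (P \<omega>) i) \<in> borel_measurable M" "Z \<in> borel_measurable M"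
    and deg: "\<And>\<omega>. \<omega> \<in> space M \<Longrightarrow> degree (P \<omega>) \<le> N"
  shows "(\<lambda>\<omega>. poly (P \<omega>) (Z \<omega>)) \<in> borel_measurable M"
proof -
  have "(\<lambda>\<omega>. \<Sum>i\<le>N. coeff (P \<omega>) i * Z \<omega> ^ i) \<in> borel_measurable M" by measurable
  moreover have "poly (P \<omega>) (Z \<omega>) = (\<Sum>i\<le>N. coeff (P \<omega>) i * Z \<omega> ^ i)" if "\<omega> \<in> space M" for \<omega>
    unfolding poly_altdef
    by (rule sum.mono_neutral_left) (use deg[OF that] in \<open>auto simp: coeff_eq_0\<close>)
  ultimately show ?thesis by (subst measurable_cong) auto
qed

text \<open>No enumeration of the roots is chosen. The modulus R of the largest root is measurable
  because {R \<ge> a} says that some root lies in a compact annulus. Then {Arg \<ge> a} says that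
  some root lies on an arc of the circle of radius R, and the point is recovered from its polar
  coordinates.\<close>

lemma largest_pt_roots_measurable:
  fixes P :: "'a \<Rightarrow> complex poly"
  assumes co [measurable]: "\<And>i. (\<lambda>\<omega>. coeff (P \<omega>) i) \<in> borel_measurable M"
    and deg: "\<And>\<omega>. \<omega> \<in> space M \<Longrightarrow> degree (P \<omega>) \<le> N"
    and deg1: "\<And>\<omega>. \<omega> \<in> space M \<Longrightarrow> 1 \<le> degree (P \<omega>)"
  shows "(\<lambda>\<omega>. largest_pt (roots (P \<omega>))) \<in> borel_measurable M"
proof -
  define W where "W \<omega> = largest_pt (roots (P \<omega>))" for \<omega>
  note [measurable] = poly_measurable[OF co _ deg]
  have fin: "finite (roots (P \<omega>))" "roots (P \<omega>) \<noteq> {}" if "\<omega> \<in> space M" for \<omega>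
  proof -
    have "P \<omega> \<noteq> 0" using deg1[OF that] by auto
    then show "finite (roots (P \<omega>))" unfolding roots_def by (rule poly_roots_finite)
    have "\<not> constant (poly (P \<omega>))" using deg1[OF that] unfolding constant_degree by linarith
    then obtain z where "poly (P \<omega>) z = 0" using fundamental_theorem_of_algebra by blast
    then show "roots (P \<omega>) \<noteq> {}" unfolding roots_def by blast
  qed
  have W: "poly (P \<omega>) (W \<omega>) = 0" and Wmax: "\<And>w. poly (P \<omega>) w = 0 \<Longrightarrow> mod_arg_le w (W \<omega>)" if "\<omega> \<in> space M" for \<omega>
  proof -
    have "W \<omega> \<in> roots (P \<omega>)" unfolding W_def by (rule mod_arg_le_largest_pt(1)[OF fin[OF that]])
    then show "poly (P \<omega>) (W \<omega>) = 0" unfolding roots_def by simp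
    show "mod_arg_le w (W \<omega>)" if "poly (P \<omega>) w = 0" for w
      unfolding W_def by (rule mod_arg_le_largest_pt(2)[OF fin[OF \<open>\<omega> \<in> space M\<close>]]) (use that in \<open>simp add: roots_def\<close>)
  qed
  define R where "R \<omega> = norm (W \<omega>)" for \<omega>
  have R [measurable]: "R \<in> borel_measurable M"
    unfolding borel_measurable_iff_ge
  proof
    fix a
    have "{\<omega> \<in> space M. a \<le> R \<omega>} = (\<Union>n::nat. {\<omega> \<in> space M. \<exists>z\<in>cball 0 (real n) - ball 0 a. poly (P \<omega>) z = 0})"
      (is "?A = ?B")
    proof (intro set_eqI iffI)
      fix \<omega> assume A: "\<omega> \<in> ?A"
      obtain n where "norm (W \<omega>) \<le> real n" using real_arch_simple by blast
      then have "W \<omega> \<in> cball 0 (real n) - ball 0 a" using A by (simp add: R_def)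
      then show "\<omega> \<in> ?B" using W[of \<omega>] A by blast
    next
      fix \<omega> assume "\<omega> \<in> ?B"
      then obtain z where z: "\<omega> \<in> space M" "a \<le> norm z" "poly (P \<omega>) z = 0" by (auto simp: not_less)
      have "norm z \<le> norm (W \<omega>)" using Wmax[OF z(1,3)] unfolding mod_arg_le_def by linarith
      then show "\<omega> \<in> ?A" using z(1,2) by (simp add: R_def)
    qed
    also have "?B \<in> sets M"
    proof (rule sets.countable_UN, clarify)
      fix n :: nat
      show "{\<omega> \<in> space M. \<exists>z\<in>cball 0 (real n) - ball 0 a. poly (P \<omega>) z = 0} \<in> sets M"
        by (rule sets_exists_zero_in_compact) (auto intro!: continuous_intros compact_diff)
    qed
    finally show "{\<omega> \<in> space M. a \<le> R \<omega>} \<in> sets M" .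
  qed
  have A [measurable]: "(\<lambda>\<omega>. Arg (W \<omega>)) \<in> borel_measurable M"
    unfolding borel_measurable_iff_ge
  proof
    fix a
    show "{\<omega> \<in> space M. a \<le> Arg (W \<omega>)} \<in> sets M"
    proof (cases "a \<le> - pi")
      case True
      have "a \<le> Arg z" for z using True Arg_bounded[of z] by linarith
      then have "{\<omega> \<in> space M. a \<le> Arg (W \<omega>)} = space M" by simp
      then show ?thesis by simp
    next
      case False
      define E where "E = {\<omega> \<in> space M. \<exists>\<theta>\<in>{a..pi}. poly (P \<omega>) (complex_of_real (R \<omega>) * cis \<theta>) = 0}"
      have E: "E \<in> sets M" unfolding E_def
        by (rule sets_exists_zero_in_compact) (auto intro!: continuous_intros)
      \<comment> \<open>For a > - pi the angles of the arc are principal arguments, so a root on it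
        with modulus R competes in the tie-break. The case R = 0 is separate because every angle
        then gives the point 0, whose \<open>Arg\<close> is 0.\<close>
      have "{\<omega> \<in> space M. a \<le> Arg (W \<omega>)} = ({\<omega> \<in> space M. 0 < R \<omega>} \<inter> E) \<union> {\<omega> \<in> space M. R \<omega> = 0 \<and> a \<le> 0}" (is "?A = ?B")
      proof (intro set_eqI iffI)
        fix \<omega> assume A: "\<omega> \<in> ?A"
        show "\<omega> \<in> ?B"
        proof (cases "W \<omega> = 0")
          case True
          then show ?thesis using A by (auto simp: R_def Arg_zero)
        next
          case False
          moreover have "poly (P \<omega>) (complex_of_real (R \<omega>) * cis (Arg (W \<omega>))) = 0"
            using A W[of \<omega>] by (simp add: R_def norm_cis_Arg)
          ultimately show ?thesis using A Arg_bounded[of "W \<omega>"] by (auto simp: E_def R_def)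
        qed
      next
        fix \<omega> assume B: "\<omega> \<in> ?B"
        show "\<omega> \<in> ?A"
        proof (cases "R \<omega> = 0")
          case True
          then show ?thesis using B by (auto simp: R_def Arg_zero)
        next
          case F: False
          then obtain \<theta> where t: "a \<le> \<theta>" "\<theta> \<le> pi" "poly (P \<omega>) (complex_of_real (R \<omega>) * cis \<theta>) = 0" "\<omega> \<in> space M" "0 < R \<omega>"
            using B by (auto simp: E_def)
          have "Arg (complex_of_real (R \<omega>) * cis \<theta>) = \<theta>"
            using t False by (intro Arg_unique[of "R \<omega>"]) (auto simp: cis_conv_exp)
          moreover have "norm (complex_of_real (R \<omega>) * cis \<theta>) = R \<omega>" using t by (simp add: norm_mult)
          ultimately show ?thesis using Wmax[OF t(4,3)] t by (auto simp: mod_arg_le_def R_def)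
        qed
      qed
      also have "?B \<in> sets M" using E by measurable
      finally show ?thesis .
    qed
  qed
  have "(\<lambda>\<omega>. complex_of_real (R \<omega>) * cis (Arg (W \<omega>))) \<in> borel_measurable M" by measurable
  then show ?thesis unfolding R_def W_def norm_cis_Arg .
qed

lemma coeff_random_poly_measurable:
  fixes X :: "nat \<Rightarrow> 'a \<Rightarrow> complex"
  assumes X: "\<And>j. j \<in> J \<Longrightarrow> X j \<in> borel_measurable M" and "finite J"
  shows "(\<lambda>\<omega>. coeff (\<Prod>j\<in>J. [:- X j \<omega>, 1:]) i) \<in> borel_measurable M"
  using \<open>finite J\<close> X
proof (induction J arbitrary: i)
  case empty
  then show ?case by simp
next
  case (insert j J)
  have Xj [measurable]: "X j \<in> borel_measurable M" and [measurable]: "\<And>k. (\<lambda>\<omega>. coeff (\<Prod>j\<in>J. [:- X j \<omega>, 1:]) k) \<in> borel_measurable M"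
    using insert by auto
  have [measurable]: "(\<lambda>\<omega>. coeff [:- X j \<omega>, 1:] k) \<in> borel_measurable M" for k
    by (cases k; cases "k - 1") (use borel_measurable_uminus[OF Xj] in \<open>auto simp: coeff_pCons split: nat.split\<close>)
  have "(\<lambda>\<omega>. \<Sum>k\<le>i. coeff [:- X j \<omega>, 1:] k * coeff (\<Prod>j\<in>J. [:- X j \<omega>, 1:]) (i - k)) \<in> borel_measurable M"
    by measurable
  then show ?case unfolding prod.insert[OF insert(1,2)] coeff_mult .
qed

lemma degree_random_poly: "degree (random_poly X n \<omega>) = n"
  unfolding random_poly_def by (subst degree_prod_eq_sum_degree) auto

lemma largest_root_measurable:
  assumes "\<And>j. 1 \<le> j \<Longrightarrow> X j \<in> borel_measurable M" "1 \<le> n"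
  shows "(\<lambda>\<omega>. largest_pt (roots (random_poly X n \<omega>))) \<in> borel_measurable M"
proof -
  have [measurable]: "(\<lambda>\<omega>. coeff (random_poly X n \<omega>) i) \<in> borel_measurable M" for i
    unfolding random_poly_def by (intro coeff_random_poly_measurable) (auto intro: assms)
  show ?thesis
    by (rule largest_pt_roots_measurable[where N=n]) (use assms(2) in \<open>auto simp: degree_random_poly\<close>)
qed

lemma largest_critical_point_measurable:
  assumes "\<And>j. 1 \<le> j \<Longrightarrow> X j \<in> borel_measurable M"
  shows "(\<lambda>\<omega>. largest_pt (critical_points (random_poly X n \<omega>))) \<in> borel_measurable M"
proof (cases "2 \<le> n")
  case True
  have [measurable]: "(\<lambda>\<omega>. coeff (random_poly X n \<omega>) i) \<in> borel_measurable M" for i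
    unfolding random_poly_def by (intro coeff_random_poly_measurable) (auto intro: assms)
  show ?thesis unfolding critical_points_def
    by (rule largest_pt_roots_measurable[where N=n]) (use True in \<open>auto simp: coeff_pderiv degree_pderiv degree_random_poly\<close>)
next
  case False
  \<comment> \<open>For n = 0 the derivative is zero and for n = 1 it is 1. Either way the root set
    is deterministic, so \<open>largest_pt\<close> returns a constant.\<close>
  have "pderiv (random_poly X n \<omega>) = [:of_nat n:]" for \<omega>
    using False by (cases n; cases "n - 1") (auto simp: random_poly_def pderiv_pCons)
  then show ?thesis unfolding critical_points_def by simp
qed

section \<open>Radially symmetric laws with a power edge\<close>

text \<open>Jordan's inequality: by concavity the sine lies above its chord from 0 to pi /
  2.\<close>

lemma sin_ge_chord:
  assumes "0 \<le> x" "x \<le> pi / 2"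
  shows "2 * x / pi \<le> sin x"
proof -
  have c: "concave_on {0..pi} (sin :: real \<Rightarrow> real)"
  proof (rule f''_le0_imp_concave[where f' = cos and f'' = "\<lambda>x. - sin x"])
    show "convex {0..pi}" by (rule convex_real_interval)
    show "(sin has_real_derivative cos x) (at x)" for x :: real by (rule DERIV_sin)
    show "(cos has_real_derivative - sin x) (at x)" for x :: real by (rule DERIV_cos)
    show "- sin x \<le> 0" if "x \<in> {0..pi}" for x using sin_ge_zero[of x] that by simp
  qed
  define t where "t = 2 * x / pi"
  have t: "0 \<le> t" "t \<le> 1" using assms by (auto simp: t_def field_simps)
  have x: "x = t * (pi / 2)" by (simp add: t_def)
  have "(1 - t) * sin 0 + t * sin (pi / 2) \<le> sin ((1 - t) *\<^sub>R 0 + t *\<^sub>R (pi / 2))"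
    using t by (intro concave_onD[OF c]) auto
  then have "t \<le> sin (t * (pi / 2))" by simp
  then show ?thesis unfolding x[symmetric] by (simp only: t_def)
qed

text \<open>The squared distance is (1 - r)^2 + 2 r (1 - cos \<theta>). The second term is bounded
  below by Jordan's inequality at the half angle, with r \<ge> 1/2 supplying the constant.\<close>

lemma norm_one_minus_polar:
  assumes "1 / 2 \<le> r" "r \<le> 1" "\<bar>\<theta>\<bar> \<le> pi"
  shows "\<bar>\<theta>\<bar> / pi \<le> norm (1 - complex_of_real r * cis \<theta>)" "1 - r \<le> norm (1 - complex_of_real r * cis \<theta>)"
proof -
  have s: "(2 * (\<bar>\<theta>\<bar> / 2) / pi)\<^sup>2 \<le> (sin (\<bar>\<theta>\<bar> / 2))\<^sup>2"
    using assms by (intro power_mono sin_ge_chord) auto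
  have s2: "(sin (\<bar>\<theta>\<bar> / 2))\<^sup>2 = (1 - cos \<theta>) / 2"
  proof -
    have "cos (2 * (\<bar>\<theta>\<bar> / 2)) = 1 - 2 * (sin (\<bar>\<theta>\<bar> / 2))\<^sup>2" by (rule cos_double_sin)
    then show ?thesis by simp
  qed
  have "(norm (1 - complex_of_real r * cis \<theta>))\<^sup>2 = (1 - r * cos \<theta>)\<^sup>2 + (r * sin \<theta>)\<^sup>2"
    by (simp add: cmod_power2)
  also have "(r * sin \<theta>)\<^sup>2 = r\<^sup>2 * (1 - (cos \<theta>)\<^sup>2)"
    by (simp add: power_mult_distrib sin_squared_eq)
  also have "(1 - r * cos \<theta>)\<^sup>2 + r\<^sup>2 * (1 - (cos \<theta>)\<^sup>2) = (1 - r)\<^sup>2 + 2 * r * (1 - cos \<theta>)"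
    by (simp add: power2_eq_square algebra_simps)
  finally have n: "(norm (1 - complex_of_real r * cis \<theta>))\<^sup>2 = (1 - r)\<^sup>2 + 2 * r * (1 - cos \<theta>)" .
  have "(\<bar>\<theta>\<bar> / pi)\<^sup>2 \<le> (1 - cos \<theta>) / 2" using s s2 by simp
  also have "\<dots> \<le> 1 * (1 - cos \<theta>)" by simp
  also have "\<dots> \<le> 2 * r * (1 - cos \<theta>)" using assms by (intro mult_right_mono) auto
  finally have "(\<bar>\<theta>\<bar> / pi)\<^sup>2 \<le> (norm (1 - complex_of_real r * cis \<theta>))\<^sup>2"
    unfolding n using zero_le_power2[of "1 - r"] by linarith
  then show "\<bar>\<theta>\<bar> / pi \<le> norm (1 - complex_of_real r * cis \<theta>)"
    by (rule power2_le_imp_le) (rule norm_ge_zero)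
  show "1 - r \<le> norm (1 - complex_of_real r * cis \<theta>)"
    using norm_triangle_ineq2[of 1 "complex_of_real r * cis \<theta>"] assms by (simp add: norm_mult)
qed

lemma nn_integral_FTC_square:
  assumes "0 \<le> a"
  shows "(\<integral>\<^sup>+r. ennreal (2 * pi * r) * indicator {0..a} r \<partial>lborel) = ennreal (pi * a\<^sup>2)"
proof -
  have d: "((\<lambda>r. pi * r\<^sup>2) has_real_derivative 2 * pi * x) (at x)" for x :: real
    by (auto intro!: derivative_eq_intros)
  show ?thesis
    using nn_integral_FTC_Icc[of "\<lambda>r. 2 * pi * r" 0 a "\<lambda>r. pi * r\<^sup>2"] d assms by simp
qed

text \<open>Half-lines generate the Borel sets and are stable under intersection, so the areas of
  discs determine the image measure.\<close>

lemma distr_norm_lborel: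
  "distr (lborel :: complex measure) borel norm = density lborel (\<lambda>r. ennreal (2 * pi * r) * indicator {0..} r)"
  (is "?L = ?R")
proof (rule measure_eqI_generator_eq[where A="\<lambda>i::nat. {..real i}" and \<Omega>=UNIV and E="range (\<lambda>a. {..a})"])
  show "Int_stable (range (\<lambda>a::real. {..a}))" by (auto simp: Int_stable_def)
  have e: "emeasure ?L {..a} = ennreal (if 0 \<le> a then pi * a\<^sup>2 else 0)" for a
  proof -
    have v: "norm -` {..a} = cball (0::complex) a" by auto
    have "emeasure lborel (cball (0::complex) a) = ennreal (pi * a\<^sup>2)" if "0 \<le> a"
      using that by (simp add: emeasure_cball unit_ball_vol_2)
    moreover have "cball (0::complex) a = {}" if "\<not> 0 \<le> a" using that by auto
    ultimately show ?thesis by (subst emeasure_distr) (auto simp: v)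
  qed
  show "emeasure ?L X = emeasure ?R X" if "X \<in> range (\<lambda>a::real. {..a})" for X
  proof -
    from that obtain a where X: "X = {..a}" by (rule rangeE)
    have "emeasure ?R {..a} = (\<integral>\<^sup>+r. ennreal (2 * pi * r) * indicator {0..a} r \<partial>lborel)"
      by (subst emeasure_density) (auto intro!: nn_integral_cong simp: indicator_def)
    also have "\<dots> = ennreal (if 0 \<le> a then pi * a\<^sup>2 else 0)"
      using nn_integral_FTC_square[of a] by auto
    finally show ?thesis using e X by simp
  qed
  show "emeasure ?L {..real i} \<noteq> \<infinity>" for i using e by simp
  show "sets ?L = sigma_sets UNIV (range (\<lambda>a::real. {..a}))"
    by (simp add: borel_eq_atMost) 
  show "sets ?R = sigma_sets UNIV (range (\<lambda>a::real. {..a}))"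
    by (simp add: borel_eq_atMost) 
  show "(\<Union>i. {..real i}) = UNIV" using real_arch_simple by auto
qed auto

lemma nn_integral_norm_lborel:
  fixes G :: "real \<Rightarrow> ennreal"
  assumes [measurable]: "G \<in> borel_measurable borel"
  shows "(\<integral>\<^sup>+z. G (norm z) \<partial>(lborel :: complex measure)) = (\<integral>\<^sup>+r. ennreal (2 * pi * r) * indicator {0..} r * G r \<partial>lborel)"
proof -
  have "(\<integral>\<^sup>+z. G (norm z) \<partial>(lborel :: complex measure)) = (\<integral>\<^sup>+r. G r \<partial>distr (lborel :: complex measure) borel norm)"
    by (subst nn_integral_distr) auto
  also have "\<dots> = (\<integral>\<^sup>+r. ennreal (2 * pi * r) * indicator {0..} r * G r \<partial>lborel)"
    unfolding distr_norm_lborel by (subst nn_integral_density) auto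
  finally show ?thesis .
qed

lemma nn_integral_periodic_shift:
  fixes h :: "real \<Rightarrow> ennreal"
  assumes [measurable]: "h \<in> borel_measurable borel" and per: "\<And>x. h (x + 2 * pi) = h x" and a: "0 \<le> a" "a \<le> 2 * pi"
  shows "(\<integral>\<^sup>+x. h (x + a) * indicator {-pi..<pi} x \<partial>lborel) = (\<integral>\<^sup>+x. h x * indicator {-pi..<pi} x \<partial>lborel)"
proof -
  have "(\<integral>\<^sup>+x. h x * indicator {a-pi..<a+pi} x \<partial>lborel) = (\<integral>\<^sup>+x. h (x + a) * indicator {-pi..<pi} x \<partial>lborel)"
    by (subst nn_integral_real_affine[of _ 1 a]) (auto intro!: nn_integral_cong simp: indicator_def add.commute)
  moreover have "(\<integral>\<^sup>+x. h x * indicator {a-pi..<a+pi} x \<partial>lborel) = 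
      (\<integral>\<^sup>+x. h x * indicator {a-pi..<pi} x \<partial>lborel) + (\<integral>\<^sup>+x. h x * indicator {pi..<a+pi} x \<partial>lborel)"
    by (subst nn_integral_add[symmetric]) (use a in \<open>auto intro!: nn_integral_cong simp: indicator_def\<close>)
  moreover have "(\<integral>\<^sup>+x. h x * indicator {pi..<a+pi} x \<partial>lborel) = (\<integral>\<^sup>+x. h x * indicator {-pi..<a-pi} x \<partial>lborel)"
    by (subst nn_integral_real_affine[of _ 1 "2*pi"]) (auto intro!: nn_integral_cong simp: indicator_def add.commute[of "2*pi"] per)
  moreover have "(\<integral>\<^sup>+x. h x * indicator {-pi..<pi} x \<partial>lborel) = 
      (\<integral>\<^sup>+x. h x * indicator {a-pi..<pi} x \<partial>lborel) + (\<integral>\<^sup>+x. h x * indicator {-pi..<a-pi} x \<partial>lborel)"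
    by (subst nn_integral_add[symmetric]) (use a in \<open>auto intro!: nn_integral_cong simp: indicator_def\<close>)
  ultimately show ?thesis by simp
qed

text \<open>The radial density \<open>\<rho>\<close> is a function on the line, and the law enters
  near the edge only through the masses of annuli. The bound \<open>\<epsilon>\<close> \<le> 1/2
  keeps r \<ge> 1/2 on the annulus, as \<open>norm_one_minus_polar\<close> requires.\<close>

locale radial_law = prob_space \<mu> for \<mu> :: "complex measure" +
  fixes \<rho> :: "real \<Rightarrow> real" and \<alpha> \<epsilon> c C :: real
  assumes alpha: "-0.095 < \<alpha>" "\<alpha> < 0"
    and eps: "0 < \<epsilon>" "\<epsilon> \<le> 1 / 2"
    and cC: "0 < c" "0 < C"
    and sets_mu [measurable_cong]: "sets \<mu> = sets borel"
    and rot: "distr \<mu> borel (\<lambda>z. cis \<theta> * z) = \<mu>"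
    and supp: "emeasure \<mu> (- cball 0 1) = 0"
    and rho_measurable [measurable]: "\<rho> \<in> borel_measurable borel"
    and radial: "A \<in> sets borel \<Longrightarrow> A \<subseteq> {1-\<epsilon>..} \<Longrightarrow>
       emeasure \<mu> (norm -` A) = (\<integral>\<^sup>+r. ennreal (\<rho> r) * indicator (A \<inter> {1-\<epsilon>..<1}) r \<partial>lborel)"
    and rho_bounds: "1-\<epsilon> \<le> r \<Longrightarrow> r < 1 \<Longrightarrow> c * (1 - r) powr \<alpha> \<le> \<rho> r"
      "1-\<epsilon> \<le> r \<Longrightarrow> r < 1 \<Longrightarrow> \<rho> r \<le> C * (1 - r) powr \<alpha>"
begin

lemma space_mu: "space \<mu> = UNIV"
  using sets_eq_imp_space_eq[OF sets_mu] by simp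

lemma AE_norm_le: "AE z in \<mu>. norm z \<le> 1"
  by (rule AE_I[where N="- cball 0 1"]) (auto simp: supp space_mu sets_mu)

lemma nn_integral_norm:
  fixes G :: "real \<Rightarrow> ennreal"
  assumes [measurable]: "G \<in> borel_measurable borel"
  shows "(\<integral>\<^sup>+z. G (norm z) * indicator {1-\<epsilon>..} (norm z) \<partial>\<mu>) = (\<integral>\<^sup>+r. ennreal (\<rho> r) * indicator {1-\<epsilon>..<1} r * G r \<partial>lborel)"
proof -
  have eq: "distr (density \<mu> (\<lambda>z. indicator {1-\<epsilon>..} (norm z))) borel norm = density lborel (\<lambda>r. ennreal (\<rho> r) * indicator {1-\<epsilon>..<1} r)"
    (is "?L = ?R")
  proof (rule measure_eqI)
    fix A assume "A \<in> sets ?L"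
    then have [measurable]: "A \<in> sets borel" by simp
    have vs [measurable]: "norm -` B \<in> sets \<mu>" if "B \<in> sets borel" for B :: "real set"
    proof -
      have "norm \<in> measurable \<mu> borel" by measurable
      from measurable_sets[OF this that] show ?thesis by (simp add: space_mu)
    qed
    have "emeasure ?L A = emeasure (density \<mu> (\<lambda>z. indicator {1-\<epsilon>..} (norm z))) (norm -` A)"
      by (subst emeasure_distr) (auto simp: space_mu)
    also have "\<dots> = (\<integral>\<^sup>+z. indicator {1-\<epsilon>..} (norm z) * indicator (norm -` A) z \<partial>\<mu>)"
      by (rule emeasure_density) (auto intro: vs)
    also have "\<dots> = (\<integral>\<^sup>+z. indicator (norm -` (A \<inter> {1-\<epsilon>..})) z \<partial>\<mu>)"
      by (rule nn_integral_cong) (auto simp: indicator_def)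
    also have "\<dots> = emeasure \<mu> (norm -` (A \<inter> {1-\<epsilon>..}))"
      by (rule nn_integral_indicator) (auto intro: vs)
    also have "\<dots> = (\<integral>\<^sup>+r. ennreal (\<rho> r) * indicator (A \<inter> {1-\<epsilon>..} \<inter> {1-\<epsilon>..<1}) r \<partial>lborel)"
      by (rule radial) auto
    also have "\<dots> = emeasure ?R A"
      by (subst emeasure_density) (auto intro!: nn_integral_cong simp: indicator_def)
    finally show "emeasure ?L A = emeasure ?R A" .
  qed simp
  have "(\<integral>\<^sup>+z. G (norm z) * indicator {1-\<epsilon>..} (norm z) \<partial>\<mu>) = (\<integral>\<^sup>+r. G r \<partial>?L)"
    by (subst nn_integral_distr) (auto simp: nn_integral_density mult.commute)
  also have "\<dots> = (\<integral>\<^sup>+r. G r \<partial>?R)" unfolding eq ..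
  also have "\<dots> = (\<integral>\<^sup>+r. ennreal (\<rho> r) * indicator {1-\<epsilon>..<1} r * G r \<partial>lborel)"
    by (subst nn_integral_density) auto
  finally show ?thesis .
qed

text \<open>By invariance G may be replaced by its average K over all rotations. K depends on the
  modulus only, so the radial formula applies to it.\<close>

lemma nn_integral_polar:
  fixes G :: "complex \<Rightarrow> ennreal"
  assumes [measurable]: "G \<in> borel_measurable borel"
  shows "(\<integral>\<^sup>+z. G z * indicator {1-\<epsilon>..} (norm z) \<partial>\<mu>) =
    (\<integral>\<^sup>+r. ennreal (\<rho> r) * indicator {1-\<epsilon>..<1} r *
       (\<integral>\<^sup>+\<theta>. ennreal (1 / (2 * pi)) * G (complex_of_real r * cis \<theta>) * indicator {-pi..<pi} \<theta> \<partial>lborel) \<partial>lborel)"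
proof -
  interpret P: pair_sigma_finite lborel \<mu> ..
  define Gi where "Gi z = G z * indicator {1-\<epsilon>..} (norm z)" for z
  have [measurable]: "cis \<in> borel_measurable borel" by (intro borel_measurable_continuous_onI continuous_intros)
  have [measurable]: "Gi \<in> borel_measurable borel" unfolding Gi_def by measurable
  define K where "K z = (\<integral>\<^sup>+\<theta>. ennreal (1 / (2 * pi)) * Gi (cis \<theta> * z) * indicator {-pi..<pi} \<theta> \<partial>lborel)" for z
  have inv: "(\<integral>\<^sup>+z. Gi (cis \<theta> * z) \<partial>\<mu>) = (\<integral>\<^sup>+z. Gi z \<partial>\<mu>)" for \<theta>
    by (subst rot[of \<theta>, symmetric], subst nn_integral_distr) auto
  have "(\<integral>\<^sup>+z. K z \<partial>\<mu>) = (\<integral>\<^sup>+\<theta>. (\<integral>\<^sup>+z. ennreal (1 / (2 * pi)) * Gi (cis \<theta> * z) * indicator {-pi..<pi} \<theta> \<partial>\<mu>) \<partial>lborel)"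
    unfolding K_def by (rule P.Fubini') simp
  also have "\<dots> = (\<integral>\<^sup>+\<theta>. ennreal (1 / (2 * pi)) * indicator {-pi..<pi} \<theta> * (\<integral>\<^sup>+z. Gi z \<partial>\<mu>) \<partial>lborel)"
  proof (rule nn_integral_cong)
    fix \<theta> :: real
    have "(\<integral>\<^sup>+z. ennreal (1 / (2 * pi)) * Gi (cis \<theta> * z) * indicator {-pi..<pi} \<theta> \<partial>\<mu>) = 
       (\<integral>\<^sup>+z. ennreal (1 / (2 * pi)) * indicator {-pi..<pi} \<theta> * Gi (cis \<theta> * z) \<partial>\<mu>)"
      by (simp add: mult_ac)
    also have "\<dots> = ennreal (1 / (2 * pi)) * indicator {-pi..<pi} \<theta> * (\<integral>\<^sup>+z. Gi z \<partial>\<mu>)"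
      by (subst nn_integral_cmult) (auto simp: inv)
    finally show "(\<integral>\<^sup>+z. ennreal (1 / (2 * pi)) * Gi (cis \<theta> * z) * indicator {-pi..<pi} \<theta> \<partial>\<mu>) =
       ennreal (1 / (2 * pi)) * indicator {-pi..<pi} \<theta> * (\<integral>\<^sup>+z. Gi z \<partial>\<mu>)" .
  qed
  also have "\<dots> = (\<integral>\<^sup>+z. Gi z \<partial>\<mu>)"
    by (simp add: nn_integral_multc nn_integral_cmult ennreal_mult[symmetric])
  finally have 1: "(\<integral>\<^sup>+z. Gi z \<partial>\<mu>) = (\<integral>\<^sup>+z. K z \<partial>\<mu>)" by simp
  have Krad: "K z = K (complex_of_real (norm z))" for z
  proof -
    \<comment> \<open>The argument is moved into [0, 2 pi], the range allowed for a shift in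
      \<open>nn_integral_periodic_shift\<close>.\<close>
    define a where "a = (if 0 \<le> Arg z then Arg z else Arg z + 2 * pi)"
    have a: "0 \<le> a" "a \<le> 2 * pi" using Arg_bounded[of z] by (auto simp: a_def)
    have "cis a = cis (Arg z)" by (auto simp: a_def cis_mult[symmetric] cis_2pi)
    define m where "m = complex_of_real (norm z)"
    have z: "z = m * cis a"
      unfolding \<open>cis a = _\<close> m_def by (metis cis_conv_exp Arg_eq mult_zero_left norm_zero of_real_0)
    define h where "h \<theta> = ennreal (1 / (2 * pi)) * Gi (cis \<theta> * m)" for \<theta>
    have [measurable]: "h \<in> borel_measurable borel" unfolding h_def by measurable
    have hp: "h (x + 2 * pi) = h x" for x by (simp add: h_def cis_mult[symmetric] cis_2pi)
    have "K z = (\<integral>\<^sup>+x. h (x + a) * indicator {-pi..<pi} x \<partial>lborel)"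
      unfolding K_def h_def by (subst z) (simp add: cis_mult[symmetric] mult_ac)
    also have "\<dots> = (\<integral>\<^sup>+x. h x * indicator {-pi..<pi} x \<partial>lborel)"
      by (rule nn_integral_periodic_shift[where h=h and a=a, OF _ hp a]) simp
    finally show ?thesis unfolding K_def h_def m_def .
  qed
  have Ki: "K (complex_of_real r) = K (complex_of_real r) * indicator {1-\<epsilon>..} r" if "0 \<le> r" for r
    using that by (auto simp: K_def Gi_def norm_mult indicator_def)
  have [measurable]: "(\<lambda>r. K (complex_of_real r)) \<in> borel_measurable borel" unfolding K_def by measurable
  have "(\<integral>\<^sup>+z. K z \<partial>\<mu>) = (\<integral>\<^sup>+z. K (complex_of_real (norm z)) * indicator {1-\<epsilon>..} (norm z) \<partial>\<mu>)"
    by (subst Krad) (auto intro!: nn_integral_cong simp: Ki[symmetric])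
  also have "\<dots> = (\<integral>\<^sup>+r. ennreal (\<rho> r) * indicator {1-\<epsilon>..<1} r * K (complex_of_real r) \<partial>lborel)"
    by (rule nn_integral_norm) simp
  also have "\<dots> = (\<integral>\<^sup>+r. ennreal (\<rho> r) * indicator {1-\<epsilon>..<1} r *
       (\<integral>\<^sup>+\<theta>. ennreal (1 / (2 * pi)) * G (complex_of_real r * cis \<theta>) * indicator {-pi..<pi} \<theta> \<partial>lborel) \<partial>lborel)"
    by (rule nn_integral_cong) (use eps in \<open>auto simp: K_def Gi_def norm_mult indicator_def mult_ac\<close>)
  finally show ?thesis using 1 by (simp add: Gi_def)
qed
end

text \<open>At z = 1 the value is 0 by the convention for division, so upper bounds on the modulus
  survive at the singular point.\<close>

definition recip_gap :: "complex \<Rightarrow> complex" where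
  "recip_gap z = 1 / (1 - z)"

lemma recip_gap_measurable [measurable]: "recip_gap \<in> borel_measurable borel"
  unfolding recip_gap_def by measurable

lemma geometric_remainder:
  fixes w :: complex
  assumes "w \<noteq> 1"
  shows "1 / (1 - w) = (\<Sum>m<N. w ^ m) + w ^ N / (1 - w)"
proof -
  have "w - 1 \<noteq> 0" "1 - w \<noteq> 0" using assms by auto
  then show ?thesis unfolding geometric_sum[OF assms] by (simp add: divide_simps) (simp add: algebra_simps)
qed

section \<open>Mass near the edge and near 1, and moments of 1 / (1 - X)\<close>

context radial_law
begin

text \<open>
  Since \<open>1 + \<alpha> > 0.905\<close>, the exponent 0.905 may be used uniformly in \<open>\<alpha>\<close>.
\<close>

lemma nn_integral_rho_le:
  assumes "1 - \<epsilon> \<le> a" "a \<le> b" "b \<le> 1" "b - a \<le> 1"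
  shows "(\<integral>\<^sup>+r. ennreal (\<rho> r) * indicator ({a..b} \<inter> {..<1}) r \<partial>lborel) \<le> ennreal (C / 0.905 * (b - a) powr 0.905)"
proof -
  have "(\<integral>\<^sup>+r. ennreal (\<rho> r) * indicator ({a..b} \<inter> {..<1}) r \<partial>lborel) \<le>
    (\<integral>\<^sup>+r. ennreal C * (ennreal ((b - r) powr \<alpha>) * indicator {a..b} r) \<partial>lborel)"
  proof (rule nn_integral_mono_AE)
    \<comment> \<open>At r = b the right side vanishes, since 0 \<open>powr\<close> anything is 0;
      this single point is discarded.\<close>
    have "AE r in lborel. r \<noteq> b" by (rule AE_lborel_singleton)
    then show "AE r in lborel. ennreal (\<rho> r) * indicator ({a..b} \<inter> {..<1}) r \<le> ennreal C * (ennreal ((b - r) powr \<alpha>) * indicator {a..b} r)"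
    proof eventually_elim
      case (elim r)
      show ?case
      proof (cases "r \<in> {a..b} \<inter> {..<1}")
        case True
        then have "\<rho> r \<le> C * (1 - r) powr \<alpha>" using assms by (intro rho_bounds) auto
        \<comment> \<open>As \<alpha> < 0 and b \<le> 1, moving the singularity from 1 to the right
          end b only increases the bound, which then integrates exactly and depends on b - a
          alone.\<close>
        also have "\<dots> \<le> C * (b - r) powr \<alpha>"
          using True elim assms alpha cC by (intro mult_left_mono powr_mono2') auto
        finally have "ennreal (\<rho> r) \<le> ennreal C * ennreal ((b - r) powr \<alpha>)"
          using cC by (simp add: ennreal_mult[symmetric] ennreal_leI)
        then show ?thesis using True by simp
      qed auto
    qed
  qed
  also have "\<dots> = ennreal C * (\<integral>\<^sup>+r. ennreal ((b - r) powr \<alpha>) * indicator {a..b} r \<partial>lborel)"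
    by (rule nn_integral_cmult) simp
  also have "(\<integral>\<^sup>+r. ennreal ((b - r) powr \<alpha>) * indicator {a..b} r \<partial>lborel) = (\<integral>\<^sup>+x. ennreal (x powr \<alpha>) * indicator {0..b-a} x \<partial>lborel)"
    by (subst nn_integral_real_affine[of _ "-1" b]) (auto intro!: nn_integral_cong simp: indicator_def)
  also have "\<dots> = ennreal ((b - a) powr (\<alpha> + 1) / (\<alpha> + 1))"
    by (rule nn_integral_has_integral_lebesgue') (use alpha assms in \<open>auto intro!: has_integral_powr_from_0\<close>)
  also have "ennreal C * \<dots> = ennreal (C * ((b - a) powr (\<alpha> + 1) / (\<alpha> + 1)))"
    using cC alpha by (subst ennreal_mult) auto
  also have "\<dots> \<le> ennreal (C / 0.905 * (b - a) powr 0.905)"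
  proof (rule ennreal_leI)
    have "(b - a) powr (\<alpha> + 1) \<le> (b - a) powr 0.905"
      using assms alpha by (intro powr_mono') auto
    then have "(b - a) powr (\<alpha> + 1) / (\<alpha> + 1) \<le> (b - a) powr 0.905 / 0.905"
      using alpha by (intro frac_le) auto
    then show "C * ((b - a) powr (\<alpha> + 1) / (\<alpha> + 1)) \<le> C / 0.905 * (b - a) powr 0.905"
      using mult_left_mono[of _ _ C] cC by fastforce
  qed
  finally show ?thesis .
qed

lemma annulus_prob_le:
  assumes "1 - \<epsilon> \<le> a" "a \<le> b" "b - a \<le> 1"
  shows "measure \<mu> {z. a \<le> norm z \<and> norm z \<le> b} \<le> C / 0.905 * (b - a) powr 0.905"
proof -
  have K0: "0 \<le> C / 0.905 * (b - a) powr 0.905" using cC by simp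
  have "emeasure \<mu> {z. a \<le> norm z \<and> norm z \<le> b} = emeasure \<mu> (norm -` {a..b})"
    by (rule arg_cong[of _ _ "emeasure \<mu>"]) auto
  also have "\<dots> = (\<integral>\<^sup>+r. ennreal (\<rho> r) * indicator ({a..b} \<inter> {1-\<epsilon>..<1}) r \<partial>lborel)"
    by (rule radial) (use assms in auto)
  also have "\<dots> \<le> ennreal (C / 0.905 * (b - a) powr 0.905)"
  proof (cases "a < 1")
    case True
    have "(\<integral>\<^sup>+r. ennreal (\<rho> r) * indicator ({a..b} \<inter> {1-\<epsilon>..<1}) r \<partial>lborel) \<le>
       (\<integral>\<^sup>+r. ennreal (\<rho> r) * indicator ({a..min b 1} \<inter> {..<1}) r \<partial>lborel)"
      by (intro nn_integral_mono mult_left_mono) (auto simp: indicator_def)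
    also have "\<dots> \<le> ennreal (C / 0.905 * (min b 1 - a) powr 0.905)"
      by (rule nn_integral_rho_le) (use assms True in auto)
    also have "\<dots> \<le> ennreal (C / 0.905 * (b - a) powr 0.905)"
      using assms True cC by (intro ennreal_leI mult_left_mono powr_mono2) auto
    finally show ?thesis .
  next
    case False
    then have "(\<lambda>r. ennreal (\<rho> r) * indicator ({a..b} \<inter> {1-\<epsilon>..<1}) r) = (\<lambda>r. 0)" by (auto simp: fun_eq_iff)
    then show ?thesis by simp
  qed
  finally show ?thesis using K0 by (simp add: emeasure_eq_measure)
qed

lemma outer_prob_le:
  assumes "0 \<le> s" "s \<le> \<epsilon>"
  shows "measure \<mu> {z. 1 - s \<le> norm z} \<le> C / 0.905 * s powr 0.905"
proof -
  have "measure \<mu> {z. 1 - s \<le> norm z} = measure \<mu> {z. 1 - s \<le> norm z \<and> norm z \<le> 1}"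
    by (rule finite_measure_eq_AE) (use AE_norm_le in \<open>auto simp: sets_mu\<close>)
  also have "\<dots> \<le> C / 0.905 * (1 - (1 - s)) powr 0.905"
    by (rule annulus_prob_le) (use assms eps in auto)
  finally show ?thesis by simp
qed

lemma outer_prob_ge:
  assumes "0 \<le> s" "s \<le> \<epsilon>"
  shows "c * s \<le> measure \<mu> {z. 1 - s \<le> norm z}"
proof -
  have "ennreal (c * s) = ennreal c * emeasure lborel {1-s..<1}" using assms cC by (simp add: ennreal_mult)
  also have "\<dots> = (\<integral>\<^sup>+r. ennreal c * indicator {1-s..<1} r \<partial>lborel)"
    by (rule nn_integral_cmult_indicator[symmetric]) simp
  also have "\<dots> \<le> (\<integral>\<^sup>+r. ennreal (\<rho> r) * indicator ({1-s..} \<inter> {1-\<epsilon>..<1}) r \<partial>lborel)"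
  proof (rule nn_integral_mono)
    fix r :: real
    show "ennreal c * indicator {1-s..<1} r \<le> ennreal (\<rho> r) * indicator ({1-s..} \<inter> {1-\<epsilon>..<1}) r"
    proof (cases "r \<in> {1-s..<1}")
      case True
      have "1 powr \<alpha> \<le> (1 - r) powr \<alpha>" using True assms eps alpha by (intro powr_mono2') auto
      then have "c * 1 \<le> c * (1 - r) powr \<alpha>" using cC by (intro mult_left_mono) auto
      also have "\<dots> \<le> \<rho> r" using True assms by (intro rho_bounds) auto
      finally show ?thesis using True assms by (auto simp: indicator_def intro!: ennreal_leI)
    qed auto
  qed
  also have "\<dots> = emeasure \<mu> (norm -` {1-s..})"
    by (rule radial[symmetric]) (use assms in auto)
  also have "norm -` {1-s..} = {z. 1 - s \<le> norm z}" for s by auto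
  finally show ?thesis by (simp add: emeasure_eq_measure)
qed

text \<open>The two constraints decouple in polar coordinates: the layer contributes s^0.905, and |1
  - z| \<le> t confines the angle to [- pi t, pi t], a fraction t of the circle.\<close>

lemma outer_disc_prob_le:
  assumes s: "0 \<le> s" "s \<le> \<epsilon>" and "0 \<le> t"
  shows "measure \<mu> {z. 1 - s \<le> norm z \<and> norm (1 - z) \<le> t} \<le> C / 0.905 * s powr 0.905 * t"
proof -
  let ?A = "{z. 1 - s \<le> norm z \<and> norm (1 - z) \<le> t}"
  have K0: "0 \<le> C / 0.905 * s powr 0.905" using cC by simp
  have "emeasure \<mu> ?A = (\<integral>\<^sup>+z. indicator ?A z * indicator {1-\<epsilon>..} (norm z) \<partial>\<mu>)"
  proof -
    have "emeasure \<mu> ?A = (\<integral>\<^sup>+z. indicator ?A z \<partial>\<mu>)"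
      by (rule nn_integral_indicator[symmetric]) (simp add: sets_mu)
    also have "\<dots> = (\<integral>\<^sup>+z. indicator ?A z * indicator {1-\<epsilon>..} (norm z) \<partial>\<mu>)"
      by (rule nn_integral_cong) (use s in \<open>auto simp: indicator_def\<close>)
    finally show ?thesis .
  qed
  also have "\<dots> = (\<integral>\<^sup>+r. ennreal (\<rho> r) * indicator {1-\<epsilon>..<1} r *
       (\<integral>\<^sup>+\<theta>. ennreal (1 / (2 * pi)) * indicator ?A (complex_of_real r * cis \<theta>) * indicator {-pi..<pi} \<theta> \<partial>lborel) \<partial>lborel)"
    by (rule nn_integral_polar) simp
  also have "\<dots> \<le> (\<integral>\<^sup>+r. ennreal (\<rho> r) * indicator ({1-s..1} \<inter> {..<1}) r * ennreal t \<partial>lborel)"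
  proof (rule nn_integral_mono)
    fix r :: real
    show "ennreal (\<rho> r) * indicator {1-\<epsilon>..<1} r *
       (\<integral>\<^sup>+\<theta>. ennreal (1 / (2 * pi)) * indicator ?A (complex_of_real r * cis \<theta>) * indicator {-pi..<pi} \<theta> \<partial>lborel) \<le>
       ennreal (\<rho> r) * indicator ({1-s..1} \<inter> {..<1}) r * ennreal t"
    proof (cases "r \<in> {1-\<epsilon>..<1}")
      case True
      have "(\<integral>\<^sup>+\<theta>. ennreal (1 / (2 * pi)) * indicator ?A (complex_of_real r * cis \<theta>) * indicator {-pi..<pi} \<theta> \<partial>lborel)
         \<le> (\<integral>\<^sup>+\<theta>. ennreal (1 / (2 * pi)) * indicator {1-s..} r * indicator {-(pi*t)..pi*t} \<theta> \<partial>lborel)"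
      proof (rule nn_integral_mono)
        fix \<theta> :: real
        have "indicator ?A (complex_of_real r * cis \<theta>) * indicator {-pi..<pi} \<theta> \<le> (indicator {1-s..} r * indicator {-(pi*t)..pi*t} \<theta> :: ennreal)"
        proof (cases "complex_of_real r * cis \<theta> \<in> ?A \<and> \<theta> \<in> {-pi..<pi}")
          case T: True
          then have "\<bar>\<theta>\<bar> / pi \<le> t"
          proof -
            have "\<bar>\<theta>\<bar> \<le> pi" using T by auto
            then show ?thesis using norm_one_minus_polar(1)[of r \<theta>] True eps T by auto
          qed
          then have "\<bar>\<theta>\<bar> \<le> pi * t" by (simp add: field_simps)
          moreover have "1 - s \<le> r" using T True eps by (auto simp: norm_mult)
          ultimately show ?thesis using T by (auto simp: indicator_def abs_le_iff)
        qed (auto simp: indicator_def)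
        from mult_left_mono[OF this, of "ennreal (1 / (2 * pi))"]
        show "ennreal (1 / (2 * pi)) * indicator ?A (complex_of_real r * cis \<theta>) * indicator {-pi..<pi} \<theta> \<le>
          ennreal (1 / (2 * pi)) * indicator {1-s..} r * indicator {-(pi*t)..pi*t} \<theta>"
          by (simp add: mult.assoc)
      qed
      also have "\<dots> = ennreal (1 / (2 * pi)) * indicator {1-s..} r * emeasure lborel {-(pi*t)..pi*t}"
        by (rule nn_integral_cmult_indicator) simp
      also have "emeasure lborel {-(pi*t)..pi*t} = ennreal (2 * pi * t)" using \<open>0 \<le> t\<close> by simp
      also have "ennreal (1 / (2 * pi)) * indicator {1-s..} r * ennreal (2 * pi * t) = indicator {1-s..} r * ennreal t"
        using \<open>0 \<le> t\<close> by (simp add: indicator_def ennreal_mult[symmetric])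
      finally have "ennreal (\<rho> r) * (\<integral>\<^sup>+\<theta>. ennreal (1 / (2 * pi)) * indicator ?A (complex_of_real r * cis \<theta>) * indicator {-pi..<pi} \<theta> \<partial>lborel)
         \<le> ennreal (\<rho> r) * (indicator {1-s..} r * ennreal t)" by (rule mult_left_mono) simp
      then show ?thesis using True by (auto simp: indicator_def)
    qed auto
  qed
  also have "\<dots> = (\<integral>\<^sup>+r. ennreal (\<rho> r) * indicator ({1-s..1} \<inter> {..<1}) r \<partial>lborel) * ennreal t"
    by (rule nn_integral_multc) simp
  also have "\<dots> \<le> ennreal (C / 0.905 * (1 - (1 - s)) powr 0.905) * ennreal t"
    by (intro mult_right_mono nn_integral_rho_le) (use s eps in auto)
  also have "\<dots> = ennreal (C / 0.905 * s powr 0.905 * t)"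
  proof -
    have "1 - (1 - s) = s" by simp
    then show ?thesis by (simp only: ennreal_mult''[OF \<open>0 \<le> t\<close>])
  qed
  finally show ?thesis using K0 \<open>0 \<le> t\<close> by (simp add: emeasure_eq_measure)
qed

text \<open>The first summand serves radii t \<le> \<open>\<epsilon>\<close>; the second makes the
  bound on disc probabilities exceed 1 for larger t.\<close>

definition "disc_const = C / 0.905 + 1 / \<epsilon>\<^sup>2"

lemma disc_const_pos: "0 < disc_const"
  using cC eps by (simp add: disc_const_def add_pos_pos)

lemma disc_prob_le:
  assumes "0 < t" "t \<le> 1"
  shows "measure \<mu> {z. norm (1 - z) \<le> t} \<le> disc_const * t powr 1.905"
proof (cases "t \<le> \<epsilon>")
  case True
  have "measure \<mu> {z. norm (1 - z) \<le> t} \<le> measure \<mu> {z. 1 - t \<le> norm z \<and> norm (1 - z) \<le> t}"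
  proof (rule finite_measure_mono)
    show "{z :: complex. norm (1 - z) \<le> t} \<subseteq> {z. 1 - t \<le> norm z \<and> norm (1 - z) \<le> t}"
    proof (rule subsetI)
      fix z :: complex assume "z \<in> {z. norm (1 - z) \<le> t}"
      then show "z \<in> {z. 1 - t \<le> norm z \<and> norm (1 - z) \<le> t}" using norm_triangle_ineq2[of 1 z] by simp
    qed
  qed (simp add: sets_mu)
  also have "\<dots> \<le> C / 0.905 * t powr 0.905 * t"
    by (rule outer_disc_prob_le) (use True assms in auto)
  also have "\<dots> = C / 0.905 * t powr 1.905"
    using assms powr_add[of t "0.905" 1] by simp
  also have "\<dots> \<le> disc_const * t powr 1.905"
    unfolding disc_const_def by (intro mult_right_mono) auto
  finally show ?thesis .
next
  case False
  have "\<epsilon> powr 2 \<le> \<epsilon> powr 1.905" using eps by (intro powr_mono') auto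
  also have "\<dots> \<le> t powr 1.905" using False eps by (intro powr_mono2) auto
  finally have "\<epsilon>\<^sup>2 \<le> t powr 1.905" using eps by (simp add: powr_realpow)
  then have "1 \<le> 1 / \<epsilon>\<^sup>2 * t powr 1.905" using eps by (simp add: field_simps)
  also have "\<dots> \<le> disc_const * t powr 1.905" unfolding disc_const_def using cC by (intro mult_right_mono) auto
  finally show ?thesis using prob_le_1 order_trans by blast
qed

text \<open>Dominates the singular power by a weighted sum of indicators of dyadic discs around 1,
  so that its integral is controlled by disc probabilities.\<close>

lemma recip_gap_dyadic:
  "ennreal (norm (recip_gap z) powr 1.8) \<le> 1 + (\<Sum>k. ennreal (2 powr (1.8 * real (Suc k))) * indicator {z. norm (1 - z) \<le> (1/2)^k} z)"
proof -
  define d where "d = norm (1 - z)"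
  have n: "norm (recip_gap z) powr 1.8 = (1 / d) powr 1.8" by (simp add: recip_gap_def d_def norm_divide)
  consider "d = 0" | "1 \<le> d" | "0 < d" "d < 1" using norm_ge_zero[of "1 - z"] unfolding d_def by linarith
  then show ?thesis
  proof cases
    case 1
    then show ?thesis unfolding n by simp
  next
    case 2
    then have "(1 / d) powr 1.8 \<le> 1 powr 1.8" by (intro powr_mono2) auto
    then have "ennreal (norm (recip_gap z) powr 1.8) \<le> 1" unfolding n by simp
    then show ?thesis by (meson add_increasing2 zero_le)
  next
    case 3
    \<comment> \<open>Since d < 1 the least m is positive. Its predecessor k satisfies d \<le>
      2^(-k), so the k-th indicator is 1, while 1 / d \<le> 2^(k + 1) matches the k-th
      weight.\<close>
    define m where "m = (LEAST m. (1/2)^m < d)"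
    have ex: "\<exists>m. (1/2)^m < d" using 3 by (intro real_arch_pow_inv) auto
    have m: "(1/2)^m < d" unfolding m_def using ex by (rule LeastI_ex)
    have "m \<noteq> 0" using m 3 by (cases m) auto
    then obtain k where k: "m = Suc k" by (cases m) auto
    have dk: "d \<le> (1/2)^k" using not_less_Least[of k "\<lambda>m. (1/2)^m < d"] k by (simp add: m_def)
    have "1 / d \<le> 2 ^ Suc k"
    proof -
      have "2 ^ Suc k * (1/2) ^ Suc k \<le> (2::real) ^ Suc k * d" using m unfolding k by (intro mult_left_mono) auto
      moreover have "2 ^ Suc k * (1/2) ^ Suc k = (1::real)" by (simp only: power_mult_distrib[symmetric]) simp
      ultimately show ?thesis using 3 by (simp only: pos_divide_le_eq)
    qed
    then have "(1 / d) powr 1.8 \<le> (2 ^ Suc k) powr 1.8" using 3 by (intro powr_mono2) auto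
    also have "\<dots> = 2 powr (1.8 * real (Suc k))"
      by (simp only: powr_realpow[symmetric] powr_powr zero_less_numeral mult.commute)
    finally have "ennreal (norm (recip_gap z) powr 1.8) \<le> ennreal (2 powr (1.8 * real (Suc k))) * indicator {z. norm (1 - z) \<le> (1/2)^k} z"
      using dk unfolding n by (simp add: d_def ennreal_leI)
    also have "\<dots> \<le> (\<Sum>k. ennreal (2 powr (1.8 * real (Suc k))) * indicator {z. norm (1 - z) \<le> (1/2)^k} z)"
    proof -
      have "T k \<le> suminf T" for T :: "nat \<Rightarrow> ennreal" using sum_le_suminf[of T "{k}"] by simp
      then show ?thesis .
    qed
    also have "\<dots> \<le> 1 + \<dots>" by (simp add: add_increasing)
    finally show ?thesis .
  qed
qed

text \<open>Disc probabilities have exponent 1.905, so the dyadic series is geometric with ratio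
  2^(1.8 - 1.905). The order 1.8 lies between 1 and 1.905; truncating at distance \<eta> then costs
  a factor \<eta>^(1.8 - 2) in the second moment and leaves an error \<eta>^(1.8 - 1) in the
  first.\<close>

lemma recip_gap_moment: "integrable \<mu> (\<lambda>z. norm (recip_gap z) powr 1.8)"
proof (rule integrableI_bounded)
  define q :: real where "q = 2 powr (-0.105)"
  have q: "0 \<le> q" "q < 1" using powr_less_mono[of "-0.105" 0 2] by (auto simp: q_def)
  have "(\<integral>\<^sup>+z. ennreal (norm (norm (recip_gap z) powr 1.8)) \<partial>\<mu>) \<le>
     (\<integral>\<^sup>+z. 1 + (\<Sum>k. ennreal (2 powr (1.8 * real (Suc k))) * indicator {z. norm (1 - z) \<le> (1/2)^k} z) \<partial>\<mu>)"
    by (intro nn_integral_mono) (simp only: real_norm_def abs_of_nonneg powr_ge_zero recip_gap_dyadic)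
  also have "\<dots> = 1 + (\<Sum>k. \<integral>\<^sup>+z. ennreal (2 powr (1.8 * real (Suc k))) * indicator {z. norm (1 - z) \<le> (1/2)^k} z \<partial>\<mu>)"
    by (subst nn_integral_add) (auto simp: nn_integral_suminf emeasure_space_1)
  also have "\<dots> = 1 + (\<Sum>k. ennreal (2 powr (1.8 * real (Suc k))) * emeasure \<mu> {z. norm (1 - z) \<le> (1/2)^k})"
    by (simp add: nn_integral_cmult_indicator sets_mu)
  also have "\<dots> \<le> 1 + (\<Sum>k. ennreal (2 powr 1.8 * disc_const * q ^ k))"
  proof (intro add_left_mono suminf_le)
    fix k :: nat
    have "measure \<mu> {z. norm (1 - z) \<le> (1/2)^k} \<le> disc_const * ((1/2)^k) powr 1.905"
      by (rule disc_prob_le) (auto simp: power_le_one)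
    then have "2 powr (1.8 * real (Suc k)) * measure \<mu> {z. norm (1 - z) \<le> (1/2)^k} \<le> 2 powr (1.8 * real (Suc k)) * (disc_const * ((1/2)^k) powr 1.905)"
      by (intro mult_left_mono) auto
    also have "((1/2)^k) powr 1.905 = (2::real) powr (- 1.905 * real k)"
      by (simp add: powr_realpow[symmetric] powr_powr powr_minus_divide powr_divide power_divide mult.commute)
    also have "2 powr (1.8 * real (Suc k)) * (disc_const * (2::real) powr (- 1.905 * real k)) = 2 powr 1.8 * disc_const * q ^ k"
    proof -
      have "2 powr (1.8 * real (Suc k)) * (2::real) powr (- 1.905 * real k) = 2 powr (1.8 * real (Suc k) + - 1.905 * real k)"
        by (simp only: powr_add)
      also have "1.8 * real (Suc k) + - 1.905 * real k = 1.8 + - 0.105 * real k" by (simp add: field_simps)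
      also have "(2::real) powr (1.8 + - 0.105 * real k) = 2 powr 1.8 * (2 powr - 0.105) powr real k"
        by (simp only: powr_add powr_powr)
      also have "(2 powr - 0.105) powr real k = q ^ k" by (simp add: q_def powr_realpow)
      finally show ?thesis by (simp only: mult_ac)
    qed
    finally show "ennreal (2 powr (1.8 * real (Suc k))) * emeasure \<mu> {z. norm (1 - z) \<le> (1/2)^k} \<le> ennreal (2 powr 1.8 * disc_const * q ^ k)"
      by (simp add: emeasure_eq_measure ennreal_mult[symmetric] ennreal_leI)
  qed auto
  also have "\<dots> < \<infinity>"
    using q disc_const_pos by (subst suminf_ennreal2) (auto intro!: summable_mult summable_geometric)
  finally show "(\<integral>\<^sup>+z. ennreal (norm (norm (recip_gap z) powr 1.8)) \<partial>\<mu>) < \<infinity>" .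
qed simp

definition "gap_moment = (LINT z|\<mu>. norm (recip_gap z) powr 1.8)"

lemma integrable_recip_gap: "integrable \<mu> recip_gap"
proof (rule Bochner_Integration.integrable_bound)
  show "integrable \<mu> (\<lambda>z. 1 + norm (recip_gap z) powr 1.8)" using recip_gap_moment by simp
  have "norm w \<le> 1 + norm w powr 1.8" for w :: complex
  proof (cases "norm w \<le> 1")
    case False
    then have "norm w powr 1 \<le> norm w powr 1.8" by (intro powr_mono) auto
    then show ?thesis using False by simp
  qed (simp add: add_increasing2)
  then show "AE z in \<mu>. norm (recip_gap z) \<le> norm (1 + norm (recip_gap z) powr 1.8)"
    by (auto simp: abs_of_nonneg)
qed simp

lemma recip_gap_truncated_square:
  assumes "0 < \<eta>"
  shows "integrable \<mu> (\<lambda>z. (norm (recip_gap z))\<^sup>2 * indicator {z. \<eta> \<le> norm (1 - z)} z)"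
    and "(LINT z|\<mu>. (norm (recip_gap z))\<^sup>2 * indicator {z. \<eta> \<le> norm (1 - z)} z) \<le> \<eta> powr (-0.2) * gap_moment"
proof -
  have b: "(norm (recip_gap z))\<^sup>2 * indicator {z. \<eta> \<le> norm (1 - z)} z \<le> \<eta> powr (-0.2) * norm (recip_gap z) powr 1.8" for z
  proof (cases "\<eta> \<le> norm (1 - z)")
    case True
    then have p: "0 < norm (recip_gap z)" using assms by (auto simp: recip_gap_def)
    have "(norm (recip_gap z))\<^sup>2 = norm (recip_gap z) powr 0.2 * norm (recip_gap z) powr 1.8"
    proof -
      have "norm (recip_gap z) powr 0.2 * norm (recip_gap z) powr 1.8 = norm (recip_gap z) powr (0.2 + 1.8)"
        by (simp only: powr_add)
      also have "0.2 + 1.8 = (2 :: real)" by simp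
      finally show ?thesis using p by simp
    qed
    also have "norm (recip_gap z) powr 0.2 \<le> (1 / \<eta>) powr 0.2"
      using True assms by (intro powr_mono2) (auto simp: recip_gap_def norm_divide intro!: frac_le)
    also have "(1 / \<eta>) powr 0.2 = \<eta> powr (-0.2)" using assms by (simp add: powr_divide powr_minus_divide)
    finally show ?thesis using True by (simp add: mult_right_mono)
  qed simp
  show i: "integrable \<mu> (\<lambda>z. (norm (recip_gap z))\<^sup>2 * indicator {z. \<eta> \<le> norm (1 - z)} z)"
    by (rule Bochner_Integration.integrable_bound[OF integrable_mult_right[OF recip_gap_moment, of "\<eta> powr (-0.2)"]])
      (use b in \<open>auto simp: sets_mu\<close>)
  show "(LINT z|\<mu>. (norm (recip_gap z))\<^sup>2 * indicator {z. \<eta> \<le> norm (1 - z)} z) \<le> \<eta> powr (-0.2) * gap_moment"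
    unfolding gap_moment_def by (subst integral_mult_right_zero[symmetric], rule integral_mono)
      (use i b recip_gap_moment in auto)
qed

lemma recip_gap_truncated_tail:
  assumes "0 < \<eta>"
  shows "(LINT z|\<mu>. norm (recip_gap z) * indicator {z. norm (1 - z) < \<eta>} z) \<le> \<eta> powr 0.8 * gap_moment"
proof -
  have b: "norm (recip_gap z) * indicator {z. norm (1 - z) < \<eta>} z \<le> \<eta> powr 0.8 * norm (recip_gap z) powr 1.8" for z
  proof (cases "norm (1 - z) < \<eta> \<and> z \<noteq> 1")
    case True
    then have p: "0 < norm (recip_gap z)" by (auto simp: recip_gap_def)
    have "norm (recip_gap z) = norm (recip_gap z) powr (-0.8) * norm (recip_gap z) powr 1.8"
    proof -
      have "norm (recip_gap z) powr (-0.8) * norm (recip_gap z) powr 1.8 = norm (recip_gap z) powr (-0.8 + 1.8)"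
        by (simp only: powr_add)
      also have "-0.8 + 1.8 = (1 :: real)" by simp
      finally show ?thesis using p by simp
    qed
    also have "norm (recip_gap z) powr (-0.8) \<le> (1 / \<eta>) powr (-0.8)"
      using True assms by (intro powr_mono2') (auto simp: recip_gap_def norm_divide intro!: frac_le)
    also have "(1 / \<eta>) powr (-0.8) = \<eta> powr 0.8" using assms by (simp add: powr_divide powr_minus_divide)
    finally show ?thesis using True by (simp add: mult_right_mono)
  qed (auto simp: recip_gap_def)
  show ?thesis
    unfolding gap_moment_def by (subst integral_mult_right_zero[symmetric], rule integral_mono)
      (use b recip_gap_moment integrable_norm[OF integrable_recip_gap] in \<open>auto simp: sets_mu intro!: integrable_real_mult_indicator\<close>)
qed

text \<open>Rotation by pi / m changes the sign of z^m.\<close>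

lemma mean_power:
  assumes "m \<noteq> 0"
  shows "(CLINT z|\<mu>. z ^ m) = 0"
proof -
  have "(CLINT z|\<mu>. z ^ m) = (CLINT z|distr \<mu> borel (\<lambda>z. cis (pi / real m) * z). z ^ m)"
    unfolding rot ..
  also have "\<dots> = (CLINT z|\<mu>. (cis (pi / real m) * z) ^ m)"
    by (subst integral_distr) auto
  also have "\<dots> = (CLINT z|\<mu>. - (z ^ m))"
  proof -
    have "cis (pi / real m) ^ m = - 1" using assms by (simp add: Complex.DeMoivre)
    then show ?thesis by (simp add: power_mult_distrib)
  qed
  finally show ?thesis by simp
qed

lemma AE_neq_1: "AE z in \<mu>. z \<noteq> 1"
proof -
  have "measure \<mu> {1} \<le> disc_const * ((1/2)^k) powr 1.905" for k :: nat
  proof -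
    have "measure \<mu> {1} \<le> measure \<mu> {z. norm (1 - z) \<le> (1/2)^k}"
      by (rule finite_measure_mono) (auto simp: sets_mu)
    also have "\<dots> \<le> disc_const * ((1/2)^k) powr 1.905" by (rule disc_prob_le) (auto simp: power_le_one)
    finally show ?thesis .
  qed
  moreover have "(\<lambda>k. disc_const * ((1/2)^k) powr 1.905) \<longlonglongrightarrow> 0" by real_asymp
  ultimately have "measure \<mu> {1} \<le> 0" by (intro LIMSEQ_le_const) auto
  then have "emeasure \<mu> {1} = 0" by (simp add: emeasure_eq_measure measure_le_0_iff)
  then show ?thesis by (intro AE_I[where N="{1}"]) (auto simp: sets_mu)
qed

text \<open>The geometric series cannot be integrated at the singular kernel itself. For 1 / (1 - r
  z) with r < 1 it has a uniformly small remainder, and all positive powers have mean 0. The passage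
  r to 1 is dominated convergence.\<close>

lemma mean_recip_gap: "(CLINT z|\<mu>. recip_gap z) = 1"
proof -
  have geo: "(CLINT z|\<mu>. 1 / (1 - complex_of_real r * z)) = 1" if r: "0 \<le> r" "r < 1" for r
  proof -
    have lb: "1 - r \<le> norm (1 - complex_of_real r * z)" if "norm z \<le> 1" for z
    proof -
      have "norm (complex_of_real r * z) \<le> r * 1" using that r by (simp add: norm_mult mult_left_le)
      then show ?thesis using norm_triangle_ineq2[of 1 "complex_of_real r * z"] by simp
    qed
    have int: "integrable \<mu> (\<lambda>z. z ^ m)" for m
      by (rule integrable_const_bound[of _ 1]) (use AE_norm_le in \<open>auto simp: norm_power power_le_one\<close>)
    have i2: "integrable \<mu> (\<lambda>z. (complex_of_real r * z) ^ N / (1 - complex_of_real r * z))" for N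
    proof (rule integrable_const_bound[of _ "1 / (1 - r)"])
      show "AE z in \<mu>. norm ((complex_of_real r * z) ^ N / (1 - complex_of_real r * z)) \<le> 1 / (1 - r)"
        using AE_norm_le
      proof eventually_elim
        case (elim z)
        have "norm (complex_of_real r * z) \<le> 1 * 1" unfolding norm_mult using elim r by (intro mult_mono) auto
        then show ?case using lb[OF elim] r by (auto simp: norm_divide norm_power power_le_one intro!: frac_le)
      qed
    qed simp
    have N: "norm ((CLINT z|\<mu>. 1 / (1 - complex_of_real r * z)) - 1) \<le> r ^ N / (1 - r)" if "0 < N" for N
    proof -
      have "(CLINT z|\<mu>. 1 / (1 - complex_of_real r * z)) = (CLINT z|\<mu>. (\<Sum>m<N. (complex_of_real r * z) ^ m) + (complex_of_real r * z) ^ N / (1 - complex_of_real r * z))"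
      proof (rule integral_cong_AE)
        show "AE z in \<mu>. 1 / (1 - complex_of_real r * z) = (\<Sum>m<N. (complex_of_real r * z) ^ m) + (complex_of_real r * z) ^ N / (1 - complex_of_real r * z)"
          using AE_norm_le
        proof eventually_elim
          case (elim z)
          then have nz: "complex_of_real r * z \<noteq> 1" using lb[OF elim] r by auto
          then show ?case by (rule geometric_remainder)
        qed
      qed auto
      also have "\<dots> = (\<Sum>m<N. complex_of_real r ^ m * (CLINT z|\<mu>. z ^ m)) + (CLINT z|\<mu>. (complex_of_real r * z) ^ N / (1 - complex_of_real r * z))"
        using int i2 by (subst Bochner_Integration.integral_add) (auto simp: power_mult_distrib)
      also have "(\<Sum>m<N. complex_of_real r ^ m * (CLINT z|\<mu>. z ^ m)) = (\<Sum>m\<in>{0}. complex_of_real r ^ m * (CLINT z|\<mu>. z ^ m))"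
        by (rule sum.mono_neutral_right) (use \<open>0 < N\<close> in \<open>auto simp: mean_power\<close>)
      also have "\<dots> = 1" by (simp add: prob_space)
      finally have "(CLINT z|\<mu>. 1 / (1 - complex_of_real r * z)) - 1 = (CLINT z|\<mu>. (complex_of_real r * z) ^ N / (1 - complex_of_real r * z))" by simp
      also have "norm \<dots> \<le> (LINT z|\<mu>. norm ((complex_of_real r * z) ^ N / (1 - complex_of_real r * z)))" by simp
      also have "\<dots> \<le> (LINT z|\<mu>. r ^ N / (1 - r))"
      proof (rule integral_mono_AE)
        show "AE z in \<mu>. norm ((complex_of_real r * z) ^ N / (1 - complex_of_real r * z)) \<le> r ^ N / (1 - r)"
          using AE_norm_le
        proof eventually_elim
          case (elim z)
          have "norm (complex_of_real r * z) \<le> r" using elim r by (simp add: norm_mult mult_left_le)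
          then have "norm (complex_of_real r * z) ^ N \<le> r ^ N" by (intro power_mono) auto
          then show ?case using lb[OF elim] r by (auto simp: norm_divide norm_power intro!: frac_le)
        qed
      qed (use i2 in auto)
      finally show ?thesis by (simp add: prob_space)
    qed
    have "(\<lambda>N. r ^ N / (1 - r)) \<longlonglongrightarrow> 0 / (1 - r)"
      using r by (intro tendsto_divide LIMSEQ_power_zero tendsto_const) auto
    then have "norm ((CLINT z|\<mu>. 1 / (1 - complex_of_real r * z)) - 1) \<le> 0 / (1 - r)"
      by (rule LIMSEQ_le_const) (use N in \<open>auto intro!: exI[of _ 1]\<close>)
    then show ?thesis by simp
  qed
  define r where "r k = 1 - 1 / real (Suc (Suc k))" for k
  have r: "0 \<le> r k" "r k < 1" for k by (auto simp: r_def)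
  have rl: "r \<longlonglongrightarrow> 1" unfolding r_def by real_asymp
  have "(\<lambda>k. CLINT z|\<mu>. 1 / (1 - complex_of_real (r k) * z)) \<longlonglongrightarrow> (CLINT z|\<mu>. recip_gap z)"
  proof (rule integral_dominated_convergence[where w="\<lambda>z. 2 * norm (recip_gap z)"])
    show "integrable \<mu> (\<lambda>z. 2 * norm (recip_gap z))" using integrable_recip_gap by auto
    show "AE z in \<mu>. (\<lambda>k. 1 / (1 - complex_of_real (r k) * z)) \<longlonglongrightarrow> recip_gap z"
      using AE_neq_1
    proof eventually_elim
      case (elim z)
      have "(\<lambda>k. 1 / (1 - complex_of_real (r k) * z)) \<longlonglongrightarrow> 1 / (1 - complex_of_real 1 * z)"
        using elim by (intro tendsto_intros rl) auto
      then show ?case by (simp add: recip_gap_def)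
    qed
    show "AE z in \<mu>. norm (1 / (1 - complex_of_real (r k) * z)) \<le> 2 * norm (recip_gap z)" for k
      using AE_norm_le AE_neq_1
    proof eventually_elim
      case (elim z)
      have 1: "norm (complex_of_real (r k) * z) \<le> r k" using elim r by (simp add: norm_mult mult_left_le)
      \<comment> \<open>Source of the factor 2 in the majorant: |1 - z| \<le> |1 - r z| + (1 - r)
        |z|, and (1 - r) |z| \<le> 1 - r \<le> |1 - r z|.\<close>
      have "1 - z = (1 - complex_of_real (r k) * z) - complex_of_real (1 - r k) * z" by (simp add: algebra_simps)
      then have "norm (1 - z) \<le> norm (1 - complex_of_real (r k) * z) + norm (complex_of_real (1 - r k) * z)"
        by (metis norm_triangle_ineq4)
      also have "norm (complex_of_real (1 - r k) * z) \<le> 1 - r k"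
        using elim r[of k] by (simp only: norm_mult norm_of_real) (simp add: mult_left_le)
      also have "1 - r k \<le> norm (1 - complex_of_real (r k) * z)"
        using 1 norm_triangle_ineq2[of 1 "complex_of_real (r k) * z"] by simp
      finally have "norm (1 - z) \<le> 2 * norm (1 - complex_of_real (r k) * z)" by simp
      moreover have p: "0 < norm (1 - z)" using elim by auto
      ultimately have "0 < norm (1 - complex_of_real (r k) * z)" "norm (1 - z) \<le> 2 * norm (1 - complex_of_real (r k) * z)" by linarith+
      then show ?case using p unfolding recip_gap_def norm_divide by (simp add: divide_simps mult.commute)
    qed
  qed auto
  then have "(\<lambda>k::nat. 1::complex) \<longlonglongrightarrow> (CLINT z|\<mu>. recip_gap z)" using geo[OF r] by simp
  then show ?thesis using LIMSEQ_const_iff by metis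
qed
end

section \<open>The stable characteristic exponent\<close>

text \<open>The compensated exponential of the Levy-Khintchine formula. Subtracting the linear term
  is harmless for centred variables and makes the integrand quadratic at 0.\<close>

definition iexp2 :: "real \<Rightarrow> complex" where
  "iexp2 x = iexp x - 1 - \<i> * complex_of_real x"

lemma iexp2_measurable [measurable]: "iexp2 \<in> borel_measurable borel"
  unfolding iexp2_def by measurable

lemma norm_iexp2_le: "norm (iexp2 x) \<le> 2 * \<bar>x\<bar>" "norm (iexp2 x) \<le> x\<^sup>2 / 2"
  using iexp_approx2[of x 1] iexp_approx1[of x 1]
  by (auto simp: iexp2_def numeral_2_eq_2 algebra_simps)

text \<open>Interpolates between the linear and the quadratic bound. The right side uses a bound y
  in place of |x|, so that a geometric estimate can be inserted.\<close>

lemma norm_iexp2_le_powr: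
  assumes "1 \<le> q" "q \<le> 2" "0 \<le> y" "\<bar>x\<bar> \<le> y"
  shows "norm (iexp2 x) \<le> 2 * y powr q"
proof (cases "y \<le> 1")
  case True
  have "norm (iexp2 x) \<le> x\<^sup>2 / 2" by (rule norm_iexp2_le)
  also have "\<dots> \<le> 2 * \<bar>x\<bar>\<^sup>2" by simp
  also have "\<dots> \<le> 2 * y\<^sup>2" using assms by (intro mult_left_mono power_mono) auto
  also have "y\<^sup>2 = y powr 2" using assms by simp
  also have "2 * y powr 2 \<le> 2 * y powr q" using assms True by (intro mult_left_mono powr_mono') auto
  finally show ?thesis .
next
  case False
  have "norm (iexp2 x) \<le> 2 * \<bar>x\<bar>" by (rule norm_iexp2_le)
  also have "\<dots> \<le> 2 * y powr 1" using assms by simp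
  also have "\<dots> \<le> 2 * y powr q" using assms False by (intro mult_left_mono powr_mono) auto
  finally show ?thesis .
qed

text \<open>An envelope with exponent a near 0 and b near infinity, for integrands that need
  different bounds at the two ends.\<close>

definition two_powr :: "real \<Rightarrow> real \<Rightarrow> real \<Rightarrow> real" where
  "two_powr a b s = s powr a * indicator {0<..1} s + s powr b * indicator {1<..} s"

lemma two_powr_measurable [measurable]: "two_powr a b \<in> borel_measurable borel"
  unfolding two_powr_def by measurable

lemma two_powr_nonneg: "0 \<le> two_powr a b s"
  by (simp add: two_powr_def)

lemma integrable_two_powr:
  assumes "-1 < a" "b < -1"
  shows "integrable lborel (two_powr a b)"
  unfolding two_powr_def
proof (rule Bochner_Integration.integrable_add)
  have 1: "(\<integral>\<^sup>+s. ennreal (s powr a) * indicator {0..1} s \<partial>lborel) = ennreal (1 powr (a + 1) / (a + 1))"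
    by (rule nn_integral_has_integral_lebesgue') (use assms has_integral_powr_from_0[of a 1] in auto)
  show "integrable lborel (\<lambda>s. s powr a * indicator {0<..1} s)"
  proof (rule integrableI_bounded)
    have "(\<integral>\<^sup>+s. ennreal (norm (s powr a * indicator {0<..1} s)) \<partial>lborel) \<le> (\<integral>\<^sup>+s. ennreal (s powr a) * indicator {0..1} s \<partial>lborel)"
      by (intro nn_integral_mono) (auto simp: indicator_def)
    then show "(\<integral>\<^sup>+s. ennreal (norm (s powr a * indicator {0<..1} s)) \<partial>lborel) < \<infinity>"
      using 1 by (simp add: le_less_trans)
  qed simp
  have 2: "(\<integral>\<^sup>+s. ennreal (s powr b) * indicator {1..} s \<partial>lborel) = ennreal (- (1 powr (b + 1)) / (b + 1))"
    by (rule nn_integral_has_integral_lebesgue') (use assms has_integral_powr_to_inf[of b 1] in auto)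
  show "integrable lborel (\<lambda>s. s powr b * indicator {1<..} s)"
  proof (rule integrableI_bounded)
    have "(\<integral>\<^sup>+s. ennreal (norm (s powr b * indicator {1<..} s)) \<partial>lborel) \<le> (\<integral>\<^sup>+s. ennreal (s powr b) * indicator {1..} s \<partial>lborel)"
      by (intro nn_integral_mono) (auto simp: indicator_def)
    then show "(\<integral>\<^sup>+s. ennreal (norm (s powr b * indicator {1<..} s)) \<partial>lborel) < \<infinity>"
      using 2 by (simp add: le_less_trans)
  qed simp
qed

text \<open>With r = 1 / s this is the integral of (exp (i x r) - 1 - i x r) r^(-1-p) over r > 0,
  the exponent of a one-sided p-stable law. The variable s is kept because it is the rescaled
  distance to the unit circle.\<close>

definition levy_int :: "real \<Rightarrow> real \<Rightarrow> complex" where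
  "levy_int p x = (CLINT s|lborel. complex_of_real (s powr (p - 1) * indicator {0<..} s) * iexp2 (x / s))"

lemma levy_int_bound:
  assumes "0 < s"
  shows "norm (complex_of_real (s powr (p - 1) * indicator {0<..} s) * iexp2 (x / s)) \<le> (2 * \<bar>x\<bar> + x\<^sup>2) * two_powr (p - 2) (p - 3) s"
proof -
  have n: "norm (complex_of_real (s powr (p - 1) * indicator {0<..} s) * iexp2 (x / s)) = s powr (p - 1) * norm (iexp2 (x / s))"
    using assms by (simp add: norm_mult)
  show ?thesis
  proof (cases "s \<le> 1")
    case True
    have "norm (iexp2 (x / s)) \<le> (2 * \<bar>x\<bar>) * s powr (-1)"
      using norm_iexp2_le(1)[of "x / s"] assms by (simp add: powr_minus_divide)
    also have "\<dots> \<le> (2 * \<bar>x\<bar> + x\<^sup>2) * s powr (-1)" by (intro mult_right_mono) auto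
    finally have "s powr (p - 1) * norm (iexp2 (x / s)) \<le> s powr (p - 1) * ((2 * \<bar>x\<bar> + x\<^sup>2) * s powr (-1))"
      by (intro mult_left_mono) auto
    also have "\<dots> = (2 * \<bar>x\<bar> + x\<^sup>2) * (s powr (p - 1) * s powr (-1))" by simp
    also have "s powr (p - 1) * s powr (-1) = s powr (p - 2)" using powr_add[of s "p - 1" "-1"] by simp
    finally show ?thesis unfolding n using True assms by (simp add: two_powr_def)
  next
    case False
    have "norm (iexp2 (x / s)) \<le> x\<^sup>2 * s powr (-2)"
      using norm_iexp2_le(2)[of "x / s"] assms by (simp add: powr_minus_divide power_divide field_simps)
        (smt (verit) zero_le_power2)
    also have "\<dots> \<le> (2 * \<bar>x\<bar> + x\<^sup>2) * s powr (-2)" by (intro mult_right_mono) auto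
    finally have "s powr (p - 1) * norm (iexp2 (x / s)) \<le> s powr (p - 1) * ((2 * \<bar>x\<bar> + x\<^sup>2) * s powr (-2))"
      by (intro mult_left_mono) auto
    also have "\<dots> = (2 * \<bar>x\<bar> + x\<^sup>2) * (s powr (p - 1) * s powr (-2))" by simp
    also have "s powr (p - 1) * s powr (-2) = s powr (p - 3)" using powr_add[of s "p - 1" "-2"] by simp
    finally show ?thesis unfolding n using False assms by (simp add: two_powr_def)
  qed
qed

lemma integrable_levy_int:
  assumes "1 < p" "p < 2"
  shows "integrable lborel (\<lambda>s. complex_of_real (s powr (p - 1) * indicator {0<..} s) * iexp2 (x / s))"
proof (rule Bochner_Integration.integrable_bound)
  show "integrable lborel (\<lambda>s. (2 * \<bar>x\<bar> + x\<^sup>2) * two_powr (p - 2) (p - 3) s)"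
    using assms by (intro integrable_mult_right integrable_two_powr) auto
  show "AE s in lborel. norm (complex_of_real (s powr (p - 1) * indicator {0<..} s) * iexp2 (x / s)) \<le> norm ((2 * \<bar>x\<bar> + x\<^sup>2) * two_powr (p - 2) (p - 3) s)"
  proof (rule AE_I2)
    fix s :: real
    have "0 \<le> (2 * \<bar>x\<bar> + x\<^sup>2) * two_powr (p - 2) (p - 3) s" using two_powr_nonneg by (intro mult_nonneg_nonneg) auto
    then show "norm (complex_of_real (s powr (p - 1) * indicator {0<..} s) * iexp2 (x / s)) \<le> norm ((2 * \<bar>x\<bar> + x\<^sup>2) * two_powr (p - 2) (p - 3) s)"
      using levy_int_bound[of s p x] by (cases "0 < s") auto
  qed
qed simp

lemma levy_int_0: "levy_int p 0 = 0"
  by (simp add: levy_int_def iexp2_def)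

lemma levy_int_scale:
  assumes "0 < a"
  shows "levy_int p (a * x) = complex_of_real (a powr p) * levy_int p x"
proof -
  have "levy_int p (a * x) = \<bar>a\<bar> *\<^sub>R (CLINT s|lborel. complex_of_real ((0 + a * s) powr (p - 1) * indicator {0<..} (0 + a * s)) * iexp2 (a * x / (0 + a * s)))"
    unfolding levy_int_def using assms by (intro lborel_integral_real_affine) auto
  also have "(\<lambda>s. complex_of_real ((0 + a * s) powr (p - 1) * indicator {0<..} (0 + a * s)) * iexp2 (a * x / (0 + a * s))) =
     (\<lambda>s. complex_of_real (a powr (p - 1)) * (complex_of_real (s powr (p - 1) * indicator {0<..} s) * iexp2 (x / s)))"
    using assms by (auto simp: fun_eq_iff indicator_def zero_less_mult_iff powr_mult)
  also have "\<bar>a\<bar> *\<^sub>R (CLINT s|lborel. complex_of_real (a powr (p - 1)) * (complex_of_real (s powr (p - 1) * indicator {0<..} s) * iexp2 (x / s)))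
     = complex_of_real (a * a powr (p - 1)) * levy_int p x"
    using assms by (simp add: levy_int_def scaleR_conv_of_real)
  also have "a * a powr (p - 1) = a powr p" using assms by (simp add: powr_mult_base)
  finally show ?thesis .
qed

lemma levy_int_minus: "levy_int p (- x) = cnj (levy_int p x)"
proof -
  have "(CLINT s|lborel. complex_of_real (s powr (p - 1) * indicator {0<..} s) * iexp2 (- x / s)) =
     (CLINT s|lborel. cnj (complex_of_real (s powr (p - 1) * indicator {0<..} s) * iexp2 (x / s)))"
    by (rule Bochner_Integration.integral_cong) (auto simp: iexp2_def exp_cnj)
  also have "\<dots> = cnj (CLINT s|lborel. complex_of_real (s powr (p - 1) * indicator {0<..} s) * iexp2 (x / s))"
    by (rule Bochner_Integration.integral_cnj)
  finally show ?thesis by (simp add: levy_int_def)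
qed

section \<open>Phase and sign of the one-sided stable exponent\<close>

definition exp2 :: "complex \<Rightarrow> complex" where
  "exp2 u = exp (- u) - 1 + u"

lemma norm_exp2_le:
  assumes "0 \<le> Re u"
  shows "1 \<le> norm u \<Longrightarrow> norm (exp2 u) \<le> 3 * norm u"
    and "norm u \<le> 1 \<Longrightarrow> norm (exp2 u) \<le> 3 * (norm u)\<^sup>2"
proof -
  assume 1: "1 \<le> norm u"
  have "norm (exp2 u) \<le> norm (exp (- u)) + norm (1::complex) + norm u"
    unfolding exp2_def by (metis norm_triangle_le norm_triangle_ineq4 add_right_mono)
  also have "norm (exp (- u)) \<le> 1" using assms by simp
  finally show "norm (exp2 u) \<le> 3 * norm u" using 1 by simp
next
  assume 1: "norm u \<le> 1"
  have "norm (exp (- u) - (\<Sum>k\<le>1. (- u) ^ k / fact k)) \<le> exp \<bar>Re (- u)\<bar> * norm (- u) ^ Suc 1 / fact 1"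
    by (rule Taylor_exp)
  then have "norm (exp2 u) \<le> exp \<bar>Re u\<bar> * (norm u)\<^sup>2" by (simp add: exp2_def numeral_2_eq_2 algebra_simps)
  also have "\<bar>Re u\<bar> \<le> 1" using abs_Re_le_cmod[of u] 1 by linarith
  then have "exp \<bar>Re u\<bar> \<le> exp 1" by simp
  also have "exp (1::real) \<le> 3" by (rule exp_le)
  finally show "norm (exp2 u) \<le> 3 * (norm u)\<^sup>2" by (simp add: mult_right_mono)
qed

lemma iexp2_exp2: "iexp2 x = exp2 (- \<i> * complex_of_real x)"
  by (simp add: iexp2_def exp2_def)

text \<open>
  Rotating the ray of integration in \<open>\<integral> exp2 (u / s) s\<^bsup>p-1\<^esup> ds\<close> from \<open>u = 1\<close> to \<open>u = -\<i>\<close> multiplies the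
  integral by \<open>e\<^bsup>-\<i>\<pi>p/2\<^esup>\<close>: the derivative with respect to the angle is an exact derivative in \<open>s\<close>.
\<close>

lemma levy_int_phase_finite:
  assumes p: "1 < p" "p < 2" and e: "0 < e" "e \<le> 1" and R: "1 \<le> R"
  shows "\<bar>Im (exp (\<i> * complex_of_real (pi * p / 2)) *
      integral {e..R} (\<lambda>s. complex_of_real (s powr (p - 1)) * iexp2 (1 / s)))\<bar> \<le> 6 * (R powr (p - 2) + e powr (p - 1))"
proof -
  define f where "f \<theta> s = exp (- \<i> * of_real p * \<theta>) * exp2 (exp (\<i> * \<theta>) / complex_of_real s) * complex_of_real (s powr (p - 1))" for \<theta> s
  define E where "E \<theta> s = exp (\<i> * \<theta>) / complex_of_real s" for \<theta> s
  define fx where "fx \<theta> s = exp (- \<i> * of_real p * \<theta>) * (- \<i>) *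
     (of_real p * exp2 (E \<theta> s) - (1 - exp (- E \<theta> s)) * E \<theta> s) * complex_of_real (s powr (p - 1))" for \<theta> s
  \<comment> \<open>The twist exp (- i p \<theta>) is chosen so that \<open>fx\<close> is the
    derivative of Q in s: differentiating s^p gives the term with p, and differentiating 1 / s
    inside \<open>exp2\<close> gives the other.\<close>
  define Q where "Q \<theta> s = exp (- \<i> * of_real p * \<theta>) * (- \<i>) * (exp2 (E \<theta> s) * complex_of_real (s powr p))" for \<theta> s
  \<comment> \<open>H is real at \<theta> = 0 and equals the twisted oscillatory integral at
    \<theta> = - pi / 2. Its derivative consists of boundary values of Q, so the imaginary part at -
    pi / 2 is bounded by them.\<close>
  define H where "H \<theta> = integral (cbox e R) (f \<theta>)" for \<theta>
  have sp: "0 < s" if "s \<in> cbox e R" for s using that e by auto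
  have exp2_deriv: "(exp2 has_field_derivative (1 - exp (- u))) (at u within T)" for u T
    unfolding exp2_def by (auto intro!: derivative_eq_intros)
  have H': "(H has_field_derivative integral (cbox e R) (fx \<theta>)) (at \<theta> within UNIV)" for \<theta>
    unfolding H_def
  proof (rule leibniz_rule_field_derivative)
    show "((\<lambda>x. f x s) has_field_derivative fx \<theta> s) (at \<theta> within UNIV)" if "s \<in> cbox e R" for \<theta> s
    proof -
      have dP: "((\<lambda>x. exp (- \<i> * of_real p * x)) has_field_derivative exp (- \<i> * of_real p * \<theta>) * (- \<i> * of_real p)) (at \<theta>)"
        by (rule DERIV_fun_exp) (auto intro!: derivative_eq_intros)
      have dE: "((\<lambda>x. E x s) has_field_derivative \<i> * E \<theta> s) (at \<theta>)"
        unfolding E_def using sp[OF that] by (auto intro!: derivative_eq_intros)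
      have d2: "((\<lambda>x. exp2 (E x s)) has_field_derivative (1 - exp (- E \<theta> s)) * (\<i> * E \<theta> s)) (at \<theta>)"
        by (rule DERIV_chain2[OF exp2_deriv dE])
      have "f x s = exp (- \<i> * of_real p * x) * exp2 (E x s) * complex_of_real (s powr (p - 1))" for x
        by (simp add: f_def E_def)
      moreover have "((\<lambda>x. exp (- \<i> * of_real p * x) * exp2 (E x s) * complex_of_real (s powr (p - 1))) has_field_derivative fx \<theta> s) (at \<theta>)"
        by (rule DERIV_cong[OF DERIV_cmult_right[OF DERIV_mult[OF dP d2]]]) (simp add: fx_def algebra_simps)
      ultimately show ?thesis by simp
    qed
    have c1: "continuous_on (cbox e R) (\<lambda>s. s powr (p - 1))"
      by (intro continuous_on_powr continuous_intros) (use sp in force)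
    show "f \<theta> integrable_on cbox e R" for \<theta>
      unfolding f_def exp2_def
      by (intro integrable_continuous continuous_on_mult continuous_on_add continuous_on_diff continuous_on_of_real[OF c1]
           continuous_on_exp continuous_on_minus continuous_on_divide continuous_on_const continuous_on_of_real[OF continuous_on_id]) (use sp in force)+
    have c2: "continuous_on (UNIV \<times> cbox e R) (\<lambda>z::complex \<times> real. snd z powr (p - 1))"
      by (intro continuous_on_powr continuous_intros) (use sp in force)
    have c3: "continuous_on (UNIV \<times> cbox e R) (\<lambda>z. E (fst z) (snd z))"
      unfolding E_def by (intro continuous_on_divide continuous_intros) (use sp in force)
    show "continuous_on (UNIV \<times> cbox e R) (\<lambda>(x, t). fx x t)"
      unfolding fx_def exp2_def case_prod_unfold by (intro continuous_intros c2 c3)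
  qed auto
  have Qd: "(Q \<theta> has_vector_derivative fx \<theta> s) (at s within {e..R})" if "s \<in> {e..R}" for \<theta> s
  proof -
    have s: "0 < s" using that e by auto
    have d1: "((\<lambda>s. complex_of_real (s powr p)) has_vector_derivative complex_of_real (p * s powr (p - 1))) (at s within {e..R})"
      using s by (auto intro!: derivative_eq_intros has_vector_derivative_of_real simp: has_real_derivative_iff_has_vector_derivative[symmetric])
    have d0: "((\<lambda>s. E \<theta> s) has_vector_derivative (- E \<theta> s / of_real s)) (at s within {e..R})"
    proof -
      have "((\<lambda>s. complex_of_real (1 / s)) has_vector_derivative complex_of_real (- (1 / s\<^sup>2))) (at s within {e..R})"
        using s by (intro has_vector_derivative_of_real) (auto intro!: derivative_eq_intros simp: has_real_derivative_iff_has_vector_derivative[symmetric] power2_eq_square)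
      then have "((\<lambda>s. exp (\<i> * \<theta>) * complex_of_real (1 / s)) has_vector_derivative exp (\<i> * \<theta>) * complex_of_real (- (1 / s\<^sup>2))) (at s within {e..R})"
        by (rule has_vector_derivative_mult_right)
      then show ?thesis by (simp add: E_def power2_eq_square field_simps)
    qed
    have d2: "((\<lambda>s. exp2 (E \<theta> s)) has_vector_derivative (- E \<theta> s / of_real s) * (1 - exp (- E \<theta> s))) (at s within {e..R})"
      using field_vector_diff_chain_within[OF d0 exp2_deriv] by (simp add: o_def)
    have "(Q \<theta> has_vector_derivative exp (- \<i> * of_real p * \<theta>) * (- \<i>) * (exp2 (E \<theta> s) * complex_of_real (p * s powr (p - 1)) + 
       (- E \<theta> s / of_real s) * (1 - exp (- E \<theta> s)) * complex_of_real (s powr p))) (at s within {e..R})"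
      unfolding Q_def by (intro has_vector_derivative_mult_right has_vector_derivative_mult d1 d2)
    moreover have "complex_of_real (s powr p) = complex_of_real (s powr (p - 1)) * of_real s"
      using s by (simp add: powr_diff)
    ultimately show ?thesis
      by (rule_tac has_vector_derivative_eq_rhs) (use s in \<open>auto simp: fx_def field_simps\<close>)
  qed
  have intfx: "integral (cbox e R) (fx \<theta>) = Q \<theta> R - Q \<theta> e" for \<theta>
    using fundamental_theorem_of_calculus[of e R "Q \<theta>" "fx \<theta>"] Qd[of _ \<theta>] e R by (simp add: integral_unique)
  define S where "S = closed_segment (complex_of_real (- pi / 2)) 0"
  have S: "\<exists>x. \<theta> = complex_of_real x \<and> - pi / 2 \<le> x \<and> x \<le> 0" if "\<theta> \<in> S" for \<theta>
  proof -
    have "\<theta> \<in> complex_of_real ` closed_segment (- pi / 2) 0"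
      using that unfolding S_def closed_segment_of_real[symmetric] by (metis closed_segment_of_real of_real_0)
    then show ?thesis by (auto simp: closed_segment_eq_real_ivl)
  qed
  have bound: "norm (integral (cbox e R) (fx \<theta>)) \<le> 3 * (R powr (p - 2) + e powr (p - 1))" if "\<theta> \<in> S" for \<theta>
  proof -
    have "\<exists>x. \<theta> = complex_of_real x \<and> - pi / 2 \<le> x \<and> x \<le> 0" by (rule S[OF that])
    then obtain x where x: "\<theta> = complex_of_real x" "- pi / 2 \<le> x" "x \<le> 0" by blast
    have c: "0 \<le> cos x" using x by (intro cos_ge_zero) auto
    have E1: "0 \<le> Re (E \<theta> s)" "norm (E \<theta> s) = 1 / s" if "0 < s" for s
      using that c x by (auto simp: E_def Re_exp norm_divide Re_divide_of_real)
    have n1: "norm (exp (- \<i> * of_real p * \<theta>)) = 1" by (simp add: x)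
    \<comment> \<open>At R the argument of \<open>exp2\<close> has modulus 1 / R \<le> 1 and the
      quadratic bound applies; at e its modulus is at least 1 and the linear bound does. Both use
      that its real part is nonnegative for angles between - pi / 2 and 0.\<close>
    have "norm (Q \<theta> R) \<le> (3 * (1 / R)\<^sup>2) * R powr p"
      unfolding Q_def norm_mult n1 using norm_exp2_le(2)[of "E \<theta> R"] E1[of R] R
      by (auto simp: field_simps intro!: mult_right_mono)
    also have "\<dots> = 3 * R powr (p - 2)" using R by (simp add: powr_diff field_simps)
    finally have 1: "norm (Q \<theta> R) \<le> 3 * R powr (p - 2)" .
    have "norm (Q \<theta> e) \<le> (3 * (1 / e)) * e powr p"
      unfolding Q_def norm_mult n1 using norm_exp2_le(1)[of "E \<theta> e"] E1[of e] e
      by (auto simp: field_simps intro!: mult_right_mono)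
    also have "\<dots> = 3 * e powr (p - 1)" using e by (simp add: powr_diff field_simps)
    finally have 2: "norm (Q \<theta> e) \<le> 3 * e powr (p - 1)" .
    show ?thesis unfolding intfx using 1 2 norm_triangle_ineq4[of "Q \<theta> R" "Q \<theta> e"] by simp
  qed
  have diff: "norm (H (complex_of_real (- pi / 2)) - H 0) \<le> 3 * (R powr (p - 2) + e powr (p - 1)) * norm (complex_of_real (- pi / 2) - 0)"
  proof (rule field_differentiable_bound)
    show "convex S" unfolding S_def by (rule convex_closed_segment)
    show "(H has_field_derivative integral (cbox e R) (fx z)) (at z within S)" for z
      using H' by (rule has_field_derivative_at_within)
  qed (use bound in \<open>auto simp: S_def\<close>)
  have "norm (complex_of_real (- pi / 2) - 0) = pi / 2" by (simp add: norm_divide)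
  then have "3 * (R powr (p - 2) + e powr (p - 1)) * norm (complex_of_real (- pi / 2) - 0) \<le> 3 * (R powr (p - 2) + e powr (p - 1)) * 2"
    using pi_less_4 by (intro mult_left_mono) auto
  with diff have "norm (H (complex_of_real (- pi / 2)) - H 0) \<le> 3 * (R powr (p - 2) + e powr (p - 1)) * 2"
    by (rule order_trans)
  moreover have "H (complex_of_real (- pi / 2)) = exp (\<i> * complex_of_real (pi * p / 2)) *
      integral {e..R} (\<lambda>s. complex_of_real (s powr (p - 1)) * iexp2 (1 / s))"
  proof -
    have "exp (\<i> * complex_of_real (- pi / 2)) = - \<i>"
      using cis_conv_exp[of "- pi / 2"] by (simp add: complex_eq_iff)
    then have "f (complex_of_real (- pi / 2)) = (\<lambda>s. exp (\<i> * complex_of_real (pi * p / 2)) * (complex_of_real (s powr (p - 1)) * iexp2 (1 / s)))"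
      by (auto simp: f_def fun_eq_iff iexp2_exp2 mult_ac)
    then show ?thesis by (simp add: H_def)
  qed
  moreover have "Im (H 0) = 0"
  proof -
    have f0: "f 0 s = complex_of_real ((exp (- (1 / s)) - 1 + 1 / s) * s powr (p - 1))" for s
      by (simp add: f_def exp2_def exp_of_real[symmetric])
    have "(\<lambda>s. (exp (- (1 / s)) - 1 + 1 / s) * s powr (p - 1)) integrable_on cbox e R"
      using e by (intro integrable_continuous continuous_intros) auto
    then have "((\<lambda>s. complex_of_real ((exp (- (1 / s)) - 1 + 1 / s) * s powr (p - 1))) has_integral complex_of_real (integral (cbox e R) (\<lambda>s. (exp (- (1 / s)) - 1 + 1 / s) * s powr (p - 1)))) (cbox e R)"
      by (intro has_integral_of_real integrable_integral)
    then have "H 0 = complex_of_real (integral (cbox e R) (\<lambda>s. (exp (- (1 / s)) - 1 + 1 / s) * s powr (p - 1)))"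
      unfolding H_def f0[abs_def] by (rule integral_unique)
    then show ?thesis by simp
  qed
  ultimately show ?thesis
    using abs_Im_le_cmod[of "H (complex_of_real (- pi / 2)) - H 0"] by simp
qed

text \<open>The boundary terms R^(p - 2) and e^(p - 1) vanish in the limit exactly because 1 < p <
  2.\<close>

lemma levy_int_phase:
  assumes p: "1 < p" "p < 2"
  shows "Im (exp (\<i> * complex_of_real (pi * p / 2)) * levy_int p 1) = 0"
proof -
  define g where "g s = complex_of_real (s powr (p - 1) * indicator {0<..} s) * iexp2 (1 / s)" for s
  have gi: "integrable lborel g" unfolding g_def using integrable_levy_int[OF p] .
  define I where "I n = (CLINT s|lborel. indicator {1 / real (Suc n)..real (Suc n)} s *\<^sub>R g s)" for n
  have I: "I \<longlonglongrightarrow> levy_int p 1"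
    unfolding I_def levy_int_def g_def[symmetric]
  proof (rule integral_dominated_convergence[where w="\<lambda>s. norm (g s)"])
    show "AE s in lborel. (\<lambda>n. indicator {1 / real (Suc n)..real (Suc n)} s *\<^sub>R g s) \<longlonglongrightarrow> g s"
    proof (rule AE_I2)
      fix s :: real
      show "(\<lambda>n. indicator {1 / real (Suc n)..real (Suc n)} s *\<^sub>R g s) \<longlonglongrightarrow> g s"
      proof (cases "0 < s")
        case True
        have "\<forall>\<^sub>F n in sequentially. 1 / real (Suc n) \<le> s" using True by real_asymp
        moreover have "\<forall>\<^sub>F n in sequentially. s \<le> real (Suc n)" by real_asymp
        ultimately have "\<forall>\<^sub>F n in sequentially. indicator {1 / real (Suc n)..real (Suc n)} s *\<^sub>R g s = g s"
          by eventually_elim simp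
        then show ?thesis by (rule tendsto_eventually)
      qed (simp add: g_def)
    qed
    show "AE s in lborel. norm (indicator {1 / real (Suc n)..real (Suc n)} s *\<^sub>R g s) \<le> norm (g s)" for n
      by (auto simp: indicator_def)
  qed (use gi in auto)
  have eq: "I n = integral {1 / real (Suc n)..real (Suc n)} (\<lambda>s. complex_of_real (s powr (p - 1)) * iexp2 (1 / s))" for n
  proof -
    have "set_integrable lborel {1 / real (Suc n)..real (Suc n)} g"
      unfolding set_integrable_def by (rule integrable_mult_indicator) (use gi in auto)
    then have "I n = integral {1 / real (Suc n)..real (Suc n)} g"
      using set_borel_integral_eq_integral(2) unfolding I_def set_lebesgue_integral_def by blast
    also have "\<dots> = integral {1 / real (Suc n)..real (Suc n)} (\<lambda>s. complex_of_real (s powr (p - 1)) * iexp2 (1 / s))"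
    proof (rule integral_cong)
      fix s assume "s \<in> {1 / real (Suc n)..real (Suc n)}"
      moreover have "0 < 1 / real (Suc n)" by simp
      ultimately have "0 < s" by (meson atLeastAtMost_iff less_le_trans)
      then show "g s = complex_of_real (s powr (p - 1)) * iexp2 (1 / s)" by (simp add: g_def)
    qed
    finally show ?thesis .
  qed
  have b: "\<bar>Im (exp (\<i> * complex_of_real (pi * p / 2)) * I n)\<bar> \<le> 6 * (real (Suc n) powr (p - 2) + (1 / real (Suc n)) powr (p - 1))" for n
    unfolding eq by (rule levy_int_phase_finite[OF p]) auto
  have "(\<lambda>n. \<bar>Im (exp (\<i> * complex_of_real (pi * p / 2)) * I n)\<bar>) \<longlonglongrightarrow> \<bar>Im (exp (\<i> * complex_of_real (pi * p / 2)) * levy_int p 1)\<bar>"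
    by (intro tendsto_intros I)
  moreover have "(\<lambda>n. 6 * (real (Suc n) powr (p - 2) + (1 / real (Suc n)) powr (p - 1))) \<longlonglongrightarrow> 0"
  proof -
    have r: "filterlim (\<lambda>n. real (Suc n)) at_top sequentially" by real_asymp
    have "(\<lambda>n. 6 * (real (Suc n) powr (p - 2) + real (Suc n) powr (- (p - 1)))) \<longlonglongrightarrow> 6 * (0 + 0)"
      using p by (intro tendsto_intros tendsto_neg_powr r) auto
    moreover have "(1 / real (Suc n)) powr (p - 1) = real (Suc n) powr (- (p - 1))" for n
      by (simp only: powr_minus_divide powr_divide powr_one_eq_one)
    ultimately show ?thesis by simp
  qed
  ultimately have "\<bar>Im (exp (\<i> * complex_of_real (pi * p / 2)) * levy_int p 1)\<bar> \<le> 0"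
    by (rule LIMSEQ_le) (use b in auto)
  then show ?thesis by simp
qed

text \<open>The real part is minus the integral of the nonnegative function s^(p-1) (1 - cos (1 /
  s)), which is positive for 1 < s < 2, where 0 < 1 / s < 1. The strict sign is what makes the
  spectral measure nonzero.\<close>

lemma Re_levy_int_neg:
  assumes p: "1 < p" "p < 2"
  shows "Re (levy_int p 1) < 0"
proof -
  define g where "g s = s powr (p - 1) * indicator {0<..} s * (1 - cos (1 / s))" for s :: real
  note i = integrable_levy_int[OF p, of 1]
  have "(\<lambda>s. Re (complex_of_real (s powr (p - 1) * indicator {0<..} s) * iexp2 (1 / s))) = (\<lambda>s. - g s)"
    by (auto simp: fun_eq_iff g_def iexp2_def Re_exp algebra_simps)
  then have gi: "integrable lborel g" and r: "Re (levy_int p 1) = - integral\<^sup>L lborel g"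
    using integrable_Re[OF i] integral_Re[OF i] by (auto simp: levy_int_def)
  have g0: "0 \<le> g s" for s by (simp add: g_def)
  have "integral\<^sup>L lborel g \<noteq> 0"
  proof
    assume "integral\<^sup>L lborel g = 0"
    then have "AE s in lborel. g s = 0" using integral_nonneg_eq_0_iff_AE[OF gi] g0 by auto
    then have "AE s in lborel. s \<notin> {1<..<2::real}"
    proof eventually_elim
      case (elim s)
      show ?case
      proof
        assume s: "s \<in> {1<..<2}"
        have "0 < 1 / s" "1 / s < 1" using s by auto
        then have "cos (1 / s) < cos 0" using pi_gt3 by (intro cos_monotone_0_pi) linarith+
        then show False using elim s by (simp add: g_def)
      qed
    qed
    then have "{1<..<2::real} \<in> null_sets lborel" by (subst AE_iff_null_sets) auto
    then show False by (auto simp: null_sets_def)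
  qed
  then have "0 < integral\<^sup>L lborel g" using g0 by (simp add: order_less_le)
  then show ?thesis using r by simp
qed

text \<open>The vanishing imaginary part is one linear relation between real and imaginary part;
  dividing it by cos (pi p / 2), which is negative, produces the tangent of the stable law.\<close>

lemma levy_int_1:
  assumes p: "1 < p" "p < 2"
  shows "levy_int p 1 = complex_of_real (Re (levy_int p 1)) * (1 - \<i> * complex_of_real (tan (pi * p / 2)))"
proof -
  let ?J = "levy_int p 1"
  have "cos (pi * p / 2) < 0" 
  proof -
    have "cos (pi * p / 2) < cos (pi / 2)" using p by (intro cos_monotone_0_pi) auto
    then show ?thesis by simp
  qed
  moreover have "cos (pi * p / 2) * Im ?J + sin (pi * p / 2) * Re ?J = 0"
    using levy_int_phase[OF p] by (simp add: Re_exp Im_exp)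
  ultimately have "Im ?J = - Re ?J * tan (pi * p / 2)" by (simp add: tan_def field_simps)
  then show ?thesis by (simp add: complex_eq_iff)
qed

section \<open>The limiting exponent of a summand\<close>

lemma tan_measurable [measurable]: "(tan :: real \<Rightarrow> real) \<in> borel_measurable borel"
  unfolding tan_def by measurable

text \<open>The substitution x = tan v over the whole line in the form of an image measure; it is
  enough to compare intervals, whose preimages have arctangents as end points.\<close>

lemma distr_tan:
  "distr (density lborel (\<lambda>v. ennreal (1 / (cos v)\<^sup>2) * indicator {-(pi/2)<..<pi/2} v)) borel tan = (lborel :: real measure)"
proof (rule lborel_eqI[symmetric])
  fix l u :: real
  assume "\<And>b. b \<in> Basis \<Longrightarrow> l \<bullet> b \<le> u \<bullet> b"
  then have lu: "l \<le> u" by simp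
  have b: "arctan l \<le> arctan u" using lu by (simp add: arctan_monotone')
  have iff: "(v \<in> {-(pi/2)<..<pi/2} \<and> tan v \<in> {l<..<u}) \<longleftrightarrow> v \<in> {arctan l<..<arctan u}" for v
  proof
    assume v: "v \<in> {-(pi/2)<..<pi/2} \<and> tan v \<in> {l<..<u}"
    then have "arctan l < arctan (tan v)" "arctan (tan v) < arctan u" by (auto simp: arctan_less_iff)
    moreover have "arctan (tan v) = v" using v by (intro arctan_tan) auto
    ultimately show "v \<in> {arctan l<..<arctan u}" by simp
  next
    assume v: "v \<in> {arctan l<..<arctan u}"
    then have v2: "-(pi/2) < v" "v < pi/2" using arctan_bounded[of l] arctan_bounded[of u] by auto
    then have "arctan l < arctan (tan v)" "arctan (tan v) < arctan u" using v by (auto simp: arctan_tan)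
    then show "v \<in> {-(pi/2)<..<pi/2} \<and> tan v \<in> {l<..<u}" using v2 by (auto simp: arctan_less_iff)
  qed
  have "emeasure (distr (density lborel (\<lambda>v. ennreal (1 / (cos v)\<^sup>2) * indicator {-(pi/2)<..<pi/2} v)) borel tan) (box l u) =
     (\<integral>\<^sup>+v. ennreal (1 / (cos v)\<^sup>2) * indicator {-(pi/2)<..<pi/2} v * indicator (tan -` {l<..<u}) v \<partial>lborel)"
  proof -
    have "tan -` {l<..<u} \<in> sets borel"
      using measurable_sets[of tan "borel :: real measure" borel "{l<..<u}"] by simp
    then have "emeasure (density lborel (\<lambda>v. ennreal (1 / (cos v)\<^sup>2) * indicator {-(pi/2)<..<pi/2} v)) (tan -` {l<..<u}) =
       (\<integral>\<^sup>+v. ennreal (1 / (cos v)\<^sup>2) * indicator {-(pi/2)<..<pi/2} v * indicator (tan -` {l<..<u}) v \<partial>lborel)"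
      by (intro emeasure_density) auto
    then show ?thesis by (subst emeasure_distr) auto
  qed
  also have "\<dots> = (\<integral>\<^sup>+v. ennreal (1 / (cos v)\<^sup>2) * indicator {arctan l<..<arctan u} v \<partial>lborel)"
    by (rule nn_integral_cong) (use iff in \<open>auto simp: indicator_def\<close>)
  also have "\<dots> = (\<integral>\<^sup>+v. ennreal (1 / (cos v)\<^sup>2) * indicator {arctan l..arctan u} v \<partial>lborel)"
  proof (rule nn_integral_cong_AE)
    have "AE v in lborel. v \<noteq> arctan l" "AE v in lborel. v \<noteq> arctan u" by (rule AE_lborel_singleton)+
    then show "AE v in lborel. ennreal (1 / (cos v)\<^sup>2) * indicator {arctan l<..<arctan u} v = ennreal (1 / (cos v)\<^sup>2) * indicator {arctan l..arctan u} v"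
      by eventually_elim (auto simp: indicator_def)
  qed
  also have "\<dots> = ennreal (tan (arctan u) - tan (arctan l))"
  proof (rule nn_integral_FTC_Icc[where F=tan])
    fix x assume x: "x \<in> {arctan l..arctan u}"
    then have "cos x > 0" using arctan_bounded[of l] arctan_bounded[of u] by (intro cos_gt_zero_pi) auto
    then show "(tan has_real_derivative 1 / (cos x)\<^sup>2) (at x)" using DERIV_tan[of x] by (simp add: inverse_eq_divide)
  qed (use b in auto)
  finally show "emeasure (distr (density lborel (\<lambda>v. ennreal (1 / (cos v)\<^sup>2) * indicator {-(pi/2)<..<pi/2} v)) borel tan) (box l u) =
     ennreal (\<Prod>b\<in>Basis. (u - l) \<bullet> b)"
    by (simp add: tan_arctan)
qed simp

lemma nn_integral_tan_subst:
  fixes \<Phi> :: "real \<Rightarrow> ennreal"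
  assumes [measurable]: "\<Phi> \<in> borel_measurable borel" and a: "0 < a"
  shows "(\<integral>\<^sup>+\<theta>. \<Phi> \<theta> \<partial>lborel) = (\<integral>\<^sup>+v. ennreal (a / (cos v)\<^sup>2 * indicator {-(pi/2)<..<pi/2} v) * \<Phi> (a * tan v) \<partial>lborel)"
proof -
  have "(\<integral>\<^sup>+\<theta>. \<Phi> \<theta> \<partial>lborel) = ennreal a * (\<integral>\<^sup>+x. \<Phi> (a * x) \<partial>lborel)"
    using nn_integral_real_affine[of \<Phi> a 0] a by simp
  also have "(\<integral>\<^sup>+x. \<Phi> (a * x) \<partial>lborel) = (\<integral>\<^sup>+v. ennreal (1 / (cos v)\<^sup>2) * indicator {-(pi/2)<..<pi/2} v * \<Phi> (a * tan v) \<partial>lborel)"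
    by (subst distr_tan[symmetric], subst nn_integral_distr) (auto simp: nn_integral_density)
  also have "ennreal a * \<dots> = (\<integral>\<^sup>+v. ennreal a * (ennreal (1 / (cos v)\<^sup>2) * indicator {-(pi/2)<..<pi/2} v * \<Phi> (a * tan v)) \<partial>lborel)"
    by (rule nn_integral_cmult[symmetric]) simp
  also have "\<dots> = (\<integral>\<^sup>+v. ennreal (a / (cos v)\<^sup>2 * indicator {-(pi/2)<..<pi/2} v) * \<Phi> (a * tan v) \<partial>lborel)"
  proof (rule nn_integral_cong)
    fix v
    have "ennreal a * ennreal (1 / (cos v)\<^sup>2) = ennreal (a / (cos v)\<^sup>2)" using a by (simp add: ennreal_mult[symmetric])
    then show "ennreal a * (ennreal (1 / (cos v)\<^sup>2) * indicator {-(pi/2)<..<pi/2} v * \<Phi> (a * tan v)) =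
       ennreal (a / (cos v)\<^sup>2 * indicator {-(pi/2)<..<pi/2} v) * \<Phi> (a * tan v)"
      by (auto simp: indicator_def mult.assoc[symmetric])
  qed
  finally show ?thesis .
qed

text \<open>For a < 0 the singularities sit at both ends. Jordan's inequality bounds the cosine
  below by a multiple of the distance to the nearer end, and one shifted copy of x^a serves each
  end.\<close>

lemma integrable_cos_powr:
  assumes a: "-1 < a" "a \<le> 0"
  shows "integrable lborel (\<lambda>v. cos v powr a * indicator {-(pi/2)<..<pi/2} v)"
proof -
  define g where "g x = (2 / pi) powr a * (x powr a * indicator {0..pi/2} x)" for x :: real
  have "integrable lborel (\<lambda>x::real. x powr a * indicator {0..pi/2} x)"
  proof (rule integrableI_bounded)
    have "(\<integral>\<^sup>+x. ennreal (norm (x powr a * indicator {0..pi/2} x)) \<partial>lborel) = (\<integral>\<^sup>+x. ennreal (x powr a) * indicator {0..pi/2} x \<partial>lborel)"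
      by (intro nn_integral_cong) (auto simp: indicator_def)
    also have "\<dots> = ennreal ((pi/2) powr (a + 1) / (a + 1))"
      by (rule nn_integral_has_integral_lebesgue') (use a has_integral_powr_from_0[of a "pi/2"] in auto)
    finally show "(\<integral>\<^sup>+x. ennreal (norm (x powr a * indicator {0..pi/2} x)) \<partial>lborel) < \<infinity>" by simp
  qed simp
  then have gi: "integrable lborel g" unfolding g_def by (rule integrable_mult_right)
  have g1: "integrable lborel (\<lambda>v. g (pi/2 + (-1) * v))" and g2: "integrable lborel (\<lambda>v. g (pi/2 + 1 * v))"
    by (rule lborel_integrable_real_affine[OF gi], simp)+
  have g0: "0 \<le> g x" for x by (simp add: g_def)
  show ?thesis
  proof (rule Bochner_Integration.integrable_bound[OF Bochner_Integration.integrable_add[OF g1 g2]])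
    show "AE v in lborel. norm (cos v powr a * indicator {-(pi/2)<..<pi/2} v) \<le> norm (g (pi/2 + (-1) * v) + g (pi/2 + 1 * v))"
    proof (rule AE_I2)
      fix v
      show "norm (cos v powr a * indicator {-(pi/2)<..<pi/2} v) \<le> norm (g (pi/2 + (-1) * v) + g (pi/2 + 1 * v))"
      proof (cases "v \<in> {-(pi/2)<..<pi/2}")
        case True
        define x where "x = pi/2 - \<bar>v\<bar>"
        have x: "0 < x" "x \<le> pi/2" using True by (auto simp: x_def)
        have "2 * x / pi \<le> sin x" using x by (intro sin_ge_chord) auto
        also have "sin x = cos v" unfolding x_def by (simp add: sin_diff)
        finally have "cos v powr a \<le> (2 * x / pi) powr a" using x a by (intro powr_mono2') auto
        also have "\<dots> = g x" using x by (simp add: g_def powr_mult[symmetric] mult_ac)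
        also have "\<dots> \<le> g (pi/2 + (-1) * v) + g (pi/2 + 1 * v)"
          using g0 by (auto simp: x_def abs_if)
        finally show ?thesis using True by simp
      qed (simp add: g0)
    qed
  qed simp
qed

section \<open>Boundary layer coordinates and the limit of the compensated integral\<close>

locale radial_limit = radial_law +
  fixes L :: real
  assumes ratio_lim: "((\<lambda>r. \<rho> r / (1 - r) powr \<alpha>) \<longlongrightarrow> L) (at_left 1)"
begin

text \<open>
  In the coordinates \<open>z = (1 - d s) exp (\<i> d s tan v)\<close> the gap \<open>1 - z\<close> is close to \<open>d s (1 - \<i> tan v)\<close>, so
  \<open>d / (1 - z)\<close> tends to \<open>cos v exp (\<i> v) / s\<close>.
\<close>

definition "layer_weight d s v = \<rho> (1 - d * s) * indicator {0<..\<epsilon>} (d * s) * (1 / (2 * pi)) * indicator {-pi..<pi} (d * s * tan v) *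
   (d * (d * s) / (cos v)\<^sup>2 * indicator {-(pi/2)<..<pi/2} v)"

definition "layer_point d s v = complex_of_real (1 - d * s) * cis (d * s * tan v)"

lemma layer_weight_measurable [measurable]: "(\<lambda>x. layer_weight d (fst x) (snd x)) \<in> borel_measurable (lborel \<Otimes>\<^sub>M lborel)"
  unfolding layer_weight_def by measurable

lemma layer_point_measurable [measurable]: "(\<lambda>x. layer_point d (fst x) (snd x)) \<in> borel_measurable (lborel \<Otimes>\<^sub>M lborel)"
  unfolding layer_point_def by measurable

lemma rho_pos: "1-\<epsilon> \<le> r \<Longrightarrow> r < 1 \<Longrightarrow> 0 \<le> \<rho> r"
  using rho_bounds(1)[of r] cC by (meson less_imp_le mult_nonneg_nonneg order_trans powr_ge_zero)

lemma layer_weight_nonneg: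
  assumes "0 < d" shows "0 \<le> layer_weight d s v"
proof (cases "d * s \<in> {0<..\<epsilon>}")
  case True
  then have "0 \<le> \<rho> (1 - d * s)" "0 < s" using assms by (auto intro!: rho_pos simp: zero_less_mult_iff)
  then show ?thesis unfolding layer_weight_def using True assms by (intro mult_nonneg_nonneg divide_nonneg_nonneg) auto
qed (simp add: layer_weight_def)

text \<open>Polar coordinates with r = 1 - d s and angle d s tan v. The factors d and d s / (cos
  v)^2 in the weight are the Jacobians of these two substitutions; the indicators are the original
  ranges of radius and angle.\<close>

lemma nn_integral_stretched:
  fixes G :: "complex \<Rightarrow> ennreal"
  assumes [measurable]: "G \<in> borel_measurable borel" and d: "0 < d"
  shows "(\<integral>\<^sup>+z. G z * indicator {1-\<epsilon>..} (norm z) \<partial>\<mu>) =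
    (\<integral>\<^sup>+x. ennreal (layer_weight d (fst x) (snd x)) * G (layer_point d (fst x) (snd x)) \<partial>(lborel \<Otimes>\<^sub>M lborel))"
proof -
  define inner where "inner r = (\<integral>\<^sup>+\<theta>. ennreal (1 / (2 * pi)) * G (complex_of_real r * cis \<theta>) * indicator {-pi..<pi} \<theta> \<partial>lborel)" for r
  have [measurable]: "inner \<in> borel_measurable borel" unfolding inner_def by measurable
  have "(\<integral>\<^sup>+z. G z * indicator {1-\<epsilon>..} (norm z) \<partial>\<mu>) = (\<integral>\<^sup>+r. ennreal (\<rho> r) * indicator {1-\<epsilon>..<1} r * inner r \<partial>lborel)"
    unfolding inner_def by (rule nn_integral_polar) simp
  also have "\<dots> = ennreal \<bar>-d\<bar> * (\<integral>\<^sup>+s. ennreal (\<rho> (1 + (-d) * s)) * indicator {1-\<epsilon>..<1} (1 + (-d) * s) * inner (1 + (-d) * s) \<partial>lborel)"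
    using d by (intro nn_integral_real_affine) auto
  also have "\<dots> = (\<integral>\<^sup>+s. ennreal d * (ennreal (\<rho> (1 - d * s)) * indicator {1-\<epsilon>..<1} (1 - d * s) * inner (1 - d * s)) \<partial>lborel)"
    using d by (subst nn_integral_cmult) auto
  also have "\<dots> = (\<integral>\<^sup>+s. (\<integral>\<^sup>+v. ennreal (layer_weight d s v) * G (layer_point d s v) \<partial>lborel) \<partial>lborel)"
  proof (rule nn_integral_cong)
    fix s :: real
    show "ennreal d * (ennreal (\<rho> (1 - d * s)) * indicator {1-\<epsilon>..<1} (1 - d * s) * inner (1 - d * s)) =
       (\<integral>\<^sup>+v. ennreal (layer_weight d s v) * G (layer_point d s v) \<partial>lborel)"
    proof (cases "d * s \<in> {0<..\<epsilon>}")
      case True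
      have r0: "0 \<le> \<rho> (1 - d * s)" using True by (intro rho_pos) auto
      have "inner (1 - d * s) = (\<integral>\<^sup>+v. ennreal (d * s / (cos v)\<^sup>2 * indicator {-(pi/2)<..<pi/2} v) *
          (ennreal (1 / (2 * pi)) * G (complex_of_real (1 - d * s) * cis (d * s * tan v)) * indicator {-pi..<pi} (d * s * tan v)) \<partial>lborel)"
        unfolding inner_def by (rule nn_integral_tan_subst) (use True in auto)
      then have "ennreal d * (ennreal (\<rho> (1 - d * s)) * indicator {1-\<epsilon>..<1} (1 - d * s) * inner (1 - d * s)) =
         (ennreal d * ennreal (\<rho> (1 - d * s))) * (\<integral>\<^sup>+v. ennreal (d * s / (cos v)\<^sup>2 * indicator {-(pi/2)<..<pi/2} v) *
          (ennreal (1 / (2 * pi)) * G (layer_point d s v) * indicator {-pi..<pi} (d * s * tan v)) \<partial>lborel)"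
        using True by (simp add: mult.assoc layer_point_def)
      also have "\<dots> = (\<integral>\<^sup>+v. (ennreal d * ennreal (\<rho> (1 - d * s))) * (ennreal (d * s / (cos v)\<^sup>2 * indicator {-(pi/2)<..<pi/2} v) *
          (ennreal (1 / (2 * pi)) * G (layer_point d s v) * indicator {-pi..<pi} (d * s * tan v))) \<partial>lborel)"
        by (rule nn_integral_cmult[symmetric]) (simp add: layer_point_def)
      also have "\<dots> = (\<integral>\<^sup>+v. ennreal (layer_weight d s v) * G (layer_point d s v) \<partial>lborel)"
      proof (rule nn_integral_cong)
        fix v :: real
        define w where "w = d * s / (cos v)\<^sup>2 * indicator {-(pi/2)<..<pi/2} v"
        have w: "0 \<le> w" using True by (auto simp: w_def)
        define i :: real where "i = indicator {-pi..<pi} (d * s * tan v)"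
        have i: "0 \<le> i" "indicator {-pi..<pi} (d * s * tan v) = ennreal i" by (auto simp: i_def indicator_def)
        define k :: real where "k = 1 / (2 * pi)"
        have k: "0 \<le> k" by (simp add: k_def)
        have "layer_weight d s v = d * \<rho> (1 - d * s) * (w * k * i)"
          using True by (simp add: layer_weight_def w_def i_def k_def mult_ac)
        then have "ennreal (layer_weight d s v) = ennreal d * ennreal (\<rho> (1 - d * s)) * (ennreal w * ennreal k * ennreal i)"
          using d r0 w i k by (simp add: ennreal_mult)
        then show "(ennreal d * ennreal (\<rho> (1 - d * s))) * (ennreal (d * s / (cos v)\<^sup>2 * indicator {-(pi/2)<..<pi/2} v) *
          (ennreal (1 / (2 * pi)) * G (layer_point d s v) * indicator {-pi..<pi} (d * s * tan v))) = ennreal (layer_weight d s v) * G (layer_point d s v)"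
          unfolding w_def[symmetric] i(2) k_def[symmetric] by (simp add: mult_ac)
      qed
      finally show ?thesis .
    qed (auto simp: layer_weight_def indicator_def)
  qed
  also have "\<dots> = (\<integral>\<^sup>+x. ennreal (layer_weight d (fst x) (snd x)) * G (layer_point d (fst x) (snd x)) \<partial>(lborel \<Otimes>\<^sub>M lborel))"
    by (subst lborel.nn_integral_fst[symmetric]) auto
  finally show ?thesis .
qed

lemma integral_stretched:
  fixes G :: "complex \<Rightarrow> complex"
  assumes [measurable]: "G \<in> borel_measurable borel" and d: "0 < d"
  shows "(CLINT z|\<mu>. indicator {1-\<epsilon>..} (norm z) *\<^sub>R G z) =
    (CLINT x|(lborel \<Otimes>\<^sub>M lborel). layer_weight d (fst x) (snd x) *\<^sub>R G (layer_point d (fst x) (snd x)))"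
proof -
  let ?Z = "\<lambda>x. layer_point d (fst x) (snd x)" and ?w = "\<lambda>x. layer_weight d (fst x) (snd x)"
  have eq: "distr (density (lborel \<Otimes>\<^sub>M lborel) (\<lambda>x. ennreal (?w x))) borel ?Z = density \<mu> (\<lambda>z. ennreal (indicator {1-\<epsilon>..} (norm z)))"
    (is "?D = ?E")
  proof (rule measure_eqI)
    fix A assume "A \<in> sets ?D"
    then have A [measurable]: "A \<in> sets borel" by simp
    have "emeasure ?D A = emeasure (density (lborel \<Otimes>\<^sub>M lborel) (\<lambda>x. ennreal (?w x))) (?Z -` A \<inter> space (lborel \<Otimes>\<^sub>M lborel))"
      by (subst emeasure_distr) auto
    also have "\<dots> = (\<integral>\<^sup>+x. ennreal (?w x) * indicator (?Z -` A \<inter> space (lborel \<Otimes>\<^sub>M lborel)) x \<partial>(lborel \<Otimes>\<^sub>M lborel))"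
      by (rule emeasure_density) (use measurable_sets[OF layer_point_measurable A] in auto)
    also have "\<dots> = (\<integral>\<^sup>+x. ennreal (?w x) * indicator A (?Z x) \<partial>(lborel \<Otimes>\<^sub>M lborel))"
      by (rule nn_integral_cong) (auto simp: indicator_def space_pair_measure)
    also have "\<dots> = (\<integral>\<^sup>+z. indicator A z * indicator {1-\<epsilon>..} (norm z) \<partial>\<mu>)"
      by (rule nn_integral_stretched[symmetric]) (use d in auto)
    also have "\<dots> = (\<integral>\<^sup>+z. ennreal (indicator {1-\<epsilon>..} (norm z)) * indicator A z \<partial>\<mu>)"
      by (rule nn_integral_cong) (auto simp: indicator_def)
    also have "\<dots> = emeasure ?E A"
      by (rule emeasure_density[symmetric]) (auto simp: sets_mu)
    finally show "emeasure ?D A = emeasure ?E A" .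
  qed (simp add: sets_mu)
  have "(CLINT z|\<mu>. indicator {1-\<epsilon>..} (norm z) *\<^sub>R G z) = (CLINT z|?E. G z)"
    by (subst integral_density) auto
  also have "\<dots> = (CLINT z|?D. G z)" unfolding eq ..
  also have "\<dots> = (CLINT x|(lborel \<Otimes>\<^sub>M lborel). ?w x *\<^sub>R G (?Z x))"
    using layer_weight_nonneg[OF d] by (subst integral_distr) (auto simp: integral_density)
  finally show ?thesis .
qed

lemma ratio_limit_ge: "c \<le> L"
proof (rule tendsto_lowerbound[OF ratio_lim])
  have "\<forall>\<^sub>F r in at_left 1. r \<in> {1-\<epsilon><..<1}" using eps by (intro eventually_at_leftI[of "1-\<epsilon>"]) auto
  then show "\<forall>\<^sub>F r in at_left 1. c \<le> \<rho> r / (1 - r) powr \<alpha>"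
  proof eventually_elim
    case (elim r)
    then have "c * (1 - r) powr \<alpha> \<le> \<rho> r" by (intro rho_bounds) auto
    then show ?case using elim by (simp add: pos_le_divide_eq)
  qed
qed simp

definition "p = 2 + \<alpha>"

lemma p: "1 < p" "p < 2" "1.905 < p"
  using alpha by (auto simp: p_def)

text \<open>The pointwise limit of n times \<open>layer_weight\<close> when n d^p = 1. It is a
  product of a function of s and a function of v.\<close>

definition "lim_weight s v = L / (2 * pi) * (s powr (1 + \<alpha>) * indicator {0<..} s) * (1 / (cos v)\<^sup>2 * indicator {-(pi/2)<..<pi/2} v)"

lemma lim_weight_measurable [measurable]: "(\<lambda>x. lim_weight (fst x) (snd x)) \<in> borel_measurable (lborel \<Otimes>\<^sub>M lborel)"
  unfolding lim_weight_def by measurable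

lemma recip_gap_minus_1: "z \<noteq> 1 \<Longrightarrow> recip_gap z - 1 = z / (1 - z)"
  by (simp add: recip_gap_def field_simps)

text \<open>A majorant independent of n. The exponent argument is at most y = 5 |t| cos v / s, and
  |\<open>iexp2\<close>| \<le> 2 y^q leaves s^(1 + \<alpha> - q) (cos v)^(q - 2). Integrability
  needs q < 2 + \<alpha> near s = 0, q > 2 + \<alpha> at infinity and q > 1 for the cosine; hence q
  = 1.5 for s \<le> 1 and q = 2 for s > 1. The weaker power -1/2 of the cosine serves both
  cases.\<close>

lemma st_domination:
  assumes d: "0 < d" "real n * d powr p = 1" 
  shows "norm ((real n * layer_weight d s v) *\<^sub>R iexp2 (t \<bullet> (complex_of_real d * (recip_gap (layer_point d s v) - 1))))
    \<le> C / pi * ((5 * norm t) powr 1.5 + (5 * norm t) powr 2) * (two_powr (\<alpha> - 1/2) (\<alpha> - 1) s * (cos v powr (-1/2) * indicator {-(pi/2)<..<pi/2} v))"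
    (is "?l \<le> ?r")
proof (cases "d * s \<in> {0<..\<epsilon>} \<and> d * s * tan v \<in> {-pi..<pi} \<and> v \<in> {-(pi/2)<..<pi/2}")
  case False
  then have "layer_weight d s v = 0" by (auto simp: layer_weight_def)
  then show ?thesis using cC by (auto simp: two_powr_nonneg intro!: mult_nonneg_nonneg)
next
  case True
  then have s: "0 < s" using d by (auto simp: zero_less_mult_iff)
  have cv: "0 < cos v" "cos v \<le> 1" using True by (auto intro: cos_gt_zero_pi)
  define r where "r = 1 - d * s"
  have r: "1 / 2 \<le> r" "r < 1" "1 - \<epsilon> \<le> r" using True eps by (auto simp: r_def)
  define z where "z = layer_point d s v"
  have z: "z = complex_of_real r * cis (d * s * tan v)" by (simp add: z_def layer_point_def r_def)
  have nz: "norm z \<le> 1" using r by (simp add: z norm_mult)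
  have "\<bar>d * s * tan v\<bar> \<le> pi" using True by auto
  note lb = norm_one_minus_polar[OF r(1) less_imp_le[OF r(2)] this, folded z]
  have ds: "0 < d * s" using True by auto
  \<comment> \<open>This combines the radial and the angular lower bound on |1 - z|, weighted by cos
    v and |sin v|. It yields d s \<le> (1 + pi) cos v |1 - z|, and 1 + pi \<le> 5.\<close>
  have sc: "1 \<le> cos v + \<bar>sin v\<bar>"
  proof -
    have "(sin v)\<^sup>2 + (cos v)\<^sup>2 \<le> (cos v + \<bar>sin v\<bar>)\<^sup>2" using cv by (simp add: power2_sum)
    then have "1\<^sup>2 \<le> (cos v + \<bar>sin v\<bar>)\<^sup>2" by simp
    then show ?thesis by (rule power2_le_imp_le) (use cv in auto)
  qed
  have low: "d * s \<le> 5 * cos v * norm (1 - z)"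
  proof -
    have 1: "d * s \<le> norm (1 - z)" using lb(2) by (simp add: r_def)
    have 2: "d * s * \<bar>tan v\<bar> \<le> pi * norm (1 - z)" using lb(1) d s by (simp add: abs_mult field_simps)
    have "d * s * \<bar>sin v\<bar> = d * s * \<bar>tan v\<bar> * cos v" using cv by (simp add: tan_def)
    also have "\<dots> \<le> pi * norm (1 - z) * cos v" using 2 cv by (intro mult_right_mono) auto
    finally have 3: "d * s * \<bar>sin v\<bar> \<le> pi * norm (1 - z) * cos v" .
    have 4: "d * s * cos v \<le> norm (1 - z) * cos v" using 1 cv by (intro mult_right_mono) auto
    have "d * s * 1 \<le> d * s * (cos v + \<bar>sin v\<bar>)" using sc ds by (intro mult_left_mono) auto
    also have "\<dots> \<le> (1 + pi) * (norm (1 - z) * cos v)" using 3 4 by (simp add: algebra_simps)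
    also have "\<dots> \<le> 5 * (norm (1 - z) * cos v)" using pi_less_4 cv by (intro mult_right_mono) auto
    finally show ?thesis by (simp add: mult_ac)
  qed
  have p1: "0 < norm (1 - z)" using low ds cv by (metis less_le_trans mult.commute mult_zero_left norm_ge_zero order_less_le)
  then have z1: "z \<noteq> 1" by auto
  define y where "y = 5 * norm t * cos v / s"
  have y: "0 \<le> y" using s cv by (simp add: y_def)
  have "\<bar>t \<bullet> (complex_of_real d * (recip_gap z - 1))\<bar> \<le> norm t * norm (complex_of_real d * (recip_gap z - 1))"
    by (rule Cauchy_Schwarz_ineq2)
  also have "norm (complex_of_real d * (recip_gap z - 1)) = d * (norm z / norm (1 - z))"
    using d z1 by (simp add: recip_gap_minus_1 norm_mult norm_divide)
  also have "\<dots> \<le> d * (1 / norm (1 - z))" using d nz by (intro mult_left_mono divide_right_mono) auto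
  also have "\<dots> \<le> 5 * cos v / s" using low s p1 d by (simp add: field_simps)
  also have "norm t * (5 * cos v / s) = y" by (simp add: y_def)
  finally have xy: "\<bar>t \<bullet> (complex_of_real d * (recip_gap z - 1))\<bar> \<le> y" by (simp add: mult_left_mono)
  have w: "real n * layer_weight d s v \<le> C / (2 * pi) * (s powr (1 + \<alpha>) * (1 / (cos v)\<^sup>2))"
  proof -
    have "\<rho> r \<le> C * (1 - r) powr \<alpha>" using r by (intro rho_bounds) auto
    also have "(1 - r) powr \<alpha> = d powr \<alpha> * s powr \<alpha>" using d s by (simp add: r_def powr_mult)
    finally have rr: "\<rho> r \<le> C * (d powr \<alpha> * s powr \<alpha>)" .
    have "real n * layer_weight d s v = \<rho> r * (real n * d * d * s / (2 * pi * (cos v)\<^sup>2))"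
      using True by (simp add: layer_weight_def r_def mult_ac)
    also have "\<dots> \<le> C * (d powr \<alpha> * s powr \<alpha>) * (real n * d * d * s / (2 * pi * (cos v)\<^sup>2))"
      using rr d s by (intro mult_right_mono) auto
    also have "\<dots> = C / (2 * pi) * (real n * (d powr \<alpha> * d * d)) * (s powr \<alpha> * s) * (1 / (cos v)\<^sup>2)"
      by (simp add: field_simps)
    also have "d powr \<alpha> * d * d = d powr p"
      using d by (simp add: p_def powr_add power2_eq_square)
    also have "real n * d powr p = 1" by (rule d(2))
    also have "s powr \<alpha> * s = s powr (1 + \<alpha>)" using s by (simp add: powr_add)
    finally show ?thesis by (simp add: mult_ac)
  qed
  have w0: "0 \<le> real n * layer_weight d s v" using layer_weight_nonneg[OF d(1)] by simp
  have key: "?l \<le> C / (2 * pi) * (s powr (1 + \<alpha>) * (1 / (cos v)\<^sup>2)) * (2 * y powr q)" if "1 \<le> q" "q \<le> 2" for q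
    unfolding norm_scaleR abs_of_nonneg[OF w0] z_def[symmetric]
    by (intro mult_mono w norm_iexp2_le_powr that y xy) (use cC in auto)
  have yq: "C / (2 * pi) * (s powr (1 + \<alpha>) * (1 / (cos v)\<^sup>2)) * (2 * y powr q) =
      C / pi * (5 * norm t) powr q * (s powr (1 + \<alpha> - q) * cos v powr (q - 2))" for q
  proof -
    have "y powr q = (5 * norm t) powr q * cos v powr q / s powr q"
      using s cv by (simp add: y_def powr_mult powr_divide)
    moreover have "cos v powr (q - 2) = cos v powr q / (cos v)\<^sup>2" using cv by (simp add: powr_diff)
    moreover have "s powr (1 + \<alpha> - q) = s powr (1 + \<alpha>) / s powr q" by (simp add: powr_diff)
    ultimately show ?thesis by (simp add: mult_ac)
  qed
  show ?thesis
  proof (cases "s \<le> 1")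
    case s1: True
    have "?l \<le> C / pi * (5 * norm t) powr 1.5 * (s powr (1 + \<alpha> - 1.5) * cos v powr (1.5 - 2))"
      using key[of "1.5"] unfolding yq by simp
    also have "\<dots> \<le> C / pi * ((5 * norm t) powr 1.5 + (5 * norm t) powr 2) * (s powr (1 + \<alpha> - 1.5) * cos v powr (1.5 - 2))"
      using cC by (intro mult_right_mono mult_left_mono) auto
    also have "s powr (1 + \<alpha> - 1.5) = two_powr (\<alpha> - 1/2) (\<alpha> - 1) s" using s s1 by (simp add: two_powr_def)
    also have "cos v powr (1.5 - 2) = cos v powr (-1/2) * indicator {-(pi/2)<..<pi/2} v" using True by simp
    finally show ?thesis .
  next
    case s1: False
    have "?l \<le> C / pi * (5 * norm t) powr 2 * (s powr (1 + \<alpha> - 2) * cos v powr (2 - 2))"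
      using key[of 2] unfolding yq by simp
    also have "\<dots> \<le> C / pi * ((5 * norm t) powr 1.5 + (5 * norm t) powr 2) * (s powr (1 + \<alpha> - 2) * cos v powr (-1/2))"
    proof (rule mult_mono)
      show "s powr (1 + \<alpha> - 2) * cos v powr (2 - 2) \<le> s powr (1 + \<alpha> - 2) * cos v powr (-1/2)"
        using cv by (intro mult_left_mono powr_mono') auto
      show "C / pi * (5 * norm t) powr 2 \<le> C / pi * ((5 * norm t) powr 1.5 + (5 * norm t) powr 2)"
        using cC by (intro mult_left_mono) auto
    qed (use cC in auto)
    also have "s powr (1 + \<alpha> - 2) = two_powr (\<alpha> - 1/2) (\<alpha> - 1) s" using s s1 by (simp add: two_powr_def)
    also have "cos v powr (-1/2) = cos v powr (-1/2) * indicator {-(pi/2)<..<pi/2} v" using True by simp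
    finally show ?thesis .
  qed
qed

lemma st_dominating_integrable:
  "integrable (lborel \<Otimes>\<^sub>M lborel) (\<lambda>x. K * (two_powr (\<alpha> - 1/2) (\<alpha> - 1) (fst x) * (cos (snd x) powr (-1/2) * indicator {-(pi/2)<..<pi/2} (snd x))))"
  by (intro integrable_mult_right lborel_pair.product_integral(1) integrable_two_powr integrable_cos_powr) (use alpha in auto)

lemma st_pointwise_limit:
  assumes d: "\<And>n. 0 < d n" "d \<longlonglongrightarrow> 0" "\<And>n. 1 \<le> n \<Longrightarrow> real n * d n powr p = 1" and s: "0 < s" and v: "v \<in> {-(pi/2)<..<pi/2}"
  shows "(\<lambda>n. (real n * layer_weight (d n) s v) *\<^sub>R iexp2 (t \<bullet> (complex_of_real (d n) * (recip_gap (layer_point (d n) s v) - 1))))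
     \<longlonglongrightarrow> lim_weight s v *\<^sub>R iexp2 (cos v * (t \<bullet> cis v) / s)"
proof (intro tendsto_scaleR)
  have ds: "(\<lambda>n. d n * s) \<longlonglongrightarrow> 0" using tendsto_mult[OF d(2) tendsto_const[of s]] by simp
  have dst: "(\<lambda>n. d n * s * tan v) \<longlonglongrightarrow> 0" using tendsto_mult[OF ds tendsto_const[of "tan v"]] by simp
  have ev1: "\<forall>\<^sub>F n in sequentially. d n * s < \<epsilon>" using order_tendstoD(2)[OF ds] eps by auto
  have ev2: "\<forall>\<^sub>F n in sequentially. d n * s * tan v < pi" "\<forall>\<^sub>F n in sequentially. - pi < d n * s * tan v"
    using order_tendstoD[OF dst] by auto
  have cv: "0 < cos v" using v by (auto intro: cos_gt_zero_pi)
  have rl: "filterlim (\<lambda>n. 1 - d n * s) (at_left 1) sequentially"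
  proof (rule tendsto_imp_filterlim_at_left)
    show "(\<lambda>n. 1 - d n * s) \<longlonglongrightarrow> 1" using tendsto_diff[OF tendsto_const[of 1] ds] by simp
    show "\<forall>\<^sub>F n in sequentially. 1 - d n * s < 1" using d(1) s by (auto intro!: always_eventually)
  qed
  have "(\<lambda>n. \<rho> (1 - d n * s) / (1 - (1 - d n * s)) powr \<alpha> * (1 / (2 * pi) * s powr (1 + \<alpha>) * (1 / (cos v)\<^sup>2)))
     \<longlonglongrightarrow> L * (1 / (2 * pi) * s powr (1 + \<alpha>) * (1 / (cos v)\<^sup>2))"
    by (intro tendsto_mult tendsto_const filterlim_compose[OF ratio_lim rl])
  also have "L * (1 / (2 * pi) * s powr (1 + \<alpha>) * (1 / (cos v)\<^sup>2)) = lim_weight s v"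
    using s v by (simp add: lim_weight_def)
  finally have l1: "(\<lambda>n. \<rho> (1 - d n * s) / (1 - (1 - d n * s)) powr \<alpha> * (1 / (2 * pi) * s powr (1 + \<alpha>) * (1 / (cos v)\<^sup>2))) \<longlonglongrightarrow> lim_weight s v" .
  show "(\<lambda>n. real n * layer_weight (d n) s v) \<longlonglongrightarrow> lim_weight s v"
  proof (rule Lim_transform_eventually[OF l1])
    show "\<forall>\<^sub>F n in sequentially. \<rho> (1 - d n * s) / (1 - (1 - d n * s)) powr \<alpha> * (1 / (2 * pi) * s powr (1 + \<alpha>) * (1 / (cos v)\<^sup>2)) = real n * layer_weight (d n) s v"
      using ev1 ev2 eventually_ge_at_top[of 1]
    proof eventually_elim
      case (elim n)
      have dn: "0 < d n" by (rule d)
      have "real n * layer_weight (d n) s v = \<rho> (1 - d n * s) * (real n * (d n * (d n * s)) / (2 * pi * (cos v)\<^sup>2))"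
        using elim dn s v by (simp add: layer_weight_def mult_ac)
      also have "real n * (d n * (d n * s)) = s powr (1 + \<alpha>) / (d n * s) powr \<alpha>"
      proof -
        have "(d n) powr p = d n powr \<alpha> * (d n * d n)" using dn by (simp add: p_def powr_add power2_eq_square)
        then have "real n * (d n * d n) = 1 / d n powr \<alpha>" using d(3)[OF elim(4)] dn by (simp add: field_simps)
        then have "real n * (d n * (d n * s)) = s / d n powr \<alpha>" by (simp add: mult.assoc[symmetric])
        also have "\<dots> = (s * s powr \<alpha>) / (d n powr \<alpha> * s powr \<alpha>)" using s by simp
        also have "s * s powr \<alpha> = s powr (1 + \<alpha>)" using s by (simp add: powr_add)
        also have "d n powr \<alpha> * s powr \<alpha> = (d n * s) powr \<alpha>" using dn s by (simp add: powr_mult)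
        finally show ?thesis .
      qed
      finally show ?case by simp
    qed
  qed
  show "(\<lambda>n. iexp2 (t \<bullet> (complex_of_real (d n) * (recip_gap (layer_point (d n) s v) - 1)))) \<longlonglongrightarrow> iexp2 (cos v * (t \<bullet> cis v) / s)"
  proof -
    define y where "y = s * tan v"
    have cd: "(\<lambda>n. complex_of_real (d n)) \<longlonglongrightarrow> 0" using tendsto_of_real[OF d(2)] by simp
    have "((\<lambda>u. exp (\<i> * complex_of_real y * u)) has_field_derivative (exp (\<i> * complex_of_real y * 0) * (\<i> * complex_of_real y))) (at 0)"
      by (auto intro!: derivative_eq_intros)
    then have D: "((\<lambda>h. (exp (\<i> * complex_of_real y * h) - 1) / h) \<longlongrightarrow> \<i> * complex_of_real y) (at 0)"
      by (simp add: DERIV_def)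
    have fl: "filterlim (\<lambda>n. complex_of_real (d n)) (at 0) sequentially"
      using cd d(1) by (intro filterlim_atI) (auto intro!: always_eventually simp: less_imp_neq[THEN not_sym])
    have e1: "(\<lambda>n. (exp (\<i> * complex_of_real y * complex_of_real (d n)) - 1) / complex_of_real (d n)) \<longlonglongrightarrow> \<i> * complex_of_real y"
      by (rule filterlim_compose[OF D fl])
    have ee: "exp (\<i> * complex_of_real y * complex_of_real (d n)) = cis (d n * s * tan v)" for n
      by (simp add: cis_conv_exp y_def mult_ac)
    have c1: "(\<lambda>n. cis (d n * s * tan v)) \<longlonglongrightarrow> cis 0"
      unfolding cis_conv_exp by (intro tendsto_intros dst)
    \<comment> \<open>With c = cis (d s tan v) one has 1 - z = d s c - (c - 1), so (1 - z) / d is s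
      c minus a difference quotient of the exponential at 0.\<close>
    have "(\<lambda>n. complex_of_real s * cis (d n * s * tan v) - (exp (\<i> * complex_of_real y * complex_of_real (d n)) - 1) / complex_of_real (d n))
       \<longlonglongrightarrow> complex_of_real s * cis 0 - \<i> * complex_of_real y"
      by (intro tendsto_intros c1 e1)
    moreover have "complex_of_real s * cis (d n * s * tan v) - (exp (\<i> * complex_of_real y * complex_of_real (d n)) - 1) / complex_of_real (d n)
       = (1 - layer_point (d n) s v) / complex_of_real (d n)" for n
      unfolding ee layer_point_def using d(1)[of n] by (simp add: field_simps)
    ultimately have l2: "(\<lambda>n. (1 - layer_point (d n) s v) / complex_of_real (d n)) \<longlonglongrightarrow> complex_of_real s - \<i> * complex_of_real y" by simp
    have sy: "complex_of_real s - \<i> * complex_of_real y \<noteq> 0" using s by (auto simp: complex_eq_iff)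
    have "(\<lambda>n. complex_of_real (1 - d n * s) * cis (d n * s * tan v)) \<longlonglongrightarrow> complex_of_real (1 - 0) * cis 0"
      by (intro tendsto_intros ds c1)
    then have l3: "(\<lambda>n. layer_point (d n) s v) \<longlonglongrightarrow> 1" by (simp add: layer_point_def)
    have l4: "(\<lambda>n. layer_point (d n) s v / ((1 - layer_point (d n) s v) / complex_of_real (d n))) \<longlonglongrightarrow> 1 / (complex_of_real s - \<i> * complex_of_real y)"
      by (rule tendsto_divide[OF l3 l2 sy])
    have "\<forall>\<^sub>F n in sequentially. norm ((1 - layer_point (d n) s v) / complex_of_real (d n)) > 0"
      using sy by (intro order_tendstoD(1)[OF tendsto_norm[OF l2]]) auto
    then have "\<forall>\<^sub>F n in sequentially. layer_point (d n) s v / ((1 - layer_point (d n) s v) / complex_of_real (d n)) = complex_of_real (d n) * (recip_gap (layer_point (d n) s v) - 1)"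
    proof eventually_elim
      case (elim n)
      then have "layer_point (d n) s v \<noteq> 1" by auto
      then show ?case by (simp add: recip_gap_minus_1)
    qed
    then have l5: "(\<lambda>n. complex_of_real (d n) * (recip_gap (layer_point (d n) s v) - 1)) \<longlonglongrightarrow> 1 / (complex_of_real s - \<i> * complex_of_real y)"
      by (rule Lim_transform_eventually[OF l4])
    have val: "1 / (complex_of_real s - \<i> * complex_of_real y) = complex_of_real (cos v / s) * cis v"
    proof -
      have "complex_of_real s - \<i> * complex_of_real y = complex_of_real (s / cos v) * cis (- v)"
        using cv by (simp add: complex_eq_iff y_def tan_def)
      then have "(complex_of_real s - \<i> * complex_of_real y) * (complex_of_real (cos v / s) * cis v) =
         complex_of_real ((s / cos v) * (cos v / s)) * (cis (- v) * cis v)"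
        by (simp only: of_real_mult mult_ac)
      also have "\<dots> = 1" using s cv by (simp add: cis_mult)
      finally have "(complex_of_real s - \<i> * complex_of_real y) * (complex_of_real (cos v / s) * cis v) = 1" .
      then show ?thesis using inverse_unique by (metis inverse_eq_divide)
    qed
    have "t \<bullet> (complex_of_real (cos v / s) * cis v) = cos v * (t \<bullet> cis v) / s"
      by (simp add: inner_complex_def algebra_simps add_divide_distrib)
    moreover have "(\<lambda>n. iexp2 (t \<bullet> (complex_of_real (d n) * (recip_gap (layer_point (d n) s v) - 1)))) \<longlonglongrightarrow> iexp2 (t \<bullet> (1 / (complex_of_real s - \<i> * complex_of_real y)))"
      unfolding iexp2_def by (intro tendsto_intros l5)
    ultimately show ?thesis unfolding val by simp
  qed
qed

definition "levy_exponent t = (CLINT x|(lborel \<Otimes>\<^sub>M lborel). lim_weight (fst x) (snd x) *\<^sub>R iexp2 (cos (snd x) * (t \<bullet> cis (snd x)) / fst x))"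

lemma st_limit:
  assumes d: "\<And>n. 0 < d n" "d \<longlonglongrightarrow> 0" "\<And>n. 1 \<le> n \<Longrightarrow> real n * d n powr p = 1"
  shows "(\<lambda>n. CLINT x|(lborel \<Otimes>\<^sub>M lborel). (real n * layer_weight (d n) (fst x) (snd x)) *\<^sub>R
      iexp2 (t \<bullet> (complex_of_real (d n) * (recip_gap (layer_point (d n) (fst x) (snd x)) - 1)))) \<longlonglongrightarrow> levy_exponent t" (is ?A)
    and "integrable (lborel \<Otimes>\<^sub>M lborel) (\<lambda>x. lim_weight (fst x) (snd x) *\<^sub>R iexp2 (cos (snd x) * (t \<bullet> cis (snd x)) / fst x))" (is ?B)
proof -
  let ?K = "C / pi * ((5 * norm t) powr 1.5 + (5 * norm t) powr 2)"
  let ?w = "\<lambda>x. ?K * (two_powr (\<alpha> - 1/2) (\<alpha> - 1) (fst x) * (cos (snd x) powr (-1/2) * indicator {-(pi/2)<..<pi/2} (snd x)))"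
  let ?f = "\<lambda>n x. (real n * layer_weight (d n) (fst x) (snd x)) *\<^sub>R
      iexp2 (t \<bullet> (complex_of_real (d n) * (recip_gap (layer_point (d n) (fst x) (snd x)) - 1)))"
  let ?g = "\<lambda>x. lim_weight (fst x) (snd x) *\<^sub>R iexp2 (cos (snd x) * (t \<bullet> cis (snd x)) / fst x)"
  have lim: "AE x in lborel \<Otimes>\<^sub>M lborel. (\<lambda>n. ?f n x) \<longlonglongrightarrow> ?g x"
  proof (rule AE_I2)
    fix x :: "real \<times> real"
    show "(\<lambda>n. ?f n x) \<longlonglongrightarrow> ?g x"
    proof (cases "0 < fst x \<and> snd x \<in> {-(pi/2)<..<pi/2}")
      case True
      then show ?thesis using st_pointwise_limit[OF d, of "fst x" "snd x" t] by simp
    next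
      case False
      have "layer_weight (d n) (fst x) (snd x) = 0" for n
        using False d(1)[of n] by (auto simp: layer_weight_def indicator_def zero_less_mult_iff)
      moreover have "lim_weight (fst x) (snd x) = 0" using False by (auto simp: lim_weight_def)
      ultimately show ?thesis by simp
    qed
  qed
  have bound: "norm (?f n x) \<le> ?w x" if "1 \<le> n" for n x
    by (rule st_domination) (use d that in auto)
  \<comment> \<open>The sequence is shifted by one because n d^p = 1, on which the majorant rests,
    is available only for n \<ge> 1.\<close>
  have bound': "AE x in lborel \<Otimes>\<^sub>M lborel. norm (?f (Suc n) x) \<le> ?w x" for n
    by (rule AE_I2) (rule bound, simp)
  have m1: "?g \<in> borel_measurable (lborel \<Otimes>\<^sub>M lborel)" and m2: "?f n \<in> borel_measurable (lborel \<Otimes>\<^sub>M lborel)" for n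
    by measurable
  have lim': "AE x in lborel \<Otimes>\<^sub>M lborel. (\<lambda>n. ?f (Suc n) x) \<longlonglongrightarrow> ?g x"
    using lim by eventually_elim (rule LIMSEQ_Suc)
  note dc = m1 m2 st_dominating_integrable[of ?K] lim' bound'
  show ?B by (rule integrable_dominated_convergence[OF dc])
  have "(\<lambda>n. CLINT x|(lborel \<Otimes>\<^sub>M lborel). ?f (Suc n) x) \<longlonglongrightarrow> levy_exponent t"
    unfolding levy_exponent_def by (rule integral_dominated_convergence[OF dc])
  then show ?A by (rule LIMSEQ_imp_Suc)
qed

text \<open>Only the annulus near the unit circle contributes. On its complement 1 / (1 - z) is
  bounded, so the quadratic bound gives a term of order n d^2 = d^(2 - p), which vanishes since p <
  2.\<close>

lemma inner_limit:
  assumes d: "\<And>n. 0 < d n" "d \<longlonglongrightarrow> 0" "\<And>n. 1 \<le> n \<Longrightarrow> real n * d n powr p = 1"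
  shows "(\<lambda>n. real n * (CLINT z|\<mu>. iexp2 (t \<bullet> (complex_of_real (d n) * (recip_gap z - 1))))) \<longlonglongrightarrow> levy_exponent t"
proof -
  let ?k = "\<lambda>n z. iexp2 (t \<bullet> (complex_of_real (d n) * (recip_gap z - 1)))"
  have ki: "integrable \<mu> (?k n)" for n
  proof (rule Bochner_Integration.integrable_bound)
    show "integrable \<mu> (\<lambda>z. 2 * (norm t * (d n * norm (recip_gap z - 1))))"
      using integrable_recip_gap by (intro integrable_mult_right integrable_norm Bochner_Integration.integrable_diff) auto
    show "AE z in \<mu>. norm (?k n z) \<le> norm (2 * (norm t * (d n * norm (recip_gap z - 1))))"
    proof (rule AE_I2)
      fix z
      have "norm (?k n z) \<le> 2 * \<bar>t \<bullet> (complex_of_real (d n) * (recip_gap z - 1))\<bar>" by (rule norm_iexp2_le)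
      also have "\<dots> \<le> 2 * (norm t * norm (complex_of_real (d n) * (recip_gap z - 1)))"
        by (intro mult_left_mono Cauchy_Schwarz_ineq2) auto
      finally show "norm (?k n z) \<le> norm (2 * (norm t * (d n * norm (recip_gap z - 1))))"
        using d(1)[of n] by (simp add: norm_mult abs_mult)
    qed
  qed simp
  define A where "A n = (CLINT z|\<mu>. indicator {1-\<epsilon>..} (norm z) *\<^sub>R ?k n z)" for n
  define B where "B n = (CLINT z|\<mu>. indicator {..<1-\<epsilon>} (norm z) *\<^sub>R ?k n z)" for n
  have iA: "integrable \<mu> (\<lambda>z. indicator {1-\<epsilon>..} (norm z) *\<^sub>R ?k n z)" for n
    by (rule Bochner_Integration.integrable_bound[OF ki[of n]]) (auto simp: indicator_def)
  have iB: "integrable \<mu> (\<lambda>z. indicator {..<1-\<epsilon>} (norm z) *\<^sub>R ?k n z)" for n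
    by (rule Bochner_Integration.integrable_bound[OF ki[of n]]) (auto simp: indicator_def)
  have split: "(CLINT z|\<mu>. ?k n z) = A n + B n" for n
    unfolding A_def B_def Bochner_Integration.integral_add[OF iA iB, symmetric]
    by (rule Bochner_Integration.integral_cong) (auto simp: indicator_def)
  have A: "(\<lambda>n. real n * A n) \<longlonglongrightarrow> levy_exponent t"
  proof -
    have "real n * A n = (CLINT x|(lborel \<Otimes>\<^sub>M lborel). (real n * layer_weight (d n) (fst x) (snd x)) *\<^sub>R
      iexp2 (t \<bullet> (complex_of_real (d n) * (recip_gap (layer_point (d n) (fst x) (snd x)) - 1))))" for n
      unfolding A_def by (subst integral_stretched[OF _ d(1)[of n]], simp, subst integral_mult_right_zero[symmetric]) (simp add: scaleR_conv_of_real mult.assoc)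
    then show ?thesis using st_limit(1)[OF d] by simp
  qed
  have B: "(\<lambda>n. real n * B n) \<longlonglongrightarrow> 0"
  proof (rule Lim_null_comparison)
    let ?D = "(norm t * (1 + 1 / \<epsilon>))\<^sup>2"
    show "\<forall>\<^sub>F n in sequentially. norm (real n * B n) \<le> ?D * d n powr (2 - p)"
      using eventually_ge_at_top[of 1]
    proof eventually_elim
      case (elim n)
      have "norm (B n) \<le> (LINT z|\<mu>. ?D * (d n)\<^sup>2)"
        unfolding B_def
      proof (rule norm_integral_le)
        fix z
        show "norm (indicator {..<1-\<epsilon>} (norm z) *\<^sub>R ?k n z) \<le> ?D * (d n)\<^sup>2"
        proof (cases "norm z < 1 - \<epsilon>")
          case True
          then have e: "\<epsilon> \<le> norm (1 - z)" using norm_triangle_ineq2[of 1 z] by simp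
          then have "norm (recip_gap z) \<le> 1 / \<epsilon>" using eps by (auto simp: recip_gap_def norm_divide intro!: frac_le)
          then have "norm (recip_gap z - 1) \<le> 1 + 1 / \<epsilon>" using norm_triangle_ineq4[of "recip_gap z" 1] by simp
          then have "norm (complex_of_real (d n) * (recip_gap z - 1)) \<le> d n * (1 + 1 / \<epsilon>)"
            using d(1)[of n] by (simp only: norm_mult norm_of_real) (simp add: mult_left_mono)
          then have "norm t * norm (complex_of_real (d n) * (recip_gap z - 1)) \<le> norm t * (d n * (1 + 1 / \<epsilon>))" by (intro mult_left_mono) auto
          then have b: "\<bar>t \<bullet> (complex_of_real (d n) * (recip_gap z - 1))\<bar> \<le> norm t * (1 + 1 / \<epsilon>) * d n"
            using Cauchy_Schwarz_ineq2[of t "complex_of_real (d n) * (recip_gap z - 1)"] by (simp add: mult_ac)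
          have "norm (?k n z) \<le> (t \<bullet> (complex_of_real (d n) * (recip_gap z - 1)))\<^sup>2 / 2" by (rule norm_iexp2_le)
          also have "\<dots> \<le> \<bar>t \<bullet> (complex_of_real (d n) * (recip_gap z - 1))\<bar>\<^sup>2" by simp
          also have "\<dots> \<le> (norm t * (1 + 1 / \<epsilon>) * d n)\<^sup>2" using b by (intro power_mono) auto
          also have "\<dots> = ?D * (d n)\<^sup>2" by (rule power_mult_distrib)
          finally show ?thesis using True by simp
        qed simp
      qed auto
      then have "norm (B n) \<le> ?D * (d n)\<^sup>2" by (simp add: prob_space)
      then have "norm (real n * B n) \<le> real n * (?D * (d n)\<^sup>2)" by (simp add: norm_mult mult_left_mono)
      also have "\<dots> = ?D * (real n * d n powr p) * d n powr (2 - p)"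
        using d(1)[of n] by (simp add: powr_diff)
      also have "real n * d n powr p = 1" using d(3) elim by simp
      finally show ?case by simp
    qed
    have "(\<lambda>n. d n powr (2 - p)) \<longlonglongrightarrow> 0 powr (2 - p)"
      using p d(1) by (intro tendsto_powr'[OF d(2) tendsto_const]) (auto intro!: always_eventually less_imp_le)
    then show "(\<lambda>n. ?D * d n powr (2 - p)) \<longlonglongrightarrow> 0"
      using tendsto_mult[OF tendsto_const[of ?D]] by fastforce
  qed
  show ?thesis using tendsto_add[OF A B] unfolding split by (simp add: distrib_left)
qed

text \<open>Origin of the spectral density. For fixed v the s-integral is \<open>levy_int\<close> at
  cos v (t . cis v); scaling releases (cos v)^p, and the Jacobian 1 / (cos v)^2 leaves (cos
  v)^\<alpha> because p - 2 = \<alpha>.\<close>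

lemma levy_exponent_eq:
  "levy_exponent t = (CLINT v|lborel. complex_of_real (L / (2 * pi) * (cos v powr \<alpha> * indicator {-(pi/2)<..<pi/2} v)) * levy_int p (t \<bullet> cis v))"
proof -
  \<comment> \<open>A concrete scaling sequence, introduced only to read off from
    \<open>st_limit\<close> the integrability that Fubini needs.\<close>
  define d where "d n = (if n = 0 then 1 else real n powr (- 1 / p))" for n
  have d1: "0 < d n" for n by (simp add: d_def)
  have d2: "d \<longlonglongrightarrow> 0"
  proof (rule Lim_transform_eventually)
    show "(\<lambda>n. real n powr (- 1 / p)) \<longlonglongrightarrow> 0"
      using p by (intro tendsto_neg_powr filterlim_real_sequentially) auto
    show "\<forall>\<^sub>F n in sequentially. real n powr (- 1 / p) = d n"
      using eventually_gt_at_top[of 0] by eventually_elim (simp add: d_def)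
  qed
  have d3: "real n * d n powr p = 1" if "1 \<le> n" for n
  proof -
    have "(real n powr (- 1 / p)) powr p = real n powr (- 1 / p * p)" by (rule powr_powr)
    also have "- 1 / p * p = - 1" using p by simp
    finally show ?thesis using that by (simp add: d_def powr_minus_divide)
  qed
  have int: "integrable (lborel \<Otimes>\<^sub>M lborel) (\<lambda>(s, v). lim_weight s v *\<^sub>R iexp2 (cos v * (t \<bullet> cis v) / s))"
    using st_limit(2)[OF d1 d2 d3] by (simp add: case_prod_unfold)
  have "levy_exponent t = (CLINT v|lborel. (CLINT s|lborel. lim_weight s v *\<^sub>R iexp2 (cos v * (t \<bullet> cis v) / s)))"
    unfolding levy_exponent_def using lborel_pair.integral_snd[OF int] by (simp add: case_prod_unfold)
  also have "\<dots> = (CLINT v|lborel. complex_of_real (L / (2 * pi) * (cos v powr \<alpha> * indicator {-(pi/2)<..<pi/2} v)) * levy_int p (t \<bullet> cis v))"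
  proof (rule Bochner_Integration.integral_cong[OF refl])
    fix v :: real
    show "(CLINT s|lborel. lim_weight s v *\<^sub>R iexp2 (cos v * (t \<bullet> cis v) / s)) =
       complex_of_real (L / (2 * pi) * (cos v powr \<alpha> * indicator {-(pi/2)<..<pi/2} v)) * levy_int p (t \<bullet> cis v)"
    proof (cases "v \<in> {-(pi/2)<..<pi/2}")
      case True
      then have cv: "0 < cos v" by (auto intro: cos_gt_zero_pi)
      have "(\<lambda>s. lim_weight s v *\<^sub>R iexp2 (cos v * (t \<bullet> cis v) / s)) = (\<lambda>s. complex_of_real (L / (2 * pi) * (1 / (cos v)\<^sup>2)) *
          (complex_of_real (s powr (p - 1) * indicator {0<..} s) * iexp2 (cos v * (t \<bullet> cis v) / s)))"
        using True by (auto simp: fun_eq_iff lim_weight_def p_def scaleR_conv_of_real add.commute)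
      then have "(CLINT s|lborel. lim_weight s v *\<^sub>R iexp2 (cos v * (t \<bullet> cis v) / s)) = 
         complex_of_real (L / (2 * pi) * (1 / (cos v)\<^sup>2)) * levy_int p (cos v * (t \<bullet> cis v))"
        by (simp only: integral_mult_right_zero levy_int_def)
      also have "levy_int p (cos v * (t \<bullet> cis v)) = complex_of_real (cos v powr p) * levy_int p (t \<bullet> cis v)"
        by (rule levy_int_scale[OF cv])
      also have "complex_of_real (L / (2 * pi) * (1 / (cos v)\<^sup>2)) * (complex_of_real (cos v powr p) * levy_int p (t \<bullet> cis v)) =
         complex_of_real (L / (2 * pi) * (cos v powr p / (cos v)\<^sup>2)) * levy_int p (t \<bullet> cis v)" by simp
      also have "cos v powr p / (cos v)\<^sup>2 = cos v powr \<alpha>" using cv by (simp add: p_def powr_add)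
      finally show ?thesis using True by simp
    qed (simp add: lim_weight_def)
  qed
  finally show ?thesis .
qed

definition "spectral_const = - (L / (2 * pi) * Re (levy_int p 1))"

lemma spectral_const_pos: "0 < spectral_const"
proof -
  have "0 < L / (2 * pi)" using ratio_limit_ge cC by simp
  then have "L / (2 * pi) * Re (levy_int p 1) < 0" using Re_levy_int_neg[OF p(1,2)] by (rule mult_pos_neg)
  then show ?thesis unfolding spectral_const_def by linarith
qed

lemma levy_int_eq:
  "levy_int p x = complex_of_real (Re (levy_int p 1)) * (complex_of_real (\<bar>x\<bar> powr p) * (1 - \<i> * complex_of_real (sgn x * tan (pi * p / 2))))"
proof -
  consider "x = 0" | "0 < x" | "x < 0" by linarith
  then show ?thesis
  proof cases
    case 1
    then show ?thesis by (simp add: levy_int_0)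
  next
    case 2
    then show ?thesis using levy_int_scale[of x p 1] levy_int_1[OF p(1,2)] by (simp add: mult_ac)
  next
    case 3
    then have "levy_int p x = complex_of_real ((-x) powr p) * levy_int p (-1)"
      using levy_int_scale[of "-x" p "-1"] by simp
    also have "levy_int p (-1) = cnj (complex_of_real (Re (levy_int p 1)) * (1 - \<i> * complex_of_real (tan (pi * p / 2))))"
      using levy_int_minus[of p 1] levy_int_1[OF p(1,2)] by simp
    finally show ?thesis using 3 by (simp add: mult_ac)
  qed
qed

lemma levy_exponent_spectral:
  "levy_exponent t = - (CLINT v|lborel. (spectral_const * (cos v powr \<alpha> * indicator {-(pi/2)<..<pi/2} v)) *\<^sub>R
     (complex_of_real (\<bar>t \<bullet> cis v\<bar> powr p) * (1 - \<i> * complex_of_real (sgn (t \<bullet> cis v) * tan (pi * p / 2)))))"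
  unfolding levy_exponent_eq Bochner_Integration.integral_minus[symmetric]
  by (rule Bochner_Integration.integral_cong) (auto simp: levy_int_eq[of "t \<bullet> cis _"] spectral_const_def scaleR_conv_of_real)
end

section \<open>The spectral measure and convergence of the sums\<close>

text \<open>Compare with w n = exp (A / n), whose n-th power is exactly exp A. Both numbers lie in
  the closed unit disc, by Re A \<le> 0 for w, so the n-th powers differ by at most n |z n - w
  n|.\<close>

lemma power_tendsto_exp:
  fixes z :: "nat \<Rightarrow> complex"
  assumes z: "\<And>n. norm (z n) \<le> 1" and lim: "(\<lambda>n. of_nat n * (z n - 1)) \<longlonglongrightarrow> A" and A: "Re A \<le> 0"
  shows "(\<lambda>n. z n ^ n) \<longlonglongrightarrow> exp A"
proof -
  define w where "w n = exp (A / of_nat n)" for n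
  have w1: "norm (w n) \<le> 1" for n
    using A by (simp add: w_def Re_divide_of_nat divide_nonpos_nonneg)
  have wn: "w n ^ n = exp A" if "0 < n" for n
    using that by (simp add: w_def exp_of_nat_mult[symmetric])
  have "((\<lambda>u. exp (A * u)) has_field_derivative exp (A * 0) * A) (at 0)"
    by (auto intro!: derivative_eq_intros)
  then have D: "((\<lambda>h. (exp (A * h) - 1) / h) \<longlongrightarrow> A) (at 0)" by (simp add: DERIV_def)
  have "(\<lambda>n. complex_of_real (1 / real (Suc n))) \<longlonglongrightarrow> complex_of_real 0"
    by (intro tendsto_of_real) real_asymp
  then have fl: "filterlim (\<lambda>n. complex_of_real (1 / real (Suc n))) (at 0) sequentially"
    by (intro filterlim_atI) (auto intro!: always_eventually simp del: of_nat_Suc)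
  have "(\<lambda>n. (exp (A * complex_of_real (1 / real (Suc n))) - 1) / complex_of_real (1 / real (Suc n))) \<longlonglongrightarrow> A"
    by (rule filterlim_compose[OF D fl])
  then have w2: "(\<lambda>n. of_nat (Suc n) * (w (Suc n) - 1)) \<longlonglongrightarrow> A"
    by (simp add: w_def mult.commute divide_inverse)
  have "(\<lambda>n. of_nat (Suc n) * (z (Suc n) - 1) - of_nat (Suc n) * (w (Suc n) - 1)) \<longlonglongrightarrow> A - A"
    by (intro tendsto_diff w2 LIMSEQ_Suc[OF lim])
  then have 0: "(\<lambda>n. norm (of_nat (Suc n) * (z (Suc n) - 1) - of_nat (Suc n) * (w (Suc n) - 1))) \<longlonglongrightarrow> 0"
    using tendsto_norm_zero by fastforce
  have "(\<lambda>n. z (Suc n) ^ Suc n - exp A) \<longlonglongrightarrow> 0"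
  proof (rule Lim_null_comparison[OF always_eventually 0], rule allI)
    fix n
    have "norm (z (Suc n) ^ Suc n - w (Suc n) ^ Suc n) \<le> real (Suc n) * norm (z (Suc n) - w (Suc n))"
      by (rule norm_power_diff[OF z w1])
    also have "\<dots> = norm (of_nat (Suc n) * (z (Suc n) - w (Suc n)))" by (simp only: norm_mult norm_of_nat)
    also have "of_nat (Suc n) * (z (Suc n) - w (Suc n)) = of_nat (Suc n) * (z (Suc n) - 1) - of_nat (Suc n) * (w (Suc n) - 1)"
      by (simp add: algebra_simps)
    finally show "norm (z (Suc n) ^ Suc n - exp A) \<le> norm (of_nat (Suc n) * (z (Suc n) - 1) - of_nat (Suc n) * (w (Suc n) - 1))"
      using wn[of "Suc n"] by simp
  qed
  then have "(\<lambda>n. z (Suc n) ^ Suc n) \<longlonglongrightarrow> exp A" by (simp add: LIM_zero_iff)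
  then show ?thesis by (rule LIMSEQ_imp_Suc)
qed

lemma integrable_exp_neg_abs:
  assumes "0 < (k::real)"
  shows "integrable lborel (\<lambda>x. exp (- k * \<bar>x\<bar>))"
proof -
  have "integrable lborel (\<lambda>x::real. exp (- k * x) * indicator {0..} x)"
  proof (rule integrableI_bounded)
    have "(\<integral>\<^sup>+x. ennreal (norm (exp (- k * x) * indicator {0..} x)) \<partial>lborel) = (\<integral>\<^sup>+x. ennreal (exp (- k * x)) * indicator {0..} x \<partial>lborel)"
      by (intro nn_integral_cong) (auto simp: indicator_def)
    also have "\<dots> = ennreal (exp (- k * 0) / k)"
      by (rule nn_integral_has_integral_lebesgue') (use has_integral_exp_minus_to_infinity[OF assms, of 0] in auto)
    finally show "(\<integral>\<^sup>+x. ennreal (norm (exp (- k * x) * indicator {0..} x)) \<partial>lborel) < \<infinity>" by simp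
  qed simp
  note i = this
  have i2: "integrable lborel (\<lambda>x::real. exp (- k * (0 + (-1) * x)) * indicator {0..} (0 + (-1) * x))"
    by (rule lborel_integrable_real_affine[OF i]) simp
  show ?thesis
    by (rule Bochner_Integration.integrable_bound[OF Bochner_Integration.integrable_add[OF i i2]])
      (auto simp: indicator_def intro!: AE_I2)
qed

context radial_limit
begin

definition "angle_weight v = spectral_const * (cos v powr \<alpha> * indicator {-(pi/2)<..<pi/2} v)"

lemma angle_weight_measurable [measurable]: "angle_weight \<in> borel_measurable borel"
  unfolding angle_weight_def by measurable

lemma angle_weight_nonneg: "0 \<le> angle_weight v"
  using spectral_const_pos by (simp add: angle_weight_def)

lemma integrable_angle_weight: "integrable lborel angle_weight"
  unfolding angle_weight_def using alpha by (intro integrable_mult_right integrable_cos_powr) auto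

definition stable_kernel :: "complex \<Rightarrow> complex \<Rightarrow> complex" where
  "stable_kernel s t = complex_of_real (\<bar>t \<bullet> s\<bar> powr p) * (1 - \<i> * complex_of_real (sgn (t \<bullet> s) * tan (pi * p / 2)))"

lemma stable_kernel_measurable [measurable]:
  "(\<lambda>x. stable_kernel (fst x) (snd x)) \<in> borel_measurable (borel \<Otimes>\<^sub>M borel)"
  unfolding stable_kernel_def by measurable

lemma levy_exponent_kernel: "levy_exponent t = - (CLINT v|lborel. angle_weight v *\<^sub>R stable_kernel (cis v) t)"
  unfolding levy_exponent_spectral angle_weight_def stable_kernel_def ..

lemma inner_cis_le: "\<bar>t \<bullet> cis v\<bar> \<le> norm t"
  using Cauchy_Schwarz_ineq2[of t "cis v"] by simp

lemma norm_stable_kernel_le: "norm (stable_kernel (cis v) t) \<le> (1 + \<bar>tan (pi * p / 2)\<bar>) * norm t powr p"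
proof -
  have "norm (1 - \<i> * complex_of_real (sgn (t \<bullet> cis v) * tan (pi * p / 2))) \<le> norm (1::complex) + norm (\<i> * complex_of_real (sgn (t \<bullet> cis v) * tan (pi * p / 2)))"
    by (rule norm_triangle_ineq4)
  also have "\<dots> \<le> 1 + \<bar>tan (pi * p / 2)\<bar>" by (simp add: norm_mult abs_mult abs_sgn_eq)
  finally have 1: "norm (1 - \<i> * complex_of_real (sgn (t \<bullet> cis v) * tan (pi * p / 2))) \<le> 1 + \<bar>tan (pi * p / 2)\<bar>" .
  have 2: "\<bar>t \<bullet> cis v\<bar> powr p \<le> norm t powr p"
    using inner_cis_le[of t v] p by (intro powr_mono2) auto
  have "norm (stable_kernel (cis v) t) = norm (1 - \<i> * complex_of_real (sgn (t \<bullet> cis v) * tan (pi * p / 2))) * \<bar>t \<bullet> cis v\<bar> powr p"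
    unfolding stable_kernel_def norm_mult norm_of_real by simp
  also have "\<dots> \<le> (1 + \<bar>tan (pi * p / 2)\<bar>) * norm t powr p"
    by (rule mult_mono[OF 1 2]) auto
  finally show ?thesis .
qed

lemma integrable_kernel: "integrable lborel (\<lambda>v. angle_weight v *\<^sub>R stable_kernel (cis v) t)"
proof (rule Bochner_Integration.integrable_bound[OF integrable_mult_left[OF integrable_angle_weight, of "(1 + \<bar>tan (pi * p / 2)\<bar>) * norm t powr p"]])
  show "(\<lambda>v. angle_weight v *\<^sub>R stable_kernel (cis v) t) \<in> borel_measurable lborel"
    unfolding stable_kernel_def by measurable
  show "AE v in lborel. norm (angle_weight v *\<^sub>R stable_kernel (cis v) t) \<le> norm (angle_weight v * ((1 + \<bar>tan (pi * p / 2)\<bar>) * norm t powr p))"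
    using norm_stable_kernel_le angle_weight_nonneg by (intro AE_I2) (auto simp: abs_mult intro!: mult_left_mono)
qed

lemma norm_levy_exponent_le: "norm (levy_exponent t) \<le> (1 + \<bar>tan (pi * p / 2)\<bar>) * integral\<^sup>L lborel angle_weight * norm t powr p"
proof -
  have "norm (levy_exponent t) \<le> (LINT v|lborel. angle_weight v * ((1 + \<bar>tan (pi * p / 2)\<bar>) * norm t powr p))"
    unfolding levy_exponent_kernel norm_minus_cancel
    by (rule norm_integral_le)
      (use integrable_kernel[of t] integrable_angle_weight norm_stable_kernel_le[of _ t] angle_weight_nonneg in \<open>auto intro!: mult_left_mono\<close>)
  then show ?thesis by (simp add: mult_ac)
qed

lemma isCont_exp_levy_exponent: "isCont (\<lambda>t. exp (levy_exponent t)) 0"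
proof -
  have n0: "((\<lambda>t. norm t) \<longlongrightarrow> 0) (at (0::complex))"
    by (rule tendsto_norm_zero) (rule tendsto_ident_at)
  have "((\<lambda>t. (1 + \<bar>tan (pi * p / 2)\<bar>) * integral\<^sup>L lborel angle_weight * norm t powr p) \<longlongrightarrow>
     (1 + \<bar>tan (pi * p / 2)\<bar>) * integral\<^sup>L lborel angle_weight * 0 powr p) (at (0::complex))"
    using p by (intro tendsto_mult tendsto_const tendsto_powr' n0) auto
  then have "((\<lambda>t. (1 + \<bar>tan (pi * p / 2)\<bar>) * integral\<^sup>L lborel angle_weight * norm t powr p) \<longlongrightarrow> 0) (at (0::complex))"
    using p by simp
  then have "(levy_exponent \<longlongrightarrow> 0) (at 0)"
    by (rule Lim_null_comparison[rotated]) (intro always_eventually allI norm_levy_exponent_le)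
  moreover have "levy_exponent 0 = 0"
    using norm_levy_exponent_le[of 0] p by simp
  ultimately have "isCont levy_exponent 0" by (simp add: isCont_def)
  then show ?thesis by (intro isCont_o2[OF _ isCont_exp]) auto
qed

lemma levy_exponent_0: "levy_exponent 0 = 0"
  using norm_levy_exponent_le[of 0] p by simp

lemma levy_exponent_measurable [measurable]: "levy_exponent \<in> borel_measurable borel"
  unfolding levy_exponent_kernel[abs_def] stable_kernel_def by measurable

text \<open>The value does not depend on the phase because the interval has length pi, a period of
  the squared cosine.\<close>

lemma integral_cos_squared: "integrable lborel (\<lambda>v. (cos (v - \<phi>))\<^sup>2 * indicator {-(pi/2)..pi/2} v)"
  "(LINT v|lborel. (cos (v - \<phi>))\<^sup>2 * indicator {-(pi/2)..pi/2} v) = pi / 2"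
proof -
  define F where "F v = v / 2 + sin (2 * (v - \<phi>)) / 4" for v
  have "has_bochner_integral lborel (\<lambda>v. (cos (v - \<phi>))\<^sup>2 * indicator {-(pi/2)..pi/2} v) (F (pi/2) - F (-(pi/2)))"
  proof (rule has_bochner_integral_FTC_Icc_real)
    fix x
    have "(F has_real_derivative 1 / 2 + cos (2 * (x - \<phi>)) * 2 / 4) (at x)"
      unfolding F_def by (auto intro!: derivative_eq_intros)
    moreover have "1 / 2 + cos (2 * (x - \<phi>)) * 2 / 4 = (cos (x - \<phi>))\<^sup>2"
      unfolding cos_double_cos by (simp add: field_simps)
    ultimately show "(F has_real_derivative (cos (x - \<phi>))\<^sup>2) (at x)" by simp
    show "isCont (\<lambda>v. (cos (v - \<phi>))\<^sup>2) x" by (intro continuous_intros)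
  qed auto
  moreover have "F (pi/2) - F (-(pi/2)) = pi / 2"
  proof -
    have "2 * (pi/2 - \<phi>) = pi - 2 * \<phi>" "2 * (-(pi/2) - \<phi>) = - (2 * \<phi> + pi)"
      by (simp_all add: algebra_simps)
    moreover have "sin (pi - 2 * \<phi>) = sin (2 * \<phi>)" by simp
    moreover have "sin (- (2 * \<phi> + pi)) = sin (2 * \<phi>)" by (simp only: sin_minus sin_periodic_pi minus_minus)
    ultimately have "sin (2 * (pi/2 - \<phi>)) = sin (2 * \<phi>)" "sin (2 * (-(pi/2) - \<phi>)) = sin (2 * \<phi>)" by metis+
    then show ?thesis unfolding F_def by (simp only:)
  qed
  ultimately show "integrable lborel (\<lambda>v. (cos (v - \<phi>))\<^sup>2 * indicator {-(pi/2)..pi/2} v)"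
    "(LINT v|lborel. (cos (v - \<phi>))\<^sup>2 * indicator {-(pi/2)..pi/2} v) = pi / 2"
    by (auto simp: has_bochner_integral_iff)
qed

text \<open>Nondegeneracy of the limit. For t with argument \<phi> the inner product is |t| cos (v -
  \<phi>); since (cos v)^\<alpha> \<ge> 1 and |cos|^p \<ge> cos^2, the integral is at least that of
  the squared cosine over a half circle, for every direction of t.\<close>

lemma Re_levy_exponent_le: "Re (levy_exponent t) \<le> - (spectral_const * (pi / 2) * norm t powr p)"
proof -
  have "Re (levy_exponent t) = - (LINT v|lborel. angle_weight v * \<bar>t \<bullet> cis v\<bar> powr p)"
    unfolding levy_exponent_kernel using integral_Re[OF integrable_kernel[of t]] by (simp add: stable_kernel_def)
  moreover have "spectral_const * (pi / 2) * norm t powr p \<le> (LINT v|lborel. angle_weight v * \<bar>t \<bullet> cis v\<bar> powr p)"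
  proof -
    define \<phi> where "\<phi> = Arg t"
    have t: "t = complex_of_real (norm t) * cis \<phi>" unfolding \<phi>_def
      by (metis cis_conv_exp Arg_eq mult_zero_left norm_zero of_real_0)
    have "t \<bullet> cis v = norm t * cos (v - \<phi>)" for v
      by (subst t) (simp add: inner_complex_def cos_diff algebra_simps)
    then have in_eq: "\<bar>t \<bullet> cis v\<bar> powr p = norm t powr p * \<bar>cos (v - \<phi>)\<bar> powr p" for v
      by (simp add: abs_mult powr_mult)
    have "spectral_const * (pi / 2) * norm t powr p = (LINT v|lborel. spectral_const * norm t powr p * ((cos (v - \<phi>))\<^sup>2 * indicator {-(pi/2)..pi/2} v))"
      by (simp add: integral_cos_squared)
    also have "\<dots> \<le> (LINT v|lborel. angle_weight v * \<bar>t \<bullet> cis v\<bar> powr p)"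
    proof (rule integral_mono_AE)
      show "integrable lborel (\<lambda>v. spectral_const * norm t powr p * ((cos (v - \<phi>))\<^sup>2 * indicator {-(pi/2)..pi/2} v))"
        by (intro integrable_mult_right integral_cos_squared)
      show "integrable lborel (\<lambda>v. angle_weight v * \<bar>t \<bullet> cis v\<bar> powr p)"
        using integrable_Re[OF integrable_kernel[of t]] by (simp add: stable_kernel_def)
      have "AE v in lborel. v \<noteq> pi/2" "AE v in lborel. v \<noteq> -(pi/2)" by (rule AE_lborel_singleton)+
      then show "AE v in lborel. spectral_const * norm t powr p * ((cos (v - \<phi>))\<^sup>2 * indicator {-(pi/2)..pi/2} v) \<le> angle_weight v * \<bar>t \<bullet> cis v\<bar> powr p"
      proof eventually_elim
        case (elim v)
        show ?case
        proof (cases "v \<in> {-(pi/2)<..<pi/2}")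
          case True
          then have cv: "0 < cos v" "cos v \<le> 1" by (auto intro: cos_gt_zero_pi)
          have "1 powr \<alpha> \<le> cos v powr \<alpha>" using cv alpha by (intro powr_mono2') auto
          then have a: "1 \<le> cos v powr \<alpha>" by simp
          have "(cos (v - \<phi>))\<^sup>2 = \<bar>cos (v - \<phi>)\<bar> powr 2" by simp
          also have "\<dots> \<le> \<bar>cos (v - \<phi>)\<bar> powr p" using p by (intro powr_mono') auto
          finally have b: "(cos (v - \<phi>))\<^sup>2 \<le> cos v powr \<alpha> * \<bar>cos (v - \<phi>)\<bar> powr p"
            using mult_right_mono[OF a, of "\<bar>cos (v - \<phi>)\<bar> powr p"] by simp
          have "spectral_const * norm t powr p * (cos (v - \<phi>))\<^sup>2 \<le> spectral_const * norm t powr p * (cos v powr \<alpha> * \<bar>cos (v - \<phi>)\<bar> powr p)"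
            using b spectral_const_pos by (intro mult_left_mono) auto
          then show ?thesis using True by (simp add: angle_weight_def in_eq mult_ac)
        next
          case False
          then show ?thesis using elim by (auto simp: angle_weight_def indicator_def)
        qed
      qed
    qed
    finally show ?thesis .
  qed
  ultimately show ?thesis by linarith
qed

lemma Re_levy_exponent_nonpos: "Re (levy_exponent t) \<le> 0"
  by (rule order_trans[OF Re_levy_exponent_le]) (use spectral_const_pos in auto)

text \<open>The decay rate in |t|^p is weakened to one in |Re t| + |Im t|, which factors. Since |Re
  t| + |Im t| \<le> 2 |t| \<le> 2 (|t|^p + 1), half of the constant remains and a factor exp (2 k)
  is lost.\<close>

lemma integrable_exp_levy_exponent: "integrable lborel (\<lambda>t. exp (levy_exponent t))"
proof -
  define k where "k = spectral_const * (pi / 2) / 2"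
  have k: "0 < k" using spectral_const_pos by (simp add: k_def)
  let ?b = "\<lambda>z. exp (2 * k) * (exp (- k * \<bar>Re z\<bar>) * exp (- k * \<bar>Im z\<bar>))"
  have "integrable (lborel \<Otimes>\<^sub>M lborel) (\<lambda>z. exp (2 * k) * (exp (- k * \<bar>fst z\<bar>) * exp (- k * \<bar>snd z\<bar>)))"
    by (intro integrable_mult_right lborel_pair.product_integral(1) integrable_exp_neg_abs k)
  then have "integrable lborel ?b"
    by (subst integral_lborel_complex) (auto simp: case_prod_unfold)
  then show ?thesis
  proof (rule Bochner_Integration.integrable_bound)
    show "AE t in lborel. norm (exp (levy_exponent t)) \<le> norm (?b t)"
    proof (rule AE_I2)
      fix t
      have "\<bar>Re t\<bar> + \<bar>Im t\<bar> \<le> 2 * norm t" using abs_Re_le_cmod[of t] abs_Im_le_cmod[of t] by linarith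
      moreover have "norm t - 1 \<le> norm t powr p"
      proof (cases "norm t \<le> 1")
        case False
        then have "norm t powr 1 \<le> norm t powr p" using p by (intro powr_mono) auto
        then show ?thesis using False by simp
      qed (simp add: add_increasing2 powr_ge_zero order_trans[of _ 0])
      ultimately have "\<bar>Re t\<bar> + \<bar>Im t\<bar> - 2 \<le> 2 * norm t powr p" by linarith
      then have "k * (\<bar>Re t\<bar> + \<bar>Im t\<bar> - 2) \<le> k * (2 * norm t powr p)" using k by (intro mult_left_mono) auto
      moreover have "k * (\<bar>Re t\<bar> + \<bar>Im t\<bar> - 2) = k * \<bar>Re t\<bar> + k * \<bar>Im t\<bar> - 2 * k" by (simp add: algebra_simps)
      moreover have "Re (levy_exponent t) \<le> - (k * (2 * norm t powr p))"
        using Re_levy_exponent_le[of t] unfolding k_def by (simp add: mult_ac)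
      ultimately have "Re (levy_exponent t) \<le> 2 * k + (- k * \<bar>Re t\<bar> + - k * \<bar>Im t\<bar>)" by simp
      then have "exp (Re (levy_exponent t)) \<le> exp (2 * k + (- k * \<bar>Re t\<bar> + - k * \<bar>Im t\<bar>))" by simp
      also have "\<dots> = ?b t" by (simp only: exp_add)
      finally show "norm (exp (levy_exponent t)) \<le> norm (?b t)" by simp
    qed
  qed simp
qed

section \<open>The spectral measure of the limit law\<close>

definition "spectral_measure =
  distr (density lborel (\<lambda>v. ennreal (angle_weight v))) (restrict_space borel (sphere 0 1)) cis"

lemma cis_measurable_sphere [measurable]: "cis \<in> measurable borel (restrict_space borel (sphere 0 1))"
  by (rule measurable_restrict_space2) auto

lemma sets_spectral_measure: "sets spectral_measure = sets (restrict_space borel (sphere 0 1))"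
  by (simp add: spectral_measure_def)

lemma finite_spectral_measure: "finite_measure spectral_measure"
proof -
  have "finite_measure (density lborel (\<lambda>v. ennreal (angle_weight v)))"
    by (rule finite_measureI) (use integrable_angle_weight angle_weight_nonneg in \<open>simp add: emeasure_density nn_integral_eq_integral\<close>)
  then show ?thesis unfolding spectral_measure_def by (rule finite_measure.finite_measure_distr) simp
qed

lemma integral_spectral_measure:
  "(CLINT s|spectral_measure. stable_kernel s t) = (CLINT v|lborel. angle_weight v *\<^sub>R stable_kernel (cis v) t)"
proof -
  have [measurable]: "(\<lambda>s. stable_kernel s t) \<in> borel_measurable borel" unfolding stable_kernel_def by measurable
  have "(CLINT s|spectral_measure. stable_kernel s t) = (CLINT v|density lborel (\<lambda>v. ennreal (angle_weight v)). stable_kernel (cis v) t)"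
    unfolding spectral_measure_def by (rule integral_distr) (auto intro: measurable_restrict_space1)
  also have "\<dots> = (CLINT v|lborel. angle_weight v *\<^sub>R stable_kernel (cis v) t)"
    using angle_weight_nonneg by (intro integral_density) auto
  finally show ?thesis .
qed

lemma stable_law_levy_exponent:
  assumes "prob_space H" "sets H = sets borel" "\<And>t. char_vec H t = exp (levy_exponent t)"
  shows "stable_law (2 + \<alpha>) spectral_measure H"
proof -
  \<comment> \<open>The shift b is 0, because the summands are centred at their exact mean.\<close>
  have "char_vec H t = exp (- (CLINT s|spectral_measure. complex_of_real (\<bar>t \<bullet> s\<bar> powr (2 + \<alpha>)) *
      (1 - \<i> * complex_of_real (sgn (t \<bullet> s) * tan (pi * (2 + \<alpha>) / 2)))) + \<i> * complex_of_real (t \<bullet> 0))" for t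
    using integral_spectral_measure[of t] unfolding assms levy_exponent_kernel stable_kernel_def p_def by simp
  then show ?thesis
    unfolding stable_law_def using assms sets_spectral_measure finite_spectral_measure p unfolding p_def by blast
qed

lemma measure_spectral_measure:
  assumes D: "D \<in> sets borel" "D \<subseteq> sphere 0 1"
  shows "measure spectral_measure D = spectral_const * (LINT \<theta>:{- pi / 2..pi / 2}|lborel. cos \<theta> powr \<alpha>) * cos_arg_prob \<alpha> D"
proof -
  \<comment> \<open>On the open interval the principal argument inverts \<open>cis\<close>, since
    points of D have modulus 1.\<close>
  have DA: "Arg ` D \<inter> {- pi / 2<..<pi / 2} = {v \<in> {-(pi/2)<..<pi/2}. cis v \<in> D}"
  proof (intro set_eqI iffI)
    fix v assume "v \<in> Arg ` D \<inter> {- pi / 2<..<pi / 2}"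
    then obtain z where z: "z \<in> D" "v = Arg z" "v \<in> {-(pi/2)<..<pi/2}" by auto
    then have "norm z = 1" using D by auto
    then have "cis (Arg z) = z" by (metis cis_conv_exp Arg_eq mult_1 norm_zero of_real_1 zero_neq_one)
    then show "v \<in> {v \<in> {-(pi/2)<..<pi/2}. cis v \<in> D}" using z by simp
  next
    fix v assume v: "v \<in> {v \<in> {-(pi/2)<..<pi/2}. cis v \<in> D}"
    then have "Arg (cis v) = v" by (intro Arg_unique[of 1]) (auto simp: cis_conv_exp)
    then show "v \<in> Arg ` D \<inter> {- pi / 2<..<pi / 2}" using v by (auto intro!: image_eqI[of _ _ "cis v"])
  qed
  have v: "cis -` D \<in> sets borel"
    using measurable_sets[OF borel_measurable_continuous_onI[of cis] D(1)] by (simp add: continuous_on_cis continuous_on_id)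
  \<comment> \<open>Positivity lets the normalising integral cancel the denominator of
    \<open>cos_arg_prob\<close>. It follows from (cos v)^2 \<le> 1 \<le> (cos v)^\<alpha> inside the
    interval.\<close>
  have Z: "0 < (LINT \<theta>:{- pi / 2..pi / 2}|lborel. cos \<theta> powr \<alpha>)"
  proof -
    have eq: "(LINT \<theta>:{- pi / 2..pi / 2}|lborel. cos \<theta> powr \<alpha>) = (LINT \<theta>|lborel. cos \<theta> powr \<alpha> * indicator {-(pi/2)<..<pi/2} \<theta>)"
      unfolding set_lebesgue_integral_def
    proof (rule integral_cong_AE)
      have "AE v in lborel. v \<noteq> pi/2" "AE v in lborel. v \<noteq> -(pi/2)" by (rule AE_lborel_singleton)+
      then show "AE x in lborel. indicator {- pi / 2..pi / 2} x *\<^sub>R cos x powr \<alpha> = cos x powr \<alpha> * indicator {-(pi/2)<..<pi/2} x"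
        by eventually_elim (auto simp: indicator_def)
    qed auto
    have "pi / 2 = (LINT v|lborel. (cos (v - 0))\<^sup>2 * indicator {-(pi/2)..pi/2} v)" by (rule integral_cos_squared(2)[symmetric])
    also have "\<dots> \<le> (LINT \<theta>|lborel. cos \<theta> powr \<alpha> * indicator {-(pi/2)<..<pi/2} \<theta>)"
    proof (rule integral_mono_AE)
      show "integrable lborel (\<lambda>\<theta>. cos \<theta> powr \<alpha> * indicator {-(pi/2)<..<pi/2} \<theta>)"
        using alpha by (intro integrable_cos_powr) auto
      have "AE v in lborel. v \<noteq> pi/2" "AE v in lborel. v \<noteq> -(pi/2)" by (rule AE_lborel_singleton)+
      then show "AE v in lborel. (cos (v - 0))\<^sup>2 * indicator {-(pi/2)..pi/2} v \<le> cos v powr \<alpha> * indicator {-(pi/2)<..<pi/2} v"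
      proof eventually_elim
        case (elim v)
        show ?case
        proof (cases "v \<in> {-(pi/2)<..<pi/2}")
          case True
          then have cv: "0 < cos v" "cos v \<le> 1" by (auto intro: cos_gt_zero_pi)
          have "1 powr \<alpha> \<le> cos v powr \<alpha>" using cv alpha by (intro powr_mono2') auto
          moreover have "(cos v)\<^sup>2 \<le> 1" using cv by (simp add: power_le_one)
          ultimately show ?thesis using True by simp
        qed (use elim in \<open>auto simp: indicator_def\<close>)
      qed
    qed (rule integral_cos_squared)
    finally show ?thesis unfolding eq using pi_gt_zero by linarith
  qed
  have "emeasure spectral_measure D = emeasure (density lborel (\<lambda>v. ennreal (angle_weight v))) (cis -` D)"
    unfolding spectral_measure_def using D by (subst emeasure_distr) (auto simp: sets_restrict_space)
  also have "\<dots> = (\<integral>\<^sup>+v. ennreal (angle_weight v) * indicator (cis -` D) v \<partial>lborel)"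
    by (rule emeasure_density) (use v in auto)
  also have "\<dots> = (\<integral>\<^sup>+v. ennreal (angle_weight v * indicator (cis -` D) v) \<partial>lborel)"
    by (rule nn_integral_cong) (auto simp: indicator_def)
  also have "\<dots> = ennreal (LINT v|lborel. angle_weight v * indicator (cis -` D) v)"
    by (rule nn_integral_eq_integral)
      (use integrable_angle_weight v angle_weight_nonneg in \<open>auto intro!: integrable_real_mult_indicator\<close>)
  finally have "measure spectral_measure D = (LINT v|lborel. angle_weight v * indicator (cis -` D) v)"
    using angle_weight_nonneg by (simp add: measure_def integral_nonneg)
  also have "\<dots> = (LINT v|lborel. spectral_const * (indicator {v \<in> {-(pi/2)<..<pi/2}. cis v \<in> D} v *\<^sub>R cos v powr \<alpha>))"
    by (rule Bochner_Integration.integral_cong) (auto simp: angle_weight_def indicator_def)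
  also have "\<dots> = spectral_const * (LINT \<theta>:(Arg ` D \<inter> {- pi / 2<..<pi / 2})|lborel. cos \<theta> powr \<alpha>)"
    unfolding DA set_lebesgue_integral_def by simp
  finally show ?thesis unfolding cos_arg_prob_def using Z by simp
qed

text \<open>The product is the mass of the whole circle up to the factor
  \<open>cos_arg_prob\<close>. A zero mass would force the exponent at t = 1 to vanish, against the
  lower bound on its modulus.\<close>

lemma spectral_norm_pos: "0 < spectral_const * (LINT \<theta>:{- pi / 2..pi / 2}|lborel. cos \<theta> powr \<alpha>)"
proof -
  interpret finite_measure spectral_measure by (rule finite_spectral_measure)
  have "measure spectral_measure (sphere 0 1) = integral\<^sup>L lborel angle_weight"
  proof -
    have "emeasure spectral_measure (sphere 0 1) = emeasure (density lborel (\<lambda>v. ennreal (angle_weight v))) (cis -` sphere 0 1)"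
      unfolding spectral_measure_def by (subst emeasure_distr) (auto simp: sets_restrict_space)
    also have "cis -` sphere 0 1 = UNIV" by auto
    also have "emeasure (density lborel (\<lambda>v. ennreal (angle_weight v))) UNIV = ennreal (integral\<^sup>L lborel angle_weight)"
      using integrable_angle_weight angle_weight_nonneg by (simp add: emeasure_density nn_integral_eq_integral)
    finally show ?thesis using angle_weight_nonneg by (simp add: measure_def integral_nonneg)
  qed
  moreover have "0 < integral\<^sup>L lborel angle_weight"
  proof -
    have "spectral_const * (pi / 2) * norm (1::complex) powr p \<le> norm (levy_exponent 1)"
      using Re_levy_exponent_le[of 1] abs_Re_le_cmod[of "levy_exponent 1"] by linarith
    also have "\<dots> \<le> (1 + \<bar>tan (pi * p / 2)\<bar>) * integral\<^sup>L lborel angle_weight * norm (1::complex) powr p"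
      by (rule norm_levy_exponent_le)
    finally have "spectral_const * (pi / 2) \<le> (1 + \<bar>tan (pi * p / 2)\<bar>) * integral\<^sup>L lborel angle_weight" by simp
    moreover have "0 < spectral_const * (pi / 2)" using spectral_const_pos by simp
    ultimately have "0 < (1 + \<bar>tan (pi * p / 2)\<bar>) * integral\<^sup>L lborel angle_weight" by linarith
    moreover have "0 < 1 + \<bar>tan (pi * p / 2)\<bar>" by linarith
    ultimately show ?thesis by (rule zero_less_mult_pos)
  qed
  moreover have "0 \<le> (LINT \<theta>:{- pi / 2..pi / 2}|lborel. cos \<theta> powr \<alpha>)"
    unfolding set_lebesgue_integral_def by (rule Bochner_Integration.integral_nonneg) simp
  ultimately have "(LINT \<theta>:{- pi / 2..pi / 2}|lborel. cos \<theta> powr \<alpha>) \<noteq> 0"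
    using measure_spectral_measure[of "sphere 0 1"] by auto
  then show ?thesis using spectral_const_pos \<open>0 \<le> (LINT \<theta>:{- pi / 2..pi / 2}|lborel. cos \<theta> powr \<alpha>)\<close> by simp
qed

text \<open>Since 1 / (1 - X) has mean exactly 1, the linear term integrates to 0, so n times
  (characteristic function of one summand minus 1) is the quantity treated in
  \<open>inner_limit\<close>. Independence turns the sum into an n-th power.\<close>

lemma char_sum_limit:
  fixes X :: "nat \<Rightarrow> 'b \<Rightarrow> complex"
  assumes M: "prob_space M" and ind: "prob_space.indep_vars M (\<lambda>_. borel) X {1..}"
    and law: "\<And>j. 1 \<le> j \<Longrightarrow> distr M borel (X j) = \<mu>"
    and d: "\<And>n. 0 < d n" "d \<longlonglongrightarrow> 0" "\<And>n. 1 \<le> n \<Longrightarrow> real n * d n powr p = 1"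
  shows "(\<lambda>n. CLINT \<omega>|M. iexp (t \<bullet> (complex_of_real (d n) * ((\<Sum>j=1..n. recip_gap (X j \<omega>)) - of_nat n))))
     \<longlonglongrightarrow> exp (levy_exponent t)"
proof -
  interpret M: prob_space M by fact
  define x where "x n z = t \<bullet> (complex_of_real (d n) * (recip_gap z - 1))" for n z
  have [measurable]: "x n \<in> borel_measurable borel" for n unfolding x_def by measurable
  define \<phi> where "\<phi> n = (CLINT z|\<mu>. iexp (x n z))" for n
  have Xm: "X j \<in> borel_measurable M" if "1 \<le> j" for j
    using ind that unfolding M.indep_vars_def by auto
  have xi: "integrable \<mu> (x n)" for n
  proof -
    have "integrable \<mu> (\<lambda>z. complex_of_real (d n) * (recip_gap z - 1))"
      using integrable_recip_gap by (intro integrable_mult_right Bochner_Integration.integrable_diff) auto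
    then show ?thesis unfolding x_def[abs_def] by (rule integrable_inner_right)
  qed
  have x0: "(LINT z|\<mu>. x n z) = 0" for n
  proof -
    have "integrable \<mu> (\<lambda>z. complex_of_real (d n) * (recip_gap z - 1))"
      using integrable_recip_gap by (intro integrable_mult_right Bochner_Integration.integrable_diff) auto
    then have "(LINT z|\<mu>. x n z) = t \<bullet> (CLINT z|\<mu>. complex_of_real (d n) * (recip_gap z - 1))"
      unfolding x_def by (rule integral_inner_right)
    also have "(CLINT z|\<mu>. complex_of_real (d n) * (recip_gap z - 1)) = 0"
      using integrable_recip_gap by (simp add: mean_recip_gap prob_space)
    finally show ?thesis by simp
  qed
  have \<phi>: "of_nat n * (\<phi> n - 1) = real n * (CLINT z|\<mu>. iexp2 (x n z))" for n
  proof -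
    have i1: "integrable \<mu> (\<lambda>z. iexp (x n z))" by (rule integrable_const_bound[of _ 1]) auto
    have "(CLINT z|\<mu>. iexp2 (x n z)) = \<phi> n - 1 - \<i> * complex_of_real (LINT z|\<mu>. x n z)"
      unfolding iexp2_def \<phi>_def using i1 xi[of n] by (simp add: prob_space)
    then show ?thesis by (simp add: x0)
  qed
  have lim: "(\<lambda>n. \<phi> n ^ n) \<longlonglongrightarrow> exp (levy_exponent t)"
  proof (rule power_tendsto_exp)
    show "norm (\<phi> n) \<le> 1" for n
      unfolding \<phi>_def using norm_integral_le[of \<mu> "\<lambda>_. 1" "\<lambda>z. iexp (x n z)"] by (simp add: prob_space)
    show "(\<lambda>n. of_nat n * (\<phi> n - 1)) \<longlonglongrightarrow> levy_exponent t"
      unfolding \<phi> x_def by (rule inner_limit[OF d])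
  qed (rule Re_levy_exponent_nonpos)
  have "(CLINT \<omega>|M. iexp (t \<bullet> (complex_of_real (d n) * ((\<Sum>j=1..n. recip_gap (X j \<omega>)) - of_nat n)))) = \<phi> n ^ n" for n
  proof -
    have e: "iexp (t \<bullet> (complex_of_real (d n) * ((\<Sum>j=1..n. recip_gap (X j \<omega>)) - of_nat n))) = (\<Prod>j=1..n. iexp (x n (X j \<omega>)))" for \<omega>
    proof -
      have "(\<Sum>j=1..n. recip_gap (X j \<omega>)) - of_nat n = (\<Sum>j=1..n. recip_gap (X j \<omega>) - 1)" by (simp add: sum_subtractf)
      then have "t \<bullet> (complex_of_real (d n) * ((\<Sum>j=1..n. recip_gap (X j \<omega>)) - of_nat n)) = (\<Sum>j=1..n. x n (X j \<omega>))"
        by (simp add: x_def sum_distrib_left inner_sum_right)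
      then show ?thesis by (simp add: exp_sum[symmetric] sum_distrib_left)
    qed
    have "M.indep_vars (\<lambda>_. borel) X {1..n}" by (rule M.indep_vars_subset[OF ind]) auto
    then have iv: "M.indep_vars (\<lambda>_. borel) (\<lambda>j \<omega>. iexp (x n (X j \<omega>))) {1..n}"
      by (rule M.indep_vars_compose2) auto
    have "(CLINT \<omega>|M. \<Prod>j=1..n. iexp (x n (X j \<omega>))) = (\<Prod>j=1..n. CLINT \<omega>|M. iexp (x n (X j \<omega>)))"
    proof (rule M.indep_vars_lebesgue_integral[OF _ iv])
      show "integrable M (\<lambda>\<omega>. iexp (x n (X j \<omega>)))" if "j \<in> {1..n}" for j
        using Xm[of j] that by (intro M.integrable_const_bound[of _ 1]) auto
    qed simp
    also have "\<dots> = (\<Prod>j=1..n. \<phi> n)"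
    proof (rule prod.cong[OF refl])
      fix j assume j: "j \<in> {1..n}"
      have "\<phi> n = (CLINT z|distr M borel (X j). iexp (x n z))" unfolding \<phi>_def using law[of j] j by simp
      also have "\<dots> = (CLINT \<omega>|M. iexp (x n (X j \<omega>)))"
        using Xm[of j] j by (subst integral_distr) auto
      finally show "(CLINT \<omega>|M. iexp (x n (X j \<omega>))) = \<phi> n" ..
    qed
    finally show ?thesis unfolding e by simp
  qed
  then show ?thesis using lim by simp
qed
end

section \<open>Critical points near a well separated largest root\<close>

lemma poly_pderiv_prod_roots:
  fixes x :: "nat \<Rightarrow> complex"
  assumes "finite I"
  shows "poly (pderiv (\<Prod>j\<in>I. [:- x j, 1:])) z = (\<Sum>k\<in>I. \<Prod>j\<in>I - {k}. z - x j)"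
  by (simp add: pderiv_prod poly_sum poly_prod pderiv_pCons)

lemma poly_pderiv_prod_roots_eq_0:
  fixes x :: "nat \<Rightarrow> complex"
  assumes I: "finite I" and z: "\<And>j. j \<in> I \<Longrightarrow> z \<noteq> x j"
  shows "poly (pderiv (\<Prod>j\<in>I. [:- x j, 1:])) z = 0 \<longleftrightarrow> (\<Sum>j\<in>I. 1 / (z - x j)) = 0"
proof -
  have "(\<Prod>j\<in>I - {k}. z - x j) = (\<Prod>j\<in>I. z - x j) * (1 / (z - x k))" if "k \<in> I" for k
    using that z[OF that] by (subst prod.remove[OF I that]) simp
  then have "(\<Sum>k\<in>I. \<Prod>j\<in>I - {k}. z - x j) = (\<Prod>j\<in>I. z - x j) * (\<Sum>k\<in>I. 1 / (z - x k))"
    by (simp add: sum_distrib_left)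
  moreover have "(\<Prod>j\<in>I. z - x j) \<noteq> 0" using I z by simp
  ultimately show ?thesis unfolding poly_pderiv_prod_roots[OF I] by simp
qed

text \<open>The identity behind the Gauss-Lucas theorem for discs: a root x with |x| \<le> |z|
  contributes at least 1/2 to the real part of the sum of z / (z - x), and only roots of larger
  modulus can compensate.\<close>

lemma Re_divide_diff:
  assumes "z \<noteq> x"
  shows "Re (z / (z - x)) = 1 / 2 + ((norm z)\<^sup>2 - (norm x)\<^sup>2) / (2 * (norm (z - x))\<^sup>2)"
proof -
  have n: "(norm (z - x))\<^sup>2 \<noteq> 0" using assms by simp
  have "Re (z / (z - x)) = (Re z * Re (z - x) + Im z * Im (z - x)) / (norm (z - x))\<^sup>2"
    by (simp add: cmod_power2 Re_divide)
  also have "2 * (Re z * Re (z - x) + Im z * Im (z - x)) = (norm (z - x))\<^sup>2 + ((norm z)\<^sup>2 - (norm x)\<^sup>2)"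
    unfolding cmod_power2 by (simp add: power2_eq_square algebra_simps)
  then have "Re z * Re (z - x) + Im z * Im (z - x) = ((norm (z - x))\<^sup>2 + ((norm z)\<^sup>2 - (norm x)\<^sup>2)) / 2" by simp
  finally show ?thesis using n by (simp add: add_divide_distrib)
qed

lemma norm_triangle_ineq3_sum:
  fixes a b c :: complex
  shows "norm (a + b - c) \<le> norm a + norm b + norm c"
  using norm_triangle_ineq[of a b] norm_triangle_ineq4[of "a + b" c] by linarith

lemma norm_inverse_perturb:
  fixes a :: complex
  assumes n: "0 < n" and a: "norm a \<le> b" "b \<le> n / 2"
  shows "n / 2 \<le> norm (of_real n + a)" "norm (1 / (of_real n + a) - 1 / of_real n) \<le> 2 * b / n\<^sup>2"
proof -
  have "norm (complex_of_real n) - norm a \<le> norm (of_real n + a)" by (metis norm_diff_ineq)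
  then show lb: "n / 2 \<le> norm (of_real n + a)" using assms by simp
  then have nz: "of_real n + a \<noteq> 0" using n by auto
  have "1 / (of_real n + a) - 1 / of_real n = - a / (of_real n * (of_real n + a))"
    using nz n by (simp add: field_simps)
  then have "norm (1 / (of_real n + a) - 1 / of_real n) = norm a / (n * norm (of_real n + a))"
    using n by (simp add: norm_divide norm_mult)
  also have "\<dots> \<le> b / (n * (n / 2))"
    using lb n a by (intro frac_le mult_left_mono) (auto intro: order_trans[OF norm_ge_zero])
  also have "\<dots> = 2 * b / n\<^sup>2" by (simp add: power2_eq_square)
  finally show "norm (1 / (of_real n + a) - 1 / of_real n) \<le> 2 * b / n\<^sup>2" .
qed

text \<open>
  Here \<open>s\<close> is the width of the boundary layer, \<open>\<eta>\<close> the separation of the points of the layer from all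
  other points, \<open>g\<close> the gap between the two largest moduli, and \<open>w\<close> the size of the fluctuation of
  the logarithmic derivative after removal of the nearest root.
\<close>

locale separated_roots =
  fixes n :: nat and x :: "nat \<Rightarrow> complex" and s \<eta> g w B D N :: real and J :: nat
  assumes n2: "2 \<le> n"
    and s: "0 < s" "4 * s \<le> 1 / 2" "1 / real n \<le> s" "4 * s < \<eta>"
    and D: "0 < D" "8 * s * N / real n < D\<^sup>2" "D + 4 * s \<le> \<eta> / 2" "2 * (D + 4 * s) * B \<le> w" "s \<le> D"
    and w: "2 * w \<le> real n / 2" "4 * w / (real n)\<^sup>2 \<le> s" "2 * (4 * w / (real n)\<^sup>2) < g"
    and B: "0 \<le> B"
    and x_le: "\<And>j. j \<in> {1..n} \<Longrightarrow> norm (x j) \<le> 1"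
    and J: "J \<in> {1..n}" "1 - s \<le> norm (x J)"
    and gap: "\<And>j. j \<in> {1..n} - {J} \<Longrightarrow> norm (x j) \<le> norm (x J) - g"
    and count: "real (card {j \<in> {1..n}. 1 - 4 * s \<le> norm (x j)}) \<le> N"
    and sep: "\<And>k j. k \<in> {1..n} \<Longrightarrow> 1 - 4 * s \<le> norm (x k) \<Longrightarrow> j \<in> {1..n} - {k} \<Longrightarrow> \<eta> \<le> norm (1 - cis (- Arg (x k)) * x j)"
    and fluct: "\<And>k. k \<in> {1..n} \<Longrightarrow> 1 - 4 * s \<le> norm (x k) \<Longrightarrow>
        norm ((\<Sum>j\<in>{1..n} - {k}. recip_gap (cis (- Arg (x k)) * x j)) - of_nat n) \<le> w"
    and square_sum: "\<And>k. k \<in> {1..n} \<Longrightarrow> 1 - 4 * s \<le> norm (x k) \<Longrightarrow>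
        (\<Sum>j\<in>{1..n} - {k}. (norm (recip_gap (cis (- Arg (x k)) * x j)))\<^sup>2) \<le> B"
begin

abbreviation "I \<equiv> {1..n}"
definition "S k = (\<Sum>j\<in>I - {k}. recip_gap (cis (- Arg (x k)) * x j)) - of_nat n"
definition "F k z = (\<Sum>j\<in>I - {k}. 1 / (z - x j))"
text \<open>The precision with which 1 / \<open>F k z\<close> is known to be
  \<open>cis (Arg (x k))\<close> / n: the perturbation of n is at most 2 w, which enters twice over
  n^2.\<close>

definition "e = 4 * w / (real n)\<^sup>2"
definition "P = (\<Prod>j\<in>I. [:- x j, 1:])"

lemma w_nonneg: "0 \<le> w"
  using fluct[OF J(1)] J(2) s(1) by (auto intro: order_trans[OF norm_ge_zero])

lemma e: "0 \<le> e" "e \<le> s" "2 * e < g"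
  using w w_nonneg by (auto simp: e_def)

lemma eta: "0 < \<eta>" using s by linarith

lemma modulus_direction: "x k = complex_of_real (norm (x k)) * cis (Arg (x k))"
  by (simp add: norm_cis_Arg)

lemma norm_direction_diff:
  assumes "k \<in> I"
  shows "norm (x k - cis (Arg (x k))) = 1 - norm (x k)"
proof -
  have "x k - cis (Arg (x k)) = complex_of_real (norm (x k) - 1) * cis (Arg (x k))"
    by (subst modulus_direction) (simp add: algebra_simps)
  then have "norm (x k - cis (Arg (x k))) = \<bar>norm (x k) - 1\<bar>" by (simp only: norm_mult norm_cis norm_of_real mult_1_right)
  then show ?thesis using x_le[OF assms] by simp
qed

text \<open>After rotation by \<open>cis (- Arg (x k))\<close> the root direction becomes 1 and z
  becomes a point \<zeta> with |1 - \<zeta>| \<le> r. As r is at most half the separation, each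
  denominator at \<zeta> is at least half the one at 1, so moving \<zeta> to 1 changes a term by at
  most 2 r |\<open>recip_gap\<close>|^2; these sum to at most 2 r B.\<close>

lemma F_near_root:
  assumes k: "k \<in> I" "1 - 4 * s \<le> norm (x k)" and z: "norm (z - cis (Arg (x k))) \<le> r" "r \<le> \<eta> / 2"
  shows "j \<in> I - {k} \<Longrightarrow> z \<noteq> x j"
    and "\<exists>E. F k z = cis (- Arg (x k)) * (of_nat n + (S k + E)) \<and> norm E \<le> 2 * r * B"
proof -
  define u where "u = cis (- Arg (x k))"
  have uu: "u * cis (Arg (x k)) = 1" by (simp add: u_def cis_mult)
  define \<zeta> where "\<zeta> = u * z"
  have \<zeta>1: "norm (1 - \<zeta>) \<le> r"
  proof -
    have "1 - \<zeta> = - u * (z - cis (Arg (x k)))" using uu by (simp add: \<zeta>_def algebra_simps)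
    then show ?thesis using z(1) by (simp add: norm_mult u_def)
  qed
  have lb: "norm (1 - u * x j) / 2 \<le> norm (\<zeta> - u * x j)" "0 < norm (1 - u * x j)" if "j \<in> I - {k}" for j
  proof -
    have a: "\<eta> \<le> norm (1 - u * x j)" unfolding u_def by (rule sep[OF k that])
    have "norm (1 - u * x j) \<le> norm (1 - \<zeta>) + norm (\<zeta> - u * x j)"
      using norm_triangle_ineq[of "1 - \<zeta>" "\<zeta> - u * x j"] by simp
    then show "norm (1 - u * x j) / 2 \<le> norm (\<zeta> - u * x j)" using a z(2) \<zeta>1 by linarith
    show "0 < norm (1 - u * x j)" using a eta by linarith
  qed
  have zx: "u * (z - x j) = \<zeta> - u * x j" for j by (simp add: \<zeta>_def algebra_simps)
  show ne: "j \<in> I - {k} \<Longrightarrow> z \<noteq> x j" for j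
    using lb[of j] zx[of j] by auto
  define E where "E = (\<Sum>j\<in>I - {k}. 1 / (\<zeta> - u * x j) - recip_gap (u * x j))"
  have "F k z = u * (\<Sum>j\<in>I - {k}. 1 / (\<zeta> - u * x j))"
  proof -
    have "1 / (z - x j) = u * (1 / (\<zeta> - u * x j))" for j
      unfolding zx[symmetric] by (simp add: u_def)
    then show ?thesis by (simp add: F_def sum_distrib_left)
  qed
  also have "(\<Sum>j\<in>I - {k}. 1 / (\<zeta> - u * x j)) = of_nat n + (S k + E)"
    by (simp add: E_def S_def u_def sum_subtractf)
  finally have 1: "F k z = u * (of_nat n + (S k + E))" .
  have r0: "0 \<le> r" using z(1) norm_ge_zero order_trans by blast
  have "norm E \<le> (\<Sum>j\<in>I - {k}. 2 * r * (norm (recip_gap (u * x j)))\<^sup>2)"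
    unfolding E_def
  proof (rule sum_norm_le)
    fix j assume j: "j \<in> I - {k}"
    have nz: "\<zeta> - u * x j \<noteq> 0" "1 - u * x j \<noteq> 0" using lb[OF j] by auto
    have "1 / (\<zeta> - u * x j) - recip_gap (u * x j) = (1 - \<zeta>) / ((\<zeta> - u * x j) * (1 - u * x j))"
      using nz by (simp add: recip_gap_def field_simps)
    then have "norm (1 / (\<zeta> - u * x j) - recip_gap (u * x j)) = norm (1 - \<zeta>) / (norm (\<zeta> - u * x j) * norm (1 - u * x j))"
      by (simp add: norm_divide norm_mult)
    also have "\<dots> \<le> r / (norm (1 - u * x j) / 2 * norm (1 - u * x j))"
      using lb[OF j] \<zeta>1 r0 by (intro frac_le mult_right_mono mult_pos_pos) auto
    also have "\<dots> = 2 * r * (norm (recip_gap (u * x j)))\<^sup>2"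
      by (simp add: recip_gap_def norm_divide power2_eq_square)
    finally show "norm (1 / (\<zeta> - u * x j) - recip_gap (u * x j)) \<le> 2 * r * (norm (recip_gap (u * x j)))\<^sup>2" .
  qed
  also have "\<dots> = 2 * r * (\<Sum>j\<in>I - {k}. (norm (recip_gap (u * x j)))\<^sup>2)" by (simp add: sum_distrib_left)
  also have "\<dots> \<le> 2 * r * B" unfolding u_def using square_sum[OF k] r0 by (intro mult_left_mono) auto
  finally show "\<exists>E. F k z = cis (- Arg (x k)) * (of_nat n + (S k + E)) \<and> norm E \<le> 2 * r * B"
    using 1 unfolding u_def by blast
qed

lemma inverse_F_near_root:
  assumes k: "k \<in> I" "1 - 4 * s \<le> norm (x k)" and z: "norm (z - cis (Arg (x k))) \<le> r" "r \<le> D + 4 * s"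
  shows "F k z \<noteq> 0" "norm (1 / F k z - cis (Arg (x k)) / of_nat n) \<le> e"
proof -
  have r: "r \<le> \<eta> / 2" using z D by linarith
  obtain E where E: "F k z = cis (- Arg (x k)) * (of_nat n + (S k + E))" "norm E \<le> 2 * r * B"
    using F_near_root(2)[OF k z(1) r] by blast
  have "2 * r * B \<le> 2 * (D + 4 * s) * B" using z B by (intro mult_right_mono) auto
  then have "norm E \<le> w" using E(2) D by linarith
  moreover have "norm (S k) \<le> w" unfolding S_def by (rule fluct[OF k])
  ultimately have "norm (S k + E) \<le> 2 * w" using norm_triangle_ineq[of "S k" E] by linarith
  note ni = norm_inverse_perturb[OF _ this w(1)]
  have n0: "0 < real n" using n2 by simp
  have "of_real (real n) + (S k + E) \<noteq> 0" using ni(1)[OF n0] n0 by auto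
  then show "F k z \<noteq> 0" unfolding E(1) by simp
  have "1 / F k z - cis (Arg (x k)) / of_nat n = cis (Arg (x k)) * (1 / (of_real (real n) + (S k + E)) - 1 / of_real (real n))"
  proof -
    define b where "b = of_real (real n) + (S k + E)"
    have i: "cis (Arg (x k)) = 1 / cis (- Arg (x k))" using cis_divide[of 0 "- Arg (x k)"] by simp
    have "1 / F k z = 1 / cis (- Arg (x k)) * (1 / b)" unfolding E(1) b_def by simp
    then have "1 / F k z = cis (Arg (x k)) * (1 / b)" unfolding i .
    then show ?thesis unfolding b_def[symmetric] by (simp add: right_diff_distrib)
  qed
  then have "norm (1 / F k z - cis (Arg (x k)) / of_nat n) = norm (1 / (of_real (real n) + (S k + E)) - 1 / of_real (real n))"
    by (simp only: norm_mult norm_cis mult_1_left)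
  also have "\<dots> \<le> 2 * (2 * w) / (real n)\<^sup>2" by (rule ni(2)[OF n0])
  finally show "norm (1 / F k z - cis (Arg (x k)) / of_nat n) \<le> e" by (simp add: e_def)
qed

lemma sum_split: "k \<in> I \<Longrightarrow> (\<Sum>j\<in>I. 1 / (z - x j)) = 1 / (z - x k) + F k z"
  unfolding F_def by (subst sum.remove[of I k]) auto

text \<open>A critical point off the roots is a fixed point of z = x J - 1 / \<open>F J z\<close>.
  On the disc of radius e about x J - u / n this map is continuous, and the precision of 1 /
  \<open>F J z\<close> says that it maps the disc into itself, so Brouwer's theorem applies.\<close>

lemma critical_point_near_top: "\<exists>z. poly (pderiv P) z = 0 \<and> norm (x J) - 1 / real n - e \<le> norm z"
proof -
  define u where "u = cis (Arg (x J))"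
  define c where "c = x J - u / of_nat n"
  have J4: "1 - 4 * s \<le> norm (x J)" using J s by linarith
  \<comment> \<open>Three displacements of size at most s each: e inside the disc, 1 - |x J| to the
    circle, and 1 / n.\<close>
  have near: "norm (z - u) \<le> 3 * s" if "z \<in> cball c e" for z
  proof -
    have "z - u = (z - c) + (x J - u) - u / of_nat n" by (simp add: c_def)
    then have "norm (z - u) \<le> norm (z - c) + norm (x J - u) + norm (u / of_nat n)"
      by (metis norm_triangle_ineq3_sum)
    also have "norm (z - c) \<le> e" using that by (simp add: dist_norm norm_minus_commute)
    also have "norm (x J - u) \<le> s" unfolding u_def using norm_direction_diff[OF J(1)] J(2) by simp
    also have "norm (u / of_nat n) \<le> s" using s(3) by (simp add: u_def norm_divide)
    finally show ?thesis using e(2) by linarith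
  qed
  have r: "3 * s \<le> D + 4 * s" using s D by linarith
  have r2: "3 * s \<le> \<eta> / 2" using r D by linarith
  note inv = inverse_F_near_root[OF J(1) J4 near[unfolded u_def] r]
  note ne = F_near_root(1)[OF J(1) J4 near[unfolded u_def] r2]
  define G where "G z = x J - 1 / F J z" for z
  have "\<exists>z\<in>cball c e. G z = z"
  proof (rule brouwer[of "cball c e" G])
    show "compact (cball c e)" "convex (cball c e)" "cball c e \<noteq> {}" using e by auto
    show "continuous_on (cball c e) G"
      unfolding G_def F_def by (intro continuous_intros) (use ne inv(1) in \<open>auto simp: F_def\<close>)
    show "G \<in> cball c e \<rightarrow> cball c e"
    proof
      fix z assume z: "z \<in> cball c e"
      have "c - G z = 1 / F J z - u / of_nat n" by (simp add: c_def G_def)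
      then show "G z \<in> cball c e" using inv(2)[OF z] by (simp add: dist_norm u_def)
    qed
  qed blast
  then obtain z where z: "z \<in> cball c e" "G z = z" by auto
  have zJ: "z - x J = - (1 / F J z)" using z(2) unfolding G_def by (metis add_diff_cancel_left' diff_conv_add_uminus)
  then have zJ': "z \<noteq> x J" using inv(1)[OF z(1)] by auto
  have zne: "z \<noteq> x j" if "j \<in> I" for j using ne[OF z(1)] zJ' that by (cases "j = J") auto
  have "(\<Sum>j\<in>I. 1 / (z - x j)) = 0"
    unfolding sum_split[OF J(1)] zJ using inv(1)[OF z(1)] by simp
  then have "poly (pderiv P) z = 0" unfolding P_def using zne by (subst poly_pderiv_prod_roots_eq_0) auto
  moreover have "norm (x J) - 1 / real n - e \<le> norm z"
  proof -
    have "norm (x J) - norm (u / of_nat n) \<le> norm c" unfolding c_def by (rule norm_triangle_ineq2)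
    moreover have "norm (u / of_nat n) = 1 / real n" by (simp add: u_def norm_divide)
    moreover have "norm c - norm (c - z) \<le> norm z" using norm_triangle_ineq2[of c "c - z"] by simp
    moreover have "norm (c - z) \<le> e" using z(1) by (simp add: dist_norm)
    ultimately show ?thesis by linarith
  qed
  ultimately show ?thesis by blast
qed

text \<open>Suppose no root of larger modulus lies within D of z. Take real parts in the sum of z /
  (z - x j), which is 0. Roots of modulus at most |z| give at least 1/2 each; the others, at most N
  of them, give at least 1/2 - 4 s / D^2. The total is positive because 8 s N / n < D^2. So z has a
  root at distance at most D, and near it the equation z - x k = - 1 / \<open>F k z\<close> locates
  z with precision e.\<close>

lemma outer_critical_point:
  assumes crit: "poly (pderiv P) z = 0" and z: "1 - 4 * s \<le> norm z"
  shows "\<exists>k\<in>I. 1 - 4 * s \<le> norm (x k) \<and> F k z \<noteq> 0 \<and> z - x k = - (1 / F k z) \<and>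
    norm (z - (x k - cis (Arg (x k)) / of_nat n)) \<le> e"
proof -
  \<comment> \<open>A critical point that is a root is a multiple root. Two coinciding roots in the
    layer contradict separation: rotated by the argument, the second one is at distance 1 - |x i|
    \<le> 4 s < \<eta> from 1.\<close>
  have zne: "z \<noteq> x i" if i: "i \<in> I" for i
  proof
    assume zi: "z = x i"
    have "(\<Sum>k\<in>I. \<Prod>j\<in>I - {k}. z - x j) = 0" using crit unfolding P_def by (simp add: poly_pderiv_prod_roots)
    moreover have "(\<Prod>j\<in>I - {k}. z - x j) = 0" if "k \<in> I - {i}" for k
      using that i zi by (intro prod_zero) auto
    then have "(\<Sum>k\<in>I - {i}. \<Prod>j\<in>I - {k}. z - x j) = 0" by (rule sum.neutral[OF ballI])
    moreover have "(\<Sum>k\<in>I. \<Prod>j\<in>I - {k}. z - x j) = (\<Prod>j\<in>I - {i}. z - x j) + (\<Sum>k\<in>I - {i}. \<Prod>j\<in>I - {k}. z - x j)"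
      by (rule sum.remove) (use i in auto)
    ultimately have "(\<Prod>j\<in>I - {i}. z - x j) = 0" by simp
    then have "\<exists>j\<in>I - {i}. z - x j = 0" by (subst (asm) prod_zero_iff) auto
    then obtain j where j0: "j \<in> I - {i}" "z - x j = 0" by blast
    note j = j0(1)
    have xj: "x j = x i" using j0(2) zi by simp
    have "cis (- Arg (x i)) * x i = complex_of_real (norm (x i))"
      by (subst (2) modulus_direction) (simp add: mult.left_commute cis_mult)
    then have "norm (1 - cis (- Arg (x i)) * x j) = norm (complex_of_real (1 - norm (x i)))" using xj by simp
    also have "\<dots> \<le> 4 * s" unfolding norm_of_real using z zi x_le[OF i] by simp
    finally show False using sep[OF i _ j] z zi s(4) by auto
  qed
  have sum0: "(\<Sum>j\<in>I. 1 / (z - x j)) = 0"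
    using crit zne unfolding P_def by (subst (asm) poly_pderiv_prod_roots_eq_0) auto
  have ex: "\<exists>k\<in>I. norm z < norm (x k) \<and> norm (z - x k) \<le> D"
  proof (rule ccontr)
    assume "\<not> ?thesis"
    then have far: "D < norm (z - x k)" if "k \<in> I" "norm z < norm (x k)" for k using that by force
    have "(\<Sum>j\<in>I. z / (z - x j)) = z * (\<Sum>j\<in>I. 1 / (z - x j))" by (simp add: sum_distrib_left)
    then have "0 = (\<Sum>j\<in>I. Re (z / (z - x j)))" using sum0 by (simp flip: Re_sum)
    also have "\<dots> \<ge> (\<Sum>j\<in>I. 1 / 2 - (if j \<in> {j\<in>I. 1 - 4 * s \<le> norm (x j)} then 4 * s / D\<^sup>2 else 0))"
    proof (rule sum_mono)
      fix j assume j: "j \<in> I"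
      show "1 / 2 - (if j \<in> {j\<in>I. 1 - 4 * s \<le> norm (x j)} then 4 * s / D\<^sup>2 else 0) \<le> Re (z / (z - x j))"
      proof (cases "norm z < norm (x j)")
        case True
        \<comment> \<open>Both moduli lie in [1 - 4 s, 1], so their squares differ by at most 1 - (1
          - 4 s)^2 \<le> 8 s.\<close>
        have "(norm (x j))\<^sup>2 \<le> 1" using x_le[OF j] by (simp add: power_le_one)
        moreover have "(1 - 4 * s)\<^sup>2 \<le> (norm z)\<^sup>2" using z s by (intro power_mono) auto
        moreover have "1 - 8 * s \<le> (1 - 4 * s)\<^sup>2" by (simp add: power2_eq_square algebra_simps)
        ultimately have a: "(norm (x j))\<^sup>2 - (norm z)\<^sup>2 \<le> 8 * s" by linarith
        have "((norm (x j))\<^sup>2 - (norm z)\<^sup>2) / (2 * (norm (z - x j))\<^sup>2) \<le> 8 * s / (2 * D\<^sup>2)"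
          using a far[OF j True] D(1) s by (intro frac_le mult_left_mono power_mono) auto
        moreover have "((norm z)\<^sup>2 - (norm (x j))\<^sup>2) / (2 * (norm (z - x j))\<^sup>2) = - (((norm (x j))\<^sup>2 - (norm z)\<^sup>2) / (2 * (norm (z - x j))\<^sup>2))"
          by (metis minus_diff_eq minus_divide_left)
        ultimately show ?thesis using True z j unfolding Re_divide_diff[OF zne[OF j]] by simp
      next
        case False
        then have "0 \<le> ((norm z)\<^sup>2 - (norm (x j))\<^sup>2) / (2 * (norm (z - x j))\<^sup>2)"
          by (intro divide_nonneg_nonneg) (auto simp: power_mono)
        moreover have "0 \<le> 4 * s / D\<^sup>2" using s by simp
        ultimately show ?thesis unfolding Re_divide_diff[OF zne[OF j]] by (auto simp del: divide_nonneg_nonneg)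
      qed
    qed
    also have "(\<Sum>j\<in>I. 1 / 2 - (if j \<in> {j\<in>I. 1 - 4 * s \<le> norm (x j)} then 4 * s / D\<^sup>2 else 0)) =
       real n / 2 - real (card {j\<in>I. 1 - 4 * s \<le> norm (x j)}) * (4 * s / D\<^sup>2)"
      by (simp add: sum_subtractf sum.If_cases Int_def)
    finally have "real n / 2 \<le> real (card {j\<in>I. 1 - 4 * s \<le> norm (x j)}) * (4 * s / D\<^sup>2)" by simp
    also have "\<dots> \<le> N * (4 * s / D\<^sup>2)" using count s by (intro mult_right_mono) auto
    finally have "real n * D\<^sup>2 \<le> 8 * s * N" using D(1) by (simp add: field_simps)
    then show False using D(2) n2 by (simp add: field_simps)
  qed
  then obtain k where k: "k \<in> I" "norm z < norm (x k)" "norm (z - x k) \<le> D" by auto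
  have k4: "1 - 4 * s \<le> norm (x k)" using k z by linarith
  have "norm (z - cis (Arg (x k))) \<le> norm (z - x k) + norm (x k - cis (Arg (x k)))"
    using norm_triangle_ineq[of "z - x k" "x k - cis (Arg (x k))"] by simp
  then have near: "norm (z - cis (Arg (x k))) \<le> D + 4 * s" using k(3) k4 norm_direction_diff[OF k(1)] by linarith
  note inv = inverse_F_near_root[OF k(1) k4 near order_refl]
  have zF: "z - x k = - (1 / F k z)"
  proof -
    have "1 / (z - x k) = - F k z" using sum0 unfolding sum_split[OF k(1)] by (simp add: eq_neg_iff_add_eq_0)
    then have "inverse (z - x k) = - F k z" by (simp add: inverse_eq_divide)
    then show ?thesis by (metis inverse_eq_divide inverse_inverse_eq inverse_minus_eq)
  qed
  have "z - (x k - cis (Arg (x k)) / of_nat n) = - (1 / F k z - cis (Arg (x k)) / of_nat n)"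
    using zF by (simp add: algebra_simps)
  then have "norm (z - (x k - cis (Arg (x k)) / of_nat n)) \<le> e" using inv(2) by (simp only: norm_minus_cancel)
  then show ?thesis using k(1) k4 inv(1) zF by blast
qed

lemma largest_root: "largest_pt (roots P) = x J"
proof (rule mod_arg_le_largest_pt(3))
  have r: "roots P = x ` I" by (auto simp: roots_def P_def poly_prod)
  show "finite (roots P)" "roots P \<noteq> {}" "x J \<in> roots P" unfolding r using J by auto
  fix v assume "v \<in> roots P"
  then obtain j where j: "j \<in> I" "v = x j" unfolding r by auto
  show "mod_arg_le v (x J)"
  proof (cases "j = J")
    case False
    then have "norm (x j) \<le> norm (x J) - g" using j gap by auto
    then show ?thesis using e j by (simp add: mod_arg_le_def)
  qed (use j in \<open>simp add: mod_arg_le_def\<close>)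
qed

text \<open>With a = S J + E, n^2 (|x J| / n - 1 / (n + a)) equals n (|x J| - 1) + a - a^2 / (n +
  a). The three error terms bound the distance of x J from the circle, the displacement E from
  evaluating at the circle, and the second order term, where |a| \<le> 2 w.\<close>

lemma largest_critical_point:
  assumes d: "0 \<le> d"
  shows "norm (complex_of_real ((real n)\<^sup>2 * d) * cis (- Arg (x J)) * (largest_pt (roots (pderiv P)) - x J * (1 - 1 / of_nat n)) - complex_of_real d * S J)
     \<le> d * (real n * s + 6 * s * B + 8 * w\<^sup>2 / real n)"
proof -
  define W where "W = largest_pt (roots (pderiv P))"
  have n0: "0 < real n" using n2 by simp
  have "degree P = n" unfolding P_def by (subst degree_prod_eq_sum_degree) auto
  then have "pderiv P \<noteq> 0" using n2 by (auto simp: pderiv_eq_0_iff)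
  then have fin: "finite (roots (pderiv P))" unfolding roots_def by (rule poly_roots_finite)
  obtain z1 where z1: "poly (pderiv P) z1 = 0" "norm (x J) - 1 / real n - e \<le> norm z1"
    using critical_point_near_top by blast
  have ne: "roots (pderiv P) \<noteq> {}" using z1 by (auto simp: roots_def)
  have W0: "poly (pderiv P) W = 0" using mod_arg_le_largest_pt(1)[OF fin ne] by (simp add: W_def roots_def)
  have Wz: "norm z1 \<le> norm W"
    using mod_arg_le_largest_pt(2)[OF fin ne, of z1] z1(1) by (auto simp: W_def roots_def mod_arg_le_def)
  have "1 - 4 * s \<le> norm W" using Wz z1(2) J(2) s(3) e(2) s(1) by linarith
  from outer_critical_point[OF W0 this] obtain k where k: "k \<in> I" "1 - 4 * s \<le> norm (x k)" "F k W \<noteq> 0" "W - x k = - (1 / F k W)"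
    "norm (W - (x k - cis (Arg (x k)) / of_nat n)) \<le> e" by blast
  \<comment> \<open>A partner k other than J would give |W| \<le> |x J| - g - 1/n + e, which is less
    than the modulus |x J| - 1/n - e reached by the critical point near x J, because 2 e <
    g.\<close>
  have "k = J"
  proof (rule ccontr)
    assume "k \<noteq> J"
    then have g: "norm (x k) \<le> norm (x J) - g" using k gap by auto
    have "x k - cis (Arg (x k)) / of_nat n = complex_of_real (norm (x k) - 1 / real n) * cis (Arg (x k))"
      by (subst modulus_direction) (simp add: algebra_simps)
    then have "norm (x k - cis (Arg (x k)) / of_nat n) = \<bar>norm (x k) - 1 / real n\<bar>" by (simp only: norm_mult norm_of_real norm_cis mult_1_right)
    moreover have "1 / real n \<le> norm (x k)" using k(2) s by linarith
    ultimately have "norm (x k - cis (Arg (x k)) / of_nat n) = norm (x k) - 1 / real n" by simp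
    then have "norm W \<le> norm (x k) - 1 / real n + e"
      using k(5) norm_triangle_ineq2[of W "x k - cis (Arg (x k)) / of_nat n"] by linarith
    then show False using g e(3) Wz z1(2) by linarith
  qed
  define u where "u = cis (Arg (x J))"
  have near: "norm (W - u) \<le> 3 * s"
  proof -
    have "W - u = (W - (x J - u / of_nat n)) + (x J - u) - u / of_nat n" by simp
    then have "norm (W - u) \<le> norm (W - (x J - u / of_nat n)) + norm (x J - u) + norm (u / of_nat n)"
      by (metis norm_triangle_ineq3_sum)
    also have "norm (W - (x J - u / of_nat n)) \<le> e" using k(5) \<open>k = J\<close> by (simp add: u_def)
    also have "norm (x J - u) \<le> s" unfolding u_def using norm_direction_diff[OF J(1)] J(2) by simp
    also have "norm (u / of_nat n) \<le> s" using s(3) by (simp add: u_def norm_divide)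
    finally show ?thesis using e(2) by linarith
  qed
  have J4: "1 - 4 * s \<le> norm (x J)" using J s by linarith
  have r: "3 * s \<le> \<eta> / 2" using D s by linarith
  obtain E where E: "F J W = cis (- Arg (x J)) * (of_nat n + (S J + E))" "norm E \<le> 2 * (3 * s) * B"
    using F_near_root(2)[OF J(1) J4 near[unfolded u_def] r] by blast
  define a where "a = S J + E"
  have "2 * (3 * s) * B \<le> 2 * (D + 4 * s) * B" using D s B by (intro mult_right_mono) auto
  then have "norm E \<le> w" using E(2) D by linarith
  moreover have "norm (S J) \<le> w" unfolding S_def by (rule fluct[OF J(1) J4])
  ultimately have a: "norm a \<le> 2 * w" using norm_triangle_ineq[of "S J" E] unfolding a_def by linarith
  have na: "real n / 2 \<le> norm (of_real (real n) + a)" by (rule norm_inverse_perturb(1)[OF n0 a w(1)])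
  then have nz: "of_nat n + a \<noteq> 0" using n0 by auto
  have cc: "cis (- Arg (x J)) * x J = complex_of_real (norm (x J))"
    by (subst (2) modulus_direction) (simp add: mult.left_commute cis_mult)
  have "cis (- Arg (x J)) * (1 / F J W) = 1 / (of_nat n + a)"
    unfolding E(1) a_def[symmetric] by simp
  then have "cis (- Arg (x J)) * (W - x J) = - (1 / (of_nat n + a))"
    using k(4) \<open>k = J\<close> by simp
  then have "cis (- Arg (x J)) * (W - x J * (1 - 1 / of_nat n)) = complex_of_real (norm (x J)) / of_nat n - 1 / (of_nat n + a)"
  proof -
    have "cis (- Arg (x J)) * (W - x J * (1 - 1 / of_nat n)) = cis (- Arg (x J)) * (W - x J) + (cis (- Arg (x J)) * x J) / of_nat n"
      by (simp add: algebra_simps)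
    then show ?thesis unfolding cc \<open>cis (- Arg (x J)) * (W - x J) = _\<close> by simp
  qed
  then have "complex_of_real ((real n)\<^sup>2 * d) * cis (- Arg (x J)) * (W - x J * (1 - 1 / of_nat n)) - complex_of_real d * S J =
     complex_of_real ((real n)\<^sup>2 * d) * (complex_of_real (norm (x J)) / of_nat n - 1 / (of_nat n + a)) - complex_of_real d * S J"
    by (simp add: mult.assoc)
  also have "\<dots> = complex_of_real d * (of_nat n * complex_of_real (norm (x J) - 1) + E - a\<^sup>2 / (of_nat n + a))"
  proof -
    have "S J = a - E" by (simp add: a_def)
    moreover have "(of_nat n)\<^sup>2 * (complex_of_real (norm (x J)) / of_nat n - 1 / (of_nat n + a)) =
       of_nat n * complex_of_real (norm (x J) - 1) + a - a\<^sup>2 / (of_nat n + a)"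
    proof -
      define m b where "m = complex_of_nat n" and "b = m + a"
      have b: "b \<noteq> 0" "m \<noteq> 0" "m = b - a" using nz n0 by (auto simp: m_def b_def)
      have "m\<^sup>2 / b = b - 2 * a + a\<^sup>2 / b"
        unfolding b(3) using b(1) by (simp add: power2_eq_square field_simps)
      moreover have "m\<^sup>2 * (r / m - 1 / b) = m * r - m\<^sup>2 / b" for r
        using b(2) by (simp add: power2_eq_square right_diff_distrib)
      ultimately have "m\<^sup>2 * (r / m - 1 / b) = m * r - (b - 2 * a + a\<^sup>2 / b)" for r by simp
      then show ?thesis unfolding m_def[symmetric] b_def[symmetric] by (simp add: b_def algebra_simps)
    qed
    moreover have "complex_of_real ((real n)\<^sup>2 * d) * Y - complex_of_real d * S J = complex_of_real d * ((of_nat n)\<^sup>2 * Y - S J)" for Y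
      by (simp add: algebra_simps)
    ultimately show ?thesis by (simp only:) (simp add: algebra_simps)
  qed
  finally have "norm (complex_of_real ((real n)\<^sup>2 * d) * cis (- Arg (x J)) * (W - x J * (1 - 1 / of_nat n)) - complex_of_real d * S J)
     = d * norm (of_nat n * complex_of_real (norm (x J) - 1) + E - a\<^sup>2 / (of_nat n + a))"
    using d by (simp only: norm_mult norm_of_real abs_of_nonneg)
  also have "\<dots> \<le> d * (real n * s + 6 * s * B + 8 * w\<^sup>2 / real n)"
  proof (rule mult_left_mono[OF _ d])
    have "norm (of_nat n * complex_of_real (norm (x J) - 1)) \<le> real n * s"
      unfolding norm_mult norm_of_nat norm_of_real using J(2) x_le[OF J(1)] by (intro mult_left_mono) auto
    moreover have "norm (a\<^sup>2 / (of_nat n + a)) \<le> (2 * w)\<^sup>2 / (real n / 2)"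
      unfolding norm_divide norm_power using a na n0 by (intro frac_le power_mono) auto
    moreover have "(2 * w)\<^sup>2 / (real n / 2) = 8 * w\<^sup>2 / real n" by (simp add: power2_eq_square)
    ultimately show "norm (of_nat n * complex_of_real (norm (x J) - 1) + E - a\<^sup>2 / (of_nat n + a)) \<le> real n * s + 6 * s * B + 8 * w\<^sup>2 / real n"
      using E(2) norm_triangle_ineq4[of "of_nat n * complex_of_real (norm (x J) - 1) + E" "a\<^sup>2 / (of_nat n + a)"]
        norm_triangle_ineq[of "of_nat n * complex_of_real (norm (x J) - 1)" E] by linarith
  qed
  finally show ?thesis unfolding W_def .
qed
end

section \<open>Rotating the sample by the argument of one point\<close>

locale iid_sample = radial_law + M: prob_space M for M :: "'b measure" +
  fixes X :: "nat \<Rightarrow> 'b \<Rightarrow> complex"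
  assumes X_measurable [measurable]: "\<And>j. X j \<in> borel_measurable M"
    and indep: "M.indep_vars (\<lambda>_. borel) X {1..}"
    and law: "\<And>j. 1 \<le> j \<Longrightarrow> distr M borel (X j) = \<mu>"
begin

lemma prob_X:
  assumes "1 \<le> j" "A \<in> sets borel"
  shows "M.prob {\<omega> \<in> space M. X j \<omega> \<in> A} = measure \<mu> A"
proof -
  have "measure \<mu> A = measure (distr M borel (X j)) A" using law assms by simp
  also have "\<dots> = M.prob (X j -` A \<inter> space M)" using assms by (intro measure_distr) auto
  also have "X j -` A \<inter> space M = {\<omega> \<in> space M. X j \<omega> \<in> A}" by auto
  finally show ?thesis ..
qed

lemma integral_X:
  fixes f :: "complex \<Rightarrow> 'c::{banach, second_countable_topology}"
  assumes "1 \<le> j" and [measurable]: "f \<in> borel_measurable borel"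
  shows "(LINT \<omega>|M. f (X j \<omega>)) = integral\<^sup>L \<mu> f"
  using integral_distr[of "X j" M borel f] law[OF assms(1)] by simp

lemma sets_PiM_mu: "sets (PiM K (\<lambda>_. \<mu>)) = sets (PiM K (\<lambda>_. borel))"
  by (rule sets_PiM_cong) (auto simp: sets_mu)

lemma joint_law:
  assumes k: "1 \<le> k" and K: "finite K" "K \<noteq> {}" "K \<subseteq> {1..}" "k \<notin> K"
  shows "distr M (PiM K (\<lambda>_. borel)) (\<lambda>\<omega>. \<lambda>j\<in>K. X j \<omega>) = PiM K (\<lambda>_. \<mu>)"
    and "distr M (borel \<Otimes>\<^sub>M PiM K (\<lambda>_. borel)) (\<lambda>\<omega>. (X k \<omega>, \<lambda>j\<in>K. X j \<omega>)) = \<mu> \<Otimes>\<^sub>M PiM K (\<lambda>_. \<mu>)"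
proof -
  let ?B1 = "PiM {k} (\<lambda>_. borel) :: (nat \<Rightarrow> complex) measure" and ?B2 = "PiM K (\<lambda>_. borel) :: (nat \<Rightarrow> complex) measure"
  let ?R1 = "\<lambda>\<omega>. \<lambda>j\<in>{k}. X j \<omega>" and ?R2 = "\<lambda>\<omega>. \<lambda>j\<in>K. X j \<omega>"
  have R [measurable]: "?R1 \<in> measurable M ?B1" "?R2 \<in> measurable M ?B2"
    by (intro measurable_restrict X_measurable)+
  have "distr M ?B2 ?R2 = PiM K (\<lambda>j. distr M borel (X j))"
    using M.indep_vars_iff_distr_eq_PiM'[of K X "\<lambda>_. borel"] M.indep_vars_subset[OF indep K(3)] K(2) by simp
  also have "\<dots> = PiM K (\<lambda>_. \<mu>)" by (rule PiM_cong) (use K law in auto)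
  finally show D2: "distr M ?B2 ?R2 = PiM K (\<lambda>_. \<mu>)" .
  \<comment> \<open>Independence of the two subfamilies indexed by {k} and K; the one-point family
    is then projected to its only coordinate.\<close>
  have "M.indep_var ?B1 ?R1 ?B2 ?R2"
    by (rule M.indep_var_restrict[OF indep]) (use k K in auto)
  then have J: "distr M ?B1 ?R1 \<Otimes>\<^sub>M distr M ?B2 ?R2 = distr M (?B1 \<Otimes>\<^sub>M ?B2) (\<lambda>\<omega>. (?R1 \<omega>, ?R2 \<omega>))"
    unfolding M.indep_var_distribution_eq by simp
  have pk [measurable]: "(\<lambda>f. f k) \<in> borel_measurable ?B1" by (rule measurable_component_singleton) simp
  interpret D2: prob_space "distr M ?B2 ?R2" by (rule M.prob_space_distr[OF R(2)])
  have id: "distr (distr M ?B2 ?R2) ?B2 (\<lambda>y. y) = distr M ?B2 ?R2" by (rule distr_id2) simp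
  have "\<mu> \<Otimes>\<^sub>M PiM K (\<lambda>_. \<mu>) = distr (distr M ?B1 ?R1) borel (\<lambda>f. f k) \<Otimes>\<^sub>M distr (distr M ?B2 ?R2) ?B2 (\<lambda>y. y)"
    unfolding id unfolding D2 using law[OF k] by (subst distr_distr[OF pk R(1)]) (simp add: o_def)
  also have "\<dots> = distr (distr M ?B1 ?R1 \<Otimes>\<^sub>M distr M ?B2 ?R2) (borel \<Otimes>\<^sub>M ?B2) (\<lambda>(f, y). (f k, y))"
    by (rule pair_measure_distr) (use id D2.sigma_finite_measure_axioms in \<open>auto intro: pk\<close>)
  also have "\<dots> = distr M (borel \<Otimes>\<^sub>M ?B2) ((\<lambda>(f, y). (f k, y)) \<circ> (\<lambda>\<omega>. (?R1 \<omega>, ?R2 \<omega>)))"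
    unfolding J by (rule distr_distr) measurable
  also have "(\<lambda>(f, y). (f k, y)) \<circ> (\<lambda>\<omega>. (?R1 \<omega>, ?R2 \<omega>)) = (\<lambda>\<omega>. (X k \<omega>, \<lambda>j\<in>K. X j \<omega>))"
    by (auto simp: fun_eq_iff)
  finally show "distr M (borel \<Otimes>\<^sub>M ?B2) (\<lambda>\<omega>. (X k \<omega>, \<lambda>j\<in>K. X j \<omega>)) = \<mu> \<Otimes>\<^sub>M PiM K (\<lambda>_. \<mu>)" ..
qed

lemma rotate_PiM:
  assumes "finite K"
  shows "distr (PiM K (\<lambda>_. \<mu>)) (PiM K (\<lambda>_. \<mu>)) (\<lambda>y. \<lambda>j\<in>K. cis \<theta> * y j) = PiM K (\<lambda>_. \<mu>)"
proof -
  have "distr (PiM K (\<lambda>_. \<mu>)) (PiM K (\<lambda>_. \<mu>)) (compose K (\<lambda>z. cis \<theta> * z)) = PiM K (\<lambda>_. distr \<mu> \<mu> (\<lambda>z. cis \<theta> * z))"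
    by (rule distr_PiM_finite_prob_space') (use assms prob_space_axioms in auto)
  also have "distr \<mu> \<mu> (\<lambda>z. cis \<theta> * z) = distr \<mu> borel (\<lambda>z. cis \<theta> * z)"
    by (rule distr_cong) (auto simp: sets_mu)
  finally have *: "distr (PiM K (\<lambda>_. \<mu>)) (PiM K (\<lambda>_. \<mu>)) (compose K (\<lambda>z. cis \<theta> * z)) = PiM K (\<lambda>_. \<mu>)"
    unfolding rot .
  have "compose K (\<lambda>z. cis \<theta> * z) = (\<lambda>y. \<lambda>j\<in>K. cis \<theta> * y j)" by (auto simp: compose_def fun_eq_iff)
  then show ?thesis using * by simp
qed

definition rotate_pair :: "nat set \<Rightarrow> complex \<times> (nat \<Rightarrow> complex) \<Rightarrow> complex \<times> (nat \<Rightarrow> complex)" where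
  "rotate_pair K = (\<lambda>x. (fst x, \<lambda>j\<in>K. cis (- Arg (fst x)) * snd x j))"

lemma rotate_pair_measurable [measurable]:
  "rotate_pair K \<in> measurable (borel \<Otimes>\<^sub>M PiM K (\<lambda>_. borel)) (borel \<Otimes>\<^sub>M PiM K (\<lambda>_. borel))"
  unfolding rotate_pair_def
proof (intro measurable_Pair measurable_restrict)
  fix j assume j: "j \<in> K"
  have [measurable]: "(\<lambda>x. snd x j) \<in> borel_measurable (borel \<Otimes>\<^sub>M PiM K (\<lambda>_. borel))"
    by (rule measurable_compose[OF measurable_snd measurable_component_singleton[where M="\<lambda>_. borel", OF j]])
  show "(\<lambda>x. cis (- Arg (fst x)) * snd x j) \<in> borel_measurable (borel \<Otimes>\<^sub>M PiM K (\<lambda>_. borel))"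
    by measurable
qed simp

text \<open>For a fixed first coordinate the map is one fixed rotation of all the others, which
  preserves their product law. Integrating the slices gives the claim although the angle is
  random.\<close>

lemma rotate_joint:
  assumes K: "finite K"
  shows "distr (\<mu> \<Otimes>\<^sub>M PiM K (\<lambda>_. \<mu>)) (borel \<Otimes>\<^sub>M PiM K (\<lambda>_. borel)) (rotate_pair K) = \<mu> \<Otimes>\<^sub>M PiM K (\<lambda>_. \<mu>)"
proof -
  let ?P = "PiM K (\<lambda>_. \<mu>)"
  interpret P: prob_space ?P by (rule prob_space_PiM) (rule prob_space_axioms)
  have sets_eq: "sets (\<mu> \<Otimes>\<^sub>M ?P) = sets (borel \<Otimes>\<^sub>M PiM K (\<lambda>_. borel))"
    by (rule sets_pair_measure_cong[OF sets_mu sets_PiM_mu])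
  have Rm: "rotate_pair K \<in> measurable (\<mu> \<Otimes>\<^sub>M ?P) (borel \<Otimes>\<^sub>M PiM K (\<lambda>_. borel))"
    using rotate_pair_measurable measurable_cong_sets[OF sets_eq refl] by blast
  show ?thesis
  proof (rule measure_eqI)
    fix A assume "A \<in> sets (distr (\<mu> \<Otimes>\<^sub>M ?P) (borel \<Otimes>\<^sub>M PiM K (\<lambda>_. borel)) (rotate_pair K))"
    then have A: "A \<in> sets (borel \<Otimes>\<^sub>M PiM K (\<lambda>_. borel))" by simp
    then have A': "A \<in> sets (\<mu> \<Otimes>\<^sub>M ?P)" by (simp add: sets_eq)
    have RA: "rotate_pair K -` A \<inter> space (\<mu> \<Otimes>\<^sub>M ?P) \<in> sets (\<mu> \<Otimes>\<^sub>M ?P)"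
      by (rule measurable_sets[OF Rm A])
    have slice: "emeasure ?P (Pair a -` (rotate_pair K -` A \<inter> space (\<mu> \<Otimes>\<^sub>M ?P))) = emeasure ?P (Pair a -` A)" for a
    proof -
      let ?r = "\<lambda>y. \<lambda>j\<in>K. cis (- Arg a) * y j"
      have rm: "?r \<in> measurable ?P ?P"
      proof (rule measurable_restrict)
        fix j assume j: "j \<in> K"
        have "(\<lambda>y. y j) \<in> measurable ?P \<mu>" by (rule measurable_component_singleton[OF j])
        then have [measurable]: "(\<lambda>y. y j) \<in> borel_measurable ?P" using measurable_cong_sets[OF refl sets_mu] by blast
        have "(\<lambda>y. cis (- Arg a) * y j) \<in> borel_measurable ?P" by measurable
        then show "(\<lambda>y. cis (- Arg a) * y j) \<in> measurable ?P \<mu>" using measurable_cong_sets[OF refl sets_mu] by blast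
      qed
      have "Pair a -` (rotate_pair K -` A \<inter> space (\<mu> \<Otimes>\<^sub>M ?P)) = ?r -` (Pair a -` A) \<inter> space ?P"
        by (auto simp: rotate_pair_def space_pair_measure space_mu)
      then have "emeasure ?P (Pair a -` (rotate_pair K -` A \<inter> space (\<mu> \<Otimes>\<^sub>M ?P))) = emeasure (distr ?P ?P ?r) (Pair a -` A)"
        using sets_Pair1[OF A', of a] rm by (simp add: emeasure_distr)
      then show ?thesis unfolding rotate_PiM[OF K] .
    qed
    have "emeasure (distr (\<mu> \<Otimes>\<^sub>M ?P) (borel \<Otimes>\<^sub>M PiM K (\<lambda>_. borel)) (rotate_pair K)) A = emeasure (\<mu> \<Otimes>\<^sub>M ?P) (rotate_pair K -` A \<inter> space (\<mu> \<Otimes>\<^sub>M ?P))"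
      by (rule emeasure_distr[OF Rm A])
    also have "\<dots> = (\<integral>\<^sup>+a. emeasure ?P (Pair a -` (rotate_pair K -` A \<inter> space (\<mu> \<Otimes>\<^sub>M ?P))) \<partial>\<mu>)"
      by (rule P.emeasure_pair_measure_alt[OF RA])
    also have "\<dots> = (\<integral>\<^sup>+a. emeasure ?P (Pair a -` A) \<partial>\<mu>)" unfolding slice ..
    also have "\<dots> = emeasure (\<mu> \<Otimes>\<^sub>M ?P) A" by (rule P.emeasure_pair_measure_alt[OF A', symmetric])
    finally show "emeasure (distr (\<mu> \<Otimes>\<^sub>M ?P) (borel \<Otimes>\<^sub>M PiM K (\<lambda>_. borel)) (rotate_pair K)) A = emeasure (\<mu> \<Otimes>\<^sub>M ?P) A" .
  qed (simp add: sets_eq)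
qed

lemma pair_measurable: "(\<lambda>\<omega>. (X k \<omega>, \<lambda>j\<in>K. X j \<omega>)) \<in> measurable M (borel \<Otimes>\<^sub>M PiM K (\<lambda>_. borel))"
  by (intro measurable_Pair measurable_restrict X_measurable)

lemma rotation_law:
  assumes k: "1 \<le> k" and K: "finite K" "K \<noteq> {}" "K \<subseteq> {1..}" "k \<notin> K"
  shows "distr M (borel \<Otimes>\<^sub>M PiM K (\<lambda>_. borel)) (\<lambda>\<omega>. (X k \<omega>, \<lambda>j\<in>K. cis (- Arg (X k \<omega>)) * X j \<omega>)) =
    distr M (borel \<Otimes>\<^sub>M PiM K (\<lambda>_. borel)) (\<lambda>\<omega>. (X k \<omega>, \<lambda>j\<in>K. X j \<omega>))"
proof -
  let ?B = "borel \<Otimes>\<^sub>M PiM K (\<lambda>_. borel)"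
  have "distr M ?B (\<lambda>\<omega>. (X k \<omega>, \<lambda>j\<in>K. X j \<omega>)) = distr (distr M ?B (\<lambda>\<omega>. (X k \<omega>, \<lambda>j\<in>K. X j \<omega>))) ?B (rotate_pair K)"
    unfolding joint_law(2)[OF assms] rotate_joint[OF K(1)] ..
  also have "\<dots> = distr M ?B (rotate_pair K \<circ> (\<lambda>\<omega>. (X k \<omega>, \<lambda>j\<in>K. X j \<omega>)))"
    by (rule distr_distr[OF rotate_pair_measurable pair_measurable])
  also have "rotate_pair K \<circ> (\<lambda>\<omega>. (X k \<omega>, \<lambda>j\<in>K. X j \<omega>)) = (\<lambda>\<omega>. (X k \<omega>, \<lambda>j\<in>K. cis (- Arg (X k \<omega>)) * X j \<omega>))"
    by (auto simp: rotate_pair_def fun_eq_iff restrict_def)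
  finally show ?thesis ..
qed

lemma rotated_pair_measurable: "(\<lambda>\<omega>. (X k \<omega>, \<lambda>j\<in>K. cis (- Arg (X k \<omega>)) * X j \<omega>)) \<in> measurable M (borel \<Otimes>\<^sub>M PiM K (\<lambda>_. borel))"
  by (intro measurable_Pair measurable_restrict) measurable

lemma rotation_integral:
  fixes \<Phi> :: "complex \<times> (nat \<Rightarrow> complex) \<Rightarrow> complex"
  assumes "1 \<le> k" "finite K" "K \<noteq> {}" "K \<subseteq> {1..}" "k \<notin> K"
    and \<Phi>: "\<Phi> \<in> borel_measurable (borel \<Otimes>\<^sub>M PiM K (\<lambda>_. borel))"
  shows "(CLINT \<omega>|M. \<Phi> (X k \<omega>, \<lambda>j\<in>K. cis (- Arg (X k \<omega>)) * X j \<omega>)) = (CLINT \<omega>|M. \<Phi> (X k \<omega>, \<lambda>j\<in>K. X j \<omega>))"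
  using arg_cong[OF rotation_law[OF assms(1-5)], of "\<lambda>D. integral\<^sup>L D \<Phi>"]
  by (simp add: integral_distr[OF rotated_pair_measurable \<Phi>] integral_distr[OF pair_measurable \<Phi>])

text \<open>The rest of the sample, seen from the direction of X k, is independent of X k and
  distributed like the unrotated rest. An event required only when X k is in the layer therefore
  pays the layer probability as a factor.\<close>

lemma rotation_prob:
  assumes "1 \<le> k" "finite K" "K \<noteq> {}" "K \<subseteq> {1..}" "k \<notin> K"
    and A: "A \<in> sets borel" and Q: "Q \<in> sets (PiM K (\<lambda>_. borel))"
  shows "M.prob {\<omega> \<in> space M. X k \<omega> \<in> A \<and> (\<lambda>j\<in>K. cis (- Arg (X k \<omega>)) * X j \<omega>) \<in> Q} =
    measure \<mu> A * M.prob {\<omega> \<in> space M. (\<lambda>j\<in>K. X j \<omega>) \<in> Q}"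
proof -
  let ?B = "borel \<Otimes>\<^sub>M PiM K (\<lambda>_. borel)"
  have AQ: "A \<times> Q \<in> sets ?B" using A Q by simp
  have "{\<omega> \<in> space M. X k \<omega> \<in> A \<and> (\<lambda>j\<in>K. cis (- Arg (X k \<omega>)) * X j \<omega>) \<in> Q} = (\<lambda>\<omega>. (X k \<omega>, \<lambda>j\<in>K. cis (- Arg (X k \<omega>)) * X j \<omega>)) -` (A \<times> Q) \<inter> space M"
    by auto
  then have "M.prob {\<omega> \<in> space M. X k \<omega> \<in> A \<and> (\<lambda>j\<in>K. cis (- Arg (X k \<omega>)) * X j \<omega>) \<in> Q} = measure (distr M ?B (\<lambda>\<omega>. (X k \<omega>, \<lambda>j\<in>K. X j \<omega>))) (A \<times> Q)"
    unfolding rotation_law[OF assms(1-5), symmetric] by (simp add: measure_distr[OF rotated_pair_measurable AQ])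
  also have "\<dots> = measure (\<mu> \<Otimes>\<^sub>M PiM K (\<lambda>_. \<mu>)) (A \<times> Q)" unfolding joint_law(2)[OF assms(1-5)] ..
  also have "\<dots> = measure \<mu> A * measure (PiM K (\<lambda>_. \<mu>)) Q"
  proof -
    interpret P: prob_space "PiM K (\<lambda>_. \<mu>)" by (rule prob_space_PiM) (rule prob_space_axioms)
    show ?thesis using A Q by (simp add: measure_def P.emeasure_pair_measure_Times sets_mu sets_PiM_mu enn2real_mult)
  qed
  also have "measure (PiM K (\<lambda>_. \<mu>)) Q = M.prob ((\<lambda>\<omega>. \<lambda>j\<in>K. X j \<omega>) -` Q \<inter> space M)"
    unfolding joint_law(1)[OF assms(1-5), symmetric] by (rule measure_distr[OF _ Q]) (intro measurable_restrict X_measurable)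
  also have "(\<lambda>\<omega>. \<lambda>j\<in>K. X j \<omega>) -` Q \<inter> space M = {\<omega> \<in> space M. (\<lambda>j\<in>K. X j \<omega>) \<in> Q}" by auto
  finally show ?thesis .
qed

lemma second_moment_sum:
  fixes f :: "complex \<Rightarrow> complex"
  assumes K: "finite K" "K \<subseteq> {1..}" and [measurable]: "f \<in> borel_measurable borel"
    and b: "\<And>z. norm (f z) \<le> b" and mean: "(CLINT z|\<mu>. f z) = 0"
  shows "(LINT \<omega>|M. (norm (\<Sum>j\<in>K. f (X j \<omega>)))\<^sup>2) = real (card K) * (LINT z|\<mu>. (norm (f z))\<^sup>2)"
proof -
  have b0: "0 \<le> b" using b[of 0] norm_ge_zero order_trans by blast
  have cnj_m [measurable]: "cnj \<in> borel_measurable borel"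
    by (intro borel_measurable_continuous_onI continuous_intros)
  have [measurable]: "(\<lambda>\<omega>. f (X j \<omega>) * cnj (f (X k \<omega>))) \<in> borel_measurable M" for j k
    by measurable
  have i: "integrable M (\<lambda>\<omega>. f (X j \<omega>) * cnj (f (X k \<omega>)))" for j k
    using b b0 by (intro M.integrable_const_bound[of _ "b * b"]) (auto simp: norm_mult intro!: mult_mono AE_I2)
  have cross: "(CLINT \<omega>|M. f (X j \<omega>) * cnj (f (X k \<omega>))) = (if j = k then complex_of_real (LINT z|\<mu>. (norm (f z))\<^sup>2) else 0)"
    if "j \<in> K" "k \<in> K" for j k
  proof (cases "j = k")
    case True
    have "(CLINT \<omega>|M. f (X j \<omega>) * cnj (f (X k \<omega>))) = (CLINT \<omega>|M. complex_of_real ((norm (f (X j \<omega>)))\<^sup>2))"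
      using True by (simp add: complex_norm_square[symmetric])
    also have "\<dots> = complex_of_real (LINT \<omega>|M. (norm (f (X j \<omega>)))\<^sup>2)" by (rule integral_complex_of_real)
    also have "(LINT \<omega>|M. (norm (f (X j \<omega>)))\<^sup>2) = (LINT z|\<mu>. (norm (f z))\<^sup>2)"
      by (rule integral_X) (use that K in auto)
    finally show ?thesis using True by simp
  next
    case False
    \<comment> \<open>Conjugating at one index only turns the mixed term into a product over the
      two-element index set {j, k}, the form in which independence is available.\<close>
    define F where "F i z = (if i = j then f z else cnj (f z))" for i z
    have [measurable]: "F i \<in> borel_measurable borel" for i unfolding F_def by measurable
    have iv: "M.indep_vars (\<lambda>_. borel) (\<lambda>i \<omega>. F i (X i \<omega>)) {j, k}"
      by (rule M.indep_vars_compose2[OF M.indep_vars_subset[OF indep]]) (use that K in auto)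
    have "(CLINT \<omega>|M. (\<Prod>i\<in>{j, k}. F i (X i \<omega>))) = (\<Prod>i\<in>{j, k}. CLINT \<omega>|M. F i (X i \<omega>))"
    proof (rule M.indep_vars_lebesgue_integral[OF _ iv])
      show "integrable M (\<lambda>\<omega>. F i (X i \<omega>))" for i
        using b by (intro M.integrable_const_bound[of _ b]) (auto simp: F_def)
    qed simp
    also have "\<dots> = (CLINT \<omega>|M. F j (X j \<omega>)) * (CLINT \<omega>|M. F k (X k \<omega>))" using False by simp
    also have "(CLINT \<omega>|M. F j (X j \<omega>)) = 0"
      using integral_X[of j f] that K mean by (auto simp: F_def)
    finally show ?thesis using False by (simp add: F_def)
  qed
  have "complex_of_real (LINT \<omega>|M. (norm (\<Sum>j\<in>K. f (X j \<omega>)))\<^sup>2) = (CLINT \<omega>|M. complex_of_real ((norm (\<Sum>j\<in>K. f (X j \<omega>)))\<^sup>2))"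
    by (rule integral_complex_of_real[symmetric])
  also have "\<dots> = (CLINT \<omega>|M. (\<Sum>j\<in>K. \<Sum>k\<in>K. f (X j \<omega>) * cnj (f (X k \<omega>))))"
    by (rule Bochner_Integration.integral_cong[OF refl], subst complex_norm_square) (simp only: cnj_sum sum_product)
  also have "\<dots> = (\<Sum>j\<in>K. \<Sum>k\<in>K. (CLINT \<omega>|M. f (X j \<omega>) * cnj (f (X k \<omega>))))"
    using i by (simp add: Bochner_Integration.integral_sum)
  also have "\<dots> = (\<Sum>j\<in>K. \<Sum>k\<in>K. (if j = k then complex_of_real (LINT z|\<mu>. (norm (f z))\<^sup>2) else 0))"
    by (intro sum.cong refl cross)
  also have "\<dots> = complex_of_real (real (card K) * (LINT z|\<mu>. (norm (f z))\<^sup>2))"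
    using K(1) by simp
  finally show ?thesis using of_real_eq_iff by blast
qed

text \<open>The failure of \<open>sep\<close>, \<open>fluct\<close> or \<open>square_sum\<close> of
  \<open>separated_roots\<close>, written for points already rotated so that the reference direction
  is 1.\<close>

definition bad_set :: "nat \<Rightarrow> real \<Rightarrow> real \<Rightarrow> real \<Rightarrow> nat set \<Rightarrow> (nat \<Rightarrow> complex) set" where
  "bad_set n \<eta> w B K = {y \<in> space (PiM K (\<lambda>_. borel)). (\<exists>j\<in>K. norm (1 - y j) < \<eta>) \<or>
     w < norm ((\<Sum>j\<in>K. recip_gap (y j)) - of_nat n) \<or> B < (\<Sum>j\<in>K. (norm (recip_gap (y j)))\<^sup>2)}"

lemma bad_set_measurable:
  assumes "finite K"
  shows "bad_set n \<eta> w B K \<in> sets (PiM K (\<lambda>_. borel))"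
proof -
  have [measurable]: "(\<lambda>y. \<Sum>j\<in>K. recip_gap (y j)) \<in> borel_measurable (PiM K (\<lambda>_. borel))"
    "(\<lambda>y. \<Sum>j\<in>K. (norm (recip_gap (y j)))\<^sup>2) \<in> borel_measurable (PiM K (\<lambda>_. borel))"
    by (intro borel_measurable_sum; measurable)+
  have 1: "{y \<in> space (PiM K (\<lambda>_. borel)). norm (1 - y j :: complex) < \<eta>} \<in> sets (PiM K (\<lambda>_. borel))" if "j \<in> K" for j
  proof -
    have [measurable]: "(\<lambda>y. y j :: complex) \<in> borel_measurable (PiM K (\<lambda>_. borel))" using that by simp
    show ?thesis by measurable
  qed
  have "bad_set n \<eta> w B K = (\<Union>j\<in>K. {y \<in> space (PiM K (\<lambda>_. borel)). norm (1 - y j) < \<eta>}) \<union>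
     {y \<in> space (PiM K (\<lambda>_. borel)). w < norm ((\<Sum>j\<in>K. recip_gap (y j)) - of_nat n)} \<union>
     {y \<in> space (PiM K (\<lambda>_. borel)). B < (\<Sum>j\<in>K. (norm (recip_gap (y j)))\<^sup>2)}"
    by (auto simp: bad_set_def)
  also have "\<dots> \<in> sets (PiM K (\<lambda>_. borel))"
    using 1 assms by (intro sets.Un sets.finite_UN) auto
  finally show ?thesis .
qed

text \<open>The estimate is made for the truncation h, which agrees with \<open>recip_gap\<close> on
  the sample unless some point falls within \<eta> of 1. That event has a union bound, the deviation
  of the sum of h a Chebyshev bound, and the sum of squares a Markov bound. The hypothesis on w
  reserves half of it for the bias: truncation shifts each mean by at most \<eta>^0.8 times
  \<open>gap_moment\<close>.\<close>

lemma bad_set_prob: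
  assumes K: "K = {1..n} - {k}" "k \<in> {1..n}" and \<eta>: "0 < \<eta>" "\<eta> \<le> 1" and w: "0 < w" "2 * (real n * \<eta> powr 0.8 * gap_moment + 1) \<le> w" and B: "0 < B"
  shows "M.prob {\<omega> \<in> space M. (\<lambda>j\<in>K. X j \<omega>) \<in> bad_set n \<eta> w B K} \<le>
     real n * (disc_const * \<eta> powr 1.905) + 4 * real n * (\<eta> powr (-0.2) * gap_moment) / w\<^sup>2 + real n * (\<eta> powr (-0.2) * gap_moment) / B"
proof -
  have fin: "finite K" and Ks: "K \<subseteq> {1..}" and cK: "card K = n - 1" using K by auto
  have n1: "1 \<le> n" using K by auto
  have cKn: "real (card K) \<le> real n" using cK by simp
  define h where "h z = recip_gap z * indicator {z. \<eta> \<le> norm (1 - z)} z" for z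
  have [measurable]: "h \<in> borel_measurable borel" unfolding h_def by measurable
  have hb: "norm (h z) \<le> 1 / \<eta>" for z
    using \<eta> by (auto simp: h_def recip_gap_def norm_divide indicator_def intro!: frac_le)
  have hi: "integrable \<mu> h" using hb by (intro integrable_const_bound[of _ "1 / \<eta>"]) auto
  define m where "m = (CLINT z|\<mu>. h z)"
  have m1: "norm (m - 1) \<le> \<eta> powr 0.8 * gap_moment"
  proof -
    have "m - 1 = (CLINT z|\<mu>. h z - recip_gap z)"
      unfolding m_def using hi integrable_recip_gap by (simp add: mean_recip_gap)
    also have "norm \<dots> \<le> (LINT z|\<mu>. norm (recip_gap z) * indicator {z. norm (1 - z) < \<eta>} z)"
    proof (rule norm_integral_le)
      show "integrable \<mu> (\<lambda>z. norm (recip_gap z) * indicator {z. norm (1 - z) < \<eta>} z)"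
        by (rule integrable_real_mult_indicator[OF _ integrable_norm[OF integrable_recip_gap]]) (simp add: sets_mu)
    qed (auto simp: h_def indicator_def)
    also have "\<dots> \<le> \<eta> powr 0.8 * gap_moment" by (rule recip_gap_truncated_tail[OF \<eta>(1)])
    finally show ?thesis .
  qed
  define V where "V = (LINT z|\<mu>. (norm (h z))\<^sup>2)"
  have V: "V \<le> \<eta> powr (-0.2) * gap_moment"
  proof -
    have "(\<lambda>z. (norm (h z))\<^sup>2) = (\<lambda>z. (norm (recip_gap z))\<^sup>2 * indicator {z. \<eta> \<le> norm (1 - z)} z)"
      by (auto simp: h_def fun_eq_iff indicator_def)
    then show ?thesis unfolding V_def using recip_gap_truncated_square(2)[OF \<eta>(1)] by simp
  qed
  have V0: "0 \<le> V" unfolding V_def by (rule Bochner_Integration.integral_nonneg) simp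
  have h2i: "integrable \<mu> (\<lambda>z. (norm (h z))\<^sup>2)"
    using hb \<eta> by (intro integrable_const_bound[of _ "(1 / \<eta>)\<^sup>2"]) (auto intro!: power_mono AE_I2 simp del: power_divide)
  have Vm: "(LINT z|\<mu>. (norm (h z - m))\<^sup>2) \<le> V"
  proof -
    have eq: "(norm (h z - m))\<^sup>2 = (norm (h z))\<^sup>2 + (norm m)\<^sup>2 - 2 * (m \<bullet> h z)" for z
      by (simp add: power2_norm_eq_inner inner_diff_left inner_diff_right inner_commute)
    have "(LINT z|\<mu>. (norm (h z - m))\<^sup>2) = V + (norm m)\<^sup>2 - 2 * (m \<bullet> m)"
      unfolding eq using h2i hi by (simp add: V_def prob_space integral_inner_right[OF hi] m_def[symmetric])
    also have "\<dots> = V - (norm m)\<^sup>2" by (simp add: power2_norm_eq_inner)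
    finally show ?thesis by simp
  qed
  define dev where "dev \<omega> = (\<Sum>j\<in>K. h (X j \<omega>) - m)" for \<omega>
  have [measurable]: "dev \<in> borel_measurable M" unfolding dev_def by measurable
  have dev_b: "norm (dev \<omega>) \<le> real (card K) * (1 / \<eta> + norm m)" for \<omega>
    unfolding dev_def by (rule sum_norm_bound) (use norm_triangle_ineq4[of "h (X _ \<omega>)" m] hb[of "X _ \<omega>"] in \<open>force intro: order_trans\<close>)
  have dev2: "(LINT \<omega>|M. (norm (dev \<omega>))\<^sup>2) \<le> real n * (\<eta> powr (-0.2) * gap_moment)"
  proof -
    have "(LINT \<omega>|M. (norm (dev \<omega>))\<^sup>2) = real (card K) * (LINT z|\<mu>. (norm (h z - m))\<^sup>2)"
      unfolding dev_def
    proof (rule second_moment_sum[where f="\<lambda>z. h z - m" and b="1 / \<eta> + norm m"])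
      show "norm (h z - m) \<le> 1 / \<eta> + norm m" for z using norm_triangle_ineq4[of "h z" m] hb[of z] by linarith
      show "(CLINT z|\<mu>. h z - m) = 0" using hi by (simp add: m_def prob_space)
    qed (use fin Ks in auto)
    also have "\<dots> \<le> real n * (\<eta> powr (-0.2) * gap_moment)"
      using Vm V V0 cKn by (intro mult_mono) (auto intro: Bochner_Integration.integral_nonneg)
    finally show ?thesis .
  qed
  define E1 where "E1 = {\<omega> \<in> space M. \<exists>j\<in>K. norm (1 - X j \<omega>) < \<eta>}"
  define E2 where "E2 = {\<omega> \<in> space M. (w / 2)\<^sup>2 \<le> (norm (dev \<omega>))\<^sup>2}"
  define E3 where "E3 = {\<omega> \<in> space M. B \<le> (\<Sum>j\<in>K. (norm (h (X j \<omega>)))\<^sup>2)}"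
  have E1': "E1 = (\<Union>j\<in>K. {\<omega> \<in> space M. X j \<omega> \<in> {z. norm (1 - z) < \<eta>}})" by (auto simp: E1_def)
  have ms [measurable]: "E1 \<in> sets M" "E2 \<in> sets M" "E3 \<in> sets M"
    unfolding E1' E2_def E3_def using fin by (auto intro!: sets.finite_UN)
  have P1: "M.prob E1 \<le> real n * (disc_const * \<eta> powr 1.905)"
  proof -
    have "M.prob E1 \<le> (\<Sum>j\<in>K. M.prob {\<omega> \<in> space M. X j \<omega> \<in> {z. norm (1 - z) < \<eta>}})"
      unfolding E1' by (rule measure_UNION_le[OF fin]) simp
    also have "\<dots> \<le> (\<Sum>j\<in>K. disc_const * \<eta> powr 1.905)"
    proof (rule sum_mono)
      fix j assume "j \<in> K"
      then have "M.prob {\<omega> \<in> space M. X j \<omega> \<in> {z. norm (1 - z) < \<eta>}} = measure \<mu> {z. norm (1 - z) < \<eta>}"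
        using Ks by (intro prob_X) auto
      also have "\<dots> \<le> measure \<mu> {z. norm (1 - z) \<le> \<eta>}" by (rule finite_measure_mono) (auto simp: sets_mu)
      also have "\<dots> \<le> disc_const * \<eta> powr 1.905" by (rule disc_prob_le[OF \<eta>])
      finally show "M.prob {\<omega> \<in> space M. X j \<omega> \<in> {z. norm (1 - z) < \<eta>}} \<le> disc_const * \<eta> powr 1.905" .
    qed
    also have "\<dots> \<le> real n * (disc_const * \<eta> powr 1.905)" using cKn disc_const_pos by (simp add: mult_right_mono)
    finally show ?thesis .
  qed
  have P2: "M.prob E2 \<le> 4 * real n * (\<eta> powr (-0.2) * gap_moment) / w\<^sup>2"
  proof -
    have i: "integrable M (\<lambda>\<omega>. (norm (dev \<omega>))\<^sup>2)"
    proof (rule M.integrable_const_bound[of _ "(real (card K) * (1 / \<eta> + norm m))\<^sup>2"])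
      show "AE \<omega> in M. norm ((norm (dev \<omega>))\<^sup>2) \<le> (real (card K) * (1 / \<eta> + norm m))\<^sup>2"
        using dev_b by (intro AE_I2) (simp add: power_mono del: power_mult_distrib)
    qed simp
    have "M.prob E2 \<le> (LINT \<omega>|M. (norm (dev \<omega>))\<^sup>2) / (w / 2)\<^sup>2"
      unfolding E2_def by (rule integral_Markov_inequality_measure[OF i, where A="{}"]) (use w in auto)
    also have "\<dots> \<le> real n * (\<eta> powr (-0.2) * gap_moment) / (w / 2)\<^sup>2" using dev2 by (intro divide_right_mono) auto
    also have "\<dots> = 4 * real n * (\<eta> powr (-0.2) * gap_moment) / w\<^sup>2" by (simp add: power_divide)
    finally show ?thesis .
  qed
  have P3: "M.prob E3 \<le> real n * (\<eta> powr (-0.2) * gap_moment) / B"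
  proof -
    have ij: "integrable M (\<lambda>\<omega>. (norm (h (X j \<omega>)))\<^sup>2)" for j
      using hb \<eta> by (intro M.integrable_const_bound[of _ "(1 / \<eta>)\<^sup>2"]) (auto intro!: power_mono AE_I2 simp del: power_divide)
    have "M.prob E3 \<le> (LINT \<omega>|M. (\<Sum>j\<in>K. (norm (h (X j \<omega>)))\<^sup>2)) / B"
      unfolding E3_def by (rule integral_Markov_inequality_measure[where A="{}"]) (use B ij in \<open>auto intro!: sum_nonneg\<close>)
    also have "(LINT \<omega>|M. (\<Sum>j\<in>K. (norm (h (X j \<omega>)))\<^sup>2)) = (\<Sum>j\<in>K. V)"
    proof -
      have "(LINT \<omega>|M. (norm (h (X j \<omega>)))\<^sup>2) = V" if "j \<in> K" for j
        unfolding V_def by (rule integral_X) (use that Ks in auto)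
      then show ?thesis using ij by (simp add: Bochner_Integration.integral_sum)
    qed
    also have "\<dots> \<le> real n * (\<eta> powr (-0.2) * gap_moment)" using cKn V V0 by (simp add: mult_mono)
    finally show ?thesis using B by (simp add: divide_right_mono)
  qed
  have sub: "{\<omega> \<in> space M. (\<lambda>j\<in>K. X j \<omega>) \<in> bad_set n \<eta> w B K} \<subseteq> E1 \<union> E2 \<union> E3"
  proof
    fix \<omega> assume \<omega>: "\<omega> \<in> {\<omega> \<in> space M. (\<lambda>j\<in>K. X j \<omega>) \<in> bad_set n \<eta> w B K}"
    show "\<omega> \<in> E1 \<union> E2 \<union> E3"
    proof (cases "\<omega> \<in> E1")
      case False
      then have far: "\<eta> \<le> norm (1 - X j \<omega>)" if "j \<in> K" for j using \<omega> that by (auto simp: E1_def not_less)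
      have hX: "h (X j \<omega>) = recip_gap (X j \<omega>)" if "j \<in> K" for j using far[OF that] by (simp add: h_def)
      have "w < norm ((\<Sum>j\<in>K. recip_gap (X j \<omega>)) - of_nat n) \<or> B < (\<Sum>j\<in>K. (norm (recip_gap (X j \<omega>)))\<^sup>2)"
        using \<omega> far by (auto simp: bad_set_def not_less[symmetric])
      then show ?thesis
      proof
        assume "B < (\<Sum>j\<in>K. (norm (recip_gap (X j \<omega>)))\<^sup>2)"
        then have "\<omega> \<in> E3" using \<omega> hX by (simp add: E3_def)
        then show ?thesis by simp
      next
        assume a: "w < norm ((\<Sum>j\<in>K. recip_gap (X j \<omega>)) - of_nat n)"
        have d: "dev \<omega> = (\<Sum>j\<in>K. recip_gap (X j \<omega>)) - of_nat (card K) * m"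
          using hX by (simp add: dev_def sum_subtractf)
        \<comment> \<open>The extra 1 comes from comparing n - 1 summands with the centring
          n.\<close>
        have "of_nat (card K) * m - of_nat n = of_nat (card K) * (m - 1) - 1"
          unfolding cK using n1 by (simp add: algebra_simps of_nat_diff)
        then have "(\<Sum>j\<in>K. recip_gap (X j \<omega>)) - of_nat n = dev \<omega> + (of_nat (card K) * (m - 1) - 1)"
          unfolding d by (simp add: algebra_simps)
        then have "w < norm (dev \<omega>) + norm (of_nat (card K) * (m - 1) - 1)"
          using a norm_triangle_ineq[of "dev \<omega>" "of_nat (card K) * (m - 1) - 1"] by simp
        also have "norm (of_nat (card K) * (m - 1) - 1) \<le> real (card K) * norm (m - 1) + 1"
          using norm_triangle_ineq4[of "of_nat (card K) * (m - 1)" 1] by (simp add: norm_mult)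
        also have "real (card K) * norm (m - 1) \<le> real n * (\<eta> powr 0.8 * gap_moment)"
          using m1 cKn by (intro mult_mono) auto
        finally have "w / 2 \<le> norm (dev \<omega>)" using w(2) by simp
        then have "(w / 2)\<^sup>2 \<le> (norm (dev \<omega>))\<^sup>2" using w(1) by (intro power_mono) auto
        then show ?thesis using \<omega> by (simp add: E2_def)
      qed
    qed simp
  qed
  have "M.prob {\<omega> \<in> space M. (\<lambda>j\<in>K. X j \<omega>) \<in> bad_set n \<eta> w B K} \<le> M.prob (E1 \<union> E2 \<union> E3)"
    using sub by (rule M.finite_measure_mono) simp
  also have "\<dots> \<le> M.prob (E1 \<union> E2) + M.prob E3" by (rule measure_Un_le) auto
  also have "M.prob (E1 \<union> E2) \<le> M.prob E1 + M.prob E2" by (rule measure_Un_le) auto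
  finally show ?thesis using P1 P2 P3 by linarith
qed
end

section \<open>Comparison with the sum of independent terms\<close>

lemma norm_iexp_diff_le: "norm (iexp a - iexp b) \<le> \<bar>a - b\<bar>"
proof -
  have "iexp a - iexp b = iexp b * (iexp (a - b) - 1)"
    by (simp add: right_diff_distrib exp_add[symmetric] algebra_simps)
  then have "norm (iexp a - iexp b) = norm (iexp (a - b) - 1)" by (simp add: norm_mult)
  also have "\<dots> \<le> \<bar>a - b\<bar>" using iexp_approx1[of "a - b" 0] by simp
  finally show ?thesis .
qed

context iid_sample
begin

section \<open>Probabilities of the exceptional events\<close>

lemma prob_all_inner:
  assumes "1 \<le> n" "0 < s" "s \<le> \<epsilon>"
  shows "M.prob {\<omega> \<in> space M. \<forall>j\<in>{1..n}. norm (X j \<omega>) < 1 - s} \<le> exp (- (c * s * real n))"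
proof -
  let ?A = "{z. norm z < 1 - s} :: complex set"
  have A: "?A \<in> sets borel" by simp
  have "{\<omega> \<in> space M. \<forall>j\<in>{1..n}. norm (X j \<omega>) < 1 - s} = (\<Inter>j\<in>{1..n}. X j -` ?A \<inter> space M)"
    using assms(1) by auto
  then have "M.prob {\<omega> \<in> space M. \<forall>j\<in>{1..n}. norm (X j \<omega>) < 1 - s} = (\<Prod>j\<in>{1..n}. M.prob (X j -` ?A \<inter> space M))"
    using M.indep_varsD[OF indep, of "{1..n}" "\<lambda>_. ?A"] assms(1) by auto
  also have "\<dots> = (\<Prod>j\<in>{1..n}. measure \<mu> ?A)"
  proof (rule prod.cong[OF refl])
    fix j assume "j \<in> {1..n}"
    then have "M.prob {\<omega> \<in> space M. X j \<omega> \<in> ?A} = measure \<mu> ?A" by (intro prob_X) auto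
    moreover have "X j -` ?A \<inter> space M = {\<omega> \<in> space M. X j \<omega> \<in> ?A}" by auto
    ultimately show "M.prob (X j -` ?A \<inter> space M) = measure \<mu> ?A" by simp
  qed
  also have "\<dots> = (measure \<mu> ?A) ^ n" by simp
  also have "measure \<mu> ?A = 1 - measure \<mu> {z. 1 - s \<le> norm z}"
  proof -
    have "?A = space \<mu> - {z. 1 - s \<le> norm z}" by (auto simp: space_mu)
    then show ?thesis using prob_compl[of "{z. 1 - s \<le> norm z}"] by (simp add: sets_mu)
  qed
  also have "(1 - measure \<mu> {z. 1 - s \<le> norm z}) ^ n \<le> exp (- (c * s)) ^ n"
  proof (rule power_mono)
    have "1 - measure \<mu> {z. 1 - s \<le> norm z} \<le> 1 + (- (c * s))" using outer_prob_ge[of s] assms by simp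
    also have "\<dots> \<le> exp (- (c * s))" by (rule exp_ge_add_one_self)
    finally show "1 - measure \<mu> {z. 1 - s \<le> norm z} \<le> exp (- (c * s))" .
  qed simp
  also have "\<dots> = exp (- (c * s * real n))" by (simp add: exp_of_nat_mult[symmetric] mult_ac)
  finally show ?thesis .
qed

lemma prob_many_outer:
  assumes "0 \<le> t" "t \<le> \<epsilon>" "0 < N"
  shows "M.prob {\<omega> \<in> space M. N \<le> real (card {j \<in> {1..n}. 1 - t \<le> norm (X j \<omega>)})} \<le> real n * (C / 0.905 * t powr 0.905) / N"
proof -
  let ?u = "\<lambda>\<omega>. \<Sum>j\<in>{1..n}. indicat_real {z. 1 - t \<le> norm z} (X j \<omega>)"
  have u: "real (card {j \<in> {1..n}. 1 - t \<le> norm (X j \<omega>)}) = ?u \<omega>" for \<omega>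
    by (simp add: indicator_def sum.If_cases Int_def)
  have i: "integrable M (\<lambda>\<omega>. indicat_real {z. 1 - t \<le> norm z} (X j \<omega>))" for j
    by (rule M.integrable_const_bound[of _ 1]) (auto simp: indicator_def)
  have "M.prob {\<omega> \<in> space M. N \<le> ?u \<omega>} \<le> (LINT \<omega>|M. ?u \<omega>) / N"
    by (rule integral_Markov_inequality_measure[where A="{}"]) (use i assms in \<open>auto intro!: sum_nonneg\<close>)
  also have "(LINT \<omega>|M. ?u \<omega>) = (\<Sum>j\<in>{1..n}. measure \<mu> {z. 1 - t \<le> norm z})"
  proof -
    have "(LINT \<omega>|M. indicat_real {z. 1 - t \<le> norm z} (X j \<omega>)) = measure \<mu> {z. 1 - t \<le> norm z}" if "j \<in> {1..n}" for j
      using integral_X[of j "indicat_real {z. 1 - t \<le> norm z}"] that by (simp add: sets_mu)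
    then show ?thesis using i by (simp add: Bochner_Integration.integral_sum)
  qed
  also have "\<dots> \<le> real n * (C / 0.905 * t powr 0.905)"
    using mult_left_mono[OF outer_prob_le[OF assms(1,2)], of "real n"] by simp
  finally show ?thesis unfolding u using assms(3) by (simp add: divide_right_mono)
qed

text \<open>For fixed X i in the layer, the modulus of the independent point X j is confined to an
  interval of length 2 g. The condition s + g \<le> \<epsilon> keeps this interval where the density
  bound holds.\<close>

lemma prob_close_pair:
  assumes s: "0 \<le> s" "0 < g" "s + g \<le> \<epsilon>" "2 * g \<le> 1" and ij: "1 \<le> i" "1 \<le> j" "i \<noteq> j"
  shows "M.prob {\<omega> \<in> space M. 1 - s \<le> norm (X i \<omega>) \<and> \<bar>norm (X i \<omega>) - norm (X j \<omega>)\<bar> < g} \<le>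
    (C / 0.905 * s powr 0.905) * (C / 0.905 * (2 * g) powr 0.905)"
proof -
  let ?P = "PiM {j} (\<lambda>_. \<mu>)" and ?B = "borel \<Otimes>\<^sub>M PiM {j} (\<lambda>_. borel) :: (complex \<times> (nat \<Rightarrow> complex)) measure"
  let ?q = "C / 0.905 * (2 * g) powr 0.905"
  interpret P: prob_space ?P by (rule prob_space_PiM) (rule prob_space_axioms)
  have q: "0 \<le> ?q" using cC by simp
  have J: "distr M (PiM {j} (\<lambda>_. borel)) (\<lambda>\<omega>. \<lambda>j\<in>{j}. X j \<omega>) = ?P"
    "distr M ?B (\<lambda>\<omega>. (X i \<omega>, \<lambda>j\<in>{j}. X j \<omega>)) = \<mu> \<Otimes>\<^sub>M ?P"
    by (rule joint_law; use ij in auto)+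
  define A where "A = {x \<in> space ?B. 1 - s \<le> norm (fst x) \<and> \<bar>norm (fst x) - norm (snd x j)\<bar> < g}"
  have cm [measurable]: "(\<lambda>x. snd x j) \<in> borel_measurable ?B"
    by (rule measurable_compose[OF measurable_snd measurable_component_singleton[where M="\<lambda>_. borel"]]) simp
  have A: "A \<in> sets ?B" unfolding A_def by measurable
  have sets_eq: "sets (\<mu> \<Otimes>\<^sub>M ?P) = sets ?B" by (rule sets_pair_measure_cong[OF sets_mu sets_PiM_mu])
  have slice: "emeasure ?P (Pair a -` A) \<le> ennreal ?q * indicator {z. 1 - s \<le> norm z} a" for a
  proof (cases "1 - s \<le> norm a")
    case True
    have Sa: "Pair a -` A \<in> sets (PiM {j} (\<lambda>_. borel))" using sets_Pair1[OF A] by simp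
    have "emeasure ?P (Pair a -` A) = ennreal (measure (distr M (PiM {j} (\<lambda>_. borel)) (\<lambda>\<omega>. \<lambda>j\<in>{j}. X j \<omega>)) (Pair a -` A))"
      unfolding J(1) by (simp add: P.emeasure_eq_measure)
    also have "measure (distr M (PiM {j} (\<lambda>_. borel)) (\<lambda>\<omega>. \<lambda>j\<in>{j}. X j \<omega>)) (Pair a -` A) = M.prob ((\<lambda>\<omega>. \<lambda>j\<in>{j}. X j \<omega>) -` (Pair a -` A) \<inter> space M)"
      by (rule measure_distr[OF _ Sa]) (intro measurable_restrict X_measurable)
    also have "(\<lambda>\<omega>. \<lambda>j\<in>{j}. X j \<omega>) -` (Pair a -` A) \<inter> space M = {\<omega> \<in> space M. X j \<omega> \<in> {z. \<bar>norm a - norm z\<bar> < g}}"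
      using True by (auto simp: A_def space_pair_measure space_PiM)
    also have "M.prob \<dots> = measure \<mu> {z. \<bar>norm a - norm z\<bar> < g}"
      by (rule prob_X[OF ij(2)]) simp
    also have "\<dots> \<le> measure \<mu> {z. norm a - g \<le> norm z \<and> norm z \<le> norm a + g}"
      by (rule finite_measure_mono) (auto simp: sets_mu)
    also have "\<dots> \<le> C / 0.905 * ((norm a + g) - (norm a - g)) powr 0.905"
      by (rule annulus_prob_le) (use True s in auto)
    finally show ?thesis using True by (simp add: ennreal_leI)
  next
    case False
    then have "Pair a -` A = {}" by (auto simp: A_def)
    then show ?thesis by simp
  qed
  have "{\<omega> \<in> space M. 1 - s \<le> norm (X i \<omega>) \<and> \<bar>norm (X i \<omega>) - norm (X j \<omega>)\<bar> < g} = (\<lambda>\<omega>. (X i \<omega>, \<lambda>j\<in>{j}. X j \<omega>)) -` A \<inter> space M"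
    by (auto simp: A_def space_pair_measure space_PiM)
  then have "M.prob {\<omega> \<in> space M. 1 - s \<le> norm (X i \<omega>) \<and> \<bar>norm (X i \<omega>) - norm (X j \<omega>)\<bar> < g} = measure (\<mu> \<Otimes>\<^sub>M ?P) A"
    unfolding J(2)[symmetric] by (simp only: measure_distr[OF pair_measurable A])
  also have "\<dots> \<le> (C / 0.905 * s powr 0.905) * ?q"
  proof -
    have "emeasure (\<mu> \<Otimes>\<^sub>M ?P) A = (\<integral>\<^sup>+a. emeasure ?P (Pair a -` A) \<partial>\<mu>)"
      by (rule P.emeasure_pair_measure_alt) (simp add: A sets_eq)
    also have "\<dots> \<le> (\<integral>\<^sup>+a. ennreal ?q * indicator {z. 1 - s \<le> norm z} a \<partial>\<mu>)"
      by (rule nn_integral_mono) (rule slice)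
    also have "\<dots> = ennreal ?q * emeasure \<mu> {z. 1 - s \<le> norm z}"
      by (rule nn_integral_cmult_indicator) (simp add: sets_mu)
    also have "\<dots> \<le> ennreal ?q * ennreal (C / 0.905 * s powr 0.905)"
      unfolding emeasure_eq_measure using outer_prob_le[of s] s by (intro mult_left_mono ennreal_leI) auto
    also have "\<dots> = ennreal ((C / 0.905 * s powr 0.905) * ?q)"
      using q cC by (subst ennreal_mult[symmetric]) (auto simp: mult_ac)
    finally show ?thesis using q cC unfolding measure_def by (intro enn2real_leI) auto
  qed
  finally show ?thesis .
qed

lemma prob_some_close_pair:
  assumes s: "0 \<le> s" "0 < g" "s + g \<le> \<epsilon>" "2 * g \<le> 1"
  shows "M.prob {\<omega> \<in> space M. \<exists>i\<in>{1..n}. \<exists>j\<in>{1..n} - {i}. 1 - s \<le> norm (X i \<omega>) \<and> \<bar>norm (X i \<omega>) - norm (X j \<omega>)\<bar> < g}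
    \<le> real n * (real n * ((C / 0.905 * s powr 0.905) * (C / 0.905 * (2 * g) powr 0.905)))"
proof -
  let ?E = "\<lambda>i j. {\<omega> \<in> space M. 1 - s \<le> norm (X i \<omega>) \<and> \<bar>norm (X i \<omega>) - norm (X j \<omega>)\<bar> < g}"
  let ?b = "(C / 0.905 * s powr 0.905) * (C / 0.905 * (2 * g) powr 0.905)"
  have b0: "0 \<le> ?b" using cC by simp
  have "{\<omega> \<in> space M. \<exists>i\<in>{1..n}. \<exists>j\<in>{1..n} - {i}. 1 - s \<le> norm (X i \<omega>) \<and> \<bar>norm (X i \<omega>) - norm (X j \<omega>)\<bar> < g} = (\<Union>i\<in>{1..n}. \<Union>j\<in>{1..n} - {i}. ?E i j)"
    by auto
  also have "M.prob \<dots> \<le> (\<Sum>i\<in>{1..n}. M.prob (\<Union>j\<in>{1..n} - {i}. ?E i j))"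
    by (rule measure_UNION_le) (auto intro!: sets.finite_UN)
  also have "\<dots> \<le> (\<Sum>i\<in>{1..n}. \<Sum>j\<in>{1..n} - {i}. M.prob (?E i j))"
    by (intro sum_mono measure_UNION_le) auto
  also have "\<dots> \<le> (\<Sum>i\<in>{1..n}. \<Sum>j\<in>{1..n} - {i}. ?b)"
    by (intro sum_mono prob_close_pair[OF s]) auto
  also have "\<dots> \<le> (\<Sum>i\<in>{1..n}. real n * ?b)"
  proof (rule sum_mono)
    fix i assume "i \<in> {1..n}"
    have "(\<Sum>j\<in>{1..n} - {i}. ?b) = real (card ({1..n} - {i})) * ?b" by (rule sum_constant)
    also have "\<dots> \<le> real n * ?b"
      by (rule mult_right_mono[OF _ b0]) (use card_mono[of "{1..n}" "{1..n} - {i}"] in simp)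
    finally show "(\<Sum>j\<in>{1..n} - {i}. ?b) \<le> real n * ?b" .
  qed
  also have "\<dots> = real n * (real n * ?b)" by simp
  finally show ?thesis .
qed

definition bad_at :: "nat \<Rightarrow> real \<Rightarrow> real \<Rightarrow> real \<Rightarrow> real \<Rightarrow> nat \<Rightarrow> 'b set" where
  "bad_at n t \<eta> w B k = {\<omega> \<in> space M. X k \<omega> \<in> {z. 1 - t \<le> norm z} \<and>
     (\<lambda>j\<in>{1..n} - {k}. cis (- Arg (X k \<omega>)) * X j \<omega>) \<in> bad_set n \<eta> w B ({1..n} - {k})}"

lemma bad_at_measurable: "bad_at n t \<eta> w B k \<in> sets M"
proof -
  have "bad_at n t \<eta> w B k = (\<lambda>\<omega>. (X k \<omega>, \<lambda>j\<in>{1..n} - {k}. cis (- Arg (X k \<omega>)) * X j \<omega>)) -`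
     ({z. 1 - t \<le> norm z} \<times> bad_set n \<eta> w B ({1..n} - {k})) \<inter> space M"
    by (auto simp: bad_at_def)
  also have "\<dots> \<in> sets M"
    by (rule measurable_sets[OF rotated_pair_measurable]) (auto intro!: bad_set_measurable pair_measureI)
  finally show ?thesis .
qed

lemma prob_some_bad:
  assumes n: "2 \<le> n" and t: "0 \<le> t" "t \<le> \<epsilon>" and \<eta>: "0 < \<eta>" "\<eta> \<le> 1" and w: "0 < w" "2 * (real n * \<eta> powr 0.8 * gap_moment + 1) \<le> w" and B: "0 < B"
  shows "M.prob (\<Union>k\<in>{1..n}. bad_at n t \<eta> w B k) \<le> real n * ((C / 0.905 * t powr 0.905) *
     (real n * (disc_const * \<eta> powr 1.905) + 4 * real n * (\<eta> powr (-0.2) * gap_moment) / w\<^sup>2 + real n * (\<eta> powr (-0.2) * gap_moment) / B))"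
    (is "_ \<le> real n * (?a * ?b)")
proof -
  have "M.prob (\<Union>k\<in>{1..n}. bad_at n t \<eta> w B k) \<le> (\<Sum>k\<in>{1..n}. M.prob (bad_at n t \<eta> w B k))"
    by (rule measure_UNION_le) (auto intro: bad_at_measurable)
  also have "\<dots> \<le> (\<Sum>k\<in>{1..n}. ?a * ?b)"
  proof (rule sum_mono)
    fix k assume k: "k \<in> {1..n}"
    let ?K = "{1..n} - {k}"
    have ne: "?K \<noteq> {}"
    proof -
      have "(if k = 1 then 2 else 1) \<in> ?K" using n by auto
      then show ?thesis by blast
    qed
    have "M.prob (bad_at n t \<eta> w B k) = measure \<mu> {z. 1 - t \<le> norm z} * M.prob {\<omega> \<in> space M. (\<lambda>j\<in>?K. X j \<omega>) \<in> bad_set n \<eta> w B ?K}"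
      unfolding bad_at_def by (rule rotation_prob) (use k ne in \<open>auto intro: bad_set_measurable\<close>)
    also have "\<dots> \<le> ?a * ?b"
      by (intro mult_mono outer_prob_le[OF t] bad_set_prob[OF refl k \<eta> w B]) (use cC in auto)
    finally show "M.prob (bad_at n t \<eta> w B k) \<le> ?a * ?b" .
  qed
  finally show ?thesis by simp
qed

text \<open>The comparison sum runs over all n indices, including the largest root. This excludes
  the case that the term of that root, now unrotated, is large.\<close>

lemma prob_outer_near_one:
  assumes "0 \<le> s" "s \<le> \<epsilon>" "0 \<le> \<tau>"
  shows "M.prob {\<omega> \<in> space M. \<exists>k\<in>{1..n}. 1 - s \<le> norm (X k \<omega>) \<and> norm (1 - X k \<omega>) \<le> \<tau>} \<le> real n * (C / 0.905 * s powr 0.905 * \<tau>)"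
proof -
  let ?A = "{z. 1 - s \<le> norm z \<and> norm (1 - z) \<le> \<tau>}"
  have "{\<omega> \<in> space M. \<exists>k\<in>{1..n}. 1 - s \<le> norm (X k \<omega>) \<and> norm (1 - X k \<omega>) \<le> \<tau>} = (\<Union>k\<in>{1..n}. {\<omega> \<in> space M. X k \<omega> \<in> ?A})"
    by auto
  also have "M.prob \<dots> \<le> (\<Sum>k\<in>{1..n}. M.prob {\<omega> \<in> space M. X k \<omega> \<in> ?A})"
    by (rule measure_UNION_le) auto
  also have "\<dots> \<le> (\<Sum>k\<in>{1..n}. C / 0.905 * s powr 0.905 * \<tau>)"
  proof (rule sum_mono)
    fix k assume "k \<in> {1..n}"
    then have "M.prob {\<omega> \<in> space M. X k \<omega> \<in> ?A} = measure \<mu> ?A" by (intro prob_X) auto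
    then show "M.prob {\<omega> \<in> space M. X k \<omega> \<in> ?A} \<le> C / 0.905 * s powr 0.905 * \<tau>"
      using outer_disc_prob_le[OF assms] by simp
  qed
  finally show ?thesis by simp
qed

definition good_event :: "nat \<Rightarrow> real \<Rightarrow> real \<Rightarrow> real \<Rightarrow> real \<Rightarrow> real \<Rightarrow> real \<Rightarrow> real \<Rightarrow> 'b set" where
  "good_event n s \<eta> g w B N \<tau> = {\<omega> \<in> space M. \<forall>j\<in>{1..n}. norm (X j \<omega>) \<le> 1}
     - {\<omega> \<in> space M. \<forall>j\<in>{1..n}. norm (X j \<omega>) < 1 - s}
     - {\<omega> \<in> space M. N \<le> real (card {j \<in> {1..n}. 1 - 4 * s \<le> norm (X j \<omega>)})}
     - {\<omega> \<in> space M. \<exists>i\<in>{1..n}. \<exists>j\<in>{1..n} - {i}. 1 - s \<le> norm (X i \<omega>) \<and> \<bar>norm (X i \<omega>) - norm (X j \<omega>)\<bar> < g}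
     - (\<Union>k\<in>{1..n}. bad_at n (4 * s) \<eta> w B k)
     - {\<omega> \<in> space M. \<exists>k\<in>{1..n}. 1 - s \<le> norm (X k \<omega>) \<and> norm (1 - X k \<omega>) \<le> \<tau>}"

lemma count_measurable [measurable]: "(\<lambda>\<omega>. real (card {j \<in> {1..n}. 1 - t \<le> norm (X j \<omega>)})) \<in> borel_measurable M"
proof -
  have "real (card {j \<in> {1..n}. 1 - t \<le> norm (X j \<omega>)}) = (\<Sum>j\<in>{1..n}. indicat_real {z. 1 - t \<le> norm z} (X j \<omega>))" for \<omega>
    by (simp add: indicator_def sum.If_cases Int_def)
  then show ?thesis by simp
qed

lemma good_event_measurable: "good_event n s \<eta> g w B N \<tau> \<in> sets M"
  unfolding good_event_def by (intro sets.Diff sets.finite_UN bad_at_measurable) measurable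

lemma prob_not_good:
  assumes n: "2 \<le> n" and s: "0 < s" "4 * s \<le> \<epsilon>" "s + g \<le> \<epsilon>" and g: "0 < g" "2 * g \<le> 1" and \<eta>: "0 < \<eta>" "\<eta> \<le> 1"
    and w: "0 < w" "2 * (real n * \<eta> powr 0.8 * gap_moment + 1) \<le> w" and B: "0 < B" and N: "0 < N" and \<tau>: "0 \<le> \<tau>"
  shows "M.prob (space M - good_event n s \<eta> g w B N \<tau>) \<le> exp (- (c * s * real n))
     + real n * (C / 0.905 * (4 * s) powr 0.905) / N
     + real n * (real n * ((C / 0.905 * s powr 0.905) * (C / 0.905 * (2 * g) powr 0.905)))
     + real n * ((C / 0.905 * (4 * s) powr 0.905) *
        (real n * (disc_const * \<eta> powr 1.905) + 4 * real n * (\<eta> powr (-0.2) * gap_moment) / w\<^sup>2 + real n * (\<eta> powr (-0.2) * gap_moment) / B))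
     + real n * (C / 0.905 * s powr 0.905 * \<tau>)"
proof -
  define E0 where "E0 = {\<omega> \<in> space M. \<exists>j\<in>{1..n}. 1 < norm (X j \<omega>)}"
  define E1 where "E1 = {\<omega> \<in> space M. \<forall>j\<in>{1..n}. norm (X j \<omega>) < 1 - s}"
  define E2 where "E2 = {\<omega> \<in> space M. N \<le> real (card {j \<in> {1..n}. 1 - 4 * s \<le> norm (X j \<omega>)})}"
  define E3 where "E3 = {\<omega> \<in> space M. \<exists>i\<in>{1..n}. \<exists>j\<in>{1..n} - {i}. 1 - s \<le> norm (X i \<omega>) \<and> \<bar>norm (X i \<omega>) - norm (X j \<omega>)\<bar> < g}"
  define E4 where "E4 = (\<Union>k\<in>{1..n}. bad_at n (4 * s) \<eta> w B k)"
  define E5 where "E5 = {\<omega> \<in> space M. \<exists>k\<in>{1..n}. 1 - s \<le> norm (X k \<omega>) \<and> norm (1 - X k \<omega>) \<le> \<tau>}"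
  have "E0 \<in> sets M" unfolding E0_def by measurable
  moreover have "E1 \<in> sets M" unfolding E1_def by measurable
  moreover have "E2 \<in> sets M" unfolding E2_def by measurable
  moreover have "E3 \<in> sets M" unfolding E3_def by measurable
  moreover have "E4 \<in> sets M" unfolding E4_def by (intro sets.finite_UN bad_at_measurable finite_atLeastAtMost)
  moreover have "E5 \<in> sets M" unfolding E5_def by measurable
  ultimately have m [measurable]: "E0 \<in> sets M" "E1 \<in> sets M" "E2 \<in> sets M" "E3 \<in> sets M" "E4 \<in> sets M" "E5 \<in> sets M" by auto
  have P0: "M.prob E0 \<le> 0"
  proof -
    have "E0 = (\<Union>j\<in>{1..n}. {\<omega> \<in> space M. X j \<omega> \<in> - cball 0 1})" by (auto simp: E0_def not_le)
    also have "M.prob \<dots> \<le> (\<Sum>j\<in>{1..n}. M.prob {\<omega> \<in> space M. X j \<omega> \<in> - cball 0 1})"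
      by (rule measure_UNION_le) auto
    also have "\<dots> = (\<Sum>j\<in>{1..n}. measure \<mu> (- cball 0 1))" by (intro sum.cong refl prob_X) auto
    also have "\<dots> = 0" using supp by (simp add: measure_def)
    finally show ?thesis .
  qed
  have P1: "M.prob E1 \<le> exp (- (c * s * real n))" unfolding E1_def by (rule prob_all_inner) (use n s in auto)
  have P2: "M.prob E2 \<le> real n * (C / 0.905 * (4 * s) powr 0.905) / N" unfolding E2_def by (rule prob_many_outer) (use s N in auto)
  have P3: "M.prob E3 \<le> real n * (real n * ((C / 0.905 * s powr 0.905) * (C / 0.905 * (2 * g) powr 0.905)))"
    unfolding E3_def by (rule prob_some_close_pair) (use s g in auto)
  have P4: "M.prob E4 \<le> real n * ((C / 0.905 * (4 * s) powr 0.905) *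
        (real n * (disc_const * \<eta> powr 1.905) + 4 * real n * (\<eta> powr (-0.2) * gap_moment) / w\<^sup>2 + real n * (\<eta> powr (-0.2) * gap_moment) / B))"
    unfolding E4_def by (rule prob_some_bad) (use assms in auto)
  have P5: "M.prob E5 \<le> real n * (C / 0.905 * s powr 0.905 * \<tau>)" unfolding E5_def by (rule prob_outer_near_one) (use s \<tau> in auto)
  have "space M - good_event n s \<eta> g w B N \<tau> \<subseteq> E0 \<union> E1 \<union> E2 \<union> E3 \<union> E4 \<union> E5"
    unfolding good_event_def E0_def E1_def E2_def E3_def E4_def E5_def by (auto simp: not_le)
  then have "M.prob (space M - good_event n s \<eta> g w B N \<tau>) \<le> M.prob (E0 \<union> E1 \<union> E2 \<union> E3 \<union> E4 \<union> E5)"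
    by (rule M.finite_measure_mono) simp
  also have "\<dots> \<le> M.prob (E0 \<union> E1 \<union> E2 \<union> E3 \<union> E4) + M.prob E5" by (rule measure_Un_le) auto
  also have "M.prob (E0 \<union> E1 \<union> E2 \<union> E3 \<union> E4) \<le> M.prob (E0 \<union> E1 \<union> E2 \<union> E3) + M.prob E4" by (rule measure_Un_le) auto
  also have "M.prob (E0 \<union> E1 \<union> E2 \<union> E3) \<le> M.prob (E0 \<union> E1 \<union> E2) + M.prob E3" by (rule measure_Un_le) auto
  also have "M.prob (E0 \<union> E1 \<union> E2) \<le> M.prob (E0 \<union> E1) + M.prob E2" by (rule measure_Un_le) auto
  also have "M.prob (E0 \<union> E1) \<le> M.prob E0 + M.prob E1" by (rule measure_Un_le) auto
  finally show ?thesis using P0 P1 P2 P3 P4 P5 by linarith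
qed

text \<open>J is an index of maximal modulus. It is in the layer because not all points are inner,
  and it is ahead of the others by g because no close pair involves a point of the layer.\<close>

lemma good_event_separated:
  assumes \<omega>: "\<omega> \<in> good_event n s \<eta> g w B N \<tau>"
    and num: "2 \<le> n" "0 < s" "4 * s \<le> 1 / 2" "1 / real n \<le> s" "4 * s < \<eta>"
     "0 < D" "8 * s * N / real n < D\<^sup>2" "D + 4 * s \<le> \<eta> / 2" "2 * (D + 4 * s) * B \<le> w" "s \<le> D"
     "2 * w \<le> real n / 2" "4 * w / (real n)\<^sup>2 \<le> s" "2 * (4 * w / (real n)\<^sup>2) < g" "0 \<le> B" "0 < g"
  shows "\<exists>J. separated_roots n (\<lambda>j. X j \<omega>) s \<eta> g w B D N J \<and> \<tau> < norm (1 - X J \<omega>)"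
proof -
  have sp: "\<omega> \<in> space M" using \<omega> by (simp add: good_event_def)
  have fin: "finite ((\<lambda>j. norm (X j \<omega>)) ` {1..n})" "(\<lambda>j. norm (X j \<omega>)) ` {1..n} \<noteq> {}" using num(1) by auto
  obtain J where J: "J \<in> {1..n}" "\<And>j. j \<in> {1..n} \<Longrightarrow> norm (X j \<omega>) \<le> norm (X J \<omega>)"
  proof -
    from Max_in[OF fin] obtain J where "J \<in> {1..n}" "Max ((\<lambda>j. norm (X j \<omega>)) ` {1..n}) = norm (X J \<omega>)" by blast
    then show ?thesis using Max_ge[OF fin(1)] by (intro that[of J]) auto
  qed
  have bnd: "\<And>j. j \<in> {1..n} \<Longrightarrow> norm (X j \<omega>) \<le> 1" using \<omega> by (auto simp: good_event_def)
  obtain i where "i \<in> {1..n}" "1 - s \<le> norm (X i \<omega>)" using \<omega> sp by (auto simp: good_event_def not_less)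
  then have Js: "1 - s \<le> norm (X J \<omega>)" using J(2)[of i] by linarith
  have gap: "norm (X j \<omega>) \<le> norm (X J \<omega>) - g" if j: "j \<in> {1..n} - {J}" for j
  proof -
    have "\<not> \<bar>norm (X J \<omega>) - norm (X j \<omega>)\<bar> < g" using \<omega> sp J(1) Js j by (auto simp: good_event_def)
    then show ?thesis using J(2)[of j] j by auto
  qed
  have nb: "(\<lambda>j\<in>{1..n} - {k}. cis (- Arg (X k \<omega>)) * X j \<omega>) \<notin> bad_set n \<eta> w B ({1..n} - {k})"
    if "k \<in> {1..n}" "1 - 4 * s \<le> norm (X k \<omega>)" for k
    using \<omega> sp that by (auto simp: good_event_def bad_at_def)
  have inS: "(\<lambda>j\<in>K. h j :: complex) \<in> space (PiM K (\<lambda>_. borel))" for K :: "nat set" and h by (simp add: space_PiM)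
  have "separated_roots n (\<lambda>j. X j \<omega>) s \<eta> g w B D N J"
  proof unfold_locales
    show "real (card {j \<in> {1..n}. 1 - 4 * s \<le> norm (X j \<omega>)}) \<le> N"
      using \<omega> sp by (auto simp: good_event_def)
    fix k assume k: "k \<in> {1..n}" "1 - 4 * s \<le> norm (X k \<omega>)"
    have b: "(\<forall>j\<in>{1..n} - {k}. \<eta> \<le> norm (1 - cis (- Arg (X k \<omega>)) * X j \<omega>)) \<and>
      norm ((\<Sum>j\<in>{1..n} - {k}. recip_gap (cis (- Arg (X k \<omega>)) * X j \<omega>)) - of_nat n) \<le> w \<and>
      (\<Sum>j\<in>{1..n} - {k}. (norm (recip_gap (cis (- Arg (X k \<omega>)) * X j \<omega>)))\<^sup>2) \<le> B"
      using nb[OF k] inS[of "\<lambda>j. cis (- Arg (X k \<omega>)) * X j \<omega>" "{1..n} - {k}"]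
      unfolding bad_set_def mem_Collect_eq by (simp add: not_less)
    show "\<eta> \<le> norm (1 - cis (- Arg (X k \<omega>)) * X j \<omega>)" if "j \<in> {1..n} - {k}" for j using b that by blast
    show "norm ((\<Sum>j\<in>{1..n} - {k}. recip_gap (cis (- Arg (X k \<omega>)) * X j \<omega>)) - of_nat n) \<le> w" using b by blast
    show "(\<Sum>j\<in>{1..n} - {k}. (norm (recip_gap (cis (- Arg (X k \<omega>)) * X j \<omega>)))\<^sup>2) \<le> B" using b by blast
  qed (use num J Js bnd gap in auto)
  moreover have "\<tau> < norm (1 - X J \<omega>)"
  proof (rule ccontr)
    assume "\<not> \<tau> < norm (1 - X J \<omega>)"
    then have "\<exists>k\<in>{1..n}. 1 - s \<le> norm (X k \<omega>) \<and> norm (1 - X k \<omega>) \<le> \<tau>" using J(1) Js by (intro bexI[of _ J]) auto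
    then show False using \<omega> sp unfolding good_event_def by blast
  qed
  ultimately show ?thesis by blast
qed

text \<open>For d = n^(-1 / (2 + \<alpha>)) the prefactor n^2 d is n^((3 + 2 \<alpha>) / (2 +
  \<alpha>)). Keeping d as a parameter makes it also the scale of
  \<open>centred_sum\<close>.\<close>

definition rescaled_error :: "nat \<Rightarrow> real \<Rightarrow> 'b \<Rightarrow> complex" where
  "rescaled_error n d \<omega> = complex_of_real ((real n)\<^sup>2 * d) * cis (- Arg (largest_pt (roots (random_poly X n \<omega>)))) *
     (largest_pt (critical_points (random_poly X n \<omega>)) - largest_pt (roots (random_poly X n \<omega>)) * (1 - 1 / of_nat n))"

definition centred_sum :: "nat \<Rightarrow> real \<Rightarrow> 'b \<Rightarrow> complex" where
  "centred_sum n d \<omega> = complex_of_real d * ((\<Sum>j=1..n. recip_gap (X j \<omega>)) - of_nat n)"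

lemma rescaled_error_measurable:
  assumes "1 \<le> n" shows "rescaled_error n d \<in> borel_measurable M"
proof -
  have [measurable]: "(\<lambda>\<omega>. largest_pt (roots (random_poly X n \<omega>))) \<in> borel_measurable M"
    by (rule largest_root_measurable) (use assms in auto)
  have [measurable]: "(\<lambda>\<omega>. largest_pt (critical_points (random_poly X n \<omega>))) \<in> borel_measurable M"
    by (rule largest_critical_point_measurable) simp
  show ?thesis unfolding rescaled_error_def by measurable
qed

text \<open>
  The index of the largest root depends on the moduli only, so the other roots may be rotated by the
  argument of the largest one without changing the joint law. This removes the conditioning.
\<close>

lemma char_comparison:
  assumes num: "2 \<le> n" "0 < s" "4 * s \<le> 1 / 2" "1 / real n \<le> s" "4 * s < \<eta>"
     "0 < D" "8 * s * N / real n < D\<^sup>2" "D + 4 * s \<le> \<eta> / 2" "2 * (D + 4 * s) * B \<le> w" "s \<le> D"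
     "2 * w \<le> real n / 2" "4 * w / (real n)\<^sup>2 \<le> s" "2 * (4 * w / (real n)\<^sup>2) < g" "0 \<le> B" "0 < g"
    and d: "0 < d" and \<tau>: "0 < \<tau>"
  shows "norm ((CLINT \<omega>|M. iexp (t \<bullet> rescaled_error n d \<omega>)) - (CLINT \<omega>|M. iexp (t \<bullet> centred_sum n d \<omega>))) \<le>
     norm t * (d * (real n * s + 6 * s * B + 8 * w\<^sup>2 / real n)) + norm t * (d / \<tau>) + 4 * M.prob (space M - good_event n s \<eta> g w B N \<tau>)"
proof -
  let ?G = "good_event n s \<eta> g w B N \<tau>"
  let ?err = "d * (real n * s + 6 * s * B + 8 * w\<^sup>2 / real n)"
  define K where "K k = {1..n} - {k}" for k
  define V where "V k y = complex_of_real d * ((\<Sum>j\<in>K k. recip_gap (y j)) - of_nat n)" for k and y :: "nat \<Rightarrow> complex"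
  \<comment> \<open>Summing over k with the indicator that k is strictly largest replaces the random
    index by fixed ones. Each term is a function of X k and the remaining points, and at most one
    term is nonzero.\<close>
  define \<Phi> where "\<Phi> k x = (if \<forall>j\<in>K k. norm (snd x j) < norm (fst x) then iexp (t \<bullet> V k (snd x)) else 0)" for k and x :: "complex \<times> (nat \<Rightarrow> complex)"
  define top where "top k \<omega> \<longleftrightarrow> (\<forall>j\<in>K k. norm (X j \<omega>) < norm (X k \<omega>))" for k \<omega>
  define Zr where "Zr \<omega> = (\<Sum>k\<in>{1..n}. \<Phi> k (X k \<omega>, \<lambda>j\<in>K k. cis (- Arg (X k \<omega>)) * X j \<omega>))" for \<omega>
  define Z where "Z \<omega> = (\<Sum>k\<in>{1..n}. \<Phi> k (X k \<omega>, \<lambda>j\<in>K k. X j \<omega>))" for \<omega>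
  have comp [measurable]: "(\<lambda>x. snd x j) \<in> borel_measurable (borel \<Otimes>\<^sub>M PiM (K k) (\<lambda>_. borel))" if "j \<in> K k" for j k
    by (rule measurable_compose[OF measurable_snd measurable_component_singleton[where M="\<lambda>_. borel", OF that]])
  have \<Phi>m: "\<Phi> k \<in> borel_measurable (borel \<Otimes>\<^sub>M PiM (K k) (\<lambda>_. borel))" for k
  proof -
    have [measurable]: "(\<lambda>x. V k (snd x)) \<in> borel_measurable (borel \<Otimes>\<^sub>M PiM (K k) (\<lambda>_. borel))"
      unfolding V_def
      by (intro borel_measurable_times borel_measurable_diff borel_measurable_sum borel_measurable_const
            measurable_compose[OF comp recip_gap_measurable])
    have [measurable]: "Measurable.pred (borel \<Otimes>\<^sub>M PiM (K k) (\<lambda>_. borel)) (\<lambda>x. \<forall>j\<in>K k. norm (snd x j :: complex) < norm (fst x :: complex))"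
    proof (rule pred_intros_finite(3))
      show "finite (K k)" by (simp add: K_def)
      fix j assume "j \<in> K k"
      note [measurable] = comp[OF this]
      show "Measurable.pred (borel \<Otimes>\<^sub>M PiM (K k) (\<lambda>_. borel)) (\<lambda>x. norm (snd x j :: complex) < norm (fst x :: complex))" by measurable
    qed
    show ?thesis unfolding \<Phi>_def by measurable
  qed
  have \<Phi>1: "norm (\<Phi> k x) \<le> 1" for k x by (simp add: \<Phi>_def)
  have Vr: "V k (\<lambda>j\<in>K k. y j) = V k y" for k y
    unfolding V_def by (intro arg_cong2[of _ _ _ _ "\<lambda>a b. complex_of_real d * (a - b)"] sum.cong) auto
  have \<Phi>_rot: "\<Phi> k (X k \<omega>, \<lambda>j\<in>K k. cis (- Arg (X k \<omega>)) * X j \<omega>) = (if top k \<omega> then iexp (t \<bullet> V k (\<lambda>j. cis (- Arg (X k \<omega>)) * X j \<omega>)) else 0)" for k \<omega>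
    unfolding \<Phi>_def top_def snd_conv fst_conv Vr by (simp add: norm_mult)
  have \<Phi>_id: "\<Phi> k (X k \<omega>, \<lambda>j\<in>K k. X j \<omega>) = (if top k \<omega> then iexp (t \<bullet> V k (\<lambda>j. X j \<omega>)) else 0)" for k \<omega>
    unfolding \<Phi>_def top_def snd_conv fst_conv Vr by simp
  have uniq: "k = l" if "top k \<omega>" "top l \<omega>" "k \<in> {1..n}" "l \<in> {1..n}" for k l \<omega>
  proof (rule ccontr)
    assume "k \<noteq> l"
    then have "norm (X l \<omega>) < norm (X k \<omega>)" "norm (X k \<omega>) < norm (X l \<omega>)" using that by (auto simp: top_def K_def)
    then show False by simp
  qed
  have sum_top: "(\<Sum>k\<in>{1..n}. if top k \<omega> then F k else 0) = F J" if "top J \<omega>" "J \<in> {1..n}" for F :: "nat \<Rightarrow> complex" and J \<omega>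
  proof -
    have "(\<Sum>k\<in>{1..n}. if top k \<omega> then F k else 0) = (\<Sum>k\<in>{1..n}. if k = J then F J else 0)"
    proof (rule sum.cong[OF refl])
      fix k assume k: "k \<in> {1..n}"
      show "(if top k \<omega> then F k else 0) = (if k = J then F J else 0)"
        using uniq[OF _ that(1) k that(2)] that(1) by (cases "k = J") (simp, meson)
    qed
    also have "\<dots> = F J" using that(2) by (simp only: sum.delta finite_atLeastAtMost if_True)
    finally show ?thesis .
  qed
  have sum_le1: "norm (\<Sum>k\<in>{1..n}. if top k \<omega> then F k else 0) \<le> 1" if "\<And>k. norm (F k) \<le> 1" for F :: "nat \<Rightarrow> complex" and \<omega>
  proof (cases "\<exists>J\<in>{1..n}. top J \<omega>")
    case True
    then obtain J where J: "J \<in> {1..n}" "top J \<omega>" by blast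
    show ?thesis using sum_top[OF J(2,1), of F] that[of J] by (simp only:)
  next
    case False
    then have "(\<Sum>k\<in>{1..n}. if top k \<omega> then F k else 0) = 0" by (intro sum.neutral) auto
    then show ?thesis by simp
  qed
  have Zr1: "norm (Zr \<omega>) \<le> 1" and Z1: "norm (Z \<omega>) \<le> 1" for \<omega>
    unfolding Zr_def Z_def \<Phi>_rot \<Phi>_id by (rule sum_le1; simp)+
  have mr: "(\<lambda>\<omega>. \<Phi> k (X k \<omega>, \<lambda>j\<in>K k. cis (- Arg (X k \<omega>)) * X j \<omega>)) \<in> borel_measurable M"
    and mi: "(\<lambda>\<omega>. \<Phi> k (X k \<omega>, \<lambda>j\<in>K k. X j \<omega>)) \<in> borel_measurable M" for k
    by (rule measurable_compose[OF rotated_pair_measurable \<Phi>m], rule measurable_compose[OF pair_measurable \<Phi>m])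
  have Zm [measurable]: "Zr \<in> borel_measurable M" "Z \<in> borel_measurable M"
    unfolding Zr_def[abs_def] Z_def[abs_def] by (intro borel_measurable_sum mr mi)+
  \<comment> \<open>Rotation leaves moduli and hence the indicators unchanged, so the two
    expectations agree term by term by \<open>rotation_integral\<close>.\<close>
  have EZ: "(CLINT \<omega>|M. Zr \<omega>) = (CLINT \<omega>|M. Z \<omega>)"
  proof -
    have "(CLINT \<omega>|M. Zr \<omega>) = (\<Sum>k\<in>{1..n}. CLINT \<omega>|M. \<Phi> k (X k \<omega>, \<lambda>j\<in>K k. cis (- Arg (X k \<omega>)) * X j \<omega>))"
      unfolding Zr_def by (rule Bochner_Integration.integral_sum) (rule M.integrable_const_bound[of _ 1], use \<Phi>1 mr in auto)
    also have "\<dots> = (\<Sum>k\<in>{1..n}. CLINT \<omega>|M. \<Phi> k (X k \<omega>, \<lambda>j\<in>K k. X j \<omega>))"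
    proof (rule sum.cong[OF refl])
      fix k assume k: "k \<in> {1..n}"
      have "(if k = 1 then 2 else 1) \<in> K k" using num(1) by (auto simp: K_def)
      then have ne: "K k \<noteq> {}" by blast
      show "(CLINT \<omega>|M. \<Phi> k (X k \<omega>, \<lambda>j\<in>K k. cis (- Arg (X k \<omega>)) * X j \<omega>)) = (CLINT \<omega>|M. \<Phi> k (X k \<omega>, \<lambda>j\<in>K k. X j \<omega>))"
        by (rule rotation_integral[OF _ _ ne _ _ \<Phi>m]) (use k in \<open>auto simp: K_def\<close>)
    qed
    also have "\<dots> = (CLINT \<omega>|M. Z \<omega>)"
      unfolding Z_def by (rule Bochner_Integration.integral_sum[symmetric]) (rule M.integrable_const_bound[of _ 1], use \<Phi>1 mi in auto)
    finally show ?thesis .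
  qed
  have [measurable]: "rescaled_error n d \<in> borel_measurable M" by (rule rescaled_error_measurable) (use num in auto)
  have [measurable]: "centred_sum n d \<in> borel_measurable M" unfolding centred_sum_def[abs_def] by measurable
  have Gm [measurable]: "?G \<in> sets M" by (rule good_event_measurable)
  have good: "norm (iexp (t \<bullet> rescaled_error n d \<omega>) - Zr \<omega>) \<le> norm t * ?err" "norm (Z \<omega> - iexp (t \<bullet> centred_sum n d \<omega>)) \<le> norm t * (d / \<tau>)"
    if \<omega>: "\<omega> \<in> ?G" for \<omega>
  proof -
    obtain J where sr: "separated_roots n (\<lambda>j. X j \<omega>) s \<eta> g w B D N J" and \<tau>J: "\<tau> < norm (1 - X J \<omega>)"
      using good_event_separated[OF \<omega> num] by blast
    interpret R: separated_roots n "\<lambda>j. X j \<omega>" s \<eta> g w B D N J by (rule sr)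
    have topJ: "top J \<omega>" unfolding top_def K_def
    proof
      fix j assume "j \<in> {1..n} - {J}"
      from R.gap[OF this] num(15) show "norm (X j \<omega>) < norm (X J \<omega>)" by linarith
    qed
    have ZrJ: "Zr \<omega> = iexp (t \<bullet> V J (\<lambda>j. cis (- Arg (X J \<omega>)) * X j \<omega>))"
      unfolding Zr_def \<Phi>_rot by (rule sum_top[OF topJ R.J(1)])
    have ZJ: "Z \<omega> = iexp (t \<bullet> V J (\<lambda>j. X j \<omega>))"
      unfolding Z_def \<Phi>_id by (rule sum_top[OF topJ R.J(1)])
    have PR: "random_poly X n \<omega> = R.P" by (simp add: random_poly_def R.P_def)
    have "norm (rescaled_error n d \<omega> - V J (\<lambda>j. cis (- Arg (X J \<omega>)) * X j \<omega>)) \<le> ?err"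
      unfolding rescaled_error_def critical_points_def PR R.largest_root V_def K_def
      using R.largest_critical_point[of d] d unfolding R.S_def by simp
    then have "norm t * norm (rescaled_error n d \<omega> - V J (\<lambda>j. cis (- Arg (X J \<omega>)) * X j \<omega>)) \<le> norm t * ?err"
      by (rule mult_left_mono) simp
    moreover have "norm (iexp (t \<bullet> rescaled_error n d \<omega>) - Zr \<omega>) \<le> \<bar>t \<bullet> rescaled_error n d \<omega> - t \<bullet> V J (\<lambda>j. cis (- Arg (X J \<omega>)) * X j \<omega>)\<bar>"
      unfolding ZrJ by (rule norm_iexp_diff_le)
    moreover have "\<bar>t \<bullet> rescaled_error n d \<omega> - t \<bullet> V J (\<lambda>j. cis (- Arg (X J \<omega>)) * X j \<omega>)\<bar> \<le> norm t * norm (rescaled_error n d \<omega> - V J (\<lambda>j. cis (- Arg (X J \<omega>)) * X j \<omega>))"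
      unfolding inner_diff_right[symmetric] by (rule Cauchy_Schwarz_ineq2)
    ultimately show "norm (iexp (t \<bullet> rescaled_error n d \<omega>) - Zr \<omega>) \<le> norm t * ?err" by linarith
    \<comment> \<open>The full sum contains the term of J, which V omits; on the good event this
      term is at most d / \<tau>.\<close>
    have "centred_sum n d \<omega> = V J (\<lambda>j. X j \<omega>) + complex_of_real d * recip_gap (X J \<omega>)"
      unfolding centred_sum_def V_def K_def using sum.remove[of "{1..n}" J "\<lambda>j. recip_gap (X j \<omega>)"] R.J(1)
      by (simp add: algebra_simps)
    then have "norm (V J (\<lambda>j. X j \<omega>) - centred_sum n d \<omega>) = d * norm (recip_gap (X J \<omega>))"
      using d by (simp add: norm_mult)
    also have "\<dots> \<le> d * (1 / \<tau>)"
      using d \<tau> \<tau>J by (intro mult_left_mono) (auto simp: recip_gap_def norm_divide intro!: frac_le)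
    finally have "norm (V J (\<lambda>j. X j \<omega>) - centred_sum n d \<omega>) \<le> d / \<tau>" by simp
    then have "norm t * norm (V J (\<lambda>j. X j \<omega>) - centred_sum n d \<omega>) \<le> norm t * (d / \<tau>)" by (rule mult_left_mono) simp
    moreover have "norm (Z \<omega> - iexp (t \<bullet> centred_sum n d \<omega>)) \<le> \<bar>t \<bullet> V J (\<lambda>j. X j \<omega>) - t \<bullet> centred_sum n d \<omega>\<bar>"
      unfolding ZJ by (rule norm_iexp_diff_le)
    moreover have "\<bar>t \<bullet> V J (\<lambda>j. X j \<omega>) - t \<bullet> centred_sum n d \<omega>\<bar> \<le> norm t * norm (V J (\<lambda>j. X j \<omega>) - centred_sum n d \<omega>)"
      unfolding inner_diff_right[symmetric] by (rule Cauchy_Schwarz_ineq2)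
    ultimately show "norm (Z \<omega> - iexp (t \<bullet> centred_sum n d \<omega>)) \<le> norm t * (d / \<tau>)" by linarith
  qed
  have err0: "0 \<le> norm t * ?err" "0 \<le> norm t * (d / \<tau>)" using num d \<tau> by (auto intro!: mult_nonneg_nonneg add_nonneg_nonneg)
  have iY: "integrable M (\<lambda>\<omega>. iexp (t \<bullet> rescaled_error n d \<omega>))" and iT: "integrable M (\<lambda>\<omega>. iexp (t \<bullet> centred_sum n d \<omega>))"
    and iZr: "integrable M Zr" and iZ: "integrable M Z"
    using Zr1 Z1 by (auto intro!: M.integrable_const_bound[of _ 1])
  \<comment> \<open>Outside the good event the integrands are only bounded by 2. This is used for
    two differences, which explains the factor 4 in the conclusion.\<close>
  have bound: "norm (CLINT \<omega>|M. F \<omega>) \<le> b + 2 * M.prob (space M - ?G)"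
    if "F \<in> borel_measurable M" "0 \<le> b" "\<And>\<omega>. \<omega> \<in> ?G \<Longrightarrow> norm (F \<omega>) \<le> b" "\<And>\<omega>. norm (F \<omega>) \<le> 2" for F :: "'b \<Rightarrow> complex" and b
  proof -
    have i: "integrable M (\<lambda>\<omega>. 2 * indicat_real (space M - ?G) \<omega>)"
      by (rule M.integrable_const_bound[of _ 2]) (auto simp: indicator_def)
    have "norm (CLINT \<omega>|M. F \<omega>) \<le> (LINT \<omega>|M. b + 2 * indicat_real (space M - ?G) \<omega>)"
    proof (rule norm_integral_le)
      fix \<omega> assume "\<omega> \<in> space M"
      then show "norm (F \<omega>) \<le> b + 2 * indicator (space M - ?G) \<omega>"
        using that(2) that(3)[of \<omega>] that(4)[of \<omega>] by (cases "\<omega> \<in> ?G") auto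
    next
      show "integrable M (\<lambda>\<omega>. b + 2 * indicat_real (space M - ?G) \<omega>)" using i by simp
    qed (rule that(1))
    also have "\<dots> = (LINT \<omega>|M. b) + (LINT \<omega>|M. 2 * indicat_real (space M - ?G) \<omega>)"
      by (rule Bochner_Integration.integral_add[OF _ i]) simp
    also have "\<dots> = b + 2 * M.prob (space M - ?G)"
      by (simp add: M.prob_space Int_absorb2[OF sets.sets_into_space])
    finally show ?thesis .
  qed
  have "norm (CLINT \<omega>|M. iexp (t \<bullet> rescaled_error n d \<omega>) - Zr \<omega>) \<le> norm t * ?err + 2 * M.prob (space M - ?G)"
  proof (rule bound[OF _ err0(1) good(1)])
    show "norm (iexp (t \<bullet> rescaled_error n d \<omega>) - Zr \<omega>) \<le> 2" for \<omega>
      using norm_triangle_ineq4[of "iexp (t \<bullet> rescaled_error n d \<omega>)" "Zr \<omega>"] Zr1[of \<omega>] by simp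
  qed auto
  moreover have "norm (CLINT \<omega>|M. Z \<omega> - iexp (t \<bullet> centred_sum n d \<omega>)) \<le> norm t * (d / \<tau>) + 2 * M.prob (space M - ?G)"
  proof (rule bound[OF _ err0(2) good(2)])
    show "norm (Z \<omega> - iexp (t \<bullet> centred_sum n d \<omega>)) \<le> 2" for \<omega>
      using norm_triangle_ineq4[of "Z \<omega>" "iexp (t \<bullet> centred_sum n d \<omega>)"] Z1[of \<omega>] by simp
  qed auto
  moreover have "(CLINT \<omega>|M. iexp (t \<bullet> rescaled_error n d \<omega>)) - (CLINT \<omega>|M. iexp (t \<bullet> centred_sum n d \<omega>)) =
     (CLINT \<omega>|M. iexp (t \<bullet> rescaled_error n d \<omega>) - Zr \<omega>) + (CLINT \<omega>|M. Z \<omega> - iexp (t \<bullet> centred_sum n d \<omega>))"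
    using iY iT iZr iZ EZ by simp
  ultimately show ?thesis
    using norm_triangle_ineq[of "CLINT \<omega>|M. iexp (t \<bullet> rescaled_error n d \<omega>) - Zr \<omega>" "CLINT \<omega>|M. Z \<omega> - iexp (t \<bullet> centred_sum n d \<omega>)"] by simp
qed
end

section \<open>Convergence in distribution\<close>

text \<open>Translates the planar density into the radial form used so far. The annulus is shrunk to
  width at most 1/2, and \<open>\<rho>\<close> is set to 0 off it to be Borel on the whole
  line.\<close>

lemma assumption_A_radial_limit:
  assumes A: "assumption_A \<alpha> \<mu> f" and \<alpha>: "- 0.095 < \<alpha>" "\<alpha> < 0"
    and L: "((\<lambda>r. radial_density f r / (1 - r) powr \<alpha>) \<longlongrightarrow> L) (at_left 1)"
  shows "\<exists>\<rho> \<epsilon> c C. radial_limit \<mu> \<rho> \<alpha> \<epsilon> c C L"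
proof -
  from A have A0: "prob_space \<mu>" "sets \<mu> = sets borel" "\<And>\<theta>. distr \<mu> borel (\<lambda>z. cis \<theta> * z) = \<mu>" "emeasure \<mu> (- cball 0 1) = 0"
    unfolding assumption_A_def by auto
  from A obtain e0 where e0: "0 < e0" "e0 \<le> 1" and
     Ae: "let ann = {z. 1 - e0 \<le> norm z \<and> norm z \<le> 1} in
           f \<in> borel_measurable (restrict_space borel ann) \<and>
           (\<forall>z\<in>ann. 0 \<le> f z) \<and>
           restrict_space \<mu> ann = density (restrict_space lborel ann) (\<lambda>z. ennreal (f z))"
     and frot: "\<forall>r \<theta>. 1 - e0 \<le> r \<and> r < 1 \<longrightarrow> f (complex_of_real r * cis \<theta>) = f (complex_of_real r)"
     and cC: "\<exists>c C. 0 < c \<and> 0 < C \<and> (\<forall>r. 1 - e0 \<le> r \<and> r < 1 \<longrightarrow>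
              c \<le> radial_density f r / (1 - r) powr \<alpha> \<and> radial_density f r / (1 - r) powr \<alpha> \<le> C)"
    unfolding assumption_A_def by blast
  from cC obtain c C where c: "0 < c" and C: "0 < C" and
     bd: "\<And>r. 1 - e0 \<le> r \<Longrightarrow> r < 1 \<Longrightarrow> c \<le> radial_density f r / (1 - r) powr \<alpha>"
         "\<And>r. 1 - e0 \<le> r \<Longrightarrow> r < 1 \<Longrightarrow> radial_density f r / (1 - r) powr \<alpha> \<le> C"
    by blast
  define ann where "ann = {z :: complex. 1 - e0 \<le> norm z \<and> norm z \<le> 1}"
  have fm: "f \<in> borel_measurable (restrict_space borel ann)" and f0: "\<And>z. z \<in> ann \<Longrightarrow> 0 \<le> f z"
    and fd: "restrict_space \<mu> ann = density (restrict_space lborel ann) (\<lambda>z. ennreal (f z))"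
    using Ae unfolding ann_def[symmetric] Let_def by auto
  have annm [measurable]: "ann \<in> sets borel" unfolding ann_def by measurable
  define \<epsilon> where "\<epsilon> = min e0 (1 / 2)"
  have \<epsilon>: "0 < \<epsilon>" "\<epsilon> \<le> 1 / 2" "\<epsilon> \<le> e0" using e0 by (auto simp: \<epsilon>_def)
  define F where "F z = indicat_real ann z *\<^sub>R f z" for z
  have Fm [measurable]: "F \<in> borel_measurable borel"
    using fm unfolding F_def[abs_def] by (subst (asm) borel_measurable_restrict_space_iff) auto
  define \<rho> where "\<rho> r = indicat_real {1 - \<epsilon>..<1} r * (2 * pi * r * F (complex_of_real r))" for r
  have \<rho>m [measurable]: "\<rho> \<in> borel_measurable borel" unfolding \<rho>_def[abs_def] by measurable
  have \<rho>_eq: "\<rho> r = radial_density f r" if "1 - \<epsilon> \<le> r" "r < 1" for r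
    using that \<epsilon> by (simp add: \<rho>_def F_def ann_def radial_density_def)
  \<comment> \<open>On the unit circle f is arbitrary while \<open>\<rho>\<close> stops before 1;
    the two descriptions agree because the circle is a null set.\<close>
  have sphere: "AE z in (lborel :: complex measure). norm z \<noteq> 1"
  proof -
    have "sphere (0::complex) 1 \<in> null_sets lebesgue" using negligible_sphere negligible_iff_null_sets by blast
    then have "sphere (0::complex) 1 \<in> null_sets lborel" by (subst (asm) null_sets_completion_iff) auto
    from AE_not_in[OF this] show ?thesis by eventually_elim simp
  qed
  have radial: "emeasure \<mu> (norm -` A) = (\<integral>\<^sup>+r. ennreal (\<rho> r) * indicator (A \<inter> {1-\<epsilon>..<1}) r \<partial>lborel)"
    if Am [measurable]: "A \<in> sets borel" and As: "A \<subseteq> {1-\<epsilon>..}" for A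
  proof -
    define G where "G r = ennreal (F (complex_of_real r)) * indicator (A \<inter> {1-\<epsilon>..<1}) r" for r
    have [measurable]: "G \<in> borel_measurable borel" unfolding G_def[abs_def] by measurable
    have Bm [measurable]: "norm -` A \<in> sets (borel :: complex measure)"
      using measurable_sets[of norm "borel :: complex measure" borel A] by simp
    have "emeasure \<mu> (norm -` A) = emeasure \<mu> (norm -` A \<inter> ann)"
    proof (rule emeasure_eq_AE)
      have "AE z in \<mu>. z \<notin> - cball 0 1" using A0 by (intro AE_not_in) auto
      then show "AE z in \<mu>. z \<in> norm -` A \<longleftrightarrow> z \<in> norm -` A \<inter> ann"
        by eventually_elim (use As \<epsilon> in \<open>force simp: ann_def\<close>)
    qed (auto simp: A0)
    also have "\<dots> = emeasure (restrict_space \<mu> ann) (norm -` A \<inter> ann)"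
      by (rule emeasure_restrict_space[symmetric]) (auto simp: A0 sets_eq_imp_space_eq[OF A0(2)])
    also have "\<dots> = (\<integral>\<^sup>+z. ennreal (f z) * indicator (norm -` A \<inter> ann) z \<partial>restrict_space lborel ann)"
      unfolding fd
    proof (rule emeasure_density)
      have "f \<in> borel_measurable (restrict_space lborel ann)"
        using fm by (simp cong: measurable_cong_sets add: sets_restrict_space)
      then show "(\<lambda>z. ennreal (f z)) \<in> borel_measurable (restrict_space lborel ann)" by measurable
      show "norm -` A \<inter> ann \<in> sets (restrict_space lborel ann)" by (subst sets_restrict_space_iff) auto
    qed
    also have "\<dots> = (\<integral>\<^sup>+z. ennreal (f z) * indicator (norm -` A \<inter> ann) z * indicator ann z \<partial>lborel)"
      by (rule nn_integral_restrict_space) simp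
    also have "\<dots> = (\<integral>\<^sup>+z. G (norm z) \<partial>(lborel :: complex measure))"
    proof (rule nn_integral_cong_AE)
      have eq: "ennreal (f z) * indicator (norm -` A \<inter> ann) z * indicator ann z = G (norm z)" if z1: "norm z \<noteq> 1" for z
      proof (cases "norm z \<in> A \<and> norm z < 1")
        case True
        then have z: "1 - \<epsilon> \<le> norm z" "norm z < 1" "norm z \<in> A" using As by auto
        have "complex_of_real (norm z) * cis (Arg z) = z" by (rule norm_cis_Arg)
        then have "f z = f (complex_of_real (norm z))"
          using frot[rule_format, of "norm z" "Arg z"] z \<epsilon> by auto
        then show ?thesis using z \<epsilon> by (simp add: G_def F_def ann_def)
      next
        case False
        then have "norm z \<notin> A \<or> z \<notin> ann" using z1 by (auto simp: ann_def)
        then show ?thesis using False by (auto simp: G_def)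
      qed
      show "AE z in (lborel :: complex measure). ennreal (f z) * indicator (norm -` A \<inter> ann) z * indicator ann z = G (norm z)"
        by (rule eventually_mono[OF sphere eq])
    qed
    also have "\<dots> = (\<integral>\<^sup>+r. ennreal (2 * pi * r) * indicator {0..} r * G r \<partial>lborel)"
      by (rule nn_integral_norm_lborel) simp
    also have "\<dots> = (\<integral>\<^sup>+r. ennreal (\<rho> r) * indicator (A \<inter> {1-\<epsilon>..<1}) r \<partial>lborel)"
    proof (rule nn_integral_cong)
      fix r :: real
      show "ennreal (2 * pi * r) * indicator {0..} r * G r = ennreal (\<rho> r) * indicator (A \<inter> {1-\<epsilon>..<1}) r"
      proof (cases "r \<in> A \<inter> {1-\<epsilon>..<1}")
        case True
        then have "0 \<le> r" using \<epsilon> by auto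
        then show ?thesis using True by (simp add: G_def \<rho>_def ennreal_mult' indicator_def)
      qed (simp add: G_def)
    qed
    finally show ?thesis .
  qed
  have rb: "c * (1 - r) powr \<alpha> \<le> \<rho> r \<and> \<rho> r \<le> C * (1 - r) powr \<alpha>" if r: "1 - \<epsilon> \<le> r" "r < 1" for r
  proof -
    have "0 < (1 - r) powr \<alpha>" using r by simp
    then show ?thesis using bd[of r] r \<epsilon> unfolding \<rho>_eq[OF r] by (simp add: pos_le_divide_eq pos_divide_le_eq)
  qed
  have "((\<lambda>r. \<rho> r / (1 - r) powr \<alpha>) \<longlongrightarrow> L) (at_left 1)"
  proof (rule Lim_transform_eventually[OF L])
    show "\<forall>\<^sub>F r in at_left 1. radial_density f r / (1 - r) powr \<alpha> = \<rho> r / (1 - r) powr \<alpha>"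
      by (rule eventually_at_leftI[of "1 - \<epsilon>"]) (use \<rho>_eq \<epsilon> in auto)
  qed
  moreover have "radial_law \<mu> \<rho> \<alpha> \<epsilon> c C"
    by (intro radial_law.intro radial_law_axioms.intro) (use A0 \<alpha> \<epsilon> c C radial rb in auto)
  ultimately show ?thesis by (auto intro!: radial_limit.intro radial_limit_axioms.intro exI)
qed

context iid_sample
begin

text \<open>The deterministic and probabilistic errors of \<open>char_comparison\<close> and
  \<open>prob_not_good\<close> are evaluated at explicit powers of n, with the free constants C,
  \<open>gap_moment\<close> and \<open>disc_const\<close> carried outside.\<close>

lemma char_difference_tendsto_0:
  assumes d: "\<And>n. 1 \<le> n \<Longrightarrow> d n = real n powr (- 1 / (2 + \<alpha>))"
  shows "(\<lambda>n. (CLINT \<omega>|M. iexp (t \<bullet> rescaled_error n (d n) \<omega>)) - (CLINT \<omega>|M. iexp (t \<bullet> centred_sum n (d n) \<omega>))) \<longlonglongrightarrow> 0"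
proof -
  \<comment> \<open>The exponents are chosen so that every term of \<open>R\<close> below is a negative power of \<open>n\<close>; this needs \<open>\<alpha>\<close> close to 0.\<close>
  define s where "s n = real n powr (-0.97)" for n
  define \<eta> where "\<eta> n = real n powr (-0.8)" for n
  \<comment> \<open>The gap must exceed 8 w / n^2 = 8 n^(-1.3), yet remain so small that close pairs
    in the layer are unlikely: 2 - 0.905 (0.97 + 1.28) < 0.\<close>
  define g where "g n = real n powr (-1.28)" for n
  define w where "w n = real n powr 0.7" for n
  define B where "B n = real n powr 1.4" for n
  \<comment> \<open>The factor 3 is needed because the exponents agree: D^2 = 9 n^(-1.82) against 8
    s N / n = 8 n^(-1.82).\<close>
  define D where "D n = 3 * real n powr (-0.91)" for n
  define N where "N n = real n powr 0.15" for n
  define \<tau> where "\<tau> n = real n powr (-0.2)" for n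
  note defs = s_def \<eta>_def g_def w_def B_def D_def N_def \<tau>_def
  \<comment> \<open>Apart from the exponential, R is a combination with fixed coefficients of terms
    that involve only numerical exponents, so each can be shown to vanish separately.\<close>
  define R where "R n = norm t * (real n powr (-0.5) * (real n * s n + 6 * s n * B n + 8 * (w n)\<^sup>2 / real n))
     + norm t * (real n powr (-0.5) / \<tau> n)
     + 4 * (exp (- (c * s n * real n))
     + C / 0.905 * (real n * (4 * s n) powr 0.905 / N n)
     + (C / 0.905)\<^sup>2 * (real n * (real n * (s n powr 0.905 * (2 * g n) powr 0.905)))
     + (C / 0.905 * disc_const * (real n * (4 * s n) powr 0.905 * (real n * \<eta> n powr 1.905))
        + C / 0.905 * gap_moment * (real n * (4 * s n) powr 0.905 * (4 * real n * \<eta> n powr (-0.2) / (w n)\<^sup>2))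
        + C / 0.905 * gap_moment * (real n * (4 * s n) powr 0.905 * (real n * \<eta> n powr (-0.2) / B n)))
     + C / 0.905 * (real n * (s n powr 0.905 * \<tau> n)))" for n
  have R0: "R \<longlonglongrightarrow> 0"
  proof -
    have e: "(\<lambda>n. exp (- (c * s n * real n))) \<longlonglongrightarrow> 0" unfolding defs using cC(1) by real_asymp
    have "(\<lambda>n. real n powr (-0.5) * (real n * s n + 6 * s n * B n + 8 * (w n)\<^sup>2 / real n)) \<longlonglongrightarrow> 0"
      "(\<lambda>n. real n powr (-0.5) / \<tau> n) \<longlonglongrightarrow> 0"
      "(\<lambda>n. real n * (4 * s n) powr 0.905 / N n) \<longlonglongrightarrow> 0"
      "(\<lambda>n. real n * (real n * (s n powr 0.905 * (2 * g n) powr 0.905))) \<longlonglongrightarrow> 0"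
      "(\<lambda>n. real n * (4 * s n) powr 0.905 * (real n * \<eta> n powr 1.905)) \<longlonglongrightarrow> 0"
      "(\<lambda>n. real n * (4 * s n) powr 0.905 * (4 * real n * \<eta> n powr (-0.2) / (w n)\<^sup>2)) \<longlonglongrightarrow> 0"
      "(\<lambda>n. real n * (4 * s n) powr 0.905 * (real n * \<eta> n powr (-0.2) / B n)) \<longlonglongrightarrow> 0"
      "(\<lambda>n. real n * (s n powr 0.905 * \<tau> n)) \<longlonglongrightarrow> 0"
      unfolding defs by real_asymp+
    note l = this[THEN tendsto_mult_right_zero]
    show ?thesis unfolding R_def[abs_def]
      by (intro tendsto_add_zero tendsto_mult_right_zero e l)
  qed
  have ev: "\<forall>\<^sub>F n in sequentially. 2 \<le> n" "\<forall>\<^sub>F n in sequentially. 4 * s n < \<epsilon>" "\<forall>\<^sub>F n in sequentially. s n + g n < \<epsilon>"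
    "\<forall>\<^sub>F n in sequentially. 2 * g n \<le> 1" "\<forall>\<^sub>F n in sequentially. \<eta> n \<le> 1"
    "\<forall>\<^sub>F n in sequentially. 2 * gap_moment * (real n * \<eta> n powr 0.8 / w n) + 2 / w n < 1"
    "\<forall>\<^sub>F n in sequentially. 4 * s n \<le> 1 / 2" "\<forall>\<^sub>F n in sequentially. 1 / real n \<le> s n" "\<forall>\<^sub>F n in sequentially. 4 * s n < \<eta> n"
    "\<forall>\<^sub>F n in sequentially. 8 * s n * N n / real n < (D n)\<^sup>2" "\<forall>\<^sub>F n in sequentially. D n + 4 * s n \<le> \<eta> n / 2"
    "\<forall>\<^sub>F n in sequentially. 2 * (D n + 4 * s n) * B n \<le> w n" "\<forall>\<^sub>F n in sequentially. s n \<le> D n"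
    "\<forall>\<^sub>F n in sequentially. 2 * w n \<le> real n / 2" "\<forall>\<^sub>F n in sequentially. 4 * w n / (real n)\<^sup>2 \<le> s n"
    "\<forall>\<^sub>F n in sequentially. 2 * (4 * w n / (real n)\<^sup>2) < g n"
  proof -
    show "\<forall>\<^sub>F n in sequentially. 2 \<le> n" by (rule eventually_ge_at_top)
    have "(\<lambda>n. 4 * s n) \<longlonglongrightarrow> 0" unfolding defs by real_asymp
    from order_tendstoD(2)[OF this eps(1)] show "\<forall>\<^sub>F n in sequentially. 4 * s n < \<epsilon>" .
    have "(\<lambda>n. s n + g n) \<longlonglongrightarrow> 0" unfolding defs by real_asymp
    from order_tendstoD(2)[OF this eps(1)] show "\<forall>\<^sub>F n in sequentially. s n + g n < \<epsilon>" .
    have "(\<lambda>n. real n * \<eta> n powr 0.8 / w n) \<longlonglongrightarrow> 0" "(\<lambda>n. 2 / w n) \<longlonglongrightarrow> 0" unfolding defs by real_asymp+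
    then have "(\<lambda>n. 2 * gap_moment * (real n * \<eta> n powr 0.8 / w n) + 2 / w n) \<longlonglongrightarrow> 0"
      by (intro tendsto_add_zero tendsto_mult_right_zero)
    from order_tendstoD(2)[OF this, of 1] show "\<forall>\<^sub>F n in sequentially. 2 * gap_moment * (real n * \<eta> n powr 0.8 / w n) + 2 / w n < 1" by simp
  qed (unfold defs, real_asymp+)
  have "\<forall>\<^sub>F n in sequentially. norm ((CLINT \<omega>|M. iexp (t \<bullet> rescaled_error n (d n) \<omega>)) - (CLINT \<omega>|M. iexp (t \<bullet> centred_sum n (d n) \<omega>))) \<le> R n"
    using ev
  proof eventually_elim
    case (elim n)
    note el = elim
    have pos: "0 < s n" "0 < \<eta> n" "0 < g n" "0 < w n" "0 < B n" "0 < D n" "0 < N n" "0 < \<tau> n"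
      using el(1) by (auto simp: defs)
    \<comment> \<open>As \<alpha> < 0, the scale d is at most n^(-1/2); with this bound R no longer
      depends on \<alpha> through d.\<close>
    have dn: "0 < d n" "d n \<le> real n powr (-0.5)"
    proof -
      have "- 1 / (2 + \<alpha>) \<le> -0.5" using alpha by (simp add: field_simps)
      then show "0 < d n" "d n \<le> real n powr (-0.5)" using d[of n] el(1) by (auto intro!: powr_mono)
    qed
    have w2: "2 * (real n * \<eta> n powr 0.8 * gap_moment + 1) \<le> w n"
    proof -
      have "(2 * gap_moment * (real n * \<eta> n powr 0.8 / w n) + 2 / w n) * w n < 1 * w n" using el(6) pos by (intro mult_strict_right_mono)
      also have "(2 * gap_moment * (real n * \<eta> n powr 0.8 / w n) + 2 / w n) * w n = 2 * (real n * \<eta> n powr 0.8 * gap_moment + 1)"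
        using pos by (simp add: field_simps)
      finally show ?thesis by simp
    qed
    let ?P = "M.prob (space M - good_event n (s n) (\<eta> n) (g n) (w n) (B n) (N n) (\<tau> n))"
    have "norm ((CLINT \<omega>|M. iexp (t \<bullet> rescaled_error n (d n) \<omega>)) - (CLINT \<omega>|M. iexp (t \<bullet> centred_sum n (d n) \<omega>))) \<le>
       norm t * (d n * (real n * s n + 6 * s n * B n + 8 * (w n)\<^sup>2 / real n)) + norm t * (d n / \<tau> n) + 4 * ?P"
      by (rule char_comparison[where D = "D n"]) (use el pos dn in auto)
    also have "norm t * (d n * (real n * s n + 6 * s n * B n + 8 * (w n)\<^sup>2 / real n)) \<le>
       norm t * (real n powr (-0.5) * (real n * s n + 6 * s n * B n + 8 * (w n)\<^sup>2 / real n))"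
      by (intro mult_left_mono mult_right_mono dn(2) add_nonneg_nonneg) (use pos in auto)
    also have "norm t * (d n / \<tau> n) \<le> norm t * (real n powr (-0.5) / \<tau> n)"
      by (intro mult_left_mono divide_right_mono dn(2)) (use pos in auto)
    also have "?P \<le> exp (- (c * s n * real n))
     + real n * (C / 0.905 * (4 * s n) powr 0.905) / N n
     + real n * (real n * ((C / 0.905 * s n powr 0.905) * (C / 0.905 * (2 * g n) powr 0.905)))
     + real n * ((C / 0.905 * (4 * s n) powr 0.905) *
        (real n * (disc_const * \<eta> n powr 1.905) + 4 * real n * (\<eta> n powr (-0.2) * gap_moment) / (w n)\<^sup>2 + real n * (\<eta> n powr (-0.2) * gap_moment) / B n))
     + real n * (C / 0.905 * s n powr 0.905 * \<tau> n)"
      by (rule prob_not_good) (use el pos w2 in auto)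
    also have "\<dots> = exp (- (c * s n * real n))
     + C / 0.905 * (real n * (4 * s n) powr 0.905 / N n)
     + (C / 0.905)\<^sup>2 * (real n * (real n * (s n powr 0.905 * (2 * g n) powr 0.905)))
     + (C / 0.905 * disc_const * (real n * (4 * s n) powr 0.905 * (real n * \<eta> n powr 1.905))
        + C / 0.905 * gap_moment * (real n * (4 * s n) powr 0.905 * (4 * real n * \<eta> n powr (-0.2) / (w n)\<^sup>2))
        + C / 0.905 * gap_moment * (real n * (4 * s n) powr 0.905 * (real n * \<eta> n powr (-0.2) / B n)))
     + C / 0.905 * (real n * (s n powr 0.905 * \<tau> n))"
      (is "_ = ?Q")
      by (simp add: algebra_simps power2_eq_square add_divide_distrib)
    finally show "norm ((CLINT \<omega>|M. iexp (t \<bullet> rescaled_error n (d n) \<omega>)) - (CLINT \<omega>|M. iexp (t \<bullet> centred_sum n (d n) \<omega>))) \<le> R n"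
      unfolding R_def by simp
  qed
  then show ?thesis using R0 by (rule Lim_null_comparison)
qed

end

theorem theorem2p8:
  fixes M :: "'a measure" and X :: "nat \<Rightarrow> 'a \<Rightarrow> complex"
    and \<mu> :: "complex measure" and f :: "complex \<Rightarrow> real" and \<alpha> :: real
  assumes "iid_draws M X \<mu>"
    and "assumption_A \<alpha> \<mu> f"
    and "- 0.095 < \<alpha>" and "\<alpha> < 0"
    and "\<exists>L. ((\<lambda>r. radial_density f r / (1 - r) powr \<alpha>) \<longlongrightarrow> L) (at_left 1)"
  defines "W1 \<equiv> \<lambda>n \<omega>. largest_pt (critical_points (random_poly X n \<omega>))"
    and "X1 \<equiv> \<lambda>n \<omega>. largest_pt (roots (random_poly X n \<omega>))"
  shows "\<exists>H \<Gamma> c. 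
    stable_law (2 + \<alpha>) \<Gamma> H \<and>
    0 < c \<and> (\<forall>D \<in> sets borel. D \<subseteq> sphere 0 1 \<longrightarrow> measure \<Gamma> D = c * cos_arg_prob \<alpha> D) \<and>
    converges_in_distr M
      (\<lambda>n \<omega>. complex_of_real (real n powr ((3 + 2 * \<alpha>) / (2 + \<alpha>))) / exp (\<i> * Arg (X1 n \<omega>))
               * (W1 n \<omega> - X1 n \<omega> * (1 - 1 / of_nat n))) H"
proof -
  have M: "prob_space M" and ind: "prob_space.indep_vars M (\<lambda>_. borel) X {1..}" and law: "\<And>j. 1 \<le> j \<Longrightarrow> distr M borel (X j) = \<mu>"
    using assms(1) unfolding iid_draws_def by auto
  interpret M: prob_space M by (rule M)
  obtain L where L: "((\<lambda>r. radial_density f r / (1 - r) powr \<alpha>) \<longlongrightarrow> L) (at_left 1)" using assms(5) by blast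
  obtain \<rho> \<epsilon> c0 C where "radial_limit \<mu> \<rho> \<alpha> \<epsilon> c0 C L"
    using assumption_A_radial_limit[OF assms(2-4) L] by blast
  then interpret R: radial_limit \<mu> \<rho> \<alpha> \<epsilon> c0 C L .
  \<comment> \<open>The sample starts at index 1 and nothing is known about X 0, so it is replaced
    by a constant; the polynomials do not change.\<close>
  define X' where "X' j = (if 1 \<le> j then X j else (\<lambda>_. 0))" for j
  have Xm: "X j \<in> borel_measurable M" if "1 \<le> j" for j using ind that unfolding M.indep_vars_def by auto
  have ind': "M.indep_vars (\<lambda>_. borel) X' {1..}"
    using ind by (subst M.indep_vars_cong[where Y=X]) (auto simp: X'_def)
  interpret I: iid_sample \<mu> \<rho> \<alpha> \<epsilon> c0 C M X'
    by unfold_locales (use Xm ind' law in \<open>auto simp: X'_def\<close>)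
  have poly: "random_poly X n \<omega> = random_poly X' n \<omega>" for n \<omega>
    unfolding random_poly_def X'_def by (intro prod.cong) auto
  \<comment> \<open>The value at n = 0 is set to 1 because the limit lemmas ask for a positive scale
    at every index.\<close>
  define d where "d n = (if n = 0 then 1 else real n powr (- 1 / R.p))" for n
  have d1: "0 < d n" for n by (simp add: d_def)
  have d2: "d \<longlonglongrightarrow> 0"
  proof (rule Lim_transform_eventually)
    show "(\<lambda>n. real n powr (- 1 / R.p)) \<longlonglongrightarrow> 0"
      using R.p by (intro tendsto_neg_powr filterlim_real_sequentially) auto
    show "\<forall>\<^sub>F n in sequentially. real n powr (- 1 / R.p) = d n"
      using eventually_gt_at_top[of 0] by eventually_elim (simp add: d_def)
  qed
  have d3: "real n * d n powr R.p = 1" if "1 \<le> n" for n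
  proof -
    have "(real n powr (- 1 / R.p)) powr R.p = real n powr (- 1 / R.p * R.p)" by (rule powr_powr)
    also have "- 1 / R.p * R.p = - 1" using R.p by simp
    finally show ?thesis using that by (simp add: d_def powr_minus_divide)
  qed
  define Y where "Y n \<omega> = complex_of_real (real n powr ((3 + 2 * \<alpha>) / (2 + \<alpha>))) / exp (\<i> * Arg (X1 n \<omega>)) * (W1 n \<omega> - X1 n \<omega> * (1 - 1 / of_nat n))" for n \<omega>
  \<comment> \<open>At n = 0 the prefactor vanishes, since 0 \<open>powr\<close> anything is 0. For
    n > 0 the exponent is 2 - 1 / (2 + \<alpha>), that is n^2 times d.\<close>
  have Y: "Y n \<omega> = (if n = 0 then 0 else I.rescaled_error n (d n) \<omega>)" for n \<omega>
  proof (cases "n = 0")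
    case False
    have "(3 + 2 * \<alpha>) / (2 + \<alpha>) = 2 + - 1 / (2 + \<alpha>)" using assms(3) by (simp add: field_simps)
    then have "real n powr ((3 + 2 * \<alpha>) / (2 + \<alpha>)) = (real n)\<^sup>2 * d n"
      using False by (simp only: powr_add) (simp add: d_def R.p_def powr_numeral)
    moreover have "z / exp (\<i> * complex_of_real a) = z * cis (- a)" for z a
      by (simp only: cis_conv_exp exp_minus divide_inverse of_real_minus mult_minus_right)
    ultimately show ?thesis
      using False unfolding Y_def I.rescaled_error_def W1_def X1_def poly by (simp only: if_False)
  qed (simp add: Y_def)
  have Ym: "Y n \<in> borel_measurable M" for n
    using I.rescaled_error_measurable[of n "d n"] unfolding Y by (cases "n = 0") auto
  have char: "(\<lambda>n. CLINT \<omega>|M. iexp (t \<bullet> Y n \<omega>)) \<longlonglongrightarrow> exp (R.levy_exponent t)" for t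
  proof -
    have "(\<lambda>n. CLINT \<omega>|M. iexp (t \<bullet> I.centred_sum n (d n) \<omega>)) \<longlonglongrightarrow> exp (R.levy_exponent t)"
      unfolding I.centred_sum_def by (rule R.char_sum_limit[OF M ind' I.law d1 d2 d3])
    moreover have "(\<lambda>n. (CLINT \<omega>|M. iexp (t \<bullet> I.rescaled_error n (d n) \<omega>)) - (CLINT \<omega>|M. iexp (t \<bullet> I.centred_sum n (d n) \<omega>))) \<longlonglongrightarrow> 0"
      by (rule I.char_difference_tendsto_0) (simp add: d_def R.p_def)
    ultimately have "(\<lambda>n. CLINT \<omega>|M. iexp (t \<bullet> I.rescaled_error n (d n) \<omega>)) \<longlonglongrightarrow> exp (R.levy_exponent t)"
      using tendsto_add by fastforce
    then show ?thesis
    proof (rule Lim_transform_eventually)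
      show "\<forall>\<^sub>F n in sequentially. (CLINT \<omega>|M. iexp (t \<bullet> I.rescaled_error n (d n) \<omega>)) = (CLINT \<omega>|M. iexp (t \<bullet> Y n \<omega>))"
        using eventually_gt_at_top[of 0] by eventually_elim (simp add: Y)
    qed
  qed
  obtain H where H: "prob_space H" "sets H = sets borel" "converges_in_distr M Y H" "\<And>t. char_vec H t = exp (R.levy_exponent t)"
    using levy_continuity_plane[OF M Ym char R.integrable_exp_levy_exponent R.isCont_exp_levy_exponent] R.levy_exponent_0 by auto
  have "stable_law (2 + \<alpha>) R.spectral_measure H" by (rule R.stable_law_levy_exponent[OF H(1,2,4)])
  moreover note R.spectral_norm_pos
  moreover have "\<forall>D\<in>sets borel. D \<subseteq> sphere 0 1 \<longrightarrow> measure R.spectral_measure D =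
      R.spectral_const * (LINT \<theta>:{- pi / 2..pi / 2}|lborel. cos \<theta> powr \<alpha>) * cos_arg_prob \<alpha> D"
    using R.measure_spectral_measure by blast
  ultimately show ?thesis using H(3) unfolding Y_def[abs_def] by blast
qed

end
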